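(* Let $m\in\mathbb{N}_0$ and assume that $\mathfrak{A}\in C^m(\mathbb{R}^d;\mathbb{R}^{d\times d})$ and $f\in H^m(\Omega)$. Let $\mathcal{U}\in H^1_\rho(y^\alpha,\mathbb{R}^d\times\mathbb{R}^+)$ solve $$A(\mathcal{U},\mathcal{V})=d_\beta\,(f,\mathrm{tr}_0\mathcal{V})_{L^2(\mathbb{R}^d)}\qquad\text{for all }\mathcal{V}\in H^1_\rho(y^\alpha,\mathbb{R}^d\times\mathbb{R}^+).$$ Then, for every multiindex $\zeta\in\mathbb{N}_0^d$ with $|\zeta|=m$, there holds $$\|\nabla\partial_x^\zeta\,\mathcal{U}\|_{L^2(y^\alpha,\mathbb{R}^d\times\mathbb{R}^+)}\le C\,\|f\|_{H^m(\Omega)}.$$ The constant $C$ depends on $\Omega$, $\mathfrak{A}$, $m$ and $d$, but is independent of $f$ and $\mathcal{U}$.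
   Context: Data: $d\in\{2,3\}$, $\beta\in(0,1)$, $\alpha:=1-2\beta\in(-1,1)$, $d_\beta:=2^{1-2\beta}\Gamma(1-\beta)/\Gamma(\beta)$, $s\ge0$; in the case $d=2$ it is assumed that $s\ge\sigma_0>0$. $\Omega\subseteq\mathbb{R}^d$ is a bounded Lipschitz domain. $\mathfrak{A}:\mathbb{R}^d\to\mathbb{R}^{d\times d}$ is pointwise symmetric, positive definite in the sense that $\mathfrak{A}(x)\eta\cdot\eta\ge\mathfrak{A}_0|\eta|^2$ for all $x,\eta\in\mathbb{R}^d$ with some $\mathfrak{A}_0>0$, and $\mathfrak{A}\equiv I$ on $\mathbb{R}^d\setminus\overline\Omega$. $f$ is a function on $\mathbb{R}^d$ with $\operatorname{supp}f\subseteq\Omega$. Put $\mathfrak{A}_x:=\begin{pmatrix}\mathfrak{A}&0\\0&1\end{pmatrix}\in\mathbb{R}^{(d+1)\times(d+1)}$. Spaces: $\rho(x,y):=(1+|x|^2+|y|^2)^{1/2}$. $L^2(y^\alpha,D)$ has norm $(\int\int_D y^\alpha|\mathcal{U}|^2\,dx\,dy)^{1/2}$. For $D\subset\mathbb{R}^d\times\mathbb{R}^+$, $H^1_\rho(y^\alpha,D)$ is the space of functions $\mathcal{U}$ with finite norm $\|\mathcal{U}\|^2_{H^1_\rho(y^\alpha,D)}:=\int\int_D y^\alpha(|\nabla\mathcal{U}|^2+\rho^{-2}|\mathcal{U}|^2)\,dx\,dy$, where $\nabla=(\nabla_x,\partial_y)$. $\mathrm{tr}_0\mathcal{U}$ denotes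 the trace at $y=0$. If $s>0$, trial and test functions in the variational problem are understood to have trace in $L^2(\mathbb{R}^d)$. Bilinear form: $A(\mathcal{U},\mathcal{V}):=\int_0^{\infty}y^\alpha\int_{\mathbb{R}^d}\mathfrak{A}_x\nabla\mathcal{U}\cdot\nabla\mathcal{V}\,dx\,dy+s\,d_\beta\int_{\mathbb{R}^d}\mathrm{tr}_0\mathcal{U}\,\mathrm{tr}_0\mathcal{V}\,dx$. The variational problem has a unique solution. *)

theory Defs
  imports "HOL-Analysis.Analysis"
begin

section \<open>Classical derivatives and multiindices\<close>

primrec C_k :: "nat \<Rightarrow> ('a::euclidean_space \<Rightarrow> 'b::real_normed_vector) \<Rightarrow> bool" where
  "C_k 0 f \<longleftrightarrow> continuous_on UNIV f"
| "C_k (Suc k) f \<longleftrightarrow>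
     (\<forall>x. f differentiable (at x)) \<and> (\<forall>b\<in>Basis. C_k k (\<lambda>x. frechet_derivative f (at x) b))"

primrec partials :: "'a::euclidean_space list \<Rightarrow> ('a \<Rightarrow> real) \<Rightarrow> 'a \<Rightarrow> real" where
  "partials [] f = f"
| "partials (v # vs) f = (\<lambda>x. frechet_derivative (partials vs f) (at x) v)"

definition mi_order :: "('d::finite \<Rightarrow> nat) \<Rightarrow> nat" where
  "mi_order \<zeta> = (\<Sum>i\<in>UNIV. \<zeta> i)"

text \<open>A multiindex \<open>\<zeta>\<close> is turned into a list of coordinates in which every \<open>i\<close> occurs exactly
  \<open>\<zeta> i\<close> times. Which list is chosen is irrelevant, since the derivatives are only
  ever applied to smooth test functions, whose partial derivatives commute.\<close>

definition mi_list :: "('d::finite \<Rightarrow> nat) \<Rightarrow> 'd list" where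
  "mi_list \<zeta> = (SOME is. \<forall>i. count_list is i = \<zeta> i)"

section \<open>Weak derivatives and weighted spaces\<close>

text \<open>Elements of Lebesgue and Sobolev spaces are represented by Borel functions; every
  almost-everywhere class contains one. Only values on the underlying set \<open>D\<close> matter.\<close>

definition test_fun :: "'a::euclidean_space set \<Rightarrow> ('a \<Rightarrow> real) \<Rightarrow> bool" where
  "test_fun D \<phi> \<longleftrightarrow> (\<forall>k. C_k k \<phi>) \<and> (\<exists>K. compact K \<and> K \<subseteq> D \<and> (\<forall>x. x \<notin> K \<longrightarrow> \<phi> x = 0))"

definition locally_integrable :: "'a::euclidean_space set \<Rightarrow> ('a \<Rightarrow> real) \<Rightarrow> bool" where
  "locally_integrable D u \<longleftrightarrow> (\<forall>K. compact K \<and> K \<subseteq> D \<longrightarrow> set_integrable lborel K u)"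

definition has_weak_deriv ::
  "'a::euclidean_space set \<Rightarrow> 'a list \<Rightarrow> ('a \<Rightarrow> real) \<Rightarrow> ('a \<Rightarrow> real) \<Rightarrow> bool" where
  "has_weak_deriv D vs u w \<longleftrightarrow>
     locally_integrable D u \<and> locally_integrable D w \<and>
     (\<forall>\<phi>. test_fun D \<phi> \<longrightarrow>
        (LINT x:D|lborel. u x * partials vs \<phi> x) =
        (- 1) ^ length vs * (LINT x:D|lborel. w x * \<phi> x))"

definition has_weak_grad ::
  "'a::euclidean_space set \<Rightarrow> ('a \<Rightarrow> real) \<Rightarrow> ('a \<Rightarrow> 'a) \<Rightarrow> bool" where
  "has_weak_grad D u G \<longleftrightarrow> (\<forall>b\<in>Basis. has_weak_deriv D [b] u (\<lambda>x. G x \<bullet> b))"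

text \<open>Weak derivatives are unique up to null sets, and the choices below only enter
  through integrals.\<close>

definition weak_deriv :: "'a::euclidean_space set \<Rightarrow> 'a list \<Rightarrow> ('a \<Rightarrow> real) \<Rightarrow> 'a \<Rightarrow> real" where
  "weak_deriv D vs u = (SOME w. has_weak_deriv D vs u w)"

definition weak_grad :: "'a::euclidean_space set \<Rightarrow> ('a \<Rightarrow> real) \<Rightarrow> 'a \<Rightarrow> 'a" where
  "weak_grad D u = (SOME G. has_weak_grad D u G)"

definition in_L2 ::
  "('a::euclidean_space \<Rightarrow> real) \<Rightarrow> 'a set \<Rightarrow> ('a \<Rightarrow> 'b::euclidean_space) \<Rightarrow> bool" where
  "in_L2 w D u \<longleftrightarrow>
     set_borel_measurable lborel D u \<and> set_integrable lborel D (\<lambda>x. w x * (norm (u x))\<^sup>2)"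

definition L2_norm ::
  "('a::euclidean_space \<Rightarrow> real) \<Rightarrow> 'a set \<Rightarrow> ('a \<Rightarrow> 'b::euclidean_space) \<Rightarrow> real" where
  "L2_norm w D u = sqrt (LINT x:D|lborel. w x * (norm (u x))\<^sup>2)"

section \<open>The space \<open>H^m(\<Omega>)\<close>\<close>

definition mi_dirs :: "('d::finite \<Rightarrow> nat) \<Rightarrow> (real^'d) list" where
  "mi_dirs \<zeta> = map (\<lambda>i. axis i 1) (mi_list \<zeta>)"

definition in_Hm :: "nat \<Rightarrow> (real^'d) set \<Rightarrow> (real^'d \<Rightarrow> real) \<Rightarrow> bool" where
  "in_Hm m \<Omega> f \<longleftrightarrow> in_L2 (\<lambda>_. 1) \<Omega> f \<and>
     (\<forall>\<zeta>. mi_order \<zeta> \<le> m \<longrightarrow> (\<exists>w. has_weak_deriv \<Omega> (mi_dirs \<zeta>) f w \<and> in_L2 (\<lambda>_. 1) \<Omega> w))"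

definition Hm_norm :: "nat \<Rightarrow> (real^'d) set \<Rightarrow> (real^'d \<Rightarrow> real) \<Rightarrow> real" where
  "Hm_norm m \<Omega> f =
     sqrt (\<Sum>\<zeta> | mi_order \<zeta> \<le> m. (L2_norm (\<lambda>_. 1) \<Omega> (weak_deriv \<Omega> (mi_dirs \<zeta>) f))\<^sup>2)"

section \<open>Lipschitz domains\<close>

text \<open>Near each boundary point the domain lies, for a suitable unit vector \<open>\<nu>\<close>, strictly
  below the graph of a Lipschitz function \<open>\<gamma>\<close> over the hyperplane orthogonal to \<open>\<nu>\<close>;
  \<open>x - (x \<bullet> \<nu>) \<nu>\<close> is the projection of \<open>x\<close> to that hyperplane.\<close>

definition bounded_Lipschitz_domain :: "'a::euclidean_space set \<Rightarrow> bool" where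
  "bounded_Lipschitz_domain \<Omega> \<longleftrightarrow>
     open \<Omega> \<and> connected \<Omega> \<and> \<Omega> \<noteq> {} \<and> bounded \<Omega> \<and>
     (\<forall>p\<in>frontier \<Omega>. \<exists>\<nu> \<gamma> L r. norm \<nu> = 1 \<and> 0 < r \<and> L-lipschitz_on UNIV (\<gamma> :: 'a \<Rightarrow> real) \<and>
        (\<forall>x\<in>ball p r. x \<in> \<Omega> \<longleftrightarrow> x \<bullet> \<nu> < \<gamma> (x - (x \<bullet> \<nu>) *\<^sub>R \<nu>)))"

section \<open>The extended problem in the half space\<close>

definition half_space :: "('a \<times> real) set" where
  "half_space = UNIV \<times> {0<..}"

definition y_weight :: "real \<Rightarrow> 'a \<times> real \<Rightarrow> real" where
  "y_weight \<alpha> z = snd z powr \<alpha>"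

definition rho :: "'a::euclidean_space \<times> real \<Rightarrow> real" where
  "rho z = sqrt (1 + (norm (fst z))\<^sup>2 + (snd z)\<^sup>2)"

definition in_H1rho ::
  "real \<Rightarrow> ('a::euclidean_space \<times> real) set \<Rightarrow> ('a \<times> real \<Rightarrow> real) \<Rightarrow> bool" where
  "in_H1rho \<alpha> D U \<longleftrightarrow>
     (\<exists>G. has_weak_grad D U G \<and> in_L2 (y_weight \<alpha>) D G) \<and>
     in_L2 (\<lambda>z. y_weight \<alpha> z * (1 / (rho z)\<^sup>2)) D U"

text \<open>The trace at \<open>y = 0\<close> is the limit of \<open>U(\<cdot>, y)\<close> in \<open>L^2_loc\<close> as \<open>y\<close> tends to \<open>0\<close> from
  the right. Since \<open>U\<close> is only defined almost everywhere, the limit is taken for the averages over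
  \<open>0 < y < h\<close>. The nonnegative integral makes the condition meaningful without
  an integrability assumption.\<close>

definition is_trace0 :: "('a::euclidean_space \<times> real \<Rightarrow> real) \<Rightarrow> ('a \<Rightarrow> real) \<Rightarrow> bool" where
  "is_trace0 U g \<longleftrightarrow> g \<in> borel_measurable lborel \<and>
     (\<forall>K. compact K \<longrightarrow>
        ((\<lambda>h. (\<integral>\<^sup>+z. indicator (K \<times> {0<..<h}) z * ennreal ((U z - g (fst z))\<^sup>2) \<partial>lborel) / ennreal h)
           \<longlongrightarrow> 0) (at_right 0))"

definition tr0 :: "('a::euclidean_space \<times> real \<Rightarrow> real) \<Rightarrow> 'a \<Rightarrow> real" where
  "tr0 U = (SOME g. is_trace0 U g)"

definition d_beta :: "real \<Rightarrow> real" where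
  "d_beta \<beta> = 2 powr (1 - 2 * \<beta>) * Gamma (1 - \<beta>) / Gamma \<beta>"

text \<open>The block matrix \<open>diag(A(x), 1)\<close> acting on pairs.\<close>

definition ext_coeff :: "(real^'d \<Rightarrow> real^'d^'d) \<Rightarrow> real^'d \<Rightarrow> (real^'d) \<times> real \<Rightarrow> (real^'d) \<times> real" where
  "ext_coeff A x p = (A x *v fst p, snd p)"

definition bilinear_A ::
  "real \<Rightarrow> real \<Rightarrow> (real^'d \<Rightarrow> real^'d^'d) \<Rightarrow>
   ((real^'d) \<times> real \<Rightarrow> real) \<Rightarrow> ((real^'d) \<times> real \<Rightarrow> real) \<Rightarrow> real" where
  "bilinear_A \<beta> s A U V =
     (LINT z:half_space|lborel. y_weight (1 - 2 * \<beta>) z *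
        (ext_coeff A (fst z) (weak_grad half_space U z) \<bullet> weak_grad half_space V z))
     + s * d_beta \<beta> * (LINT x|lborel. tr0 U x * tr0 V x)"

definition energy_space :: "real \<Rightarrow> real \<Rightarrow> ((real^'d) \<times> real \<Rightarrow> real) set" where
  "energy_space \<beta> s =
     {U. in_H1rho (1 - 2 * \<beta>) half_space U \<and> (s > 0 \<longrightarrow> in_L2 (\<lambda>_. 1) UNIV (tr0 U))}"

definition variational_solution ::
  "real \<Rightarrow> real \<Rightarrow> (real^'d \<Rightarrow> real^'d^'d) \<Rightarrow> (real^'d \<Rightarrow> real) \<Rightarrow> ((real^'d) \<times> real \<Rightarrow> real) \<Rightarrow> bool"
  where
  "variational_solution \<beta> s A f U \<longleftrightarrow>
     U \<in> energy_space \<beta> s \<and>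
     (\<forall>V \<in> energy_space \<beta> s. bilinear_A \<beta> s A U V = d_beta \<beta> * (LINT x|lborel. f x * tr0 V x))"

definition admissible_coeff :: "(real^'d) set \<Rightarrow> (real^'d \<Rightarrow> real^'d^'d) \<Rightarrow> bool" where
  "admissible_coeff \<Omega> A \<longleftrightarrow>
     (\<forall>x. transpose (A x) = A x) \<and>
     (\<exists>a0>0. \<forall>x \<eta>. (A x *v \<eta>) \<bullet> \<eta> \<ge> a0 * (norm \<eta>)\<^sup>2) \<and>
     (\<forall>x. x \<notin> closure \<Omega> \<longrightarrow> A x = mat 1)"

text \<open>The directions of \<open>\<partial>_x^\<zeta>\<close> in \<open>\<real>^d \<times> \<real>\<close>.\<close>

definition mi_xdirs :: "('d::finite \<Rightarrow> nat) \<Rightarrow> ((real^'d) \<times> real) list" where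
  "mi_xdirs \<zeta> = map (\<lambda>v. (v, 0)) (mi_dirs \<zeta>)"

end

theory Submission
  imports Defs "HOL-Library.Function_Algebras" "HOL-Computational_Algebra.Polynomial"
begin

text \<open>The estimate is obtained with Nirenberg's difference quotients. Every direction of \<open>\<real>^d\<close> is
  tangential to the boundary \<open>y = 0\<close> of the half space: horizontal translations map the half space
  onto itself, leave the weight \<open>y^\<alpha>\<close> alone and commute with the trace.

  The core is an abstract statement about a complete space \<open>E\<close> on which translations act
  isometrically. If \<open>a\<close> is a bounded coercive form and \<open>a u v = l v\<close> for all \<open>v\<close>, then the difference
  quotients \<open>D\<^sub>h u\<close> solve \<open>a (D\<^sub>h u) v = l\<^sub>h v - a\<^sub>h (T\<^sub>h u) v\<close>, where \<open>l\<^sub>h\<close> and \<open>a\<^sub>h\<close> are the difference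
  quotients of \<open>l\<close> and \<open>a\<close>. When these converge in norm to \<open>l'\<close> and \<open>a'\<close>, coercivity makes \<open>D\<^sub>h u\<close>
  converge to some \<open>w\<close> in \<open>E\<close> with \<open>a w v = l' v - a' u v\<close>. This is a problem of the same kind, one
  order lower, and induction gives \<open>regularity\<close>. The constant depends only on the bound of \<open>a\<close> and its
  derivatives, on the coercivity constant and on the order.

  For the extended problem, \<open>E\<close> consists of triples of a function, its weak gradient and its trace,
  with the norm of \<open>(\<nabla>U, sqrt(s d\<^sub>\<beta>) tr\<^sub>0 U)\<close>. In this norm the form is bounded and coercive with
  constants that do not involve \<open>s\<close>, so neither does the final constant. Completeness
  (\<open>energy_triples_complete\<close>) uses Hardy's inequality (\<open>hardy_inequality\<close>), which is where
  \<open>1 < d + \<alpha>\<close> enters, and the trace estimate \<open>trace_bound\<close> on balls. The derivatives of the form come from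
  those of \<open>\<AA>\<close>, whose difference quotients converge uniformly because \<open>\<AA>\<close> is constant outside a compact
  set (\<open>smooth_form_coeff\<close>). For the right-hand side, \<open>f\<close> extended by zero has weak derivatives in
  \<open>L\<^sup>2(\<real>^d)\<close> because its support is a compact subset of \<open>\<Omega>\<close> (\<open>Sobolev_zero_extension\<close>), and the functional
  \<open>v \<mapsto> \<integral> f tr\<^sub>0 v\<close> has the derivatives \<open>v \<mapsto> \<integral> \<partial>\<^sub>i f tr\<^sub>0 v\<close> (\<open>smooth_fun_trace_functional\<close>). Finally, limits
  of difference quotients in \<open>E\<close> are weak derivatives (\<open>smooth_vec_weak_deriv\<close>).\<close>

section \<open>Difference quotients in an abstract energy space\<close>

text \<open>The recursion solves the bookkeeping of \<open>regularity\<close>: a derivative of the solution has a right-hand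
  side of size \<open>M + 2 ^ k * B * (R * M)\<close> when the solution itself has size \<open>R * M\<close>.\<close>

primrec regularity_const :: "real => real => nat => real" where
  "regularity_const B c 0 = 1 / c"
| "regularity_const B c (Suc k) =
     regularity_const B c k * (2 + 2 ^ k * B * regularity_const B c k)"

lemma regularity_const_pos: "0 \<le> B ==> 0 < c ==> 0 < regularity_const B c k"
proof (induction k)
  case (Suc k)
  then have "0 \<le> 2 ^ k * B * regularity_const B c k" by simp
  then have "0 < 2 + 2 ^ k * B * regularity_const B c k" by linarith
  then show ?case using Suc by simp
qed simp

text \<open>\<open>N\<close> is a seminorm: elements of the concrete space are functions rather than classes modulo null sets.\<close>

locale translation_energy =
  fixes E :: "'v::real_vector set" and N :: "'v => real" and T :: "'i => real => 'v => 'v"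
  assumes E_subspace: "subspace E"
    and N_nonneg: "v \<in> E ==> 0 \<le> N v"
    and N_scale: "v \<in> E ==> N (r *\<^sub>R v) = \<bar>r\<bar> * N v"
    and N_triangle: "u \<in> E ==> v \<in> E ==> N (u + v) \<le> N u + N v"
    and T_mem: "v \<in> E ==> T i h v \<in> E"
    and T_add: "T i h (u + v) = T i h u + T i h v"
    and T_scale: "T i h (r *\<^sub>R v) = r *\<^sub>R T i h v"
    and T_inverse: "T i (- h) (T i h v) = v"
    and N_T: "v \<in> E ==> N (T i h v) = N v"
    and E_complete: "(\<And>n::nat. X n \<in> E) ==>
        (\<And>e. e > 0 ==> \<exists>M. \<forall>m\<ge>M. \<forall>n\<ge>M. N (X m - X n) < e) ==>
        \<exists>w\<in>E. (\<lambda>n. N (X n - w)) \<longlonglongrightarrow> 0"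
begin

definition diff_quot :: "'i => real => 'v => 'v" where
  "diff_quot i h v = (1 / h) *\<^sub>R (T i h v - v)"

text \<open>The bound \<open>M\<close> is part of the predicate, since the estimates have to be tracked through all orders.\<close>

definition functional :: "real => ('v => real) => bool" where
  "functional M l \<longleftrightarrow> 0 \<le> M \<and> (\<forall>u\<in>E. \<forall>v\<in>E. l (u + v) = l u + l v) \<and>
     (\<forall>v\<in>E. \<forall>r. l (r *\<^sub>R v) = r * l v) \<and> (\<forall>v\<in>E. \<bar>l v\<bar> \<le> M * N v)"

definition form :: "real => ('v => 'v => real) => bool" where
  "form B b \<longleftrightarrow> (\<forall>u\<in>E. functional (B * N u) (b u)) \<and>
     (\<forall>v\<in>E. functional (B * N v) (\<lambda>u. b u v))"

text \<open>All iterated limits of difference quotients up to order \<open>k\<close> exist in norm and are bounded by \<open>M\<close>. For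
  functionals and forms the limits are taken in the operator norm, and the translation is moved to the arguments.\<close>

primrec smooth_vec :: "nat => real => 'v => bool" where
  "smooth_vec 0 M v \<longleftrightarrow> v \<in> E \<and> N v \<le> M"
| "smooth_vec (Suc k) M v \<longleftrightarrow> v \<in> E \<and> N v \<le> M \<and>
     (\<forall>i. \<exists>w. ((\<lambda>h. N (diff_quot i h v - w)) \<longlongrightarrow> 0) (at 0) \<and> smooth_vec k M w)"

primrec smooth_fun :: "nat => real => ('v => real) => bool" where
  "smooth_fun 0 M l \<longleftrightarrow> functional M l"
| "smooth_fun (Suc k) M l \<longleftrightarrow> functional M l \<and>
     (\<forall>i. \<exists>l'. (\<forall>e>0. \<forall>\<^sub>F h in at 0. \<forall>v\<in>E. \<bar>(l (T i (- h) v) - l v) / h - l' v\<bar> \<le> e * N v) \<and>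
               smooth_fun k M l')"

primrec smooth_form :: "nat => real => ('v => 'v => real) => bool" where
  "smooth_form 0 B b \<longleftrightarrow> form B b"
| "smooth_form (Suc k) B b \<longleftrightarrow> form B b \<and>
     (\<forall>i. \<exists>b'. (\<forall>e>0. \<forall>\<^sub>F h in at 0. \<forall>u\<in>E. \<forall>v\<in>E.
                  \<bar>(b (T i (- h) u) (T i (- h) v) - b u v) / h - b' u v\<bar> \<le> e * N u * N v) \<and>
               smooth_form k B b')"

lemma smooth_vec_SucE:
  assumes "smooth_vec (Suc k) M v"
  obtains w where "((\<lambda>h. N (diff_quot i h v - w)) \<longlongrightarrow> 0) (at 0)" "smooth_vec k M w"
  using assms unfolding smooth_vec.simps by blast

lemma smooth_fun_SucE:
  assumes "smooth_fun (Suc k) M l"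
  obtains l' where "\<And>e. e > 0 ==> \<forall>\<^sub>F h in at 0. \<forall>v\<in>E. \<bar>(l (T i (- h) v) - l v) / h - l' v\<bar> \<le> e * N v"
    "smooth_fun k M l'"
  using assms unfolding smooth_fun.simps by blast

lemma smooth_form_SucE:
  assumes "smooth_form (Suc k) B b"
  obtains b' where "\<And>e. e > 0 ==> \<forall>\<^sub>F h in at 0. \<forall>u\<in>E. \<forall>v\<in>E.
                  \<bar>(b (T i (- h) u) (T i (- h) v) - b u v) / h - b' u v\<bar> \<le> e * N u * N v"
    "smooth_form k B b'"
  using assms unfolding smooth_form.simps by blast

lemma E_add: "u \<in> E ==> v \<in> E ==> u + v \<in> E"
  and E_diff: "u \<in> E ==> v \<in> E ==> u - v \<in> E"
  and E_scale: "v \<in> E ==> r *\<^sub>R v \<in> E"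
  using E_subspace by (auto simp: subspace_add subspace_diff subspace_scale)

lemma N_diff_triangle: "u \<in> E ==> v \<in> E ==> w \<in> E ==> N (u - w) \<le> N (u - v) + N (v - w)"
  using N_triangle[of "u - v" "v - w"] by (simp add: E_diff)

lemma N_le_diff: "u \<in> E ==> v \<in> E ==> N u \<le> N (u - v) + N v"
  using N_triangle[of "u - v" "v"] by (simp add: E_diff)

lemma T_inverse': "T i h (T i (- h) v) = v"
  using T_inverse[of i "- h" v] by simp

lemma diff_quot_mem: "v \<in> E ==> diff_quot i h v \<in> E"
  by (simp add: diff_quot_def E_scale E_diff T_mem)

lemma functional_diff: "functional M l ==> u \<in> E ==> v \<in> E ==> l (u - v) = l u - l v"
proof -
  assume l: "functional M l" and uv: "u \<in> E" "v \<in> E"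
  have "l (u + (-1) *\<^sub>R v) = l u + (-1) * l v"
    using l uv E_scale[of v "-1"] unfolding functional_def by metis
  then show ?thesis by simp
qed

lemma form_bound: "form B b ==> u \<in> E ==> v \<in> E ==> \<bar>b u v\<bar> \<le> B * N u * N v"
  unfolding form_def functional_def by blast

lemma form_diff_left: "form B b ==> u \<in> E ==> u' \<in> E ==> v \<in> E ==> b (u - u') v = b u v - b u' v"
  unfolding form_def using functional_diff[of "B * N v" "\<lambda>u. b u v"] by blast

lemma form_scale_left: "form B b ==> u \<in> E ==> v \<in> E ==> b (r *\<^sub>R u) v = r * b u v"
  unfolding form_def functional_def by blast

lemma functional_mono: "functional M l ==> M \<le> M' ==> functional M' l"
  unfolding functional_def by (meson N_nonneg mult_right_mono order_trans)

lemma functional_add: "functional M l ==> functional M' l' ==> functional (M + M') (\<lambda>v. l v + l' v)"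
  unfolding functional_def
  by (auto simp: algebra_simps) (smt (verit, best) distrib_left mult.commute)+

lemma functional_uminus: "functional M l ==> functional M (\<lambda>v. - l v)"
  unfolding functional_def by auto

lemma smooth_fun_functional: "smooth_fun k M l ==> functional M l"
  by (cases k) auto

lemma smooth_form_form: "smooth_form k B b ==> form B b"
  by (cases k) auto

lemma smooth_vec_mem: "smooth_vec k M v ==> v \<in> E" and smooth_vec_bound: "smooth_vec k M v ==> N v \<le> M"
  by (cases k; simp)+

lemma smooth_vec_mono: "smooth_vec k M v ==> M \<le> M' ==> smooth_vec k M' v"
proof (induction k arbitrary: v)
  case (Suc k)
  then show ?case by simp (meson order_trans)
qed auto

lemma smooth_vec_lower: "smooth_vec (Suc k) M v ==> smooth_vec k M v"
proof (induction k arbitrary: v)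
  case (Suc k)
  then show ?case by (simp only: smooth_vec.simps) blast
qed auto

lemma smooth_fun_lower: "smooth_fun (Suc k) M l ==> smooth_fun k M l"
proof (induction k arbitrary: l)
  case (Suc k)
  then show ?case by (simp only: smooth_fun.simps) blast
qed auto

lemma smooth_form_lower: "smooth_form (Suc k) B b ==> smooth_form k B b"
proof (induction k arbitrary: b)
  case (Suc k)
  then show ?case by (simp only: smooth_form.simps) blast
qed auto

lemma smooth_fun_add:
  "smooth_fun k M l ==> smooth_fun k M' l' ==> smooth_fun k (M + M') (\<lambda>v. l v + l' v)"
proof (induction k arbitrary: l l')
  case (Suc k)
  show ?case unfolding smooth_fun.simps
  proof (intro conjI allI)
    show "functional (M + M') (\<lambda>v. l v + l' v)" using Suc.prems by (simp add: functional_add)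
    fix i
    obtain m where m: "\<And>e. e > 0 ==> \<forall>\<^sub>F h in at 0. \<forall>v\<in>E. \<bar>(l (T i (- h) v) - l v) / h - m v\<bar> \<le> e * N v"
      "smooth_fun k M m" using Suc.prems(1) by (rule smooth_fun_SucE[where i=i]) (rule that)
    obtain m' where m': "\<And>e. e > 0 ==> \<forall>\<^sub>F h in at 0. \<forall>v\<in>E. \<bar>(l' (T i (- h) v) - l' v) / h - m' v\<bar> \<le> e * N v"
      "smooth_fun k M' m'" using Suc.prems(2) by (rule smooth_fun_SucE[where i=i]) (rule that)
    have "\<forall>\<^sub>F h in at 0. \<forall>v\<in>E. \<bar>((l (T i (- h) v) + l' (T i (- h) v)) - (l v + l' v)) / h - (m v + m' v)\<bar> \<le> e * N v"
      if "e > 0" for e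
      using m(1)[OF half_gt_zero[OF that]] m'(1)[OF half_gt_zero[OF that]]
    proof eventually_elim
      case (elim h)
      show ?case
      proof
        fix v assume "v \<in> E"
        then have "\<bar>(l (T i (- h) v) - l v) / h - m v\<bar> \<le> e * N v / 2"
          "\<bar>(l' (T i (- h) v) - l' v) / h - m' v\<bar> \<le> e * N v / 2"
          using elim by (auto dest!: bspec)
        then show "\<bar>((l (T i (- h) v) + l' (T i (- h) v)) - (l v + l' v)) / h - (m v + m' v)\<bar> \<le> e * N v"
          unfolding diff_divide_distrib add_divide_distrib by linarith
      qed
    qed
    then show "\<exists>n. (\<forall>e>0. \<forall>\<^sub>F h in at 0. \<forall>v\<in>E. \<bar>((l (T i (- h) v) + l' (T i (- h) v)) - (l v + l' v)) / h - n v\<bar> \<le> e * N v)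
        \<and> smooth_fun k (M + M') n"
      by (intro exI[of _ "\<lambda>v. m v + m' v"] conjI allI impI Suc.IH[OF m(2) m'(2)])
  qed
qed (simp add: functional_add)

lemma smooth_fun_uminus: "smooth_fun k M l ==> smooth_fun k M (\<lambda>v. - l v)"
proof (induction k arbitrary: l)
  case (Suc k)
  show ?case unfolding smooth_fun.simps
  proof (intro conjI allI)
    show "functional M (\<lambda>v. - l v)" using Suc.prems by (simp add: functional_uminus)
    fix i
    obtain m where m: "\<And>e. e > 0 ==> \<forall>\<^sub>F h in at 0. \<forall>v\<in>E. \<bar>(l (T i (- h) v) - l v) / h - m v\<bar> \<le> e * N v"
      "smooth_fun k M m" using Suc.prems(1) by (rule smooth_fun_SucE[where i=i]) (rule that)
    have eq: "\<bar>(- l (T i (- h) v) - - l v) / h - - m v\<bar> = \<bar>(l (T i (- h) v) - l v) / h - m v\<bar>" for h v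
      by (simp add: diff_divide_distrib)
    show "\<exists>n. (\<forall>e>0. \<forall>\<^sub>F h in at 0. \<forall>v\<in>E. \<bar>(- l (T i (- h) v) - - l v) / h - n v\<bar> \<le> e * N v)
        \<and> smooth_fun k M n"
      by (rule exI[of _ "\<lambda>v. - m v"]) (use m Suc.IH[OF m(2)] eq in simp)
  qed
qed (simp add: functional_uminus)

lemma N_translate_tendsto:
  assumes v: "v \<in> E" and lim: "((\<lambda>h. N (diff_quot i h v - w)) \<longlongrightarrow> 0) (at 0)" and w: "w \<in> E"
  shows "((\<lambda>h. N (T i h v - v)) \<longlongrightarrow> 0) (at 0)"
proof (rule tendsto_sandwich)
  show "\<forall>\<^sub>F h in at 0. 0 \<le> N (T i h v - v)" by (simp add: N_nonneg E_diff T_mem v)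
  show "\<forall>\<^sub>F h in at 0. N (T i h v - v) \<le> \<bar>h\<bar> * (N (diff_quot i h v - w) + N w)"
    unfolding eventually_at
  proof (intro exI[of _ 1] conjI ballI impI)
    fix h :: real assume "h \<noteq> 0 \<and> dist h 0 < 1"
    then have "T i h v - v = h *\<^sub>R diff_quot i h v" by (simp add: diff_quot_def)
    then have "N (T i h v - v) = \<bar>h\<bar> * N (diff_quot i h v)"
      by (simp add: N_scale diff_quot_mem v)
    then show "N (T i h v - v) \<le> \<bar>h\<bar> * (N (diff_quot i h v - w) + N w)"
      by (simp add: mult_left_mono N_le_diff diff_quot_mem v w)
  qed simp
  show "((\<lambda>h. \<bar>h\<bar> * (N (diff_quot i h v - w) + N w)) \<longlongrightarrow> 0) (at 0)"
    by (auto intro!: tendsto_eq_intros lim)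
qed simp_all

text \<open>Product rule: the derivative of \<open>v \<mapsto> b u v\<close> is \<open>v \<mapsto> b w v + b' u v\<close>, where \<open>w\<close> is the derivative of \<open>u\<close>. Two
  terms in each order explain the factor \<open>2 ^ k\<close>.\<close>

lemma smooth_form_vec:
  assumes "0 \<le> B"
  shows "smooth_vec k M u ==> smooth_form k B b ==> smooth_fun k (2 ^ k * B * M) (b u)"
proof (induction k arbitrary: u b)
  case 0
  then have "functional (B * N u) (b u)" "B * N u \<le> B * M"
    using assms by (auto simp: form_def mult_left_mono)
  then show ?case using functional_mono by simp
next
  case (Suc k)
  have uE: "u \<in> E" and NuM: "N u \<le> M" and frm: "form B b" using Suc.prems by auto
  then have M0: "0 \<le> M" using N_nonneg order_trans by blast
  have f0: "functional (2 ^ Suc k * B * M) (b u)"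
  proof (rule functional_mono)
    show "functional (B * N u) (b u)" using frm uE by (auto simp: form_def)
    have "B * N u \<le> B * M" using assms NuM by (rule mult_left_mono[rotated])
    also have "\<dots> = 1 * (B * M)" by simp
    also have "\<dots> \<le> 2 ^ Suc k * (B * M)"
      by (rule mult_right_mono) (use assms M0 in \<open>auto intro: one_le_power simp del: power_Suc\<close>)
    finally show "B * N u \<le> 2 ^ Suc k * B * M" by (simp only: mult.assoc)
  qed
  show ?case unfolding smooth_fun.simps
  proof (intro conjI allI f0)
    fix i
    obtain w where w: "((\<lambda>h. N (diff_quot i h u - w)) \<longlongrightarrow> 0) (at 0)" "smooth_vec k M w"
      using Suc.prems(1) by (rule smooth_vec_SucE[where i=i]) (rule that)
    obtain b' where b': "\<And>e. e > 0 ==> \<forall>\<^sub>F h in at 0. \<forall>u\<in>E. \<forall>v\<in>E.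
                  \<bar>(b (T i (- h) u) (T i (- h) v) - b u v) / h - b' u v\<bar> \<le> e * N u * N v"
      "smooth_form k B b'" using Suc.prems(2) by (rule smooth_form_SucE[where i=i]) (rule that)
    have wE: "w \<in> E" using w smooth_vec_mem by blast
    have frm': "form B b'" using b' smooth_form_form by blast
    have s: "smooth_fun k (2 ^ Suc k * B * M) (\<lambda>v. b w v + b' u v)"
      using smooth_fun_add[OF Suc.IH[OF w(2) smooth_form_lower[OF Suc.prems(2)]]
          Suc.IH[OF smooth_vec_lower[OF Suc.prems(1)] b'(2)]] by (simp add: algebra_simps)
    have "\<forall>\<^sub>F h in at 0. \<forall>v\<in>E. \<bar>(b u (T i (- h) v) - b u v) / h - (b w v + b' u v)\<bar> \<le> e * N v"
      if e: "e > 0" for e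
    proof -
      define d where "d = e / (2 * B + M + 1)"
      have d: "d > 0" using e assms M0 by (simp add: d_def)
      have e1: "\<forall>\<^sub>F h in at 0. N (diff_quot i h u - w) < d"
        using order_tendstoD(2)[OF w(1) d] .
      have e2: "\<forall>\<^sub>F h in at 0. N (T i h u - u) < d"
        using order_tendstoD(2)[OF N_translate_tendsto[OF uE w(1) wE] d] .
      have e3: "\<forall>\<^sub>F h in at (0::real). h \<noteq> 0" by (simp add: eventually_at_filter)
      show ?thesis using e1 e2 b'(1)[OF d] e3
      proof eventually_elim
        case (elim h)
        show ?case
        proof
          fix v assume v: "v \<in> E"
          define t where "t = T i h u"
          have t: "t \<in> E" "T i (- h) t = u" "N t = N u"
            using uE by (auto simp: t_def T_mem T_inverse N_T)
          have Q: "b (diff_quot i h u) v = (b t v - b u v) / h"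
            using frm uE v t by (simp add: diff_quot_def form_scale_left form_diff_left E_diff flip: t_def)
          have "\<bar>(b u (T i (- h) v) - b t v) / h - b' t v\<bar> \<le> d * N u * N v"
            using elim(3) t v by (metis)
          moreover have "\<bar>b (diff_quot i h u - w) v\<bar> \<le> B * d * N v"
          proof -
            have "\<bar>b (diff_quot i h u - w) v\<bar> \<le> B * N (diff_quot i h u - w) * N v"
              using form_bound[OF frm] by (simp add: diff_quot_mem E_diff uE v wE)
            also have "\<dots> \<le> B * d * N v"
              using elim(1) assms v by (intro mult_right_mono mult_left_mono) (auto simp: N_nonneg)
            finally show ?thesis .
          qed
          moreover have "\<bar>b' (t - u) v\<bar> \<le> B * d * N v"
          proof -
            have "\<bar>b' (t - u) v\<bar> \<le> B * N (t - u) * N v"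
              using form_bound[OF frm'] by (simp add: E_diff uE v t)
            also have "\<dots> \<le> B * d * N v"
              using elim(2) assms v by (intro mult_right_mono mult_left_mono) (auto simp: N_nonneg t_def)
            finally show ?thesis .
          qed
          moreover have "b (diff_quot i h u - w) v = b (diff_quot i h u) v - b w v"
            using frm by (simp add: form_diff_left diff_quot_mem uE v wE)
          moreover have "b' (t - u) v = b' t v - b' u v"
            using frm' by (simp add: form_diff_left uE v t)
          moreover have "d * N u * N v \<le> d * M * N v"
            using d NuM v by (intro mult_right_mono mult_left_mono) (auto simp: N_nonneg)
          moreover have "(b u (T i (- h) v) - b u v) / h = (b u (T i (- h) v) - b t v) / h + (b t v - b u v) / h"
            by (simp add: diff_divide_distrib)
          ultimately have "\<bar>(b u (T i (- h) v) - b u v) / h - (b w v + b' u v)\<bar> \<le> d * M * N v + B * d * N v + B * d * N v"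
            using Q by linarith
          also have "\<dots> = d * (2 * B + M) * N v" by (simp add: algebra_simps)
          also have "\<dots> \<le> e * N v"
          proof (rule mult_right_mono)
            have "d * (2 * B + M) \<le> d * (2 * B + M + 1)" using d by (intro mult_left_mono) auto
            also have "\<dots> = e" using assms M0 by (simp add: d_def)
            finally show "d * (2 * B + M) \<le> e" .
          qed (simp add: N_nonneg v)
          finally show "\<bar>(b u (T i (- h) v) - b u v) / h - (b w v + b' u v)\<bar> \<le> e * N v" .
        qed
      qed
    qed
    then show "\<exists>l'. (\<forall>e>0. \<forall>\<^sub>F h in at 0. \<forall>v\<in>E. \<bar>(b u (T i (- h) v) - b u v) / h - l' v\<bar> \<le> e * N v) \<and>
        smooth_fun k (2 ^ Suc k * B * M) l'"
      by (intro exI[of _ "\<lambda>v. b w v + b' u v"] conjI allI impI s)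
  qed
qed

text \<open>Testing the equation with a shifted \<open>v\<close> shows that \<open>a (D h) v\<close> is close to \<open>l' v - a' (T i h u) v\<close>, uniformly
  in \<open>v\<close>. Coercivity first bounds \<open>D h\<close>; then \<open>T i h u\<close> tends to \<open>u\<close>, and coercivity applied to \<open>D h - D k\<close>
  yields the Cauchy property.\<close>

lemma diff_quot_converges:
  assumes c: "0 < c" and co: "\<And>v. v \<in> E ==> c * (N v)\<^sup>2 \<le> a v v"
    and a: "form B a" and B: "0 \<le> B"
    and a': "form B a'" and a'_lim: "\<And>e. e > 0 ==> \<forall>\<^sub>F h in at 0. \<forall>u\<in>E. \<forall>v\<in>E.
                  \<bar>(a (T i (- h) u) (T i (- h) v) - a u v) / h - a' u v\<bar> \<le> e * N u * N v"
    and l: "functional M l"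
    and l': "functional M l'" and l'_lim: "\<And>e. e > 0 ==>
        \<forall>\<^sub>F h in at 0. \<forall>v\<in>E. \<bar>(l (T i (- h) v) - l v) / h - l' v\<bar> \<le> e * N v"
    and u: "u \<in> E" and sol: "\<And>v. v \<in> E ==> a u v = l v"
  shows "\<exists>w\<in>E. ((\<lambda>h. N (diff_quot i h u - w)) \<longlongrightarrow> 0) (at 0) \<and> (\<forall>v\<in>E. a w v = l' v - a' u v)"
proof -
  define D where "D h = diff_quot i h u" for h
  have DE: "D h \<in> E" for h by (simp add: D_def diff_quot_mem u)
  have ne: "\<forall>\<^sub>F h in at (0::real). h \<noteq> 0" by (simp add: eventually_at_filter)
  have Nu: "0 \<le> N u" using N_nonneg u by blast
  have approx: "\<forall>\<^sub>F h in at 0. \<forall>v\<in>E. \<bar>a (D h) v - (l' v - a' (T i h u) v)\<bar> \<le> e * N v"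
    if e: "e > 0" for e
  proof -
    define d where "d = e / (N u + 1)"
    have d: "d > 0" "d * (N u + 1) = e" using e Nu by (auto simp: d_def)
    show ?thesis using l'_lim[OF d(1)] a'_lim[OF d(1)] ne
    proof eventually_elim
      case (elim h)
      show ?case
      proof
        fix v assume v: "v \<in> E"
        define t where "t = T i h u"
        have t: "t \<in> E" "T i (- h) t = u" "N t = N u"
          using u by (auto simp: t_def T_mem T_inverse N_T)
        have Q: "a (D h) v = (a t v - a u v) / h"
          using a u v t by (simp add: D_def diff_quot_def form_scale_left form_diff_left E_diff flip: t_def)
        have "\<bar>(a u (T i (- h) v) - a t v) / h - a' t v\<bar> \<le> d * N u * N v"
          using elim(2) t v by metis
        moreover have "\<bar>(l (T i (- h) v) - l v) / h - l' v\<bar> \<le> d * N v"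
          using elim(1) v by blast
        moreover have "a u (T i (- h) v) = l (T i (- h) v)" "a u v = l v"
          using sol v T_mem by auto
        ultimately have "\<bar>a (D h) v - (l' v - a' t v)\<bar> \<le> d * N u * N v + d * N v"
          unfolding Q by (simp add: diff_divide_distrib)
        also have "\<dots> = e * N v" using d(2) by (simp add: algebra_simps flip: d(2))
        finally show "\<bar>a (D h) v - (l' v - a' (T i h u) v)\<bar> \<le> e * N v" by (simp add: t_def)
      qed
    qed
  qed
  have coD: "N v \<le> K / c" if v: "v \<in> E" and K: "\<bar>a v v\<bar> \<le> K * N v" "0 \<le> K" for v K
  proof (cases "N v = 0")
    case False
    then have pos: "N v > 0" using N_nonneg v by force
    have "c * N v * N v \<le> K * N v" using co[OF v] K by (simp add: power2_eq_square algebra_simps)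
    then have "c * N v \<le> K" using pos by simp
    then show ?thesis using c by (simp add: field_simps)
  qed (use K c in simp)
  have l'_bound: "\<bar>l' v\<bar> \<le> M * N v" if "v \<in> E" for v using l' that by (auto simp: functional_def)
  define K where "K = (M + B * N u + 1) / c"
  have M0: "0 \<le> M" using l by (simp add: functional_def)
  have K: "0 \<le> K" unfolding K_def using c B Nu M0 by simp
  have bdd: "\<forall>\<^sub>F h in at 0. N (D h) \<le> K"
    using approx[OF zero_less_one]
  proof eventually_elim
    case (elim h)
    have "\<bar>a (D h) (D h) - (l' (D h) - a' (T i h u) (D h))\<bar> \<le> 1 * N (D h)" using elim DE by blast
    moreover have "\<bar>l' (D h)\<bar> \<le> M * N (D h)" using l'_bound DE by blast
    moreover have "\<bar>a' (T i h u) (D h)\<bar> \<le> B * N u * N (D h)"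
      using form_bound[OF a', of "T i h u" "D h"] DE u by (simp add: T_mem N_T)
    ultimately have "\<bar>a (D h) (D h)\<bar> \<le> (M + B * N u + 1) * N (D h)" by (simp add: algebra_simps)
    then show ?case unfolding K_def using coD DE M0 B Nu by simp
  qed
  have approx': "\<forall>\<^sub>F h in at 0. \<forall>v\<in>E. \<bar>a (D h) v - (l' v - a' u v)\<bar> \<le> e * N v"
    if e: "e > 0" for e
  proof -
    define d where "d = e / (2 * (B * K + 1))"
    have pos: "0 < B * K + 1" using B K by (simp add: add_nonneg_pos)
    have d: "d > 0" "d * (B * K + 1) = e / 2" using e pos by (auto simp: d_def field_simps)
    have small: "\<forall>\<^sub>F h in at 0. \<bar>h\<bar> < d"
      using d(1) by (auto simp: eventually_at intro!: exI[of _ d])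
    show ?thesis using approx[OF half_gt_zero[OF e]] bdd small ne
    proof eventually_elim
      case (elim h)
      show ?case
      proof
        fix v assume v: "v \<in> E"
        have "N (T i h u - u) = \<bar>h\<bar> * N (D h)"
          using elim(4) N_scale[OF DE, of h h] by (simp add: D_def diff_quot_def)
        also have "\<dots> \<le> d * K" using elim d K by (intro mult_mono) (auto simp: N_nonneg DE)
        finally have Nt: "N (T i h u - u) \<le> d * K" .
        have "\<bar>a' (T i h u - u) v\<bar> \<le> B * N (T i h u - u) * N v"
          using form_bound[OF a'] u v by (simp add: E_diff T_mem)
        also have "\<dots> \<le> B * (d * K) * N v"
          using Nt B v by (intro mult_right_mono mult_left_mono) (auto simp: N_nonneg)
        also have "\<dots> \<le> (d * (B * K + 1)) * N v"
          using d(1) v by (intro mult_right_mono) (auto simp: N_nonneg algebra_simps)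
        finally have "\<bar>a' (T i h u - u) v\<bar> \<le> e / 2 * N v" using d(2) by simp
        moreover have "a' (T i h u - u) v = a' (T i h u) v - a' u v"
          using form_diff_left[OF a'] u v by (simp add: T_mem)
        moreover have "\<bar>a (D h) v - (l' v - a' (T i h u) v)\<bar> \<le> e / 2 * N v" using elim v by simp
        ultimately show "\<bar>a (D h) v - (l' v - a' u v)\<bar> \<le> e * N v" by linarith
      qed
    qed
  qed
  have cauchy: "\<exists>d>0. \<forall>h k. h \<noteq> 0 \<and> \<bar>h\<bar> < d \<and> k \<noteq> 0 \<and> \<bar>k\<bar> < d \<longrightarrow> N (D h - D k) \<le> e" if e: "e > 0" for e
  proof -
    have "e * c / 2 > 0" using e c by simp
    from approx'[OF this] obtain d where d: "d > 0"
      "\<And>h v. h \<noteq> 0 ==> \<bar>h\<bar> < d ==> v \<in> E ==> \<bar>a (D h) v - (l' v - a' u v)\<bar> \<le> e * c / 2 * N v"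
      unfolding eventually_at by auto
    have "N (D h - D k) \<le> e" if hk: "h \<noteq> 0" "\<bar>h\<bar> < d" "k \<noteq> 0" "\<bar>k\<bar> < d" for h k
    proof -
      define v where "v = D h - D k"
      have v: "v \<in> E" by (simp add: v_def E_diff DE)
      have "a v v = a (D h) v - a (D k) v" using form_diff_left[OF a] DE v by (simp add: v_def)
      moreover have "e * c / 2 * N v + e * c / 2 * N v = e * c * N v" by simp
      ultimately have "\<bar>a v v\<bar> \<le> e * c * N v"
        using d(2)[OF hk(1,2) v] d(2)[OF hk(3,4) v] by linarith
      then show ?thesis using coD[OF v, of "e * c"] e c by (simp flip: v_def)
    qed
    then show ?thesis using d(1) by blast
  qed
  define X where "X n = D (1 / real (Suc n))" for n
  have "\<exists>w\<in>E. (\<lambda>n. N (X n - w)) \<longlonglongrightarrow> 0"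
  proof (rule E_complete)
    show "X n \<in> E" for n by (simp add: X_def DE)
    fix e :: real assume e: "e > 0"
    obtain d where d: "d > 0" "\<And>h k. h \<noteq> 0 ==> \<bar>h\<bar> < d ==> k \<noteq> 0 ==> \<bar>k\<bar> < d ==> N (D h - D k) \<le> e / 2"
      using cauchy[of "e/2"] e by auto
    obtain m where m: "1 / real (Suc m) < d" using d(1) nat_approx_posE by metis
    have "\<bar>1 / real (Suc n)\<bar> < d" if "n \<ge> m" for n
    proof -
      have "1 / real (Suc n) \<le> 1 / real (Suc m)" using that by (simp add: frac_le)
      then show ?thesis using m by simp
    qed
    then have "N (X p - X q) \<le> e / 2" if "p \<ge> m" "q \<ge> m" for p q
      unfolding X_def using that by (intro d(2)) auto
    moreover have "e / 2 < e" using e by simp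
    ultimately show "\<exists>M. \<forall>p\<ge>M. \<forall>q\<ge>M. N (X p - X q) < e" by (meson order_le_less_trans)
  qed
  then obtain w where w: "w \<in> E" "(\<lambda>n. N (X n - w)) \<longlonglongrightarrow> 0" by blast
  have lim: "((\<lambda>h. N (D h - w)) \<longlongrightarrow> 0) (at 0)"
  proof (rule tendstoI)
    fix e :: real assume e: "e > 0"
    obtain d where d: "d > 0" "\<And>h k. h \<noteq> 0 ==> \<bar>h\<bar> < d ==> k \<noteq> 0 ==> \<bar>k\<bar> < d ==> N (D h - D k) \<le> e / 2"
      using cauchy[of "e/2"] e by auto
    have "\<forall>\<^sub>F n in sequentially. N (X n - w) < e / 2" using order_tendstoD(2)[OF w(2), of "e/2"] e by simp
    moreover have "\<forall>\<^sub>F n in sequentially. 1 / real (Suc n) < d"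
      using order_tendstoD(2)[OF LIMSEQ_Suc[OF lim_inverse_n'] d(1)] .
    ultimately obtain n where n: "N (X n - w) < e / 2" "1 / real (Suc n) < d"
      using eventually_happens'[OF sequentially_bot] eventually_conj by blast
    have "N (D h - w) < e" if "h \<noteq> 0" "\<bar>h\<bar> < d" for h
    proof -
      have "N (D h - X n) \<le> e / 2" unfolding X_def using that n by (intro d(2)) auto
      then show ?thesis using n N_diff_triangle[of "D h" "X n" w] DE w by (simp add: X_def)
    qed
    then show "\<forall>\<^sub>F h in at 0. dist (N (D h - w)) 0 < e"
      using d(1) unfolding eventually_at by (auto intro!: exI[of _ d] simp: N_nonneg E_diff DE w)
  qed
  moreover have "a w v = l' v - a' u v" if v: "v \<in> E" for v
  proof -
    have "((\<lambda>h. a (D h) v) \<longlongrightarrow> l' v - a' u v) (at 0)"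
    proof (rule tendstoI)
      fix e :: real assume e: "e > 0"
      have Nv: "0 < N v + 1" using N_nonneg[OF v] by simp
      then have "e / (N v + 1) > 0" using e by simp
      then show "\<forall>\<^sub>F h in at 0. dist (a (D h) v) (l' v - a' u v) < e"
      proof (rule eventually_mono[OF approx'])
        fix h assume "\<forall>x\<in>E. \<bar>a (D h) x - (l' x - a' u x)\<bar> \<le> e / (N v + 1) * N x"
        then have "\<bar>a (D h) v - (l' v - a' u v)\<bar> \<le> e / (N v + 1) * N v" using v by blast
        also have "\<dots> < e" using Nv e by (simp add: field_simps)
        finally show "dist (a (D h) v) (l' v - a' u v) < e" by (simp add: dist_real_def)
      qed
    qed
    moreover have "((\<lambda>h. a (D h) v) \<longlongrightarrow> a w v) (at 0)"
    proof (rule Lim_null[THEN iffD2], rule Lim_null_comparison)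
      show "\<forall>\<^sub>F h in at 0. norm (a (D h) v - a w v) \<le> B * N (D h - w) * N v"
        using form_bound[OF a, of "D _ - w" v] form_diff_left[OF a DE w(1) v] v w DE by (simp add: E_diff)
      show "((\<lambda>h. B * N (D h - w) * N v) \<longlongrightarrow> 0) (at 0)" by (auto intro!: tendsto_eq_intros lim)
    qed
    ultimately show ?thesis by (rule tendsto_unique[OF trivial_limit_at, rotated])
  qed
  ultimately show ?thesis using w(1) unfolding D_def by blast
qed

text \<open>The derivative \<open>w\<close> of \<open>u\<close> solves the problem with right-hand side \<open>l' - a' u\<close>, which is smooth of order \<open>k\<close>
  by the product rule and the induction hypothesis for \<open>u\<close>; the induction hypothesis then applies to \<open>w\<close>.\<close>

theorem regularity:
  assumes c: "0 < c" and co: "\<And>v. v \<in> E ==> c * (N v)\<^sup>2 \<le> a v v" and B: "0 \<le> B"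
  shows "smooth_form k B a ==> smooth_fun k M l ==> u \<in> E ==> (\<And>v. v \<in> E ==> a u v = l v) ==>
     smooth_vec k (regularity_const B c k * M) u"
proof (induction k arbitrary: u l M)
  case 0
  have l: "0 \<le> M" "\<bar>l u\<bar> \<le> M * N u" using 0 by (auto simp: functional_def)
  have "c * (N u)\<^sup>2 \<le> M * N u" using co[of u] 0 l by simp
  have "N u \<le> M / c"
  proof (cases "N u = 0")
    case False
    then have "N u > 0" using N_nonneg[OF \<open>u \<in> E\<close>] by simp
    then have "c * N u \<le> M" using \<open>c * (N u)\<^sup>2 \<le> M * N u\<close> by (simp add: power2_eq_square)
    then show ?thesis using c by (simp add: field_simps)
  qed (use l c in simp)
  then show ?case using 0 by simp
next
  case (Suc k)
  define R where "R = regularity_const B c k"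
  have R: "0 < R" using regularity_const_pos B c by (simp add: R_def)
  have l: "functional M l" "0 \<le> M" using Suc.prems by (auto simp: functional_def)
  have IH: "smooth_vec k (R * M) u"
    unfolding R_def using Suc.IH[OF smooth_form_lower smooth_fun_lower] Suc.prems by blast
  have RS: "regularity_const B c (Suc k) * M = R * (2 * M + 2 ^ k * B * (R * M))"
    by (simp add: R_def algebra_simps)
  have nn: "0 \<le> 2 ^ k * B * (R * M)" using B R l by simp
  have le: "R * M \<le> regularity_const B c (Suc k) * M"
    unfolding RS using R l nn by (intro mult_left_mono) auto
  show ?case unfolding smooth_vec.simps
  proof (intro conjI allI)
    show "u \<in> E" by fact
    show "N u \<le> regularity_const B c (Suc k) * M" using smooth_vec_bound[OF IH] le by linarith
    fix i
    obtain a' where a': "\<And>e. e > 0 ==> \<forall>\<^sub>F h in at 0. \<forall>u\<in>E. \<forall>v\<in>E.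
                  \<bar>(a (T i (- h) u) (T i (- h) v) - a u v) / h - a' u v\<bar> \<le> e * N u * N v"
      "smooth_form k B a'" using Suc.prems(1) by (rule smooth_form_SucE[where i=i]) (rule that)
    obtain l' where l': "\<And>e. e > 0 ==>
        \<forall>\<^sub>F h in at 0. \<forall>v\<in>E. \<bar>(l (T i (- h) v) - l v) / h - l' v\<bar> \<le> e * N v"
      "smooth_fun k M l'" using Suc.prems(2) by (rule smooth_fun_SucE[where i=i]) (rule that)
    obtain w where w: "w \<in> E" "((\<lambda>h. N (diff_quot i h u - w)) \<longlongrightarrow> 0) (at 0)"
      "\<And>v. v \<in> E ==> a w v = l' v - a' u v"
      using diff_quot_converges[OF c co smooth_form_form[OF Suc.prems(1)] B smooth_form_form[OF a'(2)]
          a'(1) l(1) smooth_fun_functional[OF l'(2)] l'(1) Suc.prems(3,4)] by blast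
    have "smooth_fun k (M + 2 ^ k * B * (R * M)) (\<lambda>v. l' v + - a' u v)"
      by (intro smooth_fun_add smooth_fun_uminus smooth_form_vec l' B IH a')
    then have "smooth_vec k (R * (M + 2 ^ k * B * (R * M))) w"
      unfolding R_def using Suc.IH[OF smooth_form_lower[OF Suc.prems(1)] _ w(1)] w(3) by (simp add: R_def)
    moreover have "R * (M + 2 ^ k * B * (R * M)) \<le> regularity_const B c (Suc k) * M"
      unfolding RS using R l by (intro mult_left_mono) auto
    ultimately have "smooth_vec k (regularity_const B c (Suc k) * M) w" by (rule smooth_vec_mono)
    then show "\<exists>w. ((\<lambda>h. N (diff_quot i h u - w)) \<longlongrightarrow> 0) (at 0) \<and>
        smooth_vec k (regularity_const B c (Suc k) * M) w" using w(2) by blast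
  qed
qed

end

section \<open>Smooth functions\<close>

abbreviation smooth :: "('a::euclidean_space => real) => bool" where
  "smooth f \<equiv> \<forall>k. C_k k f"

lemma C_k_SucI:
  assumes "\<And>x. (f has_derivative f' x) (at x)" "\<And>b. b \<in> Basis ==> C_k k (\<lambda>x. f' x b)"
  shows "C_k (Suc k) f"
proof -
  have "frechet_derivative f (at x) = f' x" for x using frechet_derivative_at[OF assms(1)] by simp
  then show ?thesis using assms by (auto simp: differentiable_def)
qed

lemma C_k_SucD: "C_k (Suc k) f ==> (f has_derivative frechet_derivative f (at x)) (at x)"
  by (simp add: frechet_derivative_works)

lemma C_k_SucD_partial: "C_k (Suc k) f ==> b \<in> Basis ==> C_k k (\<lambda>x. frechet_derivative f (at x) b)"
  by simp

lemma C_k_lower: "C_k (Suc k) f ==> C_k k f"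
proof (induction k arbitrary: f)
  case 0
  then show ?case by (auto intro!: continuous_at_imp_continuous_on differentiable_imp_continuous_within)
next
  case (Suc k)
  show ?case unfolding C_k.simps
  proof (intro conjI ballI allI)
    show "f differentiable at x" for x using Suc.prems by simp
    show "C_k k (\<lambda>x. frechet_derivative f (at x) b)" if "b \<in> Basis" for b
      using Suc.IH[OF C_k_SucD_partial[OF Suc.prems that]] .
  qed
qed

lemma C_k_continuous: "C_k k f ==> continuous_on UNIV f"
proof (induction k)
  case (Suc k)
  then show ?case using C_k_lower by blast
qed simp

lemma C_k_le: "C_k k f ==> j \<le> k ==> C_k j f"
  by (induction k) (auto simp del: C_k.simps(2) dest: C_k_lower simp: le_Suc_eq)

lemma C_k_const: "C_k k (\<lambda>x. c)"
proof (induction k arbitrary: c)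
  case (Suc k)
  show ?case by (rule C_k_SucI[where f' = "\<lambda>x h. 0"]) (simp_all add: Suc)
qed simp

lemma C_k_add: "C_k k f ==> C_k k g ==> C_k k (\<lambda>x. f x + g x)"
proof (induction k arbitrary: f g)
  case (Suc k)
  show ?case
    by (rule C_k_SucI[OF has_derivative_add[OF C_k_SucD[OF Suc.prems(1)] C_k_SucD[OF Suc.prems(2)]]])
       (intro Suc.IH C_k_SucD_partial Suc.prems)
qed (simp add: continuous_on_add)

lemma C_k_mult:
  fixes f g :: "'a::euclidean_space => real"
  shows "C_k k f ==> C_k k g ==> C_k k (\<lambda>x. f x * g x)"
proof (induction k arbitrary: f g)
  case (Suc k)
  show ?case
    by (rule C_k_SucI[OF has_derivative_mult[OF C_k_SucD[OF Suc.prems(1)] C_k_SucD[OF Suc.prems(2)]]])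
       (intro C_k_add Suc.IH C_k_SucD_partial[OF Suc.prems(1)] C_k_SucD_partial[OF Suc.prems(2)]
          C_k_lower[OF Suc.prems(1)] C_k_lower[OF Suc.prems(2)])
qed (simp add: continuous_on_mult)

lemma C_k_prod:
  fixes f :: "'i => 'a::euclidean_space => real"
  shows "(\<And>i. i \<in> I ==> C_k k (f i)) ==> C_k k (\<lambda>x. \<Prod>i\<in>I. f i x)"
  by (induction I rule: infinite_finite_induct) (auto simp: C_k_const C_k_mult)

lemma C_k_affine:
  fixes f :: "'a::euclidean_space => real"
  shows "C_k k f ==> C_k k (\<lambda>x. f (c *\<^sub>R x + t))"
proof (induction k arbitrary: f)
  case 0
  then have "continuous_on UNIV (f \<circ> (\<lambda>x. c *\<^sub>R x + t))"
    by (intro continuous_on_compose continuous_intros) (auto intro: continuous_on_subset)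
  then show ?case by (simp add: o_def)
next
  case (Suc k)
  have lin: "linear (frechet_derivative f (at x))" for x
    using C_k_SucD[OF Suc.prems] has_derivative_linear by blast
  show ?case
  proof (rule C_k_SucI[where f' = "\<lambda>x h. c * frechet_derivative f (at (c *\<^sub>R x + t)) h"])
    show "((\<lambda>x. f (c *\<^sub>R x + t)) has_derivative (\<lambda>h. c * frechet_derivative f (at (c *\<^sub>R x + t)) h)) (at x)" for x
      by (rule has_derivative_eq_rhs[OF has_derivative_compose[OF _ C_k_SucD[OF Suc.prems], of "\<lambda>x. c *\<^sub>R x + t" "\<lambda>h. c *\<^sub>R h"]])
         (auto intro!: derivative_eq_intros simp: linear_cmul[OF lin])
    show "C_k k (\<lambda>x. c * frechet_derivative f (at (c *\<^sub>R x + t)) b)" if "b \<in> Basis" for b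
      by (intro C_k_mult C_k_const Suc.IH[of "\<lambda>x. frechet_derivative f (at x) b"] C_k_SucD_partial[OF Suc.prems that])
  qed
qed

lemma C_k_inner_right:
  fixes g :: "real => real" and b :: "'a::euclidean_space"
  shows "C_k k g ==> C_k k (\<lambda>x. g (x \<bullet> b))"
proof (induction k arbitrary: g)
  case 0
  then have "continuous_on UNIV (g \<circ> (\<lambda>x. x \<bullet> b))"
    by (intro continuous_on_compose continuous_intros) (auto intro: continuous_on_subset)
  then show ?case by (simp add: o_def)
next
  case (Suc k)
  have lin: "linear (frechet_derivative g (at x))" for x
    using C_k_SucD[OF Suc.prems] has_derivative_linear by blast
  have eq: "frechet_derivative g (at x) r = r * frechet_derivative g (at x) 1" for x r
    using linear_cmul[OF lin, of x r 1] by simp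
  show ?case
  proof (rule C_k_SucI[where f' = "\<lambda>x h. (h \<bullet> b) * frechet_derivative g (at (x \<bullet> b)) 1"])
    show "((\<lambda>x. g (x \<bullet> b)) has_derivative (\<lambda>h. (h \<bullet> b) * frechet_derivative g (at (x \<bullet> b)) 1)) (at x)" for x
      by (rule has_derivative_eq_rhs[OF has_derivative_compose[OF _ C_k_SucD[OF Suc.prems], of "\<lambda>x. x \<bullet> b" "\<lambda>h. h \<bullet> b"]])
         (auto intro!: derivative_eq_intros simp: eq[of _ "_ \<bullet> b"])
    show "C_k k (\<lambda>x. (b' \<bullet> b) * frechet_derivative g (at (x \<bullet> b)) 1)" for b'
      by (intro C_k_mult C_k_const Suc.IH[of "\<lambda>x. frechet_derivative g (at x) 1"] C_k_SucD_partial[OF Suc.prems]) simp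
  qed
qed

lemma smooth_coordinate: "smooth (\<lambda>x::'a::euclidean_space. x \<bullet> b)"
proof
  fix k
  have "C_k k (\<lambda>t::real. t)"
  proof (cases k)
    case (Suc j)
    show ?thesis unfolding Suc
      by (rule C_k_SucI[where f' = "\<lambda>x h. h"]) (auto intro: C_k_const has_derivative_ident)
  qed simp
  then show "C_k k (\<lambda>x::'a. x \<bullet> b)" by (rule C_k_inner_right)
qed

lemma smooth_partial: "smooth f ==> b \<in> Basis ==> smooth (\<lambda>x. frechet_derivative f (at x) b)"
  using C_k_SucD_partial by blast

lemma smooth_has_derivative: "smooth f ==> (f has_derivative frechet_derivative f (at x)) (at x)"
  using C_k_SucD by blast

lemma smooth_continuous: "smooth f ==> continuous_on UNIV f"
  using C_k_continuous by blast

lemma smooth_derivI: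
  assumes "\<And>x. (F has_field_derivative f x) (at x)" "smooth f"
  shows "smooth F"
proof
  fix k
  have "C_k (Suc k) F"
    by (rule C_k_SucI[where f' = "\<lambda>x h. f x * h"]) (use assms in \<open>auto simp: has_field_derivative_def\<close>)
  then show "C_k k F" by (rule C_k_lower)
qed

text \<open>The functions \<open>p(1/t) exp(-1/t)\<close> on \<open>t > 0\<close>, continued by zero, with \<open>p\<close> a polynomial: a
  family that is closed under differentiation and therefore consists of smooth functions.\<close>

definition flat :: "real poly => real => real" where
  "flat p t = (if t \<le> 0 then 0 else poly p (1 / t) * exp (- (1 / t)))"

lemma poly_exp_tendsto_0: "((\<lambda>x::real. poly p x * exp (- x)) \<longlongrightarrow> 0) at_top"
proof -
  have "((\<lambda>x::real. x ^ k * poly p x * exp (- x)) \<longlongrightarrow> 0) at_top" for k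
  proof (induction p arbitrary: k)
    case (pCons a p)
    have "((\<lambda>x::real. a * (x ^ k / exp x) + x ^ Suc k * poly p x * exp (- x)) \<longlongrightarrow> a * 0 + 0) at_top"
      by (intro tendsto_intros pCons.IH tendsto_power_div_exp_0)
    then show ?case by (simp add: algebra_simps exp_minus divide_inverse)
  qed simp
  from this[of 0] show ?thesis by simp
qed

text \<open>The family is closed under differentiation, which is what makes its members smooth: in \<open>s = 1 / t\<close>
  the derivative of \<open>p(s) exp(-s)\<close> with respect to \<open>t\<close> is \<open>s^2 (p(s) - p'(s)) exp(-s)\<close>.\<close>

lemma flat_has_field_derivative:
  "(flat p has_field_derivative flat ([:0, 0, 1:] * (p - pderiv p)) t) (at t)"
proof -
  consider "t < 0" | "t > 0" | "t = 0" by linarith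
  then show ?thesis
  proof cases
    case 1
    have "((\<lambda>_. 0) has_field_derivative 0) (at t)" by simp
    then have "(flat p has_field_derivative 0) (at t)"
      by (rule has_field_derivative_transform_within_open[of _ _ _ "{..<0}"]) (use 1 in \<open>auto simp: flat_def\<close>)
    then show ?thesis using 1 by (simp add: flat_def)
  next
    case 2
    have "((\<lambda>t. poly p (1 / t) * exp (- (1 / t))) has_field_derivative
       poly ([:0, 0, 1:] * (p - pderiv p)) (1 / t) * exp (- (1 / t))) (at t)"
      using 2 by (auto intro!: derivative_eq_intros DERIV_chain'[where g = "poly p"] poly_DERIV
        simp: field_simps power2_eq_square)
    then have "(flat p has_field_derivative poly ([:0, 0, 1:] * (p - pderiv p)) (1 / t) * exp (- (1 / t))) (at t)"
      by (rule has_field_derivative_transform_within_open[of _ _ _ "{0<..}"]) (use 2 in \<open>auto simp: flat_def\<close>)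
    then show ?thesis using 2 by (simp add: flat_def)
  next
    case 3
    have "((\<lambda>h. flat p h / h) \<longlongrightarrow> 0) (at_right 0)"
    proof -
      have "((\<lambda>h. poly (pCons 0 p) (inverse h) * exp (- inverse h)) \<longlongrightarrow> 0) (at_right 0)"
        by (rule filterlim_compose[OF poly_exp_tendsto_0 filterlim_inverse_at_top_right])
      then show ?thesis
        by (rule Lim_transform_eventually)
           (auto simp: eventually_at_filter flat_def divide_inverse algebra_simps)
    qed
    moreover have "((\<lambda>h. flat p h / h) \<longlongrightarrow> 0) (at_left 0)"
      by (rule Lim_transform_eventually[OF tendsto_const]) (auto simp: eventually_at_filter flat_def)
    ultimately have "((\<lambda>h. flat p h / h) \<longlongrightarrow> 0) (at 0)" by (rule filterlim_split_at[rotated])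
    then show ?thesis using 3 by (simp add: DERIV_def flat_def)
  qed
qed

lemma smooth_flat: "smooth (flat p)"
proof -
  have "C_k k (flat p)" for k
  proof (induction k arbitrary: p)
    case 0
    show ?case
      by (auto intro!: continuous_at_imp_continuous_on DERIV_isCont flat_has_field_derivative)
  next
    case (Suc k)
    show ?case
      by (rule C_k_SucI[where f' = "\<lambda>x h. flat ([:0, 0, 1:] * (p - pderiv p)) x * h"])
         (use flat_has_field_derivative Suc in \<open>auto simp: has_field_derivative_def\<close>)
  qed
  then show ?thesis by blast
qed

lemma flat_1: "flat 1 t = (if t \<le> 0 then 0 else exp (- (1 / t)))"
  by (simp add: flat_def)

lemma smooth_affine_real: "smooth (g :: real => real) ==> smooth (\<lambda>x. g (c * x + t))"
  using C_k_affine[of _ g c t] by simp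

lemma smooth_step_exists:
  obtains h :: "real => real" where "smooth h" "\<And>t. t \<le> 0 ==> h t = 0" "\<And>t. 1 \<le> t ==> h t = 1"
proof -
  define g where "g t = flat 1 t * flat 1 (1 - t)" for t
  have "smooth (\<lambda>t. flat 1 ((-1) * t + 1))" using smooth_affine_real[OF smooth_flat] .
  then have g: "smooth g" unfolding g_def using smooth_flat[of 1] by (auto intro!: C_k_mult)
  then have cont: "continuous_on UNIV g" by (rule smooth_continuous)
  then have int: "g integrable_on {a..b}" for a b
    by (intro integrable_continuous_real) (auto intro: continuous_on_subset)
  have g0: "g t = 0" if "t \<le> 0 \<or> 1 \<le> t" for t using that by (auto simp: g_def flat_1)
  define F where "F t = integral {-1..t} g" for t
  have F0: "F t = 0" if "t \<le> 0" for t
    unfolding F_def using that by (subst integral_cong[where g = "\<lambda>_. 0"]) (auto simp: g0)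
  have F': "(F has_field_derivative g t) (at t)" for t
  proof (cases "t < 0")
    case True
    have "((\<lambda>_. 0) has_field_derivative 0) (at t)" by simp
    then have "(F has_field_derivative 0) (at t)"
      by (rule has_field_derivative_transform_within_open[of _ _ _ "{..<0}"]) (use True F0 in auto)
    then show ?thesis using True g0 by simp
  next
    case False
    have "(F has_field_derivative g t) (at t within {-1..t+1})"
      unfolding F_def using False cont
      by (intro integral_has_real_derivative) (auto intro: continuous_on_subset)
    then show ?thesis using False by (subst (asm) at_within_interior) auto
  qed
  have F1: "F t = F 1" if "1 \<le> t" for t
  proof -
    have "integral {-1..1} g + integral {1..t} g = integral {-1..t} g"
      using that int by (intro Henstock_Kurzweil_Integration.integral_combine) auto
    moreover have "integral {1..t} g = 0" by (subst integral_cong[where g = "\<lambda>_. 0"]) (auto simp: g0)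
    ultimately show ?thesis by (simp add: F_def)
  qed
  obtain z where z: "0 < z" "z < 1" "F 1 - F 0 = (1 - 0) * g z" using MVT2[of 0 1 F g] F' by auto
  then have F1_pos: "F 1 > 0" using F0[of 0] by (simp add: g_def flat_1)
  have "smooth F" using smooth_derivI[OF F' g] .
  then have "smooth (\<lambda>t. inverse (F 1) * F t)" by (auto intro!: C_k_mult C_k_const)
  then show ?thesis
  proof (rule that)
    show "inverse (F 1) * F t = 0" if "t \<le> 0" for t using F0 that by simp
    show "inverse (F 1) * F t = 1" if "1 \<le> t" for t using F1[OF that] F1_pos by simp
  qed
qed

section \<open>The fundamental lemma of the calculus of variations\<close>

text \<open>Products over the coordinates of \<open>exp(-1/(n t))\<close>, where \<open>t\<close> is the distance to a face.\<close>

lemma box_indicator_approx: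
  fixes l u :: "'a::euclidean_space"
  obtains \<psi> :: "nat => 'a => real" where "\<And>n. smooth (\<psi> n)" "\<And>n x. x \<notin> cbox l u ==> \<psi> n x = 0"
    "\<And>n x. 0 \<le> \<psi> n x" "\<And>n x. \<psi> n x \<le> 1" "\<And>x. (\<lambda>n. \<psi> n x) \<longlonglongrightarrow> indicator (box l u) x"
proof -
  define \<psi> where "\<psi> n x = (\<Prod>b\<in>Basis. flat 1 (real n * (x \<bullet> b) + - real n * (l \<bullet> b)) *
     flat 1 (- real n * (x \<bullet> b) + real n * (u \<bullet> b)))" for n :: nat and x :: 'a
  have fl: "0 \<le> flat 1 t" "flat 1 t \<le> 1" for t :: real by (auto simp: flat_1)
  show ?thesis
  proof (rule that)
    show "smooth (\<psi> n)" for n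
    proof
      fix k
      have "C_k k (\<lambda>x::'a. flat 1 (c * (x \<bullet> b) + d))" for c d and b :: 'a
        using C_k_inner_right smooth_affine_real[OF smooth_flat] by blast
      then show "C_k k (\<psi> n)" unfolding \<psi>_def by (intro C_k_prod C_k_mult)
    qed
    show "\<psi> n x = 0" if x: "x \<notin> cbox l u" for n x
    proof -
      obtain b where b: "b \<in> Basis" "x \<bullet> b < l \<bullet> b \<or> u \<bullet> b < x \<bullet> b" using x by (auto simp: mem_box not_le)
      then have "real n * (x \<bullet> b) \<le> real n * (l \<bullet> b) \<or> real n * (u \<bullet> b) \<le> real n * (x \<bullet> b)"
        by (auto intro: mult_left_mono)
      then show ?thesis unfolding \<psi>_def using b(1) by (intro prod_zero bexI[of _ b]) (auto simp: flat_1)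
    qed
    show "0 \<le> \<psi> n x" for n x unfolding \<psi>_def by (intro prod_nonneg ballI mult_nonneg_nonneg fl)
    show "\<psi> n x \<le> 1" for n x unfolding \<psi>_def by (intro prod_le_1 conjI mult_nonneg_nonneg mult_le_one fl)
    have lim: "(\<lambda>n. flat 1 (real n * c + real n * d)) \<longlonglongrightarrow> (if c + d > 0 then 1 else 0)" for c d
    proof (cases "c + d > 0")
      case True
      have "(\<lambda>n. exp (- (1 / (c + d)) * (1 / real n))) \<longlonglongrightarrow> exp (- (1 / (c + d)) * 0)"
        by (intro tendsto_intros lim_1_over_n)
      then have "(\<lambda>n. flat 1 (real n * c + real n * d)) \<longlonglongrightarrow> exp (- (1 / (c + d)) * 0)"
      proof (rule Lim_transform_eventually)
        have "exp (- (1 / (c + d)) * (1 / real n)) = flat 1 (real n * c + real n * d)" if "n > 0" for n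
        proof -
          have "real n * (c + d) > 0" using that True by simp
          then show ?thesis by (simp add: flat_1 algebra_simps not_le)
        qed
        then show "\<forall>\<^sub>F n in sequentially. exp (- (1 / (c + d)) * (1 / real n)) = flat 1 (real n * c + real n * d)"
          by (intro eventually_mono[OF eventually_gt_at_top[of 0]])
      qed
      then show ?thesis using True by simp
    next
      case False
      then have "flat 1 (real n * c + real n * d) = 0" for n
        by (simp add: flat_1 mult_nonneg_nonpos flip: distrib_left)
      then show ?thesis using False by simp
    qed
    show "(\<lambda>n. \<psi> n x) \<longlonglongrightarrow> indicator (box l u) x" for x
    proof -
      have "(\<lambda>n. \<psi> n x) \<longlonglongrightarrow> (\<Prod>b\<in>Basis. (if x \<bullet> b + - (l \<bullet> b) > 0 then 1 else 0) * (if - (x \<bullet> b) + u \<bullet> b > 0 then 1 else 0))"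
        unfolding \<psi>_def
        by (intro tendsto_prod tendsto_mult) (use lim[of "x \<bullet> _" "- (l \<bullet> _)"] lim[of "- (x \<bullet> _)" "u \<bullet> _"] in simp_all)
      also have "(\<Prod>b\<in>Basis. (if x \<bullet> b + - (l \<bullet> b) > 0 then 1 else 0) * (if - (x \<bullet> b) + u \<bullet> b > 0 then 1 else (0::real))) = indicator (box l u) x"
      proof (cases "x \<in> box l u")
        case True
        then show ?thesis by (intro trans[OF prod.neutral]) (auto simp: mem_box)
      next
        case False
        then obtain b where "b \<in> Basis" "\<not> (l \<bullet> b < x \<bullet> b \<and> x \<bullet> b < u \<bullet> b)" by (auto simp: mem_box)
        then show ?thesis using False by (subst prod_zero) (auto intro!: bexI[of _ b])
      qed
      finally show ?thesis .
    qed
  qed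
qed


lemma test_funI:
  "smooth \<phi> ==> compact K ==> K \<subseteq> D ==> (\<And>x. x \<notin> K ==> \<phi> x = 0) ==> test_fun D \<phi>"
  unfolding test_fun_def by blast

lemma locally_integrable_compact: "locally_integrable D w ==> compact K ==> K \<subseteq> D ==> set_integrable lborel K w"
  unfolding locally_integrable_def by blast

lemma set_integral_box_zero:
  fixes w :: "'a::euclidean_space => real"
  assumes w: "locally_integrable D w" and sub: "cbox l u \<subseteq> D"
    and zero: "\<And>\<phi>. test_fun D \<phi> ==> (LINT x:D|lborel. w x * \<phi> x) = 0"
  shows "(LINT x:box l u|lborel. w x) = 0"
proof -
  obtain \<psi> where psi: "\<And>n::nat. smooth (\<psi> n)" "\<And>n x. x \<notin> cbox l u ==> \<psi> n x = 0"
    "\<And>n x. 0 \<le> \<psi> n x" "\<And>n x. \<psi> n x \<le> 1" "\<And>x. (\<lambda>n. \<psi> n x) \<longlonglongrightarrow> indicator (box l u) x"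
    using box_indicator_approx[of l u] by blast
  have wi: "set_integrable lborel (cbox l u) w" using locally_integrable_compact[OF w _ sub] by simp
  then have wi': "integrable lborel (\<lambda>x. indicator (cbox l u) x * w x)" by (simp add: set_integrable_def)
  have eq: "indicator D x *\<^sub>R (w x * \<psi> n x) = (indicator (cbox l u) x * w x) * \<psi> n x" for n x
    using psi(2)[of x n] sub by (auto simp: indicator_def)
  have "(\<lambda>n. \<integral>x. (indicator (cbox l u) x * w x) * \<psi> n x \<partial>lborel) \<longlonglongrightarrow>
     (\<integral>x. (indicator (cbox l u) x * w x) * indicator (box l u) x \<partial>lborel)"
  proof (rule integral_dominated_convergence[where w = "\<lambda>x. norm (indicator (cbox l u) x * w x)"])
    have [measurable]: "\<psi> n \<in> borel_measurable borel" for n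
      using smooth_continuous[OF psi(1)] by (rule borel_measurable_continuous_onI)
    have [measurable]: "(\<lambda>x. indicator (cbox l u) x * w x) \<in> borel_measurable borel"
      using wi' by auto
    show "(\<lambda>x. indicator (cbox l u) x * w x * \<psi> n x) \<in> borel_measurable lborel" for n by measurable
    show "(\<lambda>x. indicator (cbox l u) x * w x * indicator (box l u) x) \<in> borel_measurable lborel" by measurable
    show "AE x in lborel. (\<lambda>n. indicator (cbox l u) x * w x * \<psi> n x) \<longlonglongrightarrow> indicator (cbox l u) x * w x * indicator (box l u) x"
      by (auto intro!: tendsto_intros psi)
    show "AE x in lborel. norm (indicator (cbox l u) x * w x * \<psi> n x) \<le> norm (indicator (cbox l u) x * w x)" for n
      using psi(3,4) by (auto simp: abs_mult intro!: mult_left_le AE_I2)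
  qed (use wi' in simp)
  moreover have "(\<integral>x. (indicator (cbox l u) x * w x) * \<psi> n x \<partial>lborel) = 0" for n
  proof -
    have "test_fun D (\<psi> n)" by (rule test_funI[OF psi(1) _ sub psi(2)]) auto
    from zero[OF this] show ?thesis unfolding set_lebesgue_integral_def eq .
  qed
  ultimately have "(\<lambda>n::nat. 0) \<longlonglongrightarrow> (\<integral>x. (indicator (cbox l u) x * w x) * indicator (box l u) x \<partial>lborel)"
    by simp
  then have "(\<integral>x. (indicator (cbox l u) x * w x) * indicator (box l u) x \<partial>lborel) = 0"
    by (rule LIMSEQ_unique[OF _ tendsto_const])
  moreover have "(indicator (cbox l u) x * w x) * indicator (box l u) x = indicator (box l u) x * w x" for x
    using box_subset_cbox[of l u] by (auto simp: indicator_def)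
  ultimately show ?thesis by (simp add: set_lebesgue_integral_def)
qed

text \<open>By approximation of indicators, the integral over every small box vanishes. Differentiation of the indefinite
  integral over cubes then gives zero almost everywhere, and countably many rational boxes exhaust \<open>D\<close>.\<close>

lemma fundamental_lemma:
  fixes w :: "'a::euclidean_space => real"
  assumes D: "open D" and w: "locally_integrable D w"
    and zero: "\<And>\<phi>. test_fun D \<phi> ==> (LINT x:D|lborel. w x * \<phi> x) = 0"
  shows "AE x in lborel. x \<in> D \<longrightarrow> w x = 0"
proof -
  have cube: "AE x in lborel. x \<in> cbox l u \<longrightarrow> w x = 0" if sub: "cbox l u \<subseteq> D" for l u
  proof -
    define f where "f x = (if x \<in> cbox l u then w x else 0)" for x
    have si: "set_integrable lborel (cbox l u) w" using locally_integrable_compact[OF w _ sub] by simp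
    have int0: "f integrable_on cbox a b \<and> integral (cbox a b) f = 0" for a b
    proof -
      obtain c d where cd: "cbox a b \<inter> cbox l u = cbox c d" using Int_interval by blast
      have cdD: "cbox c d \<subseteq> D" using cd sub by blast
      have si': "set_integrable lborel (cbox c d) w" using locally_integrable_compact[OF w _ cdD] by simp
      have si'': "set_integrable lborel (box c d) w"
        by (rule set_integrable_subset[OF si']) (auto simp: box_subset_cbox)
      have "integral (cbox c d) w = integral (box c d) w" by (simp add: integral_open_interval)
      also have "\<dots> = 0"
        using set_borel_integral_eq_integral(2)[OF si''] set_integral_box_zero[OF w cdD zero] by simp
      finally have 1: "integral (cbox c d) w = 0" .
      have 2: "w integrable_on cbox c d" using set_borel_integral_eq_integral(1)[OF si'] .
      have "(w has_integral 0) (cbox c d)" using 1 2 by (metis integrable_integral)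
      then have "(f has_integral 0) (cbox a b)"
        unfolding f_def using has_integral_restrict_Int[of "cbox l u" w 0 "cbox a b"] cd
        by (simp add: Int_commute)
      then show ?thesis by (auto simp: has_integral_integrable integral_unique)
    qed
    obtain Z where Z: "negligible Z" "\<And>x e. x \<notin> Z ==> 0 < e ==> \<exists>d>0. \<forall>h. 0 < h \<and> h < d \<longrightarrow>
        norm (integral (cbox x (x + h *\<^sub>R One)) f /\<^sub>R h ^ DIM('a) - f x) < e"
      using integrable_ccontinuous_explicit[of f] int0 by metis
    have "f x = 0" if xZ: "x \<notin> Z" for x
    proof (rule ccontr)
      assume "f x \<noteq> 0"
      then obtain d where "d > 0" "\<And>h. 0 < h ==> h < d ==>
        norm (integral (cbox x (x + h *\<^sub>R One)) f /\<^sub>R h ^ DIM('a) - f x) < norm (f x)"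
        using Z(2)[OF xZ, of "norm (f x)"] by auto
      from this(2)[of "d/2"] this(1) int0 show False by simp
    qed
    then have "w x = 0" if "x \<notin> Z" "x \<in> cbox l u" for x using that by (metis f_def)
    then have "{x \<in> space lebesgue. \<not> (x \<in> cbox l u \<longrightarrow> w x = 0)} \<subseteq> Z" by blast
    then have "AE x in lebesgue. x \<in> cbox l u \<longrightarrow> w x = 0"
      using Z(1) unfolding negligible_iff_null_sets by (rule AE_I'[rotated])
    then show ?thesis by (simp add: AE_completion_iff)
  qed
  define a' where "a' f = (\<Sum>(i::'a)\<in>Basis. fst (f i) *\<^sub>R i)" for f :: "'a => real \<times> real"
  define b' where "b' f = (\<Sum>(i::'a)\<in>Basis. snd (f i) *\<^sub>R i)" for f :: "'a => real \<times> real"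
  define I where "I = {f\<in>Basis \<rightarrow>\<^sub>E \<rat> \<times> \<rat>. cbox (a' f) (b' f) \<subseteq> D}"
  have un: "D = (\<Union>f\<in>I. cbox (a' f) (b' f))"
    unfolding I_def a'_def b'_def by (rule open_UNION_cbox[OF D])
  have cI: "countable I"
    unfolding I_def by (rule countable_Collect) (auto intro!: countable_PiE countable_rat countable_SIGMA)
  have "AE x in lborel. \<forall>f\<in>I. x \<in> cbox (a' f) (b' f) \<longrightarrow> w x = 0"
    unfolding AE_ball_countable[OF cI] using cube by (auto simp: I_def)
  then show ?thesis
  proof (rule AE_mp, intro AE_I2 impI)
    fix x assume *: "\<forall>f\<in>I. x \<in> cbox (a' f) (b' f) \<longrightarrow> w x = 0" "x \<in> D"
    then have "x \<in> (\<Union>f\<in>I. cbox (a' f) (b' f))" using un by blast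
    then show "w x = 0" using * by blast
  qed
qed

lemma locally_integrable_measurable:
  fixes w :: "'a::euclidean_space => real"
  assumes D: "open D" and w: "locally_integrable D w"
  shows "(\<lambda>x. indicator D x * w x) \<in> borel_measurable borel"
proof -
  obtain C where C: "\<And>n::nat. compact (C n)" "\<And>n. C n \<subseteq> D" "\<And>n. C n \<subseteq> interior (C (Suc n))" "\<Union>(range C) = D"
    using open_Union_compact_subsets[OF D] by metis
  have inc: "incseq C" using C(3) interior_subset by (intro incseq_SucI) blast
  have "(\<lambda>x. indicator (C n) x * w x) \<in> borel_measurable borel" for n
    using locally_integrable_compact[OF w C(1,2)] by (auto simp: set_integrable_def)
  moreover have "(\<lambda>n. indicator (C n) x * w x) \<longlonglongrightarrow> indicator D x * w x" for x
  proof (intro tendsto_mult tendsto_const)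
    show "(\<lambda>n. indicator (C n) x) \<longlonglongrightarrow> (indicator D x :: real)"
      using LIMSEQ_indicator_incseq[OF inc, of x] C(4) by simp
  qed
  ultimately show ?thesis by (rule borel_measurable_LIMSEQ_real[rotated])
qed

section \<open>Square integrable functions\<close>

definition sq_integrable :: "'a measure => ('a => 'b::euclidean_space) => bool" where
  "sq_integrable M f \<longleftrightarrow> f \<in> borel_measurable M \<and> integrable M (\<lambda>x. (norm (f x))\<^sup>2)"

definition l2 :: "'a measure => ('a => 'b::euclidean_space) => real" where
  "l2 M f = sqrt (\<integral>x. (norm (f x))\<^sup>2 \<partial>M)"

lemma sq_integrable_measurable [measurable_dest]: "sq_integrable M f ==> f \<in> borel_measurable M"
  by (simp add: sq_integrable_def)

lemma l2_nonneg [simp]: "0 \<le> l2 M f"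
  by (simp add: l2_def)

lemma l2_power2: "(l2 M f)\<^sup>2 = (\<integral>x. (norm (f x))\<^sup>2 \<partial>M)"
  by (simp add: l2_def)

lemma nn_integral_l2:
  "sq_integrable M f ==> (\<integral>\<^sup>+x. ennreal ((norm (f x))\<^sup>2) \<partial>M) = ennreal ((l2 M f)\<^sup>2)"
  unfolding l2_power2 sq_integrable_def by (intro nn_integral_eq_integral) auto

lemma sq_integrableI_nn:
  assumes "f \<in> borel_measurable M" "(\<integral>\<^sup>+x. ennreal ((norm (f x))\<^sup>2) \<partial>M) \<le> ennreal (c\<^sup>2)" "0 \<le> c"
  shows "sq_integrable M f" "l2 M f \<le> c"
proof -
  show 1: "sq_integrable M f" unfolding sq_integrable_def
    using assms(1) order_le_less_trans[OF assms(2) ennreal_less_top] by (auto intro!: integrableI_bounded)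
  have "ennreal ((l2 M f)\<^sup>2) \<le> ennreal (c\<^sup>2)" using nn_integral_l2[OF 1] assms by simp
  then have "(l2 M f)\<^sup>2 \<le> c\<^sup>2" by (simp add: ennreal_le_iff)
  then show "l2 M f \<le> c" using assms(3) by (rule power2_le_imp_le)
qed

lemma sq_integrable_AE:
  assumes "sq_integrable M f" "g \<in> borel_measurable M" "AE x in M. f x = g x"
  shows "sq_integrable M g" and "l2 M g = l2 M f"
proof -
  have eq: "AE x in M. (norm (f x))\<^sup>2 = (norm (g x))\<^sup>2" using assms(3) by auto
  have m: "(\<lambda>x. (norm (f x))\<^sup>2) \<in> borel_measurable M" "(\<lambda>x. (norm (g x))\<^sup>2) \<in> borel_measurable M"
    using assms by (auto simp: sq_integrable_def)
  show "sq_integrable M g" unfolding sq_integrable_def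
    using assms(1,2) integrable_cong_AE[OF m eq] by (auto simp: sq_integrable_def)
  show "l2 M g = l2 M f" unfolding l2_def using integral_cong_AE[OF m eq] by simp
qed

lemma sq_integrable_scale: "sq_integrable M f ==> sq_integrable M (\<lambda>x. c *\<^sub>R f x)"
  by (auto simp: sq_integrable_def power_mult_distrib)

lemma l2_scale: "l2 M (\<lambda>x. c *\<^sub>R f x) = \<bar>c\<bar> * l2 M f"
  by (simp add: l2_def power_mult_distrib real_sqrt_mult)

lemma sq_integrable_zero [simp]: "sq_integrable M (\<lambda>x. 0)" "l2 M (\<lambda>x. 0) = 0"
  by (auto simp: sq_integrable_def l2_def)

lemma sq_integrable_add:
  assumes f: "sq_integrable M f" and g: "sq_integrable M g"
  shows "sq_integrable M (\<lambda>x. f x + g x)"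
proof -
  have "integrable M (\<lambda>x. (norm (f x + g x))\<^sup>2)"
  proof (rule Bochner_Integration.integrable_bound)
    show "integrable M (\<lambda>x. 2 * (norm (f x))\<^sup>2 + 2 * (norm (g x))\<^sup>2)"
      using f g by (auto simp: sq_integrable_def)
    show "(\<lambda>x. (norm (f x + g x))\<^sup>2) \<in> borel_measurable M" using f g by (auto simp: sq_integrable_def)
    have "(norm (f x + g x))\<^sup>2 \<le> 2 * (norm (f x))\<^sup>2 + 2 * (norm (g x))\<^sup>2" for x
    proof -
      have "(norm (f x + g x))\<^sup>2 \<le> (norm (f x) + norm (g x))\<^sup>2" by (intro power_mono norm_triangle_ineq) simp
      also have "\<dots> \<le> 2 * (norm (f x))\<^sup>2 + 2 * (norm (g x))\<^sup>2"
        using sum_squares_bound[of "norm (f x)" "norm (g x)"] by (simp add: power2_sum)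
      finally show ?thesis .
    qed
    then show "AE x in M. norm ((norm (f x + g x))\<^sup>2) \<le> norm (2 * (norm (f x))\<^sup>2 + 2 * (norm (g x))\<^sup>2)"
      by (auto intro!: AE_I2)
  qed
  then show ?thesis using f g by (auto simp: sq_integrable_def)
qed

lemma sq_integrable_diff:
  "sq_integrable M f ==> sq_integrable M g ==> sq_integrable M (\<lambda>x. f x - g x)"
  using sq_integrable_add[OF _ sq_integrable_scale[of M g "-1"], of f] by simp

lemma Cauchy_Schwarz_l2:
  assumes f: "sq_integrable M f" and g: "sq_integrable M g"
  shows "integrable M (\<lambda>x. norm (f x) * norm (g x))"
    and "(\<integral>x. norm (f x) * norm (g x) \<partial>M) \<le> l2 M f * l2 M g"
proof -
  show i: "integrable M (\<lambda>x. norm (f x) * norm (g x))"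
  proof (rule Bochner_Integration.integrable_bound)
    show "integrable M (\<lambda>x. (norm (f x))\<^sup>2 + (norm (g x))\<^sup>2)" using f g by (auto simp: sq_integrable_def)
    have "norm (f x) * norm (g x) \<le> (norm (f x))\<^sup>2 + (norm (g x))\<^sup>2" for x
    proof -
      have "0 \<le> norm (f x) * norm (g x)" by simp
      then show ?thesis using sum_squares_bound[of "norm (f x)" "norm (g x)"] by linarith
    qed
    then show "AE x in M. norm (norm (f x) * norm (g x)) \<le> norm ((norm (f x))\<^sup>2 + (norm (g x))\<^sup>2)"
      by (auto intro!: AE_I2)
  qed (use f g in \<open>auto simp: sq_integrable_def\<close>)
  have [measurable]: "f \<in> borel_measurable M" "g \<in> borel_measurable M" using f g by (auto simp: sq_integrable_def)
  let ?b = "\<integral>x. norm (f x) * norm (g x) \<partial>M"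
  have b0: "0 \<le> ?b" by (intro integral_nonneg_AE) simp
  have "(ennreal ?b)\<^sup>2 = (\<integral>\<^sup>+x. ennreal (norm (f x)) * ennreal (norm (g x)) \<partial>M)\<^sup>2"
    using nn_integral_eq_integral[OF i] by (simp add: ennreal_mult')
  also have "\<dots> \<le> (\<integral>\<^sup>+x. ennreal (norm (f x)) ^ 2 \<partial>M) * (\<integral>\<^sup>+x. ennreal (norm (g x)) ^ 2 \<partial>M)"
    by (rule Cauchy_Schwarz_nn_integral) auto
  also have "\<dots> = ennreal ((l2 M f)\<^sup>2 * (l2 M g)\<^sup>2)"
    using nn_integral_l2[OF f] nn_integral_l2[OF g] by (simp add: ennreal_power ennreal_mult)
  finally have "?b\<^sup>2 \<le> (l2 M f * l2 M g)\<^sup>2"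
    using b0 by (simp add: ennreal_power power_mult_distrib ennreal_le_iff)
  then show "?b \<le> l2 M f * l2 M g" by (rule power2_le_imp_le) simp
qed

lemma integrable_product_l2:
  assumes f: "sq_integrable M f" and g: "sq_integrable M g"
    and h: "h \<in> borel_measurable M" "\<And>x. x \<in> space M ==> \<bar>h x\<bar> \<le> c * (norm (f x) * norm (g x))" and c: "0 \<le> c"
  shows "integrable M h" and "\<bar>\<integral>x. h x \<partial>M\<bar> \<le> c * l2 M f * l2 M g"
proof -
  have i: "integrable M (\<lambda>x. c * (norm (f x) * norm (g x)))"
    using Cauchy_Schwarz_l2(1)[OF f g] by simp
  show h1: "integrable M h"
    by (rule Bochner_Integration.integrable_bound[OF i h(1)]) (use h(2) c in \<open>auto intro!: AE_I2 simp: abs_mult\<close>)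
  have "\<bar>\<integral>x. h x \<partial>M\<bar> \<le> (\<integral>x. \<bar>h x\<bar> \<partial>M)" using integral_norm_bound[of M h] by simp
  also have "\<dots> \<le> (\<integral>x. c * (norm (f x) * norm (g x)) \<partial>M)"
    by (rule integral_mono) (use h1 i h(2) in auto)
  also have "\<dots> = c * (\<integral>x. norm (f x) * norm (g x) \<partial>M)" by simp
  also have "\<dots> \<le> c * (l2 M f * l2 M g)" using Cauchy_Schwarz_l2(2)[OF f g] c by (rule mult_left_mono)
  finally show "\<bar>\<integral>x. h x \<partial>M\<bar> \<le> c * l2 M f * l2 M g" by simp
qed

lemma l2_triangle:
  assumes f: "sq_integrable M f" and g: "sq_integrable M g"
  shows "l2 M (\<lambda>x. f x + g x) \<le> l2 M f + l2 M g"
proof (rule power2_le_imp_le)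
  note i = f[unfolded sq_integrable_def] g[unfolded sq_integrable_def]
  note fg = Cauchy_Schwarz_l2[OF f g]
  have "(l2 M (\<lambda>x. f x + g x))\<^sup>2 \<le> (\<integral>x. (norm (f x))\<^sup>2 + 2 * (norm (f x) * norm (g x)) + (norm (g x))\<^sup>2 \<partial>M)"
    unfolding l2_power2
  proof (rule integral_mono)
    show "integrable M (\<lambda>x. (norm (f x + g x))\<^sup>2)" using sq_integrable_add[OF f g] by (simp add: sq_integrable_def)
    show "integrable M (\<lambda>x. (norm (f x))\<^sup>2 + 2 * (norm (f x) * norm (g x)) + (norm (g x))\<^sup>2)"
      using i fg by auto
    fix x show "(norm (f x + g x))\<^sup>2 \<le> (norm (f x))\<^sup>2 + 2 * (norm (f x) * norm (g x)) + (norm (g x))\<^sup>2"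
      using power_mono[OF norm_triangle_ineq[of "f x" "g x"], of 2] by (simp add: power2_sum algebra_simps)
  qed
  also have "\<dots> = (l2 M f)\<^sup>2 + 2 * (\<integral>x. norm (f x) * norm (g x) \<partial>M) + (l2 M g)\<^sup>2"
    unfolding l2_power2 using i fg by simp
  also have "\<dots> \<le> (l2 M f + l2 M g)\<^sup>2" using fg(2) by (simp add: power2_sum)
  finally show "(l2 M (\<lambda>x. f x + g x))\<^sup>2 \<le> (l2 M f + l2 M g)\<^sup>2" .
qed simp

lemma l2_triangle_diff:
  assumes f: "sq_integrable M f" and g: "sq_integrable M g"
  shows "l2 M (\<lambda>x. f x - g x) \<le> l2 M f + l2 M g"
  using l2_triangle[OF f sq_integrable_scale[OF g, of "-1"]] l2_scale[of M "-1" g] by simp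

text \<open>The usual Riesz-Fischer argument: a subsequence with \<open>l2\<close>-increments below \<open>(1/4) ^ k\<close> converges almost
  everywhere, and Fatou's lemma passes to the limit in the Cauchy condition.\<close>

lemma l2_complete:
  fixes X :: "nat => 'a => 'b::euclidean_space"
  assumes X: "\<And>n. sq_integrable M (X n)"
    and cauchy: "\<And>e. e > 0 ==> \<exists>m. \<forall>p\<ge>m. \<forall>q\<ge>m. l2 M (\<lambda>x. X p x - X q x) < e"
  obtains f where "sq_integrable M f" "(\<lambda>n. l2 M (\<lambda>x. X n x - f x)) \<longlonglongrightarrow> 0"
proof -
  have meas [measurable]: "X n \<in> borel_measurable M" for n using X by (simp add: sq_integrable_def)
  have "\<exists>m. \<forall>p\<ge>m. \<forall>q\<ge>m. l2 M (\<lambda>x. X p x - X q x) < (1/4) ^ k" for k :: nat by (intro cauchy) simp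
  then obtain r0 where r0: "\<And>k p q. r0 k \<le> p ==> r0 k \<le> q ==> l2 M (\<lambda>x. X p x - X q x) < (1/4) ^ k" by metis
  define r where "r k = (\<Sum>j\<le>k. r0 j) + k" for k
  have r: "r0 k \<le> r k" "r k \<le> r (Suc k)" "k \<le> r k" for k
    by (auto simp: r_def intro: trans_le_add1 member_le_sum)
  define d where "d k x = X (r (Suc k)) x - X (r k) x" for k x
  have dsq: "sq_integrable M (d k)" for k unfolding d_def by (intro sq_integrable_diff X)
  have dk: "l2 M (d k) \<le> (1/4) ^ k" for k
    unfolding d_def using r0[of k "r (Suc k)" "r k"] r(1,2)[of k] by simp
  have [measurable]: "d k \<in> borel_measurable M" for k using dsq by (simp add: sq_integrable_def)
  define Z where "Z x = (\<Sum>k. ennreal (4 ^ k * (norm (d k x))\<^sup>2))" for x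
  have "(\<integral>\<^sup>+x. Z x \<partial>M) = (\<Sum>k. \<integral>\<^sup>+x. ennreal (4 ^ k * (norm (d k x))\<^sup>2) \<partial>M)"
    unfolding Z_def by (rule nn_integral_suminf) auto
  also have "\<dots> \<le> (\<Sum>k. ennreal ((1/4) ^ k))"
  proof (rule suminf_le)
    fix k :: nat
    have "(\<integral>\<^sup>+x. ennreal (4 ^ k * (norm (d k x))\<^sup>2) \<partial>M) = ennreal (4 ^ k) * ennreal ((l2 M (d k))\<^sup>2)"
      by (simp add: ennreal_mult nn_integral_cmult nn_integral_l2[OF dsq])
    also have "\<dots> = ennreal (4 ^ k * (l2 M (d k))\<^sup>2)" by (simp add: ennreal_mult)
    also have "\<dots> \<le> ennreal (4 ^ k * ((1/4) ^ k)\<^sup>2)"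
      using dk[of k] by (intro ennreal_leI mult_left_mono power_mono) auto
    also have "(4::real) ^ k * ((1/4) ^ k)\<^sup>2 = (1/4) ^ k"
      by (simp add: power2_eq_square flip: power_mult_distrib mult.assoc)
    finally show "(\<integral>\<^sup>+x. ennreal (4 ^ k * (norm (d k x))\<^sup>2) \<partial>M) \<le> ennreal ((1/4) ^ k)" .
  qed auto
  also have "\<dots> < \<infinity>" by (subst suminf_ennreal2) (auto intro!: summable_geometric)
  finally have fin: "(\<integral>\<^sup>+x. Z x \<partial>M) \<noteq> \<infinity>" by simp
  have "AE x in M. Z x \<noteq> \<infinity>" by (rule nn_integral_noteq_infinite[OF _ fin]) (simp add: Z_def)
  then have conv: "AE x in M. convergent (\<lambda>k. X (r k) x)"
  proof (rule AE_mp, intro AE_I2 impI)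
    fix x assume "Z x \<noteq> \<infinity>"
    then obtain z where z: "Z x = ennreal z" "0 \<le> z" by (metis ennreal_cases infinity_ennreal_def)
    have nb: "norm (d k x) \<le> sqrt z * (1/2) ^ k" for k
    proof -
      have "(\<Sum>j\<in>{k}. ennreal (4 ^ j * (norm (d j x))\<^sup>2)) \<le> Z x"
        unfolding Z_def by (intro sum_le_suminf summableI) simp_all
      then have "ennreal (4 ^ k * (norm (d k x))\<^sup>2) \<le> Z x" by simp
      then have "4 ^ k * (norm (d k x))\<^sup>2 \<le> z" using z by (simp add: ennreal_le_iff)
      moreover have "(2 ^ k * norm (d k x))\<^sup>2 = 4 ^ k * (norm (d k x))\<^sup>2"
        by (simp add: power_mult_distrib power2_eq_square[of "2 ^ k"] power_mult_distrib[symmetric])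
      ultimately have "(2 ^ k * norm (d k x))\<^sup>2 \<le> z" by simp
      then have "2 ^ k * norm (d k x) \<le> sqrt z" by (rule real_le_rsqrt)
      then show ?thesis by (simp add: field_simps power_one_over)
    qed
    have sm: "summable (\<lambda>k. sqrt z * (1/2) ^ k)" by (intro summable_mult summable_geometric) simp
    have "summable (\<lambda>k. d k x)" by (rule summable_comparison_test'[OF sm]) (rule nb)
    then have "convergent (\<lambda>n. \<Sum>k<n. d k x)" by (simp add: summable_iff_convergent)
    moreover have "(\<Sum>k<n. d k x) = X (r n) x - X (r 0) x" for n
      unfolding d_def by (rule sum_lessThan_telescope)
    ultimately have "convergent (\<lambda>n. X (r n) x - X (r 0) x + X (r 0) x)"
      by (intro convergent_add convergent_const) simp
    then show "convergent (\<lambda>k. X (r k) x)" by simp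
  qed
  define f where "f x = lim (\<lambda>k. X (r k) x)" for x
  have [measurable]: "f \<in> borel_measurable M" unfolding f_def by measurable
  have flim: "AE x in M. (\<lambda>k. X (r k) x) \<longlonglongrightarrow> f x"
    using conv by eventually_elim (simp add: f_def convergent_LIMSEQ_iff)
  have tail: "sq_integrable M (\<lambda>x. X n x - f x) \<and> l2 M (\<lambda>x. X n x - f x) \<le> e"
    if e: "e > 0" and m: "\<And>p q. m \<le> p ==> m \<le> q ==> l2 M (\<lambda>x. X p x - X q x) < e" and n: "m \<le> n" for n m e
  proof -
    have "(\<integral>\<^sup>+x. ennreal ((norm (X n x - f x))\<^sup>2) \<partial>M) = (\<integral>\<^sup>+x. liminf (\<lambda>k. ennreal ((norm (X n x - X (r k) x))\<^sup>2)) \<partial>M)"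
    proof (rule nn_integral_cong_AE)
      show "AE x in M. ennreal ((norm (X n x - f x))\<^sup>2) = liminf (\<lambda>k. ennreal ((norm (X n x - X (r k) x))\<^sup>2))"
        using flim
      proof eventually_elim
        case (elim x)
        then have "(\<lambda>k. ennreal ((norm (X n x - X (r k) x))\<^sup>2)) \<longlonglongrightarrow> ennreal ((norm (X n x - f x))\<^sup>2)"
          by (intro tendsto_intros)
        then show ?case by (rule lim_imp_Liminf[OF sequentially_bot, symmetric])
      qed
    qed
    also have "\<dots> \<le> liminf (\<lambda>k. \<integral>\<^sup>+x. ennreal ((norm (X n x - X (r k) x))\<^sup>2) \<partial>M)"
      by (rule nn_integral_liminf) auto
    also have "\<dots> \<le> ennreal (e\<^sup>2)"
    proof (rule Liminf_le)
      show "\<forall>\<^sub>F k in sequentially. (\<integral>\<^sup>+x. ennreal ((norm (X n x - X (r k) x))\<^sup>2) \<partial>M) \<le> ennreal (e\<^sup>2)"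
        using eventually_ge_at_top[of m]
      proof eventually_elim
        case (elim k)
        then have "l2 M (\<lambda>x. X n x - X (r k) x) \<le> e" using m[OF n, of "r k"] r(3)[of k] by simp
        then show ?case
          using nn_integral_l2[OF sq_integrable_diff[OF X X], of n "r k"]
          by (simp add: power_mono ennreal_leI)
      qed
    qed simp
    finally show ?thesis using sq_integrableI_nn[of "\<lambda>x. X n x - f x" M e] e by auto
  qed
  show ?thesis
  proof (rule that)
    obtain m where m: "\<And>p q. m \<le> p ==> m \<le> q ==> l2 M (\<lambda>x. X p x - X q x) < 1"
      using cauchy[OF zero_less_one] by auto
    have "sq_integrable M (\<lambda>x. X m x - f x)" using tail[OF zero_less_one m order_refl] by blast
    from sq_integrable_diff[OF X this, of m] show "sq_integrable M f" by simp
    show "(\<lambda>n. l2 M (\<lambda>x. X n x - f x)) \<longlonglongrightarrow> 0"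
    proof (rule LIMSEQ_I)
      fix e :: real assume e: "e > 0"
      obtain m where m: "\<And>p q. m \<le> p ==> m \<le> q ==> l2 M (\<lambda>x. X p x - X q x) < e / 2"
        using cauchy[of "e/2"] e by auto
      have "l2 M (\<lambda>x. X n x - f x) \<le> e / 2" if "m \<le> n" for n using tail[OF half_gt_zero[OF e] m that] by simp
      then show "\<exists>no. \<forall>n\<ge>no. norm (l2 M (\<lambda>x. X n x - f x) - 0) < e"
        using e by (intro exI[of _ m]) (force simp: intro: order_le_less_trans)
    qed
  qed
qed

section \<open>Affine substitution\<close>

lemma nn_integral_affine:
  fixes f :: "'a::euclidean_space => ennreal"
  assumes [measurable]: "f \<in> borel_measurable borel" and c: "0 < c"
  shows "(\<integral>\<^sup>+x. f x \<partial>lborel) = ennreal (c ^ DIM('a)) * (\<integral>\<^sup>+x. f (t + c *\<^sub>R x) \<partial>lborel)"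
  using c by (subst lborel_affine[of c t]) (simp_all add: nn_integral_density nn_integral_distr nn_integral_cmult)

lemma integrable_affine:
  fixes f :: "'a::euclidean_space => 'b::{banach, second_countable_topology}"
  assumes [measurable]: "f \<in> borel_measurable borel" and c: "0 < c"
  shows "integrable lborel (\<lambda>x. f (t + c *\<^sub>R x)) \<longleftrightarrow> integrable lborel f"
proof -
  have "(\<integral>\<^sup>+x. ennreal (norm (f x)) \<partial>lborel) = ennreal (c ^ DIM('a)) * (\<integral>\<^sup>+x. ennreal (norm (f (t + c *\<^sub>R x))) \<partial>lborel)"
    by (rule nn_integral_affine) (use c in auto)
  then show ?thesis
    using c by (auto simp: integrable_iff_bounded ennreal_mult_less_top)
qed

lemma integral_affine:
  fixes f :: "'a::euclidean_space => real"
  assumes [measurable]: "f \<in> borel_measurable borel" and c: "0 < c"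
  shows "(\<integral>x. f x \<partial>lborel) = c ^ DIM('a) * (\<integral>x. f (t + c *\<^sub>R x) \<partial>lborel)"
  using c by (subst lborel_affine[of c t]) (simp_all add: integral_density integral_distr)

lemma AE_affine:
  fixes P :: "'a::euclidean_space => bool"
  assumes "AE x in lborel. P x" "0 < c"
  shows "AE x in lborel. P (t + c *\<^sub>R x)"
proof -
  obtain N where N: "{x. \<not> P x} \<subseteq> N" "N \<in> null_sets lborel" using assms(1) by (auto simp: eventually_ae_filter)
  then have [measurable]: "N \<in> sets borel" by (auto simp: null_sets_def)
  have "0 = (\<integral>\<^sup>+x. indicator N x \<partial>lborel)" using N(2) by (simp add: null_sets_def)
  also have "\<dots> = ennreal (c ^ DIM('a)) * (\<integral>\<^sup>+x. indicator N (t + c *\<^sub>R x) \<partial>lborel)"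
    by (rule nn_integral_affine) (use assms in auto)
  finally have "(\<integral>\<^sup>+x. indicator N (t + c *\<^sub>R x) \<partial>(lborel :: 'a measure)) = 0" using zero_less_power[OF assms(2), of "DIM('a)"] by (auto simp: ennreal_eq_0_iff)
  then have "AE x in lborel. indicator N (t + c *\<^sub>R x) = (0::ennreal)"
    by (subst (asm) nn_integral_0_iff_AE) auto
  then show ?thesis by eventually_elim (use N(1) in \<open>auto simp: indicator_def split: if_splits\<close>)
qed


section \<open>Continuity of translations\<close>

lemma integral_translate:
  fixes f :: "'a::euclidean_space => real"
  assumes "f \<in> borel_measurable borel"
  shows "(\<integral>x. f (x + h) \<partial>lborel) = (\<integral>x. f x \<partial>lborel)"
  using integral_affine[OF assms, of 1 h] by (simp add: add.commute)

lemma integrable_translate: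
  fixes f :: "'a::euclidean_space => real"
  assumes "integrable lborel f"
  shows "integrable lborel (\<lambda>x. f (x + h))"
  using integrable_affine[of f 1 h] assms by (simp add: add.commute borel_measurable_integrable)

text \<open>The integral equals twice the measure of \<open>U\<close> minus twice that of the intersection of \<open>U\<close> with its
  translate. On an open set the indicator of the translate tends to 1, so dominated convergence applies to the latter.\<close>

lemma L1_translation_open:
  fixes U :: "'a::euclidean_space set"
  assumes U: "open U" "emeasure lborel U < \<infinity>" and h: "h \<longlonglongrightarrow> (0::'a)"
  shows "(\<lambda>n. \<integral>x. \<bar>indicator U (x + h n) - indicator U x\<bar> \<partial>lborel) \<longlonglongrightarrow> (0::real)"
proof -
  have [measurable]: "U \<in> sets borel" using U by simp
  have iU: "integrable lborel (indicator U :: 'a => real)" using U by simp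
  note iU' = integrable_translate[OF iU]
  have iP: "integrable lborel (\<lambda>x. indicator U x * indicator U (x + h) :: real)" for h
    by (rule Bochner_Integration.integrable_bound[OF iU]) (auto simp: indicator_def)
  have eq: "\<bar>indicator U (x + h) - indicator U x\<bar> = indicator U (x + h) + indicator U x - 2 * (indicator U x * indicator U (x + h) :: real)" for x h
    by (auto simp: indicator_def)
  have "(\<integral>x. \<bar>indicator U (x + h) - indicator U x\<bar> \<partial>lborel) =
     2 * (\<integral>x. indicator U x \<partial>lborel) - 2 * (\<integral>x. indicator U x * indicator U (x + h) \<partial>lborel :: real)" for h
    unfolding eq using iU iU'[of h] iP[of h] integral_translate[of "indicator U" h] by simp
  moreover have "(\<lambda>n. \<integral>x. indicator U x * indicator U (x + h n) \<partial>lborel) \<longlonglongrightarrow> (\<integral>x. indicator U x \<partial>lborel :: real)"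
  proof (rule integral_dominated_convergence[where w = "indicator U"])
    show "AE x in lborel. (\<lambda>n. indicator U x * indicator U (x + h n) :: real) \<longlonglongrightarrow> indicator U x"
    proof (intro AE_I2)
      fix x
      show "(\<lambda>n. indicator U x * indicator U (x + h n) :: real) \<longlonglongrightarrow> indicator U x"
      proof (cases "x \<in> U")
        case True
        have "(\<lambda>n. x + h n) \<longlonglongrightarrow> x + 0" by (intro tendsto_intros h)
        then have "\<forall>\<^sub>F n in sequentially. x + h n \<in> U" using True U(1) by (auto dest: topological_tendstoD)
        then have "\<forall>\<^sub>F n in sequentially. (1::real) = indicator U x * indicator U (x + h n)"
          by eventually_elim (use True in auto)
        then show ?thesis using True by (intro Lim_transform_eventually[OF tendsto_const]) auto
      qed simp
    qed
  qed (use iU in \<open>auto simp: indicator_def\<close>)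
  then have "(\<lambda>n. 2 * (\<integral>x. indicator U x \<partial>lborel) - 2 * (\<integral>x. indicator U x * indicator U (x + h n) \<partial>lborel :: real))
      \<longlonglongrightarrow> 2 * (\<integral>x. indicator U x \<partial>lborel) - 2 * (\<integral>x. indicator U x \<partial>lborel)"
    by (intro tendsto_intros)
  ultimately show ?thesis by simp
qed

definition translation_continuous :: "('a::euclidean_space => real) => bool" where
  "translation_continuous f \<longleftrightarrow> (\<forall>h. h \<longlonglongrightarrow> 0 \<longrightarrow> (\<lambda>n. \<integral>x. \<bar>f (x + h n) - f x\<bar> \<partial>lborel) \<longlonglongrightarrow> 0)"

lemma translation_continuous_approx:
  fixes f :: "'a::euclidean_space => real"
  assumes f: "integrable lborel f"
    and approx: "\<And>e. e > 0 ==> \<exists>g. integrable lborel g \<and> (\<integral>x. \<bar>f x - g x\<bar> \<partial>lborel) < e \<and> translation_continuous g"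
  shows "translation_continuous f"
  unfolding translation_continuous_def
proof (intro allI impI LIMSEQ_I)
  fix h :: "nat => 'a" and e :: real assume h: "h \<longlonglongrightarrow> 0" and e: "e > 0"
  obtain g where g: "integrable lborel g" "(\<integral>x. \<bar>f x - g x\<bar> \<partial>lborel) < e / 3" "translation_continuous g"
    using approx[of "e/3"] e by auto
  have fm: "f \<in> borel_measurable borel" "g \<in> borel_measurable borel" using f g by auto
  have lim: "(\<lambda>n. \<integral>x. \<bar>g (x + h n) - g x\<bar> \<partial>lborel) \<longlonglongrightarrow> 0"
    using g(3) h by (auto simp: translation_continuous_def)
  have "e / 3 > 0" using e by simp
  from LIMSEQ_D[OF lim this] obtain no where no: "\<And>n. n \<ge> no ==> norm ((\<integral>x. \<bar>g (x + h n) - g x\<bar> \<partial>lborel) - 0) < e / 3"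
    by blast
  have "norm ((\<integral>x. \<bar>f (x + h n) - f x\<bar> \<partial>lborel) - 0) < e" if n: "n \<ge> no" for n
  proof -
    note tr = integrable_translate[OF f, of "h n"] integrable_translate[OF g(1), of "h n"]
    have "(\<integral>x. \<bar>f (x + h n) - f x\<bar> \<partial>lborel) \<le>
       (\<integral>x. \<bar>f (x + h n) - g (x + h n)\<bar> + \<bar>g (x + h n) - g x\<bar> + \<bar>f x - g x\<bar> \<partial>lborel)"
      by (rule integral_mono) (use f g tr in auto)
    also have "\<dots> = (\<integral>x. \<bar>f (x + h n) - g (x + h n)\<bar> \<partial>lborel) + (\<integral>x. \<bar>g (x + h n) - g x\<bar> \<partial>lborel) + (\<integral>x. \<bar>f x - g x\<bar> \<partial>lborel)"
      using f g tr by simp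
    also have "(\<integral>x. \<bar>f (x + h n) - g (x + h n)\<bar> \<partial>lborel) = (\<integral>x. \<bar>f x - g x\<bar> \<partial>lborel)"
      by (rule integral_translate[where f = "\<lambda>x. \<bar>f x - g x\<bar>"]) (use fm in simp)
    finally show ?thesis using no[OF n] g(2) by simp
  qed
  then show "\<exists>no. \<forall>n\<ge>no. norm ((\<integral>x. \<bar>f (x + h n) - f x\<bar> \<partial>lborel) - 0) < e" by blast
qed

text \<open>The property survives \<open>L\<^sup>1\<close>-limits, so it passes from open sets to measurable sets by outer
  regularity, and from there to integrable functions by the induction rule.\<close>

lemma L1_translation_continuous:
  fixes f :: "'a::euclidean_space => real"
  assumes "integrable lborel f"
  shows "translation_continuous f"
  using assms
proof (induction rule: integrable_induct)
  case (base A c)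
  have [measurable]: "A \<in> sets borel" using base by simp
  have scaleU: "translation_continuous (\<lambda>x. indicator U x *\<^sub>R c)" if U: "open U" "emeasure lborel U < \<infinity>" for U :: "'a set"
    unfolding translation_continuous_def
  proof (intro allI impI)
    fix h :: "nat => 'a" assume h: "h \<longlonglongrightarrow> 0"
    have eq: "\<bar>indicator U (x + h n) *\<^sub>R c - indicator U x *\<^sub>R c\<bar> = \<bar>c\<bar> * \<bar>indicator U (x + h n) - indicator U x\<bar>" for x n
      by (simp add: abs_mult[symmetric] algebra_simps)
    show "(\<lambda>n. \<integral>x. \<bar>indicator U (x + h n) *\<^sub>R c - indicator U x *\<^sub>R c\<bar> \<partial>lborel) \<longlonglongrightarrow> 0"
      unfolding eq using tendsto_mult[OF tendsto_const L1_translation_open[OF U h], of "\<bar>c\<bar>"] by simp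
  qed
  have iA: "integrable lborel (\<lambda>x. indicator A x *\<^sub>R c)" using base by simp
  show ?case
  proof (rule translation_continuous_approx[OF iA])
    fix e :: real assume e: "e > 0"
    define d where "d = e / (\<bar>c\<bar> + 1)"
    have d: "d > 0" "\<bar>c\<bar> * d < e" using e by (auto simp: d_def field_simps)
    have "A \<in> sets lebesgue" using base by simp
    then obtain U where U: "open U" "A \<subseteq> U" "emeasure lebesgue (U - A) < ennreal d"
      using sets_lebesgue_outer_open[OF _ d(1), of A] by metis
    have [measurable]: "U \<in> sets borel" using U by simp
    have UA: "emeasure lborel (U - A) < ennreal d" using U(3) by simp
    have "emeasure lborel U \<le> emeasure lborel A + emeasure lborel (U - A)"
      using emeasure_subadditive[of A lborel "U - A"] U(2) by (simp add: Un_absorb1)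
    also have "\<dots> < \<infinity>" using base UA by (auto simp: less_top[symmetric])
    finally have Ufin: "emeasure lborel U < \<infinity>" .
    have "(\<integral>x. \<bar>indicator A x *\<^sub>R c - indicator U x *\<^sub>R c\<bar> \<partial>lborel) = (\<integral>x. \<bar>c\<bar> * indicator (U - A) x \<partial>lborel)"
      by (rule Bochner_Integration.integral_cong) (use U(2) in \<open>auto simp: indicator_def\<close>)
    also have "\<dots> = \<bar>c\<bar> * measure lborel (U - A)" by simp
    also have "\<dots> \<le> \<bar>c\<bar> * d"
      using UA d by (intro mult_left_mono) (auto simp: measure_def enn2real_leI)
    finally have "(\<integral>x. \<bar>indicator A x *\<^sub>R c - indicator U x *\<^sub>R c\<bar> \<partial>lborel) < e" using d by linarith
    then show "\<exists>g. integrable lborel g \<and> (\<integral>x. \<bar>indicator A x *\<^sub>R c - g x\<bar> \<partial>lborel) < e \<and> translation_continuous g"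
      using scaleU[OF U(1) Ufin] Ufin by (intro exI[of _ "\<lambda>x. indicator U x *\<^sub>R c"]) auto
  qed
next
  case (add f g)
  show ?case unfolding translation_continuous_def
  proof (intro allI impI)
    fix h :: "nat => 'a" assume h: "h \<longlonglongrightarrow> 0"
    have *: "(\<lambda>n. (\<integral>x. \<bar>f (x + h n) - f x\<bar> \<partial>lborel) + (\<integral>x. \<bar>g (x + h n) - g x\<bar> \<partial>lborel)) \<longlonglongrightarrow> 0 + 0"
      using add.IH h by (intro tendsto_add) (auto simp: translation_continuous_def)
    show "(\<lambda>n. \<integral>x. \<bar>f (x + h n) + g (x + h n) - (f x + g x)\<bar> \<partial>lborel) \<longlonglongrightarrow> 0"
    proof (rule tendsto_sandwich[OF _ _ tendsto_const *[simplified]])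
      show "\<forall>\<^sub>F n in sequentially. 0 \<le> (\<integral>x. \<bar>f (x + h n) + g (x + h n) - (f x + g x)\<bar> \<partial>lborel)" by simp
      have "(\<integral>x. \<bar>f (x + h n) + g (x + h n) - (f x + g x)\<bar> \<partial>lborel) \<le>
          (\<integral>x. \<bar>f (x + h n) - f x\<bar> + \<bar>g (x + h n) - g x\<bar> \<partial>lborel)" for n
        by (rule integral_mono) (use add.hyps integrable_translate[OF add.hyps(1), of "h n"] integrable_translate[OF add.hyps(2), of "h n"] in auto)
      then show "\<forall>\<^sub>F n in sequentially. (\<integral>x. \<bar>f (x + h n) + g (x + h n) - (f x + g x)\<bar> \<partial>lborel) \<le>
          (\<integral>x. \<bar>f (x + h n) - f x\<bar> \<partial>lborel) + (\<integral>x. \<bar>g (x + h n) - g x\<bar> \<partial>lborel)"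
        using add.hyps integrable_translate[OF add.hyps(1)] integrable_translate[OF add.hyps(2)] by simp
    qed
  qed
next
  case (lim f s)
  show ?case
  proof (rule translation_continuous_approx[OF lim.hyps(4)])
    fix e :: real assume e: "e > 0"
    have "(\<lambda>i. \<integral>x. \<bar>f x - s i x\<bar> \<partial>lborel) \<longlonglongrightarrow> (\<integral>x. \<bar>f x - f x\<bar> \<partial>(lborel::'a measure))"
    proof (rule integral_dominated_convergence[where w = "\<lambda>x. 3 * norm (f x)"])
      have [measurable]: "f \<in> borel_measurable borel" "s i \<in> borel_measurable borel" for i using lim.hyps(1,4) by auto
      show "(\<lambda>x. \<bar>f x - s i x\<bar>) \<in> borel_measurable lborel" for i by measurable
      show "AE x in lborel. (\<lambda>i. \<bar>f x - s i x\<bar>) \<longlonglongrightarrow> \<bar>f x - f x\<bar>"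
        by (intro AE_I2 tendsto_intros lim.hyps(2)) simp
      show "AE x in lborel. norm \<bar>f x - s i x\<bar> \<le> 3 * norm (f x)" for i
      proof (intro AE_I2)
        fix x show "norm \<bar>f x - s i x\<bar> \<le> 3 * norm (f x)" using lim.hyps(3)[of x i] by simp
      qed
    qed (use lim.hyps(4) in auto)
    then have "(\<lambda>i. \<integral>x. \<bar>f x - s i x\<bar> \<partial>lborel) \<longlonglongrightarrow> 0" by simp
    from order_tendstoD(2)[OF this e] obtain i where "(\<integral>x. \<bar>f x - s i x\<bar> \<partial>lborel) < e"
      by (auto simp: eventually_sequentially)
    then show "\<exists>g. integrable lborel g \<and> (\<integral>x. \<bar>f x - g x\<bar> \<partial>lborel) < e \<and> translation_continuous g"
      using lim.hyps(1) lim.IH by blast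
  qed
qed

text \<open>Reduces continuity of translations in \<open>L\<^sup>2\<close> to \<open>L\<^sup>1\<close>: the signed square of an \<open>L\<^sup>2\<close> function is integrable.\<close>

lemma square_diff_le_signed_square: "(a - b)\<^sup>2 \<le> 2 * \<bar>a * \<bar>a\<bar> - b * \<bar>b\<bar>\<bar>" for a b :: real
proof (cases "0 \<le> a * b")
  case True
  have ab: "\<bar>a * \<bar>a\<bar> - b * \<bar>b\<bar>\<bar> = \<bar>a - b\<bar> * (\<bar>a\<bar> + \<bar>b\<bar>)"
  proof -
    have "a * \<bar>a\<bar> - b * \<bar>b\<bar> = (a - b) * (\<bar>a\<bar> + \<bar>b\<bar>)"
      using True by (auto simp: abs_if zero_le_mult_iff algebra_simps)
    then show ?thesis by (simp add: abs_mult)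
  qed
  have "(a - b)\<^sup>2 = \<bar>a - b\<bar> * \<bar>a - b\<bar>" by (simp add: power2_eq_square)
  also have "\<dots> \<le> \<bar>a - b\<bar> * (\<bar>a\<bar> + \<bar>b\<bar>)" by (intro mult_left_mono) auto
  finally show ?thesis unfolding ab by (smt (verit) mult_nonneg_nonneg)
next
  case False
  then have "a * \<bar>a\<bar> - b * \<bar>b\<bar> = a\<^sup>2 + b\<^sup>2 \<or> a * \<bar>a\<bar> - b * \<bar>b\<bar> = - (a\<^sup>2 + b\<^sup>2)"
    by (auto simp: abs_if power2_eq_square zero_le_mult_iff)
  then have "\<bar>a * \<bar>a\<bar> - b * \<bar>b\<bar>\<bar> = a\<^sup>2 + b\<^sup>2" by auto
  moreover have "(a - b)\<^sup>2 \<le> 2 * (a\<^sup>2 + b\<^sup>2)"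
    using zero_le_power2[of "a + b"] by (simp add: power2_sum power2_diff)
  ultimately show ?thesis by simp
qed

lemma L2_translation_continuous:
  fixes f :: "'a::euclidean_space => real"
  assumes f: "sq_integrable lborel f" and e: "e > 0"
  shows "\<exists>d>0. \<forall>h. norm h < d \<longrightarrow> l2 lborel (\<lambda>x. f (x + h) - f x) < e"
proof (rule ccontr)
  assume "\<not> ?thesis"
  then have "\<exists>h. norm h < 1 / real (Suc n) \<and> e \<le> l2 lborel (\<lambda>x. f (x + h) - f x)" for n
    by (metis not_le of_nat_0_less_iff zero_less_Suc zero_less_divide_1_iff)
  then obtain h where h: "\<And>n. norm (h n) < 1 / real (Suc n)" "\<And>n. e \<le> l2 lborel (\<lambda>x. f (x + h n) - f x)" by metis
  have h0: "h \<longlonglongrightarrow> 0"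
    by (rule Lim_null_comparison[OF _ LIMSEQ_Suc[OF lim_inverse_n']]) (use h(1) in \<open>auto simp: less_imp_le\<close>)
  define g where "g x = f x * \<bar>f x\<bar>" for x
  have fm [measurable]: "f \<in> borel_measurable borel" using f by (auto simp: sq_integrable_def)
  have [measurable]: "g \<in> borel_measurable borel" unfolding g_def by measurable
  have gi: "integrable lborel g"
    by (rule Bochner_Integration.integrable_bound[of _ "\<lambda>x. (norm (f x))\<^sup>2"])
       (use f in \<open>auto simp: sq_integrable_def g_def abs_mult power2_eq_square\<close>)
  have lim: "(\<lambda>n. \<integral>x. \<bar>g (x + h n) - g x\<bar> \<partial>lborel) \<longlonglongrightarrow> 0"
    using L1_translation_continuous[OF gi] h0 by (auto simp: translation_continuous_def)
  have "e\<^sup>2 / 2 \<le> (\<integral>x. \<bar>g (x + h n) - g x\<bar> \<partial>lborel)" for n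
  proof -
    have fi: "integrable lborel (\<lambda>x. (f x)\<^sup>2)" using f by (simp add: sq_integrable_def)
    have ftr: "sq_integrable lborel (\<lambda>x. f (x + h n))"
      using integrable_translate[OF fi, of "h n"] by (simp add: sq_integrable_def)
    have di: "integrable lborel (\<lambda>x. (norm (f (x + h n) - f x))\<^sup>2)"
      using sq_integrable_diff[OF ftr f] by (simp add: sq_integrable_def)
    have "e\<^sup>2 \<le> (l2 lborel (\<lambda>x. f (x + h n) - f x))\<^sup>2" using h(2)[of n] e by (intro power_mono) auto
    also have "\<dots> \<le> (\<integral>x. 2 * \<bar>g (x + h n) - g x\<bar> \<partial>lborel)"
      unfolding l2_power2
    proof (rule integral_mono[OF di])
      show "integrable lborel (\<lambda>x. 2 * \<bar>g (x + h n) - g x\<bar>)" using gi integrable_translate[OF gi, of "h n"] by simp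
      show "(norm (f (x + h n) - f x))\<^sup>2 \<le> 2 * \<bar>g (x + h n) - g x\<bar>" for x
        using square_diff_le_signed_square[of "f (x + h n)" "f x"] by (simp add: g_def)
    qed
    finally show ?thesis by simp
  qed
  then have "e\<^sup>2 / 2 \<le> 0" by (intro LIMSEQ_le_const[OF lim]) blast
  then show False using e by simp
qed

section \<open>Weakly differentiable functions along affine flows\<close>

abbreviation pd :: "'a::euclidean_space => ('a => real) => 'a => real" where
  "pd b f \<equiv> (\<lambda>x. frechet_derivative f (at x) b)"

lemma smooth_measurable: "smooth f ==> f \<in> borel_measurable borel"
  by (intro borel_measurable_continuous_onI smooth_continuous)

lemma frechet_derivative_expand:
  fixes f :: "'a::euclidean_space => real"
  assumes "smooth f"
  shows "frechet_derivative f (at x) v = (\<Sum>b\<in>Basis. (v \<bullet> b) * pd b f x)"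
proof -
  have lin: "linear (frechet_derivative f (at x))" using smooth_has_derivative[OF assms] has_derivative_linear by blast
  have "frechet_derivative f (at x) v = frechet_derivative f (at x) (\<Sum>b\<in>Basis. (v \<bullet> b) *\<^sub>R b)"
    by (simp add: euclidean_representation)
  also have "\<dots> = (\<Sum>b\<in>Basis. (v \<bullet> b) * pd b f x)" by (simp add: linear_sum[OF lin] linear_cmul[OF lin])
  finally show ?thesis .
qed

lemma pd_affine:
  fixes f :: "'a::euclidean_space => real"
  assumes "smooth f"
  shows "pd v (\<lambda>x. f (c *\<^sub>R x + t)) x = c * pd v f (c *\<^sub>R x + t)"
proof -
  have lin: "linear (frechet_derivative f (at y))" for y using smooth_has_derivative[OF assms] has_derivative_linear by blast
  have "((\<lambda>x. f (c *\<^sub>R x + t)) has_derivative (\<lambda>h. frechet_derivative f (at (c *\<^sub>R x + t)) (c *\<^sub>R h))) (at x)"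
    by (rule has_derivative_compose[OF _ smooth_has_derivative[OF assms]]) (auto intro!: derivative_eq_intros)
  from frechet_derivative_at[OF this] show ?thesis by (simp add: linear_cmul[OF lin] fun_eq_iff)
qed

lemma pd_cmult:
  fixes f :: "'a::euclidean_space => real"
  assumes "smooth f"
  shows "pd v (\<lambda>x. r * f x) x = r * pd v f x"
proof -
  have "((\<lambda>x. r * f x) has_derivative (\<lambda>h. r * frechet_derivative f (at x) h)) (at x)"
    by (intro has_derivative_mult_right smooth_has_derivative[OF assms])
  from frechet_derivative_at[OF this] show ?thesis by (simp add: fun_eq_iff)
qed

lemma pd_mult:
  fixes f :: "'a::euclidean_space => real"
  assumes "smooth f" "smooth g"
  shows "pd v (\<lambda>x. f x * g x) x = f x * pd v g x + pd v f x * g x"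
proof -
  have "((\<lambda>x. f x * g x) has_derivative (\<lambda>h. f x * frechet_derivative g (at x) h + frechet_derivative f (at x) h * g x)) (at x)"
    by (intro has_derivative_mult smooth_has_derivative assms)
  from frechet_derivative_at[OF this] show ?thesis by (simp add: fun_eq_iff)
qed

lemma pd_zero_outside:
  fixes f :: "'a::euclidean_space => real"
  assumes "closed K" "\<And>x. x \<notin> K ==> f x = 0" "x \<notin> K"
  shows "pd v f x = 0"
proof -
  have "(f has_derivative (\<lambda>h. 0)) (at x)"
    by (rule has_derivative_transform_within_open[of "\<lambda>x. 0" _ _ _ "- K"]) (use assms in auto)
  from frechet_derivative_at[OF this] show ?thesis by (simp add: fun_eq_iff)
qed

lemma test_funE:
  assumes "test_fun D \<phi>"
  obtains K where "compact K" "K \<subseteq> D" "\<And>x. x \<notin> K ==> \<phi> x = 0" "smooth \<phi>"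
  using assms unfolding test_fun_def by blast

lemma test_fun_pd:
  assumes "test_fun D \<phi>" "b \<in> Basis"
  shows "test_fun D (pd b \<phi>)"
proof -
  obtain K where K: "compact K" "K \<subseteq> D" "\<And>x. x \<notin> K ==> \<phi> x = 0" "smooth \<phi>" using assms(1) by (rule test_funE) (rule that)
  show ?thesis
    by (rule test_funI[OF smooth_partial[OF K(4) assms(2)] K(1,2) pd_zero_outside[OF compact_imp_closed[OF K(1)] K(3)]])
qed

lemma set_integral_outside_zero:
  fixes f :: "'a => real"
  assumes "\<And>x. x \<notin> D ==> f x = 0"
  shows "(LINT x:D|M. f x) = (\<integral>x. f x \<partial>M)"
  unfolding set_lebesgue_integral_def
  by (rule Bochner_Integration.integral_cong) (use assms in \<open>auto simp: indicator_def\<close>)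

lemma smooth_bounded_compact:
  assumes "smooth (f :: 'a::euclidean_space => real)" "compact K"
  obtains C where "0 \<le> C" "\<And>x. x \<in> K ==> \<bar>f x\<bar> \<le> C"
proof -
  have "bounded (f ` K)"
    by (intro compact_imp_bounded compact_continuous_image)
       (use assms smooth_continuous continuous_on_subset in blast)+
  then obtain C where "\<And>x. x \<in> K ==> \<bar>f x\<bar> \<le> C" by (auto simp: bounded_iff)
  then show ?thesis by (intro that[of "max 0 C"]) force+
qed

lemma integrable_mult_compact:
  fixes u :: "'a::euclidean_space => real"
  assumes "set_integrable lborel K u" "smooth \<phi>" "compact K" "\<And>x. x \<notin> K ==> \<phi> x = 0"
  shows "integrable lborel (\<lambda>x. u x * \<phi> x)"
proof -
  obtain C where C: "0 \<le> C" "\<And>x. x \<in> K ==> \<bar>\<phi> x\<bar> \<le> C" using smooth_bounded_compact assms(2,3) by blast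
  have eq: "(\<lambda>x. u x * \<phi> x) = (\<lambda>x. (indicator K x * u x) * \<phi> x)"
    using assms(4) by (auto simp: indicator_def fun_eq_iff)
  have i: "integrable lborel (\<lambda>x. indicator K x * u x)" using assms(1) by (simp add: set_integrable_def)
  have [measurable]: "(\<lambda>x. indicator K x * u x) \<in> borel_measurable borel" using i by auto
  have [measurable]: "\<phi> \<in> borel_measurable borel" using assms(2) by (rule smooth_measurable)
  show ?thesis unfolding eq
  proof (rule Bochner_Integration.integrable_bound)
    show "integrable lborel (\<lambda>x. C * (indicator K x * u x))" using i by simp
    show "AE x in lborel. norm (indicator K x * u x * \<phi> x) \<le> norm (C * (indicator K x * u x))"
    proof (intro AE_I2)
      fix x show "norm (indicator K x * u x * \<phi> x) \<le> norm (C * (indicator K x * u x))"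
        using C(2)[of x] mult_left_mono[of "\<bar>\<phi> x\<bar>" C "\<bar>u x\<bar>"] C(1)
        by (auto simp: indicator_def abs_mult mult.commute)
    qed
  qed simp
qed

lemma set_integral_test:
  fixes g :: "'a::euclidean_space => real"
  assumes "test_fun D \<phi>"
  shows "(LINT x:D|lborel. g x * \<phi> x) = (\<integral>x. g x * \<phi> x \<partial>lborel)"
proof (rule set_integral_outside_zero)
  obtain K where K: "compact K" "K \<subseteq> D" "\<And>x. x \<notin> K ==> \<phi> x = 0" "smooth \<phi>" using assms by (rule test_funE) (rule that)
  show "g x * \<phi> x = 0" if "x \<notin> D" for x
  proof -
    have "x \<notin> K" using K(2) that by blast
    then show ?thesis by (simp add: K(3))
  qed
qed

lemma integrable_test:
  fixes g :: "'a::euclidean_space => real"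
  assumes "locally_integrable D g" "test_fun D \<phi>"
  shows "integrable lborel (\<lambda>x. g x * \<phi> x)"
proof -
  obtain K where K: "compact K" "K \<subseteq> D" "\<And>x. x \<notin> K ==> \<phi> x = 0" "smooth \<phi>" using assms(2) by (rule test_funE) (rule that)
  show ?thesis using integrable_mult_compact[OF locally_integrable_compact[OF assms(1) K(1,2)] K(4,1)] K(3) by auto
qed

lemma has_weak_gradD:
  "has_weak_grad D U G ==> b \<in> Basis ==> test_fun D \<phi> ==>
     (LINT x:D|lborel. U x * pd b \<phi> x) = - (LINT x:D|lborel. (G x \<bullet> b) * \<phi> x)"
  unfolding has_weak_grad_def has_weak_deriv_def by auto

lemma has_weak_grad_locally_integrable:
  assumes "has_weak_grad D U G"
  shows "locally_integrable D U" "b \<in> Basis ==> locally_integrable D (\<lambda>x. G x \<bullet> b)"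
  using assms nonempty_Basis unfolding has_weak_grad_def has_weak_deriv_def by blast+

lemma locally_integrable_norm:
  fixes G :: "'a::euclidean_space => 'a"
  assumes "\<And>b. b \<in> Basis ==> locally_integrable D (\<lambda>x. G x \<bullet> b)" "compact K" "K \<subseteq> D"
    and [measurable]: "G \<in> borel_measurable borel"
  shows "set_integrable lborel K (\<lambda>x. norm (G x))"
proof -
  have [measurable]: "K \<in> sets borel" using assms(2) by (simp add: compact_imp_closed borel_closed)
  have "integrable lborel (\<lambda>x. \<Sum>b\<in>Basis. \<bar>indicator K x * (G x \<bullet> b)\<bar>)"
    using locally_integrable_compact[OF assms(1-3)] by (auto simp: set_integrable_def)
  then show ?thesis unfolding set_integrable_def
  proof (rule Bochner_Integration.integrable_bound)
    show "AE x in lborel. norm (indicator K x *\<^sub>R norm (G x)) \<le> norm (\<Sum>b\<in>Basis. \<bar>indicator K x * (G x \<bullet> b)\<bar>)"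
      using norm_le_l1 by (auto simp: indicator_def intro!: AE_I2)
  qed simp
qed

lemma affine_compact_subset:
  fixes K :: "'a::euclidean_space set"
  assumes "compact K" and maps: "\<And>t z. 0 \<le> t ==> t \<le> 1 ==> z \<in> D ==> (1 + t * a) *\<^sub>R z + t *\<^sub>R e \<in> D" and "K \<subseteq> D"
  obtains K' where "compact K'" "K' \<subseteq> D" "\<And>t z. 0 \<le> t ==> t \<le> 1 ==> z \<in> K ==> (1 + t * a) *\<^sub>R z + t *\<^sub>R e \<in> K'"
proof (rule that)
  let ?f = "\<lambda>(t, z). (1 + t * a) *\<^sub>R z + t *\<^sub>R e"
  show "compact (?f ` ({0..1} \<times> K))"
    by (intro compact_continuous_image compact_Times assms(1))
       (auto intro!: continuous_intros simp: case_prod_beta)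
  show "?f ` ({0..1} \<times> K) \<subseteq> D" using maps assms(3) by auto
  show "(1 + t * a) *\<^sub>R z + t *\<^sub>R e \<in> ?f ` ({0..1} \<times> K)" if "0 \<le> t" "t \<le> 1" "z \<in> K" for t z
    using that by (intro image_eqI[of _ _ "(t, z)"]) auto
qed

text \<open>The density transported by \<open>z \<mapsto> (1 + t a) z + t e\<close> satisfies the continuity equation; \<open>\<Psi>\<close> is the divergence
  of \<open>\<phi>\<close> times the velocity field.\<close>

lemma flow_density_derivative:
  fixes \<phi> :: "'a::euclidean_space => real" and e w :: 'a and a t :: real
  assumes \<phi>: "smooth \<phi>" and a: "0 \<le> a" and t: "0 \<le> t"
  defines "\<Psi> \<equiv> \<lambda>z. real DIM('a) * a * \<phi> z + frechet_derivative \<phi> (at z) (a *\<^sub>R z + e)"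
  shows "((\<lambda>t. inverse ((1 + t * a) ^ DIM('a)) * \<phi> (inverse (1 + t * a) *\<^sub>R (w - t *\<^sub>R e))) has_real_derivative
     - inverse ((1 + t * a) ^ Suc DIM('a)) * \<Psi> (inverse (1 + t * a) *\<^sub>R (w - t *\<^sub>R e))) (at t)"
proof -
  define \<zeta> where "\<zeta> t = inverse (1 + t * a) *\<^sub>R (w - t *\<^sub>R e)" for t
  have s: "1 + t * a > 0" using a t by (simp add: add_pos_nonneg)
  have "(\<zeta> has_vector_derivative - inverse (1 + t * a) *\<^sub>R (a *\<^sub>R \<zeta> t + e)) (at t)"
  proof -
    have d1: "((\<lambda>t. inverse (1 + t * a)) has_real_derivative - (a * (inverse (1 + t * a) * inverse (1 + t * a)))) (at t)"
      by (rule derivative_eq_intros refl | use s in simp)+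
    have d2: "((\<lambda>t. w - t *\<^sub>R e) has_vector_derivative - e) (at t)"
      unfolding has_vector_derivative_def by (auto intro!: derivative_eq_intros)
    show ?thesis unfolding \<zeta>_def
      by (rule has_vector_derivative_eq_rhs[OF has_vector_derivative_scaleR[OF d1 d2]])
         (simp only: scaleR_scaleR scaleR_add_right scaleR_minus_left scaleR_minus_right mult_ac, simp)
  qed
  then have D0: "((\<lambda>t. \<phi> (\<zeta> t)) has_derivative (\<lambda>h. frechet_derivative \<phi> (at (\<zeta> t)) (h *\<^sub>R (- inverse (1 + t * a) *\<^sub>R (a *\<^sub>R \<zeta> t + e))))) (at t)"
    unfolding has_vector_derivative_def by (rule has_derivative_compose[OF _ smooth_has_derivative[OF \<phi>]])
  have lin: "linear (frechet_derivative \<phi> (at (\<zeta> t)))"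
    using smooth_has_derivative[OF \<phi>] has_derivative_linear by blast
  have 1: "((\<lambda>t. \<phi> (\<zeta> t)) has_real_derivative - inverse (1 + t * a) * frechet_derivative \<phi> (at (\<zeta> t)) (a *\<^sub>R \<zeta> t + e)) (at t)"
    unfolding has_field_derivative_def
    by (rule has_derivative_eq_rhs[OF D0])
       (simp add: fun_eq_iff linear_cmul[OF lin] linear_neg[OF lin] mult.commute mult.left_commute)
  have 2: "((\<lambda>t. inverse ((1 + t * a) ^ DIM('a))) has_real_derivative - (real DIM('a) * a) * inverse ((1 + t * a) ^ Suc DIM('a))) (at t)"
  proof -
    have d: "((\<lambda>t. 1 + t * a) has_real_derivative a) (at t)" by (auto intro!: derivative_eq_intros)
    have val: "real k * (a * s ^ (k - Suc 0)) * inverse ((s ^ k) ^ Suc (Suc 0)) = real k * a * inverse (s ^ Suc k)"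
      if "s > 0" for s :: real and k
      using that by (cases k) (simp_all add: field_simps)
    show ?thesis
      by (rule DERIV_cong[OF DERIV_inverse_fun[OF DERIV_power[OF d, of "DIM('a)"]]])
         (use s val[OF s, of "DIM('a)"] in \<open>simp_all only: power_eq_0_iff mult_minus_left, simp\<close>)
  qed
  show ?thesis
    unfolding \<Psi>_def \<zeta>_def[symmetric]
    by (rule DERIV_cong[OF DERIV_mult[OF 2 1]])
       (simp only: power_Suc inverse_mult_distrib, simp add: ring_distribs mult_ac)
qed


text \<open>One family of maps covers the two cases that occur: translations (\<open>a = 0\<close>), used for traces and difference
  quotients, and the dilation by 2 (\<open>a = 1\<close>, \<open>e = 0\<close>), used for Hardy's inequality.\<close>

locale affine_flow =
  fixes D :: "'a::euclidean_space set" and U :: "'a => real" and G :: "'a => 'a" and a :: real and e :: 'a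
  assumes D_open: "open D" and weak_grad: "has_weak_grad D U G" and a_nonneg: "0 \<le> a"
    and maps: "\<And>t z. 0 \<le> t ==> t \<le> 1 ==> z \<in> D ==> (1 + t * a) *\<^sub>R z + t *\<^sub>R e \<in> D"
    and U_borel [measurable]: "U \<in> borel_measurable borel" and G_borel [measurable]: "G \<in> borel_measurable borel"
begin

definition flow :: "real => 'a => 'a" where "flow t z = (1 + t * a) *\<^sub>R z + t *\<^sub>R e"

definition speed :: "'a => 'a" where "speed z = a *\<^sub>R z + e"

definition rate :: "'a => real => real" where "rate z t = indicator {0..1} t * (G (flow t z) \<bullet> speed z)"

definition backflow :: "real => 'a => 'a" where "backflow t w = inverse (1 + t * a) *\<^sub>R (w - t *\<^sub>R e)"

lemma scale_ge_1: "0 \<le> t ==> 1 \<le> 1 + t * a"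
  using a_nonneg by simp

lemma flow_backflow: "0 \<le> t ==> flow t (backflow t w) = w"
  and backflow_flow: "0 \<le> t ==> backflow t (flow t z) = z"
  using scale_ge_1[of t] by (simp_all add: flow_def backflow_def)

lemma flow_measurable [measurable]: "flow t \<in> borel_measurable borel"
  unfolding flow_def by measurable

lemma rate_measurable [measurable]: "(\<lambda>p. rate (fst p) (snd p)) \<in> borel_measurable (lborel \<Otimes>\<^sub>M lborel)"
  unfolding rate_def flow_def speed_def by measurable

lemma compact_flow:
  assumes "compact K" "K \<subseteq> D"
  obtains K' where "compact K'" "K' \<subseteq> D" "\<And>t z. 0 \<le> t ==> t \<le> 1 ==> z \<in> K ==> flow t z \<in> K'"
  using affine_compact_subset[OF assms(1) maps assms(2)] unfolding flow_def by blast

lemma nn_integral_flow_le: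
  assumes [measurable]: "f \<in> borel_measurable borel" and t: "0 \<le> t"
  shows "(\<integral>\<^sup>+z. f (flow t z) \<partial>lborel) \<le> (\<integral>\<^sup>+z. f z \<partial>lborel)"
proof -
  have "(\<integral>\<^sup>+z. f z \<partial>lborel) = ennreal ((1 + t * a) ^ DIM('a)) * (\<integral>\<^sup>+z. f (flow t z) \<partial>lborel)"
    unfolding flow_def add.commute[of _ "t *\<^sub>R e"] by (rule nn_integral_affine) (use scale_ge_1[OF t] in auto)
  moreover have "1 \<le> ennreal ((1 + t * a) ^ DIM('a))"
    using one_le_power[OF scale_ge_1[OF t], of "DIM('a)"] by simp
  ultimately show ?thesis
    using mult_right_mono[of 1 "ennreal ((1 + t * a) ^ DIM('a))" "\<integral>\<^sup>+z. f (flow t z) \<partial>lborel"] by simp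
qed

lemma integrable_rate:
  assumes K: "compact K" "K \<subseteq> D"
  shows "integrable (lborel \<Otimes>\<^sub>M lborel) (\<lambda>p. indicator K (fst p) * rate (fst p) (snd p))"
proof (rule integrableI_bounded)
  have [measurable]: "K \<in> sets borel" using K by (simp add: compact_imp_closed borel_closed)
  show "(\<lambda>p. indicator K (fst p) * rate (fst p) (snd p)) \<in> borel_measurable (lborel \<Otimes>\<^sub>M lborel)" by measurable
  obtain K' where K': "compact K'" "K' \<subseteq> D" "\<And>t z. 0 \<le> t ==> t \<le> 1 ==> z \<in> K ==> flow t z \<in> K'"
    using compact_flow[OF K] by blast
  have [measurable]: "K' \<in> sets borel" using K' by (simp add: compact_imp_closed borel_closed)
  have "bounded (speed ` K)" unfolding speed_def
    by (intro compact_imp_bounded compact_continuous_image continuous_intros K)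
  then obtain c where c: "0 < c" "\<And>z. z \<in> K ==> norm (speed z) \<le> c" by (auto simp: bounded_pos)
  define f where "f w = ennreal (indicator K' w * norm (G w))" for w
  have [measurable]: "f \<in> borel_measurable borel" unfolding f_def by measurable
  have "integrable lborel (\<lambda>w. indicator K' w * norm (G w))"
    using locally_integrable_norm[OF has_weak_grad_locally_integrable(2)[OF weak_grad] K'(1,2)]
    by (simp add: set_integrable_def)
  then have fin: "(\<integral>\<^sup>+w. f w \<partial>lborel) < \<infinity>" unfolding f_def by (simp add: integrable_iff_bounded)
  have "(\<integral>\<^sup>+p. ennreal (norm (indicator K (fst p) * rate (fst p) (snd p))) \<partial>(lborel \<Otimes>\<^sub>M lborel)) =
      (\<integral>\<^sup>+t. \<integral>\<^sup>+z. ennreal (norm (indicator K z * rate z t)) \<partial>lborel \<partial>lborel)"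
    by (subst lborel_pair.nn_integral_snd[symmetric]) auto
  also have "\<dots> \<le> (\<integral>\<^sup>+t. indicator {0..1} t * (ennreal c * (\<integral>\<^sup>+w. f w \<partial>lborel)) \<partial>(lborel :: real measure))"
  proof (rule nn_integral_mono)
    fix t :: real
    show "(\<integral>\<^sup>+z. ennreal (norm (indicator K z * rate z t)) \<partial>lborel) \<le> indicator {0..1} t * (ennreal c * (\<integral>\<^sup>+w. f w \<partial>lborel))"
    proof (cases "t \<in> {0..1}")
      case True
      have "(\<integral>\<^sup>+z. ennreal (norm (indicator K z * rate z t)) \<partial>lborel) \<le> (\<integral>\<^sup>+z. ennreal c * f (flow t z) \<partial>lborel)"
      proof (rule nn_integral_mono)
        fix z
        show "ennreal (norm (indicator K z * rate z t)) \<le> ennreal c * f (flow t z)"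
        proof (cases "z \<in> K")
          case z: True
          have "\<bar>G (flow t z) \<bullet> speed z\<bar> \<le> norm (G (flow t z)) * norm (speed z)" by (rule Cauchy_Schwarz_ineq2)
          also have "\<dots> \<le> norm (G (flow t z)) * c" using c(2)[OF z] by (intro mult_left_mono) auto
          finally show ?thesis using True z K'(3)[of t z] c(1)
            by (simp add: rate_def f_def mult.commute ennreal_leI flip: ennreal_mult)
        qed simp
      qed
      also have "\<dots> = ennreal c * (\<integral>\<^sup>+z. f (flow t z) \<partial>lborel)" by (rule nn_integral_cmult) simp
      also have "\<dots> \<le> ennreal c * (\<integral>\<^sup>+w. f w \<partial>lborel)"
        by (intro mult_left_mono nn_integral_flow_le) (use True in auto)
      finally show ?thesis using True by simp
    qed (simp add: rate_def)
  qed
  also have "\<dots> = ennreal c * (\<integral>\<^sup>+w. f w \<partial>lborel)" by (simp add: nn_integral_multc)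
  also have "\<dots> < \<infinity>" using fin by (simp add: ennreal_mult_less_top)
  finally show "(\<integral>\<^sup>+p. ennreal (norm (indicator K (fst p) * rate (fst p) (snd p))) \<partial>(lborel \<Otimes>\<^sub>M lborel)) < \<infinity>" .
qed

lemma rate_integrable_AE: "AE z in lborel. z \<in> D \<longrightarrow> integrable lborel (rate z)"
proof -
  obtain C where C: "\<And>n::nat. compact (C n)" "\<And>n. C n \<subseteq> D" "\<Union>(range C) = D"
    using open_Union_compact_subsets[OF D_open] by metis
  have "AE z in lborel. \<forall>n. z \<in> C n \<longrightarrow> integrable lborel (rate z)"
    unfolding AE_all_countable
  proof
    fix n
    have "AE z in lborel. integrable lborel (\<lambda>t. indicator (C n) z * rate z t)"
      using lborel_pair.AE_integrable_fst[of "\<lambda>z t. indicator (C n) z * rate z t"] integrable_rate[OF C(1,2), of n]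
      by (simp add: case_prod_beta')
    then show "AE z in lborel. z \<in> C n \<longrightarrow> integrable lborel (rate z)" by eventually_elim (auto simp: indicator_def split: if_splits)
  qed
  then show ?thesis by eventually_elim (use C(3) in blast)
qed

lemma rate_integral_locally_integrable: "locally_integrable D (\<lambda>z. \<integral>t. rate z t \<partial>lborel)"
  unfolding locally_integrable_def
proof (intro allI impI)
  fix K :: "'a set" assume K: "compact K \<and> K \<subseteq> D"
  show "set_integrable lborel K (\<lambda>z. \<integral>t. rate z t \<partial>lborel)"
    using lborel_pair.integrable_fst'[OF integrable_rate, of K] K by (simp add: set_integrable_def)
qed

lemma locally_integrable_flow_1: "locally_integrable D (\<lambda>z. U (flow 1 z))"
  unfolding locally_integrable_def
proof (intro allI impI)
  fix K :: "'a set" assume K: "compact K \<and> K \<subseteq> D"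
  have [measurable]: "K \<in> sets borel" using K by (simp add: compact_imp_closed borel_closed)
  obtain K' where K': "compact K'" "K' \<subseteq> D" "\<And>t z. 0 \<le> t ==> t \<le> 1 ==> z \<in> K ==> flow t z \<in> K'"
    using compact_flow K by blast
  have [measurable]: "K' \<in> sets borel" using K' by (simp add: compact_imp_closed borel_closed)
  define f where "f w = indicator K' w * U w" for w
  have [measurable]: "f \<in> borel_measurable borel" unfolding f_def by measurable
  have "integrable lborel f"
    using locally_integrable_compact[OF has_weak_grad_locally_integrable(1)[OF weak_grad] K'(1,2)]
    by (simp add: f_def[abs_def] set_integrable_def)
  then have "integrable lborel (\<lambda>z. f (flow 1 z))"
    using integrable_affine[of f "1 + a" e] a_nonneg by (simp add: flow_def add.commute)
  then have "integrable lborel (\<lambda>z. indicator K z *\<^sub>R U (flow 1 z))"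
    by (rule Bochner_Integration.integrable_bound) (use K'(3)[of 1] in \<open>auto simp: f_def indicator_def\<close>)
  then show "set_integrable lborel K (\<lambda>z. U (flow 1 z))" by (simp add: set_integrable_def)
qed

lemma smooth_backflow: "0 \<le> t ==> smooth (\<phi> :: 'a => real) ==> smooth (\<lambda>w. \<phi> (backflow t w))"
  using C_k_affine[of _ \<phi> "inverse (1 + t * a)" "- (inverse (1 + t * a) * t) *\<^sub>R e"]
  by (simp add: backflow_def algebra_simps)

lemma pd_backflow: "smooth (\<phi> :: 'a => real) ==> pd b (\<lambda>w. \<phi> (backflow t w)) w = inverse (1 + t * a) * pd b \<phi> (backflow t w)"
  using pd_affine[where f = \<phi> and v = b and c = "inverse (1 + t * a)" and t = "- (inverse (1 + t * a) * t) *\<^sub>R e" and x = w]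
  by (simp add: backflow_def algebra_simps)

lemma smooth_speed: "smooth (\<lambda>z. speed z \<bullet> b)"
proof
  fix k
  have "C_k k (\<lambda>z. a * (z \<bullet> b) + e \<bullet> b)"
    using smooth_coordinate by (intro C_k_add C_k_mult C_k_const) blast
  then show "C_k k (\<lambda>z. speed z \<bullet> b)" by (simp add: speed_def inner_add_left)
qed

lemma pd_speed: "b \<in> Basis ==> pd b (\<lambda>z. speed z \<bullet> b) z = a"
proof -
  assume b: "b \<in> Basis"
  have "((\<lambda>z. speed z \<bullet> b) has_derivative (\<lambda>h. a * (h \<bullet> b))) (at z)"
    unfolding speed_def by (auto intro!: derivative_eq_intros simp: inner_add_left)
  from fun_cong[OF frechet_derivative_at[OF this], of b] show ?thesis using b by (simp add: inner_same_Basis)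
qed

text \<open>The divergence of \<open>\<phi>\<close> times the velocity field, see \<open>source_divergence\<close>.\<close>

definition source :: "('a => real) => 'a => real" where
  "source \<phi> z = real DIM('a) * a * \<phi> z + frechet_derivative \<phi> (at z) (speed z)"

lemma source_divergence:
  assumes "smooth \<phi>"
  shows "source \<phi> z = (\<Sum>b\<in>Basis. pd b (\<lambda>z. \<phi> z * (speed z \<bullet> b)) z)"
proof -
  have "(\<Sum>b\<in>Basis. pd b (\<lambda>z. \<phi> z * (speed z \<bullet> b)) z) = (\<Sum>b\<in>Basis. \<phi> z * a + pd b \<phi> z * (speed z \<bullet> b))"
    by (rule sum.cong) (simp_all add: pd_mult[OF assms smooth_speed] pd_speed)
  also have "\<dots> = source \<phi> z"
    unfolding source_def frechet_derivative_expand[OF assms, of z "speed z"] by (simp add: sum.distrib mult.commute)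
  finally show ?thesis ..
qed

lemma smooth_source: "smooth \<phi> ==> smooth (source \<phi>)"
proof
  fix k assume \<phi>: "smooth \<phi>"
  have "C_k k (\<lambda>z. \<Sum>b\<in>I. pd b (\<lambda>z. \<phi> z * (speed z \<bullet> b)) z)" if "I \<subseteq> Basis" for I
    using finite_subset[OF that finite_Basis] that
  proof (induction I rule: finite_induct)
    case (insert b I)
    have "smooth (pd b (\<lambda>z. \<phi> z * (speed z \<bullet> b)))"
      using insert.prems \<phi> smooth_speed by (intro smooth_partial) (auto intro: C_k_mult)
    then show ?case using insert by (auto intro!: C_k_add)
  qed (simp add: C_k_const)
  from this[of Basis] show "C_k k (source \<phi>)" by (simp add: source_divergence[OF \<phi>, abs_def])
qed

definition pushed :: "('a => real) => real => 'a => real" where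
  "pushed \<phi> t w = inverse ((1 + t * a) ^ DIM('a)) * \<phi> (backflow t w)"

definition pushed_rate :: "('a => real) => real => 'a => real" where
  "pushed_rate \<phi> t w = inverse ((1 + t * a) ^ Suc DIM('a)) * source \<phi> (backflow t w)"

lemma integral_pushed:
  assumes [measurable]: "F \<in> borel_measurable borel" "\<phi> \<in> borel_measurable borel" and t: "0 \<le> t"
  shows "(\<integral>w. F w * pushed \<phi> t w \<partial>lborel) = (\<integral>z. F (flow t z) * \<phi> z \<partial>lborel)"
proof -
  have s: "0 < 1 + t * a" using scale_ge_1[OF t] by simp
  have [measurable]: "backflow t \<in> borel_measurable borel" unfolding backflow_def by measurable
  have "(\<integral>w. F w * pushed \<phi> t w \<partial>lborel) =
      (1 + t * a) ^ DIM('a) * (\<integral>z. F (flow t z) * pushed \<phi> t (flow t z) \<partial>lborel)"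
    unfolding flow_def add.commute[of _ "t *\<^sub>R e"]
    by (rule integral_affine[where f = "\<lambda>w. F w * pushed \<phi> t w"]) (use s in \<open>auto simp: pushed_def\<close>)
  also have "\<dots> = (\<integral>z. F (flow t z) * \<phi> z \<partial>lborel)"
    unfolding pushed_def backflow_flow[OF t] integral_mult_right_zero[symmetric]
    by (rule Bochner_Integration.integral_cong) (use s in simp_all)
  finally show ?thesis .
qed

text \<open>\<open>pushed_rate\<close> is a divergence of test functions, so the weak gradient may be used.\<close>

lemma integral_pushed_rate:
  assumes \<phi>: "test_fun D \<phi>" and t: "0 \<le> t" "t \<le> 1"
  shows "(\<integral>w. U w * pushed_rate \<phi> t w \<partial>lborel) = - (\<integral>z. (G (flow t z) \<bullet> speed z) * \<phi> z \<partial>lborel)"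
proof -
  obtain K where K: "compact K" "K \<subseteq> D" "\<And>x. x \<notin> K ==> \<phi> x = 0" "smooth \<phi>" using \<phi> by (rule test_funE) (rule that)
  obtain K' where K': "compact K'" "K' \<subseteq> D" "\<And>t z. 0 \<le> t ==> t \<le> 1 ==> z \<in> K ==> flow t z \<in> K'"
    using compact_flow[OF K(1,2)] by blast
  have bK: "backflow t w \<notin> K" if "w \<notin> K'" for w
    using K'(3)[OF t, of "backflow t w"] that by (auto simp: flow_backflow t)
  define \<theta> where "\<theta> b w = inverse ((1 + t * a) ^ DIM('a)) * (\<phi> (backflow t w) * (speed (backflow t w) \<bullet> b))" for b w
  have sm: "smooth (\<lambda>z. \<phi> z * (speed z \<bullet> b))" for b using K(4) smooth_speed by (auto intro: C_k_mult)
  have sm': "smooth (\<theta> b)" for b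
  proof
    show "C_k k (\<theta> b)" for k
      using smooth_backflow[OF t(1) sm, of b] unfolding \<theta>_def by (intro C_k_mult[OF C_k_const]) blast
  qed
  have \<theta>0: "\<theta> b w = 0" if "w \<notin> K'" for b w using bK[OF that] K(3) by (simp add: \<theta>_def)
  have test: "test_fun D (\<theta> b)" for b by (rule test_funI[OF sm' K'(1,2) \<theta>0])
  have pd\<theta>: "pd b (\<theta> b) w = inverse ((1 + t * a) ^ Suc DIM('a)) * pd b (\<lambda>z. \<phi> z * (speed z \<bullet> b)) (backflow t w)" for b w
    unfolding \<theta>_def pd_cmult[OF smooth_backflow[OF t(1) sm]] pd_backflow[OF sm] by simp
  have rate: "pushed_rate \<phi> t w = (\<Sum>b\<in>Basis. pd b (\<theta> b) w)" for w
    unfolding pd\<theta> sum_distrib_left[symmetric] pushed_rate_def source_divergence[OF K(4)] ..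
  have UK: "set_integrable lborel K' U"
    using locally_integrable_compact[OF has_weak_grad_locally_integrable(1)[OF weak_grad] K'(1,2)] .
  have GK: "set_integrable lborel K' (\<lambda>x. G x \<bullet> b)" if "b \<in> Basis" for b
    using locally_integrable_compact[OF has_weak_grad_locally_integrable(2)[OF weak_grad that] K'(1,2)] .
  have "(\<integral>w. U w * pushed_rate \<phi> t w \<partial>lborel) = (\<integral>w. (\<Sum>b\<in>Basis. U w * pd b (\<theta> b) w) \<partial>lborel)"
    unfolding rate sum_distrib_left ..
  also have "\<dots> = (\<Sum>b\<in>Basis. \<integral>w. U w * pd b (\<theta> b) w \<partial>lborel)"
  proof (rule Bochner_Integration.integral_sum)
    fix b :: 'a assume b: "b \<in> Basis"
    show "integrable lborel (\<lambda>w. U w * pd b (\<theta> b) w)"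
      by (rule integrable_mult_compact[OF UK smooth_partial[OF sm' b] K'(1)])
         (rule pd_zero_outside[OF compact_imp_closed[OF K'(1)] \<theta>0])
  qed
  also have "\<dots> = (\<Sum>b\<in>Basis. - (\<integral>w. (G w \<bullet> b) * \<theta> b w \<partial>lborel))"
  proof (rule sum.cong)
    fix b :: 'a assume b: "b \<in> Basis"
    have out: "w \<notin> K'" if "w \<notin> D" for w using that K'(2) by blast
    have "(LINT x:D|lborel. U x * pd b (\<theta> b) x) = - (LINT x:D|lborel. (G x \<bullet> b) * \<theta> b x)"
      by (rule has_weak_gradD[OF weak_grad b test])
    moreover have "(LINT x:D|lborel. U x * pd b (\<theta> b) x) = (\<integral>x. U x * pd b (\<theta> b) x \<partial>lborel)"
      by (rule set_integral_outside_zero) (use pd_zero_outside[OF compact_imp_closed[OF K'(1)] \<theta>0] out in simp)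
    moreover have "(LINT x:D|lborel. (G x \<bullet> b) * \<theta> b x) = (\<integral>x. (G x \<bullet> b) * \<theta> b x \<partial>lborel)"
      by (rule set_integral_outside_zero) (use \<theta>0 out in simp)
    ultimately show "(\<integral>w. U w * pd b (\<theta> b) w \<partial>lborel) = - (\<integral>w. (G w \<bullet> b) * \<theta> b w \<partial>lborel)" by simp
  qed simp
  also have "\<dots> = - (\<integral>w. (\<Sum>b\<in>Basis. (G w \<bullet> b) * \<theta> b w) \<partial>lborel)"
    unfolding sum_negf
    by (subst Bochner_Integration.integral_sum)
       (use integrable_mult_compact[OF GK sm' K'(1) \<theta>0] in auto)
  also have "(\<lambda>w. \<Sum>b\<in>Basis. (G w \<bullet> b) * \<theta> b w) = (\<lambda>w. (G w \<bullet> speed (backflow t w)) * pushed \<phi> t w)"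
    unfolding \<theta>_def pushed_def by (subst euclidean_inner) (simp add: fun_eq_iff sum_distrib_left sum_distrib_right mult_ac)
  also have "(\<integral>w. (G w \<bullet> speed (backflow t w)) * pushed \<phi> t w \<partial>lborel) = (\<integral>z. (G (flow t z) \<bullet> speed (backflow t (flow t z))) * \<phi> z \<partial>lborel)"
  proof (rule integral_pushed[OF _ smooth_measurable[OF K(4)] t(1)])
    show "(\<lambda>w. G w \<bullet> speed (backflow t w)) \<in> borel_measurable borel" unfolding speed_def backflow_def by measurable
  qed
  finally show ?thesis by (simp add: backflow_flow[OF t(1)])
qed

lemma pushed_increment:
  assumes \<phi>: "smooth \<phi>"
  shows "(\<integral>t. indicator {0..1} t * pushed_rate \<phi> t w \<partial>lborel) = pushed \<phi> 0 w - pushed \<phi> 1 w"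
proof -
  have der: "((\<lambda>t. - pushed \<phi> t w) has_real_derivative pushed_rate \<phi> t w) (at t)" if "0 \<le> t" for t
    using DERIV_minus[OF flow_density_derivative[OF \<phi> a_nonneg that, of w e]]
    unfolding pushed_def pushed_rate_def source_def backflow_def speed_def by simp
  have cont: "continuous_on {0..1} (\<lambda>t. pushed_rate \<phi> t w)"
  proof -
    have nz: "(1 + t * a) \<noteq> 0" if "t \<in> {0..1}" for t using scale_ge_1[of t] that by auto
    have "continuous_on {0..1} (\<lambda>t. backflow t w)" unfolding backflow_def
      by (intro continuous_intros) (use nz in auto)
    then have "continuous_on {0..1} (source \<phi> \<circ> (\<lambda>t. backflow t w))"
      by (rule continuous_on_compose) (rule continuous_on_subset[OF smooth_continuous[OF smooth_source[OF \<phi>]]], simp)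
    then show ?thesis unfolding pushed_rate_def o_def by (intro continuous_intros) (use nz in auto)
  qed
  have "(\<integral>t. indicator {0..1} t *\<^sub>R pushed_rate \<phi> t w \<partial>lborel) = - pushed \<phi> 1 w - (- pushed \<phi> 0 w)"
    by (rule integral_FTC_atLeastAtMost)
       (use der cont in \<open>auto simp: has_real_derivative_iff_has_vector_derivative intro: has_vector_derivative_at_within\<close>)
  then show ?thesis by simp
qed

lemma integrable_pushed_rate:
  assumes \<phi>: "test_fun D \<phi>"
  shows "integrable (lborel \<Otimes>\<^sub>M lborel) (\<lambda>p. U (fst p) * (indicator {0..1} (snd p) * pushed_rate \<phi> (snd p) (fst p)))"
proof (rule integrableI_bounded)
  obtain K where K: "compact K" "K \<subseteq> D" "\<And>x. x \<notin> K ==> \<phi> x = 0" "smooth \<phi>" using \<phi> by (rule test_funE) (rule that)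
  obtain K' where K': "compact K'" "K' \<subseteq> D" "\<And>t z. 0 \<le> t ==> t \<le> 1 ==> z \<in> K ==> flow t z \<in> K'"
    using compact_flow[OF K(1,2)] by blast
  have [measurable]: "K' \<in> sets borel" using K' by (simp add: compact_imp_closed borel_closed)
  obtain C where C: "0 \<le> C" "\<And>x. x \<in> K ==> \<bar>source \<phi> x\<bar> \<le> C"
    using smooth_bounded_compact[OF smooth_source[OF K(4)] K(1)] by blast
  have [measurable]: "source \<phi> \<in> borel_measurable borel" by (rule smooth_measurable[OF smooth_source[OF K(4)]])
  show "(\<lambda>p. U (fst p) * (indicator {0..1} (snd p) * pushed_rate \<phi> (snd p) (fst p))) \<in> borel_measurable (lborel \<Otimes>\<^sub>M lborel)"
    unfolding pushed_rate_def backflow_def by measurable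
  have source0: "source \<phi> z = 0" if "z \<notin> K" for z
  proof -
    have "pd v \<phi> z = 0" for v by (rule pd_zero_outside[OF compact_imp_closed[OF K(1)] K(3) that])
    then show ?thesis using K(3)[OF that] by (simp add: source_def)
  qed
  have bound: "\<bar>pushed_rate \<phi> t w\<bar> \<le> C * indicator K' w" if t: "t \<in> {0..1}" for t w
  proof (cases "backflow t w \<in> K")
    case True
    then have "w \<in> K'" using K'(3)[of t "backflow t w"] t by (simp add: flow_backflow)
    have p: "1 \<le> (1 + t * a) ^ Suc DIM('a)" by (rule one_le_power) (use scale_ge_1 t in simp)
    have "inverse ((1 + t * a) ^ Suc DIM('a)) \<le> 1" "0 \<le> inverse ((1 + t * a) ^ Suc DIM('a))"
      using inverse_le_1_iff[THEN iffD2, OF disjI2, OF p]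
        inverse_nonnegative_iff_nonnegative[THEN iffD2, OF order_trans[OF zero_le_one p]] by blast+
    then have "\<bar>pushed_rate \<phi> t w\<bar> \<le> 1 * C" unfolding pushed_rate_def abs_mult
      by (intro mult_mono) (use C True in auto)
    then show ?thesis using \<open>w \<in> K'\<close> by simp
  qed (use C(1) source0 in \<open>simp add: pushed_rate_def\<close>)
  have iU: "integrable lborel (\<lambda>w. indicator K' w * U w)"
    using locally_integrable_compact[OF has_weak_grad_locally_integrable(1)[OF weak_grad] K'(1,2)]
    by (simp add: set_integrable_def)
  have "(\<integral>\<^sup>+p. ennreal (norm (U (fst p) * (indicator {0..1} (snd p) * pushed_rate \<phi> (snd p) (fst p)))) \<partial>(lborel \<Otimes>\<^sub>M lborel))
      \<le> (\<integral>\<^sup>+p. ennreal (norm (C * (indicator K' (fst p) * U (fst p)))) * indicator {0..1::real} (snd p) \<partial>(lborel \<Otimes>\<^sub>M lborel))"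
  proof (rule nn_integral_mono)
    fix p :: "'a \<times> real"
    show "ennreal (norm (U (fst p) * (indicator {0..1} (snd p) * pushed_rate \<phi> (snd p) (fst p))))
       \<le> ennreal (norm (C * (indicator K' (fst p) * U (fst p)))) * indicator {0..1} (snd p)"
    proof (cases "snd p \<in> {0..1}")
      case True
      have "\<bar>U (fst p)\<bar> * \<bar>pushed_rate \<phi> (snd p) (fst p)\<bar> \<le> \<bar>U (fst p)\<bar> * (C * indicator K' (fst p))"
        by (intro mult_left_mono bound True) auto
      then show ?thesis using True C(1) by (auto simp: abs_mult mult_ac intro!: ennreal_leI)
    qed simp
  qed
  also have "\<dots> = (\<integral>\<^sup>+w. \<integral>\<^sup>+t. ennreal (norm (C * (indicator K' w * U w))) * indicator {0..1::real} t \<partial>lborel \<partial>lborel)"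
    by (subst lborel.nn_integral_fst[symmetric]) auto
  also have "\<dots> = (\<integral>\<^sup>+w. ennreal (norm (C * (indicator K' w * U w))) \<partial>lborel)" by (simp add: nn_integral_cmult)
  also have "\<dots> < \<infinity>" using integrable_mult_right[OF iU, of C] unfolding integrable_iff_bounded by blast
  finally show "(\<integral>\<^sup>+p. ennreal (norm (U (fst p) * (indicator {0..1} (snd p) * pushed_rate \<phi> (snd p) (fst p)))) \<partial>(lborel \<Otimes>\<^sub>M lborel)) < \<infinity>" .
qed

text \<open>The fundamental theorem of calculus along the flow, for weakly differentiable functions. Tested against \<open>\<phi>\<close>, the
  flow is moved to the test function, where the classical theorem applies, and the time derivative is moved back with the
  weak gradient and Fubini; the fundamental lemma concludes.\<close>

theorem flow_increment:
  "AE z in lborel. z \<in> D \<longrightarrow> integrable lborel (rate z) \<and> U (flow 1 z) - U z = (\<integral>t. rate z t \<partial>lborel)"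
proof -
  let ?R = "\<lambda>z. \<integral>t. rate z t \<partial>lborel"
  note Uloc = has_weak_grad_locally_integrable(1)[OF weak_grad]
  have loc: "locally_integrable D (\<lambda>z. U (flow 1 z) - U z - ?R z)"
    unfolding locally_integrable_def
    by (auto intro!: set_integral_diff(1) locally_integrable_compact[OF locally_integrable_flow_1]
        locally_integrable_compact[OF Uloc] locally_integrable_compact[OF rate_integral_locally_integrable])
  have "AE z in lborel. z \<in> D \<longrightarrow> U (flow 1 z) - U z - ?R z = 0"
  proof (rule fundamental_lemma[OF D_open loc])
    fix \<phi> :: "'a => real" assume \<phi>: "test_fun D \<phi>"
    obtain K where K: "compact K" "K \<subseteq> D" "\<And>x. x \<notin> K ==> \<phi> x = 0" "smooth \<phi>" using \<phi> by (rule test_funE) (rule that)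
    have [measurable]: "K \<in> sets borel" using K by (simp add: compact_imp_closed borel_closed)
    have [measurable]: "\<phi> \<in> borel_measurable borel" by (rule smooth_measurable[OF K(4)])
    have int: "integrable lborel (\<lambda>z. w z * \<phi> z)" if "locally_integrable D w" for w
      by (rule integrable_mult_compact[OF locally_integrable_compact[OF that K(1,2)] K(4,1,3)])
    have flow0: "flow 0 z = z" for z by (simp add: flow_def)
    have iH: "integrable (lborel \<Otimes>\<^sub>M lborel) (\<lambda>(z, t). rate z t * \<phi> z)"
    proof -
      obtain C where C: "0 \<le> C" "\<And>x. x \<in> K ==> \<bar>\<phi> x\<bar> \<le> C" using smooth_bounded_compact[OF K(4,1)] by blast
      show ?thesis
      proof (rule Bochner_Integration.integrable_bound)
        show "integrable (lborel \<Otimes>\<^sub>M lborel) (\<lambda>p. C * (indicator K (fst p) * rate (fst p) (snd p)))"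
          using integrable_rate[OF K(1,2)] by simp
        show "AE p in lborel \<Otimes>\<^sub>M lborel. norm (case p of (z, t) => rate z t * \<phi> z) \<le> norm (C * (indicator K (fst p) * rate (fst p) (snd p)))"
        proof (intro AE_I2)
          fix p :: "'a \<times> real"
          show "norm (case p of (z, t) => rate z t * \<phi> z) \<le> norm (C * (indicator K (fst p) * rate (fst p) (snd p)))"
            using C K(3)[of "fst p"] mult_right_mono[OF C(2)[of "fst p"], of "\<bar>rate (fst p) (snd p)\<bar>"]
            by (cases "fst p \<in> K") (auto simp: case_prod_beta abs_mult mult.commute)
        qed
      qed (simp add: case_prod_beta')
    qed
    have "(\<integral>z. U (flow 1 z) * \<phi> z \<partial>lborel) - (\<integral>z. U z * \<phi> z \<partial>lborel) =
        (\<integral>w. U w * pushed \<phi> 1 w \<partial>lborel) - (\<integral>w. U w * pushed \<phi> 0 w \<partial>lborel)"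
      using integral_pushed[of U \<phi> 1] integral_pushed[of U \<phi> 0] by (simp add: flow0)
    also have "\<dots> = (\<integral>w. U w * pushed \<phi> 1 w - U w * pushed \<phi> 0 w \<partial>lborel)"
    proof (rule Bochner_Integration.integral_diff[symmetric])
      have "integrable lborel (\<lambda>z. U (flow t z) * \<phi> z) ==> integrable lborel (\<lambda>w. U w * pushed \<phi> t w)" if t: "0 \<le> t" for t
      proof -
        assume i: "integrable lborel (\<lambda>z. U (flow t z) * \<phi> z)"
        have [measurable]: "backflow t \<in> borel_measurable borel" unfolding backflow_def by measurable
        have "integrable lborel (\<lambda>z. U (flow t z) * pushed \<phi> t (flow t z))"
          using integrable_mult_right[OF i, of "inverse ((1 + t * a) ^ DIM('a))"] by (simp add: pushed_def backflow_flow t mult_ac)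
        then show ?thesis
          using integrable_affine[of "\<lambda>w. U w * pushed \<phi> t w" "1 + t * a" "t *\<^sub>R e"] scale_ge_1[OF t]
          by (simp add: flow_def add.commute pushed_def)
      qed
      then show "integrable lborel (\<lambda>w. U w * pushed \<phi> 1 w)" "integrable lborel (\<lambda>w. U w * pushed \<phi> 0 w)"
        using int[OF locally_integrable_flow_1] int[OF Uloc] by (auto simp: flow0)
    qed
    also have "\<dots> = - (\<integral>w. \<integral>t. U w * (indicator {0..1} t * pushed_rate \<phi> t w) \<partial>lborel \<partial>lborel)"
      by (simp add: pushed_increment[OF K(4)] algebra_simps flip: Bochner_Integration.integral_minus)
    also have "\<dots> = - (\<integral>t. \<integral>w. U w * (indicator {0..1} t * pushed_rate \<phi> t w) \<partial>lborel \<partial>lborel)"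
      using lborel_pair.Fubini_integral[of "\<lambda>w t. U w * (indicator {0..1} t * pushed_rate \<phi> t w)"]
        integrable_pushed_rate[OF \<phi>] by (simp add: case_prod_beta')
    also have "\<dots> = (\<integral>t. - (\<integral>w. U w * (indicator {0..1} t * pushed_rate \<phi> t w) \<partial>lborel) \<partial>lborel)"
      by (rule Bochner_Integration.integral_minus[symmetric])
    also have "\<dots> = (\<integral>t. \<integral>z. rate z t * \<phi> z \<partial>lborel \<partial>lborel)"
    proof (rule Bochner_Integration.integral_cong)
      fix t :: real
      show "- (\<integral>w. U w * (indicator {0..1} t * pushed_rate \<phi> t w) \<partial>lborel) = (\<integral>z. rate z t * \<phi> z \<partial>lborel)"
        using integral_pushed_rate[OF \<phi>, of t] by (cases "t \<in> {0..1}") (auto simp: rate_def)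
    qed simp
    also have "\<dots> = (\<integral>z. \<integral>t. rate z t * \<phi> z \<partial>lborel \<partial>lborel)"
      using lborel_pair.Fubini_integral[OF iH] .
    also have "\<dots> = (\<integral>z. ?R z * \<phi> z \<partial>lborel)" by simp
    finally have "(\<integral>z. U (flow 1 z) * \<phi> z \<partial>lborel) - (\<integral>z. U z * \<phi> z \<partial>lborel) - (\<integral>z. ?R z * \<phi> z \<partial>lborel) = 0" by simp
    then have "(\<integral>z. (U (flow 1 z) - U z - ?R z) * \<phi> z \<partial>lborel) = 0"
      using int[OF locally_integrable_flow_1] int[OF Uloc] int[OF rate_integral_locally_integrable]
      by (simp add: left_diff_distrib)
    then show "(LINT z:D|lborel. (U (flow 1 z) - U z - ?R z) * \<phi> z) = 0"
      by (subst set_integral_outside_zero) (use K in auto)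
  qed
  with rate_integrable_AE show ?thesis by eventually_elim auto
qed

end

section \<open>Hardy's inequality in the half space\<close>

definition hs_measure :: "real => ('a::euclidean_space \<times> real) measure" where
  "hs_measure \<alpha> = density lborel (\<lambda>z. ennreal (indicator half_space z * y_weight \<alpha> z))"

definition rho_measure :: "real => ('a::euclidean_space \<times> real) measure" where
  "rho_measure \<alpha> = density lborel (\<lambda>z. ennreal (indicator half_space z * (y_weight \<alpha> z * (1 / (rho z)\<^sup>2))))"

lemma open_half_space: "open (half_space :: ('a::euclidean_space \<times> real) set)"
  unfolding half_space_def by (intro open_Times) auto

lemma half_space_borel [measurable]: "half_space \<in> sets (borel :: ('a::euclidean_space \<times> real) measure)"
  using open_half_space by (rule borel_open)

lemma in_half_space: "z \<in> half_space \<longleftrightarrow> 0 < snd z"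
  by (cases z) (simp add: half_space_def)

lemma y_weight_borel [measurable]: "y_weight \<alpha> \<in> borel_measurable (borel :: ('a::euclidean_space \<times> real) measure)"
  unfolding y_weight_def borel_prod[symmetric] by measurable

lemma rho_borel [measurable]: "rho \<in> borel_measurable (borel :: ('a::euclidean_space \<times> real) measure)"
  unfolding rho_def borel_prod[symmetric] by measurable

lemma rho_ge_1: "1 \<le> rho z" and rho_pos: "0 < rho z"
  by (simp_all add: rho_def add_pos_nonneg)

lemma rho_power2: "(rho z)\<^sup>2 = 1 + (norm z)\<^sup>2"
  by (cases z) (simp add: rho_def norm_prod_def)

lemma y_weight_nonneg [simp]: "0 \<le> y_weight \<alpha> z"
  by (simp add: y_weight_def)

lemma sets_hs_measure [simp, measurable_cong]: "sets (hs_measure \<alpha> :: ('a::euclidean_space \<times> real) measure) = sets borel"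
  and sets_rho_measure [simp, measurable_cong]: "sets (rho_measure \<alpha> :: ('a::euclidean_space \<times> real) measure) = sets borel"
  and space_hs_measure [simp]: "space (hs_measure \<alpha> :: ('a::euclidean_space \<times> real) measure) = UNIV"
  and space_rho_measure [simp]: "space (rho_measure \<alpha> :: ('a::euclidean_space \<times> real) measure) = UNIV"
  by (simp_all add: hs_measure_def rho_measure_def)

lemma nn_integral_hs:
  assumes [measurable]: "F \<in> borel_measurable borel"
  shows "(\<integral>\<^sup>+z. F z \<partial>hs_measure \<alpha>) = (\<integral>\<^sup>+z. ennreal (indicator half_space z * y_weight \<alpha> z) * F z \<partial>lborel)"
  unfolding hs_measure_def by (rule nn_integral_density) auto

lemma nn_integral_rho:
  assumes [measurable]: "F \<in> borel_measurable borel"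
  shows "(\<integral>\<^sup>+z. F z \<partial>rho_measure \<alpha>) = (\<integral>\<^sup>+z. ennreal (1 / (rho z)\<^sup>2) * F z \<partial>hs_measure \<alpha>)"
proof -
  have "(\<integral>\<^sup>+z. F z \<partial>rho_measure \<alpha>) = (\<integral>\<^sup>+z. ennreal (indicator half_space z * (y_weight \<alpha> z * (1 / (rho z)\<^sup>2))) * F z \<partial>lborel)"
    unfolding rho_measure_def by (rule nn_integral_density) auto
  also have "\<dots> = (\<integral>\<^sup>+z. ennreal (1 / (rho z)\<^sup>2) * F z \<partial>hs_measure \<alpha>)"
    by (subst nn_integral_hs) (auto intro!: nn_integral_cong simp: ennreal_mult[symmetric] mult_ac simp flip: mult.assoc)
  finally show ?thesis .
qed

lemma AE_hs: "(AE z in hs_measure \<alpha>. P z) \<longleftrightarrow> (AE z in lborel. z \<in> half_space \<longrightarrow> P z)"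
  and AE_rho: "(AE z in rho_measure \<alpha>. P z) \<longleftrightarrow> (AE z in lborel. z \<in> half_space \<longrightarrow> P z)"
proof -
  have 1: "0 < ennreal (indicator half_space z * y_weight \<alpha> z) \<longleftrightarrow> z \<in> half_space" for z :: "'a \<times> real"
    by (auto simp: indicator_def y_weight_def in_half_space)
  have 2: "0 < ennreal (indicator half_space z * (y_weight \<alpha> z * (1 / (rho z)\<^sup>2))) \<longleftrightarrow> z \<in> half_space" for z :: "'a \<times> real"
    using rho_pos[of z] by (auto simp: indicator_def y_weight_def in_half_space)
  show "(AE z in hs_measure \<alpha>. P z) \<longleftrightarrow> (AE z in lborel. z \<in> half_space \<longrightarrow> P z)"
    unfolding hs_measure_def by (subst AE_density) (measurable, simp only: 1)
  show "(AE z in rho_measure \<alpha>. P z) \<longleftrightarrow> (AE z in lborel. z \<in> half_space \<longrightarrow> P z)"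
    unfolding rho_measure_def by (subst AE_density) (measurable, simp only: 2)
qed

text \<open>The measure \<open>y^\<alpha> dx dy\<close> is homogeneous of degree \<open>d + 1 + \<alpha>\<close> under dilations.\<close>

lemma nn_integral_hs_scale:
  fixes F :: "'a::euclidean_space \<times> real => ennreal"
  assumes [measurable]: "F \<in> borel_measurable borel" and c: "0 < c"
  shows "(\<integral>\<^sup>+z. F z \<partial>hs_measure \<alpha>) = ennreal (c powr (real (DIM('a) + 1) + \<alpha>)) * (\<integral>\<^sup>+z. F (c *\<^sub>R z) \<partial>hs_measure \<alpha>)"
proof -
  have w: "ennreal (indicator half_space (c *\<^sub>R z) * y_weight \<alpha> (c *\<^sub>R z)) =
      ennreal (c powr \<alpha>) * ennreal (indicator half_space z * y_weight \<alpha> z)" for z :: "'a \<times> real"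
    using c by (auto simp: indicator_def in_half_space y_weight_def powr_mult zero_less_mult_iff simp flip: ennreal_mult)
  have p: "ennreal (c ^ DIM('a \<times> real)) * ennreal (c powr \<alpha>) = ennreal (c powr (real (DIM('a) + 1) + \<alpha>))"
    using c by (simp add: powr_add powr_realpow[symmetric] flip: ennreal_mult)
  have "(\<integral>\<^sup>+z. F z \<partial>hs_measure \<alpha>) = (\<integral>\<^sup>+z. ennreal (indicator half_space z * y_weight \<alpha> z) * F z \<partial>lborel)"
    by (rule nn_integral_hs) simp
  also have "\<dots> = ennreal (c ^ DIM('a \<times> real)) * (\<integral>\<^sup>+z. ennreal (indicator half_space (c *\<^sub>R z) * y_weight \<alpha> (c *\<^sub>R z)) * F (c *\<^sub>R z) \<partial>lborel)"
    using nn_integral_affine[of "\<lambda>z. ennreal (indicator half_space z * y_weight \<alpha> z) * F z" c 0] c by simp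
  also have "\<dots> = ennreal (c ^ DIM('a \<times> real)) * (ennreal (c powr \<alpha>) * (\<integral>\<^sup>+z. ennreal (indicator half_space z * y_weight \<alpha> z) * F (c *\<^sub>R z) \<partial>lborel))"
    unfolding w mult.assoc by (subst nn_integral_cmult) auto
  also have "\<dots> = ennreal (c powr (real (DIM('a) + 1) + \<alpha>)) * (\<integral>\<^sup>+z. ennreal (indicator half_space z * y_weight \<alpha> z) * F (c *\<^sub>R z) \<partial>lborel)"
    unfolding p[symmetric] by (simp add: mult.assoc)
  also have "(\<integral>\<^sup>+z. ennreal (indicator half_space z * y_weight \<alpha> z) * F (c *\<^sub>R z) \<partial>lborel) = (\<integral>\<^sup>+z. F (c *\<^sub>R z) \<partial>hs_measure \<alpha>)"
    by (rule nn_integral_hs[symmetric]) simp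
  finally show ?thesis .
qed

lemma Jensen_unit_interval:
  fixes r :: "real => real"
  assumes r: "integrable lborel r" and supp: "\<And>t. t \<notin> {0..1} ==> r t = 0"
  shows "ennreal ((\<integral>t. r t \<partial>lborel)\<^sup>2) \<le> (\<integral>\<^sup>+t. ennreal ((r t)\<^sup>2) \<partial>lborel)"
proof -
  have [measurable]: "r \<in> borel_measurable borel" using r by auto
  have "\<bar>\<integral>t. r t \<partial>lborel\<bar> \<le> (\<integral>t. \<bar>r t\<bar> \<partial>lborel)" using integral_norm_bound[of lborel r] by simp
  then have "ennreal \<bar>\<integral>t. r t \<partial>lborel\<bar> \<le> (\<integral>\<^sup>+t. ennreal \<bar>r t\<bar> \<partial>lborel)"
    using r by (subst nn_integral_eq_integral) (auto intro: ennreal_leI)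
  also have "\<dots> = (\<integral>\<^sup>+t. ennreal \<bar>r t\<bar> * indicator {0..1} t \<partial>lborel)"
    by (rule nn_integral_cong) (use supp in \<open>auto simp: indicator_def\<close>)
  finally have "(ennreal \<bar>\<integral>t. r t \<partial>lborel\<bar>)\<^sup>2 \<le> (\<integral>\<^sup>+t. ennreal \<bar>r t\<bar> * indicator {0..1} t \<partial>lborel)\<^sup>2"
    by (rule power_mono) simp
  also have "\<dots> \<le> (\<integral>\<^sup>+t. (ennreal \<bar>r t\<bar>)\<^sup>2 \<partial>lborel) * (\<integral>\<^sup>+t. (indicator {0..1} t)\<^sup>2 \<partial>(lborel :: real measure))"
    by (rule Cauchy_Schwarz_nn_integral) auto
  also have "(\<integral>\<^sup>+t. (indicator {0..1} t)\<^sup>2 \<partial>(lborel :: real measure)) = (\<integral>\<^sup>+t. indicator {0..1} t \<partial>(lborel :: real measure))"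
    by (rule nn_integral_cong) (auto simp: indicator_def)
  finally show ?thesis by (simp add: ennreal_power)
qed

text \<open>The gradient is carried along explicitly, since translations and linear combinations act on it directly.\<close>

definition H1 :: "real => ('a::euclidean_space \<times> real => real) => ('a \<times> real => 'a \<times> real) => bool" where
  "H1 \<alpha> U G \<longleftrightarrow> has_weak_grad half_space U G \<and> sq_integrable (hs_measure \<alpha>) G \<and> sq_integrable (rho_measure \<alpha>) U"

lemma H1_borel: "H1 \<alpha> U G ==> U \<in> borel_measurable borel" "H1 \<alpha> U G ==> G \<in> borel_measurable borel"
  by (auto simp: H1_def sq_integrable_def)

lemma H1_flow:
  assumes H: "H1 \<alpha> U G" and a: "0 \<le> a" and e: "0 \<le> snd e"
  shows "affine_flow half_space U G a e"
proof
  show "open (half_space :: ('a \<times> real) set)" by (rule open_half_space)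
  fix t :: real and z :: "'a \<times> real" assume t: "0 \<le> t" "t \<le> 1" and z: "z \<in> half_space"
  have "0 < (1 + t * a) * snd z" using t a z by (intro mult_pos_pos) (auto simp: in_half_space add_pos_nonneg)
  then show "(1 + t * a) *\<^sub>R z + t *\<^sub>R e \<in> half_space" using t e by (simp add: in_half_space add_pos_nonneg)
qed (use H H1_borel[OF H] a in \<open>auto simp: H1_def\<close>)

definition hardy_const :: "nat => real => real" where
  "hardy_const d \<alpha> = 1 / (1 - sqrt (2 powr (1 - real d - \<alpha>)))"

text \<open>Along the ray from \<open>z\<close> to \<open>2 z\<close> the increment is the integral of \<open>G \<bullet> z\<close>, and \<open>norm z \<le> rho z\<close>
  cancels the weight. Dilations by factors at least 1 do not increase the norm of \<open>G\<close>.\<close>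

lemma hardy_dilation_increment:
  fixes U :: "'a::euclidean_space \<times> real => real"
  assumes H: "H1 \<alpha> U G" and \<alpha>: "-1 < \<alpha>"
  shows "(\<integral>\<^sup>+z. ennreal ((U (2 *\<^sub>R z) - U z)\<^sup>2) \<partial>rho_measure \<alpha>) \<le> ennreal ((l2 (hs_measure \<alpha>) G)\<^sup>2)"
proof -
  note [measurable] = H1_borel[OF H]
  interpret F: affine_flow half_space U G 1 0 by (rule H1_flow[OF H]) auto
  have F1: "F.flow 1 z = 2 *\<^sub>R z" for z by (simp add: F.flow_def)
  have Gsq: "sq_integrable (hs_measure \<alpha>) G" using H by (simp add: H1_def)
  have eq: "(\<integral>\<^sup>+z. ennreal ((U (2 *\<^sub>R z) - U z)\<^sup>2) \<partial>rho_measure \<alpha>) =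
     (\<integral>\<^sup>+z. ennreal (1 / (rho z)\<^sup>2) * ennreal ((U (2 *\<^sub>R z) - U z)\<^sup>2) \<partial>hs_measure \<alpha>)"
    by (rule nn_integral_rho) simp
  also have "\<dots> \<le> (\<integral>\<^sup>+z. \<integral>\<^sup>+t. indicator {0..1} t * ennreal ((norm (G ((1 + t) *\<^sub>R z)))\<^sup>2) \<partial>lborel \<partial>hs_measure \<alpha>)"
  proof (rule nn_integral_mono_AE)
    show "AE z in hs_measure \<alpha>. ennreal (1 / (rho z)\<^sup>2) * ennreal ((U (2 *\<^sub>R z) - U z)\<^sup>2) \<le>
        (\<integral>\<^sup>+t. indicator {0..1} t * ennreal ((norm (G ((1 + t) *\<^sub>R z)))\<^sup>2) \<partial>lborel)"
      unfolding AE_hs using F.flow_increment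
    proof eventually_elim
      case (elim z)
      show ?case
      proof
      assume "z \<in> half_space"
      with elim have i: "integrable lborel (F.rate z)" "U (2 *\<^sub>R z) - U z = (\<integral>t. F.rate z t \<partial>lborel)"
        unfolding F1 by auto
      have "ennreal (1 / (rho z)\<^sup>2) * ennreal ((U (2 *\<^sub>R z) - U z)\<^sup>2) \<le>
          ennreal (1 / (rho z)\<^sup>2) * (\<integral>\<^sup>+t. ennreal ((F.rate z t)\<^sup>2) \<partial>lborel)"
        unfolding i(2) by (intro mult_left_mono Jensen_unit_interval i(1)) (auto simp: F.rate_def)
      also have "\<dots> = (\<integral>\<^sup>+t. ennreal (1 / (rho z)\<^sup>2) * ennreal ((F.rate z t)\<^sup>2) \<partial>lborel)"
        by (rule nn_integral_cmult[symmetric]) (use i(1) in auto)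
      also have "\<dots> \<le> (\<integral>\<^sup>+t. indicator {0..1} t * ennreal ((norm (G ((1 + t) *\<^sub>R z)))\<^sup>2) \<partial>lborel)"
      proof (rule nn_integral_mono)
        fix t :: real
        show "ennreal (1 / (rho z)\<^sup>2) * ennreal ((F.rate z t)\<^sup>2) \<le> indicator {0..1} t * ennreal ((norm (G ((1 + t) *\<^sub>R z)))\<^sup>2)"
        proof (cases "t \<in> {0..1}")
          case True
          have "(G ((1 + t) *\<^sub>R z) \<bullet> z)\<^sup>2 \<le> (norm (G ((1 + t) *\<^sub>R z)))\<^sup>2 * (norm z)\<^sup>2"
            using power_mono[OF Cauchy_Schwarz_ineq2[of "G ((1 + t) *\<^sub>R z)" z], of 2] by (simp add: power_mult_distrib)
          also have "\<dots> \<le> (norm (G ((1 + t) *\<^sub>R z)))\<^sup>2 * (rho z)\<^sup>2"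
            by (intro mult_left_mono) (simp_all add: rho_power2)
          finally have "1 / (rho z)\<^sup>2 * (G ((1 + t) *\<^sub>R z) \<bullet> z)\<^sup>2 \<le> (norm (G ((1 + t) *\<^sub>R z)))\<^sup>2"
            using rho_pos[of z] by (simp add: field_simps)
          then show ?thesis using True
            by (simp add: F.rate_def F.flow_def F.speed_def ennreal_leI flip: ennreal_mult)
        qed (simp add: F.rate_def)
      qed
      finally show "ennreal (1 / (rho z)\<^sup>2) * ennreal ((U (2 *\<^sub>R z) - U z)\<^sup>2) \<le>
        (\<integral>\<^sup>+t. indicator {0..1} t * ennreal ((norm (G ((1 + t) *\<^sub>R z)))\<^sup>2) \<partial>lborel)" .
      qed
    qed
  qed
  also have "\<dots> = (\<integral>\<^sup>+t. \<integral>\<^sup>+z. indicator {0..1} t * ennreal ((norm (G ((1 + t) *\<^sub>R z)))\<^sup>2) \<partial>hs_measure \<alpha> \<partial>lborel)"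
  proof -
    have sf: "sigma_finite_measure (hs_measure \<alpha> :: ('a \<times> real) measure)"
      unfolding hs_measure_def
      by (subst sigma_finite_measure.sigma_finite_iff_density_finite[OF sigma_finite_lborel]) auto
    interpret pair_sigma_finite "hs_measure \<alpha> :: ('a \<times> real) measure" "lborel :: real measure"
      using sf by (intro pair_sigma_finite.intro) (auto intro: lborel.sigma_finite_measure_axioms)
    show ?thesis by (rule Fubini'[symmetric]) (simp add: case_prod_beta')
  qed
  also have "\<dots> \<le> (\<integral>\<^sup>+t. indicator {0..1} t * ennreal ((l2 (hs_measure \<alpha>) G)\<^sup>2) \<partial>(lborel :: real measure))"
  proof (rule nn_integral_mono)
    fix t :: real
    show "(\<integral>\<^sup>+z. indicator {0..1} t * ennreal ((norm (G ((1 + t) *\<^sub>R z)))\<^sup>2) \<partial>hs_measure \<alpha>) \<le>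
        indicator {0..1} t * ennreal ((l2 (hs_measure \<alpha>) G)\<^sup>2)"
    proof (cases "t \<in> {0..1}")
      case True
      have "1 \<le> (1 + t) powr (real (DIM('a) + 1) + \<alpha>)" using True \<alpha> by (intro ge_one_powr_ge_zero) auto
      then have "1 * (\<integral>\<^sup>+z. ennreal ((norm (G ((1 + t) *\<^sub>R z)))\<^sup>2) \<partial>hs_measure \<alpha>) \<le>
          ennreal ((1 + t) powr (real (DIM('a) + 1) + \<alpha>)) * (\<integral>\<^sup>+z. ennreal ((norm (G ((1 + t) *\<^sub>R z)))\<^sup>2) \<partial>hs_measure \<alpha>)"
        by (intro mult_right_mono) auto
      also have "\<dots> = (\<integral>\<^sup>+z. ennreal ((norm (G z))\<^sup>2) \<partial>hs_measure \<alpha>)"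
        by (rule nn_integral_hs_scale[symmetric]) (use True in auto)
      also have "\<dots> = ennreal ((l2 (hs_measure \<alpha>) G)\<^sup>2)" by (rule nn_integral_l2[OF Gsq])
      finally show ?thesis using True by simp
    qed simp
  qed
  also have "\<dots> = ennreal ((l2 (hs_measure \<alpha>) G)\<^sup>2)" by (simp add: nn_integral_multc)
  finally show ?thesis .
qed

text \<open>Dilation scales the measure by \<open>2 powr (- d - 1 - \<alpha>)\<close>, while the weight \<open>1 / rho\<^sup>2\<close> changes by
  at most the factor 4.\<close>

lemma hardy_dilation:
  fixes U :: "'a::euclidean_space \<times> real => real"
  assumes U: "sq_integrable (rho_measure \<alpha>) U"
  shows "sq_integrable (rho_measure \<alpha>) (\<lambda>z. U (2 *\<^sub>R z))"
    and "l2 (rho_measure \<alpha>) (\<lambda>z. U (2 *\<^sub>R z)) \<le> sqrt (2 powr (1 - real DIM('a) - \<alpha>)) * l2 (rho_measure \<alpha>) U"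
proof -
  have [measurable]: "U \<in> borel_measurable borel" using U by (auto simp: sq_integrable_def)
  let ?p = "real (DIM('a) + 1) + \<alpha>"
  have "(\<integral>\<^sup>+z. ennreal ((norm (U (2 *\<^sub>R z)))\<^sup>2) \<partial>rho_measure \<alpha>) =
      (\<integral>\<^sup>+z. ennreal (1 / (rho z)\<^sup>2) * ennreal ((norm (U (2 *\<^sub>R z)))\<^sup>2) \<partial>hs_measure \<alpha>)"
    by (rule nn_integral_rho) simp
  also have "\<dots> \<le> (\<integral>\<^sup>+z. 4 * (ennreal (1 / (rho (2 *\<^sub>R z))\<^sup>2) * ennreal ((norm (U (2 *\<^sub>R z)))\<^sup>2)) \<partial>hs_measure \<alpha>)"
  proof (rule nn_integral_mono)
    fix z :: "'a \<times> real"
    have "(rho (2 *\<^sub>R z))\<^sup>2 \<le> 4 * (rho z)\<^sup>2" by (simp add: rho_power2 power_mult_distrib)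
    then have "1 / (rho z)\<^sup>2 \<le> 4 * (1 / (rho (2 *\<^sub>R z))\<^sup>2)"
      using rho_pos[of z] rho_pos[of "2 *\<^sub>R z"] by (simp add: field_simps)
    then have "ennreal (1 / (rho z)\<^sup>2) \<le> ennreal (4 * (1 / (rho (2 *\<^sub>R z))\<^sup>2))" by (rule ennreal_leI)
    also have "\<dots> = 4 * ennreal (1 / (rho (2 *\<^sub>R z))\<^sup>2)" by (subst ennreal_mult) auto
    finally have "ennreal (1 / (rho z)\<^sup>2) \<le> 4 * ennreal (1 / (rho (2 *\<^sub>R z))\<^sup>2)" .
    then show "ennreal (1 / (rho z)\<^sup>2) * ennreal ((norm (U (2 *\<^sub>R z)))\<^sup>2) \<le>
       4 * (ennreal (1 / (rho (2 *\<^sub>R z))\<^sup>2) * ennreal ((norm (U (2 *\<^sub>R z)))\<^sup>2))"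
      by (simp add: mult_right_mono flip: mult.assoc)
  qed
  also have "\<dots> = 4 * (\<integral>\<^sup>+z. ennreal (1 / (rho (2 *\<^sub>R z))\<^sup>2) * ennreal ((norm (U (2 *\<^sub>R z)))\<^sup>2) \<partial>hs_measure \<alpha>)"
    by (rule nn_integral_cmult) simp
  also have "(\<integral>\<^sup>+z. ennreal (1 / (rho (2 *\<^sub>R z))\<^sup>2) * ennreal ((norm (U (2 *\<^sub>R z)))\<^sup>2) \<partial>hs_measure \<alpha>) =
      ennreal (2 powr (- ?p)) * (\<integral>\<^sup>+z. ennreal (1 / (rho z)\<^sup>2) * ennreal ((norm (U z))\<^sup>2) \<partial>hs_measure \<alpha>)"
    using nn_integral_hs_scale[of "\<lambda>z. ennreal (1 / (rho z)\<^sup>2) * ennreal ((norm (U z))\<^sup>2)" 2 \<alpha>]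
    by (simp add: mult.assoc[symmetric] powr_add[symmetric] flip: ennreal_mult)
  also have "(\<integral>\<^sup>+z. ennreal (1 / (rho z)\<^sup>2) * ennreal ((norm (U z))\<^sup>2) \<partial>hs_measure \<alpha>) = ennreal ((l2 (rho_measure \<alpha>) U)\<^sup>2)"
    using nn_integral_l2[OF U] nn_integral_rho[of "\<lambda>z. ennreal ((norm (U z))\<^sup>2)" \<alpha>] by simp
  also have "4 * (ennreal (2 powr (- ?p)) * ennreal ((l2 (rho_measure \<alpha>) U)\<^sup>2)) =
      ennreal ((sqrt (2 powr (1 - real DIM('a) - \<alpha>)) * l2 (rho_measure \<alpha>) U)\<^sup>2)"
  proof -
    have "4 * 2 powr (- ?p) = 2 powr 2 * 2 powr (- ?p)" by simp
    also have "\<dots> = 2 powr (2 + - ?p)" by (rule powr_add[symmetric])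
    also have "2 + - ?p = 1 - real DIM('a) - \<alpha>" by simp
    finally have "4 * (2 powr (- ?p) * (l2 (rho_measure \<alpha>) U)\<^sup>2) = (sqrt (2 powr (1 - real DIM('a) - \<alpha>)) * l2 (rho_measure \<alpha>) U)\<^sup>2"
      by (simp add: power_mult_distrib flip: mult.assoc)
    then have "ennreal (4 * (2 powr (- ?p) * (l2 (rho_measure \<alpha>) U)\<^sup>2)) = ennreal ((sqrt (2 powr (1 - real DIM('a) - \<alpha>)) * l2 (rho_measure \<alpha>) U)\<^sup>2)" by simp
    then show ?thesis by (simp add: ennreal_mult)
  qed
  finally have "(\<integral>\<^sup>+z. ennreal ((norm (U (2 *\<^sub>R z)))\<^sup>2) \<partial>rho_measure \<alpha>) \<le>
     ennreal ((sqrt (2 powr (1 - real DIM('a) - \<alpha>)) * l2 (rho_measure \<alpha>) U)\<^sup>2)" .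
  from sq_integrableI_nn[OF _ this]
  show "sq_integrable (rho_measure \<alpha>) (\<lambda>z. U (2 *\<^sub>R z))"
    "l2 (rho_measure \<alpha>) (\<lambda>z. U (2 *\<^sub>R z)) \<le> sqrt (2 powr (1 - real DIM('a) - \<alpha>)) * l2 (rho_measure \<alpha>) U"
    by simp_all
qed

lemma hardy_const_pos: "1 < real d + \<alpha> ==> 0 < hardy_const d \<alpha>"
proof -
  assume "1 < real d + \<alpha>"
  then have "2 powr (1 - real d - \<alpha>) < 2 powr (0::real)" by (intro powr_less_mono) auto
  then show ?thesis by (simp add: hardy_const_def)
qed

text \<open>Dilation by 2 is a strict contraction in the weighted space when \<open>1 < d + \<alpha>\<close>, so \<open>U\<close> is controlled by the
  increment \<open>U (2 z) - U z\<close>. The finiteness of the left-hand side, part of \<open>H1\<close>, is essential for absorbing.\<close>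

theorem hardy_inequality:
  fixes U :: "'a::euclidean_space \<times> real => real"
  assumes H: "H1 \<alpha> U G" and \<alpha>: "-1 < \<alpha>" "1 < real DIM('a) + \<alpha>"
  shows "l2 (rho_measure \<alpha>) U \<le> hardy_const DIM('a) \<alpha> * l2 (hs_measure \<alpha>) G"
proof -
  let ?k = "sqrt (2 powr (1 - real DIM('a) - \<alpha>))"
  note [measurable] = H1_borel[OF H]
  have U: "sq_integrable (rho_measure \<alpha>) U" using H by (simp add: H1_def)
  note dil = hardy_dilation[OF U]
  have inc: "l2 (rho_measure \<alpha>) (\<lambda>z. U (2 *\<^sub>R z) - U z) \<le> l2 (hs_measure \<alpha>) G"
    by (rule sq_integrableI_nn(2)) (use hardy_dilation_increment[OF H \<alpha>(1)] in auto)
  have "l2 (rho_measure \<alpha>) U = l2 (rho_measure \<alpha>) (\<lambda>z. U (2 *\<^sub>R z) - (U (2 *\<^sub>R z) - U z))" by simp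
  also have "\<dots> \<le> l2 (rho_measure \<alpha>) (\<lambda>z. U (2 *\<^sub>R z)) + l2 (rho_measure \<alpha>) (\<lambda>z. U (2 *\<^sub>R z) - U z)"
    by (intro l2_triangle_diff sq_integrable_diff dil U)
  also have "\<dots> \<le> ?k * l2 (rho_measure \<alpha>) U + l2 (hs_measure \<alpha>) G" using dil(2) inc by linarith
  finally have "(1 - ?k) * l2 (rho_measure \<alpha>) U \<le> l2 (hs_measure \<alpha>) G" by (simp add: algebra_simps)
  moreover have "0 < 1 - ?k" using hardy_const_pos[OF \<alpha>(2)] by (simp add: hardy_const_def)
  ultimately show ?thesis by (simp add: hardy_const_def field_simps)
qed

section \<open>Traces\<close>

text \<open>The weight \<open>r^(-\<alpha>)\<close> is integrable at 0 exactly because \<open>\<alpha> < 1\<close>. This is why traces exist.\<close>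

lemma weighted_Cauchy_Schwarz_interval:
  fixes q :: "real => real"
  assumes [measurable]: "q \<in> borel_measurable borel" and \<alpha>: "-1 < \<alpha>" "\<alpha> < 1" and y: "0 \<le> y"
  shows "(\<integral>\<^sup>+r. ennreal (\<bar>indicator {0<..<y} r * q r\<bar>) \<partial>lborel)\<^sup>2 \<le>
    ennreal (y powr (1 - \<alpha>) / (1 - \<alpha>)) * (\<integral>\<^sup>+r. ennreal (indicator {0<..} r * (r powr \<alpha> * (q r)\<^sup>2)) \<partial>lborel)"
proof -
  have p: "(\<integral>\<^sup>+r. ennreal (indicator {0..y} r * r powr (- \<alpha>)) \<partial>lborel) = ennreal (y powr (1 - \<alpha>) / (1 - \<alpha>))"
  proof (rule nn_integral_has_integral_lborel)
    have "((\<lambda>r. r powr (- \<alpha>)) has_integral y powr (- \<alpha> + 1) / (- \<alpha> + 1)) {0..y}"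
      by (rule has_integral_powr_from_0) (use \<alpha> y in auto)
    then have "((\<lambda>r. if r \<in> {0..y} then r powr (- \<alpha>) else 0) has_integral y powr (1 - \<alpha>) / (1 - \<alpha>)) UNIV"
      by (subst has_integral_restrict_UNIV) (simp add: add.commute)
    then show "((\<lambda>r. indicator {0..y} r * r powr (- \<alpha>)) has_integral y powr (1 - \<alpha>) / (1 - \<alpha>)) UNIV"
      by (rule has_integral_eq[rotated]) (auto simp: indicator_def)
  qed auto
  have split: "(\<integral>\<^sup>+r. ennreal (\<bar>indicator {0<..<y} r * q r\<bar>) \<partial>lborel) =
     (\<integral>\<^sup>+r. ennreal (indicator {0<..<y} r * r powr (- \<alpha> / 2)) * ennreal (indicator {0<..} r * (r powr (\<alpha> / 2) * \<bar>q r\<bar>)) \<partial>lborel)"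
  proof (rule nn_integral_cong)
    fix r :: real
    show "ennreal (\<bar>indicator {0<..<y} r * q r\<bar>) =
       ennreal (indicator {0<..<y} r * r powr (- \<alpha> / 2)) * ennreal (indicator {0<..} r * (r powr (\<alpha> / 2) * \<bar>q r\<bar>))"
    proof (cases "r \<in> {0<..<y}")
      case True
      then have "r powr (- \<alpha> / 2) * r powr (\<alpha> / 2) = 1" by (simp add: powr_add[symmetric])
      then have "r powr (- \<alpha> / 2) * (r powr (\<alpha> / 2) * \<bar>q r\<bar>) = \<bar>q r\<bar>" by (simp only: mult.assoc[symmetric] mult_1_left)
      then have "ennreal \<bar>q r\<bar> = ennreal (r powr (- \<alpha> / 2) * (r powr (\<alpha> / 2) * \<bar>q r\<bar>))" by (simp only:)
      also have "\<dots> = ennreal (r powr (- \<alpha> / 2)) * ennreal (r powr (\<alpha> / 2) * \<bar>q r\<bar>)" by (rule ennreal_mult) auto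
      finally show ?thesis using True by simp
    qed simp
  qed
  have "(\<integral>\<^sup>+r. ennreal (\<bar>indicator {0<..<y} r * q r\<bar>) \<partial>lborel)\<^sup>2 \<le> (\<integral>\<^sup>+r. (ennreal (indicator {0<..<y} r * r powr (- \<alpha> / 2)))\<^sup>2 \<partial>lborel) *
     (\<integral>\<^sup>+r. (ennreal (indicator {0<..} r * (r powr (\<alpha> / 2) * \<bar>q r\<bar>)))\<^sup>2 \<partial>lborel)"
    unfolding split by (rule Cauchy_Schwarz_nn_integral) auto
  also have "\<dots> \<le> ennreal (y powr (1 - \<alpha>) / (1 - \<alpha>)) * (\<integral>\<^sup>+r. ennreal (indicator {0<..} r * (r powr \<alpha> * (q r)\<^sup>2)) \<partial>lborel)"
  proof (rule mult_mono)
    have sq: "(r powr c)\<^sup>2 = r powr (2 * c)" if "0 < r" for r c :: real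
      using that by (simp add: power2_eq_square powr_add[symmetric])
    show "(\<integral>\<^sup>+r. (ennreal (indicator {0<..<y} r * r powr (- \<alpha> / 2)))\<^sup>2 \<partial>lborel) \<le> ennreal (y powr (1 - \<alpha>) / (1 - \<alpha>))"
      unfolding p[symmetric]
      by (rule nn_integral_mono) (auto simp: indicator_def ennreal_power sq)
    show "(\<integral>\<^sup>+r. (ennreal (indicator {0<..} r * (r powr (\<alpha> / 2) * \<bar>q r\<bar>)))\<^sup>2 \<partial>lborel) \<le>
      (\<integral>\<^sup>+r. ennreal (indicator {0<..} r * (r powr \<alpha> * (q r)\<^sup>2)) \<partial>lborel)"
      by (rule nn_integral_mono) (auto simp: indicator_def ennreal_power power_mult_distrib sq)
  qed auto
  finally show ?thesis .
qed

definition vertical_energy :: "real => ('a::euclidean_space \<times> real => 'a \<times> real) => 'a => ennreal" where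
  "vertical_energy \<alpha> G x = (\<integral>\<^sup>+r. ennreal (indicator {0<..} r * (r powr \<alpha> * (snd (G (x, r)))\<^sup>2)) \<partial>lborel)"

definition vertical_primitive :: "('a::euclidean_space \<times> real => 'a \<times> real) => 'a \<times> real => real" where
  "vertical_primitive G z = (\<integral>r. indicator {0<..<snd z} r * snd (G (fst z, r)) \<partial>lborel)"

lemma borel_pair: "f \<in> borel_measurable (borel :: ('a::euclidean_space \<times> real) measure) ==> f \<in> borel_measurable (borel \<Otimes>\<^sub>M borel)"
  by (simp add: borel_prod)

lemma borel_pair2:
  "G \<in> borel_measurable (borel :: ('a::euclidean_space \<times> real) measure) ==>
   G \<in> (borel \<Otimes>\<^sub>M borel) \<rightarrow>\<^sub>M (borel \<Otimes>\<^sub>M (borel :: real measure) :: ('a \<times> real) measure)"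
  by (simp add: borel_prod)

lemma vertical_energy_borel [measurable]:
  fixes G :: "'a::euclidean_space \<times> real => 'a \<times> real"
  assumes "G \<in> borel_measurable borel"
  shows "vertical_energy \<alpha> G \<in> borel_measurable borel"
proof -
  note [measurable] = borel_pair2[OF assms]
  show ?thesis unfolding vertical_energy_def by measurable
qed

lemma vertical_primitive_borel [measurable]:
  fixes G :: "'a::euclidean_space \<times> real => 'a \<times> real"
  assumes "G \<in> borel_measurable borel"
  shows "vertical_primitive G \<in> borel_measurable borel"
proof -
  note [measurable] = borel_pair2[OF assms]
  have eq: "indicator {0<..<snd z} r = (if 0 < r \<and> r < snd z then 1 else (0::real))" for z :: "'a \<times> real" and r
    by (auto simp: indicator_def)
  have "vertical_primitive G \<in> borel_measurable (borel \<Otimes>\<^sub>M borel)"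
    unfolding vertical_primitive_def eq by measurable
  then show ?thesis by (simp add: borel_prod)
qed

lemma nn_integral_fst_lborel:
  fixes F :: "'a::euclidean_space \<times> real => ennreal"
  assumes "F \<in> borel_measurable borel"
  shows "(\<integral>\<^sup>+z. F z \<partial>lborel) = (\<integral>\<^sup>+x. \<integral>\<^sup>+y. F (x, y) \<partial>lborel \<partial>lborel)"
  unfolding lborel_prod[symmetric] by (rule lborel.nn_integral_fst[symmetric]) (use assms in \<open>simp add: lborel_prod\<close>)

lemma nn_integral_vertical_energy:
  fixes G :: "'a::euclidean_space \<times> real => 'a \<times> real"
  assumes G: "sq_integrable (hs_measure \<alpha>) G"
  shows "(\<integral>\<^sup>+x. vertical_energy \<alpha> G x \<partial>lborel) \<le> ennreal ((l2 (hs_measure \<alpha>) G)\<^sup>2)"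
proof -
  have [measurable]: "G \<in> borel_measurable borel" using G by (auto simp: sq_integrable_def)
  have [measurable]: "(\<lambda>z. snd (G z)) \<in> borel_measurable borel"
    using measurable_compose[OF borel_pair2 measurable_snd, of G] G
    by (simp add: borel_prod sq_integrable_def)
  have F: "(\<lambda>z. ennreal (indicator half_space z * y_weight \<alpha> z) * ennreal ((snd (G z))\<^sup>2)) \<in> borel_measurable borel"
    by measurable
  have "(\<integral>\<^sup>+x. vertical_energy \<alpha> G x \<partial>lborel) =
     (\<integral>\<^sup>+z. ennreal (indicator half_space z * y_weight \<alpha> z) * ennreal ((snd (G z))\<^sup>2) \<partial>lborel)"
    unfolding vertical_energy_def nn_integral_fst_lborel[OF F]
    by (intro nn_integral_cong) (auto simp: indicator_def in_half_space y_weight_def simp flip: ennreal_mult)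
  also have "\<dots> \<le> (\<integral>\<^sup>+z. ennreal (indicator half_space z * y_weight \<alpha> z) * ennreal ((norm (G z))\<^sup>2) \<partial>lborel)"
  proof (intro nn_integral_mono mult_left_mono ennreal_leI)
    fix z show "(snd (G z))\<^sup>2 \<le> (norm (G z))\<^sup>2" by (cases "G z") (simp add: norm_prod_def)
  qed simp
  also have "\<dots> = (\<integral>\<^sup>+z. ennreal ((norm (G z))\<^sup>2) \<partial>hs_measure \<alpha>)" by (rule nn_integral_hs[symmetric]) simp
  finally show ?thesis by (simp add: nn_integral_l2[OF G])
qed

lemma vertical_integrable:
  fixes G :: "'a::euclidean_space \<times> real => 'a \<times> real"
  assumes G: "G \<in> borel_measurable borel" and \<alpha>: "-1 < \<alpha>" "\<alpha> < 1" and fin: "vertical_energy \<alpha> G x < \<infinity>" and y: "0 \<le> y"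
  shows "integrable lborel (\<lambda>r. indicator {0<..<y} r * snd (G (x, r)))"
    and "ennreal ((vertical_primitive G (x, y))\<^sup>2) \<le> ennreal (y powr (1 - \<alpha>) / (1 - \<alpha>)) * vertical_energy \<alpha> G x"
proof -
  note [measurable] = borel_pair2[OF G]
  have [measurable]: "(\<lambda>r. snd (G (x, r))) \<in> borel_measurable borel" by measurable
  note CS = weighted_Cauchy_Schwarz_interval[of "\<lambda>r. snd (G (x, r))" \<alpha> y, folded vertical_energy_def]
  have CS': "(\<integral>\<^sup>+r. ennreal (\<bar>indicator {0<..<y} r * snd (G (x, r))\<bar>) \<partial>lborel)\<^sup>2 \<le> ennreal (y powr (1 - \<alpha>) / (1 - \<alpha>)) * vertical_energy \<alpha> G x"
    by (rule CS) (use \<alpha> y in auto)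
  also have "\<dots> < \<infinity>" using fin by (simp add: ennreal_mult_less_top)
  finally have "(\<integral>\<^sup>+r. ennreal (\<bar>indicator {0<..<y} r * snd (G (x, r))\<bar>) \<partial>lborel) < \<infinity>"
    by (auto simp: power2_eq_square ennreal_mult_less_top)
  then show i: "integrable lborel (\<lambda>r. indicator {0<..<y} r * snd (G (x, r)))"
    by (intro integrableI_bounded) auto
  have "ennreal \<bar>vertical_primitive G (x, y)\<bar> \<le> (\<integral>\<^sup>+r. ennreal (\<bar>indicator {0<..<y} r * snd (G (x, r))\<bar>) \<partial>lborel)"
    using integral_norm_bound[of lborel "\<lambda>r. indicator {0<..<y} r * snd (G (x, r))"] i
    by (subst nn_integral_eq_integral) (auto simp: vertical_primitive_def intro: ennreal_leI)
  then have "(ennreal \<bar>vertical_primitive G (x, y)\<bar>)\<^sup>2 \<le> (\<integral>\<^sup>+r. ennreal (\<bar>indicator {0<..<y} r * snd (G (x, r))\<bar>) \<partial>lborel)\<^sup>2"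
    by (rule power_mono) simp
  with CS' show "ennreal ((vertical_primitive G (x, y))\<^sup>2) \<le> ennreal (y powr (1 - \<alpha>) / (1 - \<alpha>)) * vertical_energy \<alpha> G x"
    by (simp add: ennreal_power)
qed

lemma AE_fst_lborel:
  assumes P: "Measurable.pred borel P" and ae: "AE x in (lborel :: 'a::euclidean_space measure). P x"
  shows "AE z in (lborel :: ('a \<times> real) measure). P (fst z)"
proof -
  have "Measurable.pred (lborel \<Otimes>\<^sub>M (lborel :: real measure)) (\<lambda>z. P (fst z))"
    by (rule measurable_compose[OF _ P]) simp
  then have "{z \<in> space (lborel \<Otimes>\<^sub>M lborel). P (fst z)} \<in> sets (lborel \<Otimes>\<^sub>M (lborel :: real measure))"
    by (rule predE)
  moreover have "AE x in lborel. AE y in (lborel :: real measure). P (fst (x, y))"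
    using ae by eventually_elim simp
  ultimately have "AE z in lborel \<Otimes>\<^sub>M (lborel :: real measure). P (fst z)"
    by (rule lborel_pair.AE_pair_measure)
  then show ?thesis by (simp only: lborel_prod)
qed

text \<open>\<open>U\<close> and the vertical primitive of \<open>\<partial>\<^sub>y U\<close> have the same increments along vertical translations.\<close>

lemma vertical_shift:
  fixes U :: "'a::euclidean_space \<times> real => real"
  assumes H: "H1 \<alpha> U G" and \<alpha>: "-1 < \<alpha>" "\<alpha> < 1" and \<tau>: "0 < \<tau>"
    and fin: "AE x in lborel. vertical_energy \<alpha> G x < \<infinity>"
  shows "AE z in lborel. z \<in> half_space \<longrightarrow>
     U (z + (0, \<tau>)) - vertical_primitive G (z + (0, \<tau>)) = U z - vertical_primitive G z"
proof -
  note G = H1_borel(2)[OF H]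
  interpret F: affine_flow half_space U G 0 "(0, \<tau>)" by (rule H1_flow[OF H]) (use \<tau> in auto)
  have meas: "Measurable.pred borel (\<lambda>x. vertical_energy \<alpha> G x < \<infinity>)" using vertical_energy_borel[OF G] by measurable
  show ?thesis using F.flow_increment AE_fst_lborel[OF meas fin]
  proof eventually_elim
    case (elim z)
    show ?case
    proof
      assume z: "z \<in> half_space"
      define x y where "x = fst z" and "y = snd z"
      have zxy: "z = (x, y)" and y: "0 < y" using z by (auto simp: x_def y_def in_half_space)
      have inc: "U (z + (0, \<tau>)) - U z = (\<integral>t. F.rate z t \<partial>lborel)"
        using elim(1) z by (simp add: F.flow_def)
      have fin: "vertical_energy \<alpha> G x < \<infinity>" using elim(2) by (simp add: x_def)
      note [measurable] = borel_pair2[OF G]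
      have "(\<integral>t. F.rate z t \<partial>lborel) = \<tau> * (\<integral>t. indicator {y..y+\<tau>} (y + \<tau> * t) * snd (G (x, y + \<tau> * t)) \<partial>lborel)"
      proof -
        have "F.rate z t = \<tau> * (indicator {y..y+\<tau>} (y + \<tau> * t) * snd (G (x, y + \<tau> * t)))" for t
          using \<tau> by (auto simp: F.rate_def F.flow_def F.speed_def zxy inner_prod_def indicator_def mult.commute zero_le_mult_iff)
        then show ?thesis by simp
      qed
      also have "\<dots> = (\<integral>r. indicator {y..y+\<tau>} r * snd (G (x, r)) \<partial>lborel)"
        using lborel_integral_real_affine[of \<tau> "\<lambda>r. indicator {y..y+\<tau>} r * snd (G (x, r))" y] \<tau> by simp
      also have "\<dots> = (\<integral>r. indicator {0<..<y+\<tau>} r * snd (G (x, r)) - indicator {0<..<y} r * snd (G (x, r)) \<partial>lborel)"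
      proof (rule integral_cong_AE)
        have "AE r in lborel. r \<noteq> y + \<tau>" by (rule AE_lborel_singleton)
        then show "AE r in lborel. indicator {y..y+\<tau>} r * snd (G (x, r)) = indicator {0<..<y+\<tau>} r * snd (G (x, r)) - indicator {0<..<y} r * snd (G (x, r))"
          by eventually_elim (use y \<tau> in \<open>auto simp: indicator_def\<close>)
      qed measurable
      also have "\<dots> = vertical_primitive G (z + (0, \<tau>)) - vertical_primitive G z"
        unfolding vertical_primitive_def zxy
        using vertical_integrable(1)[OF G \<alpha> fin, of "y + \<tau>"] vertical_integrable(1)[OF G \<alpha> fin, of y] y \<tau> by simp
      finally show "U (z + (0, \<tau>)) - vertical_primitive G (z + (0, \<tau>)) = U z - vertical_primitive G z"
        using inc by simp
    qed
  qed
qed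

text \<open>The difference of \<open>U\<close> and the vertical primitive of its derivative does not depend on \<open>y\<close>; its value is the trace.\<close>

theorem trace_representation:
  fixes U :: "'a::euclidean_space \<times> real => real"
  assumes H: "H1 \<alpha> U G" and \<alpha>: "-1 < \<alpha>" "\<alpha> < 1"
  obtains g where "g \<in> borel_measurable borel"
    "AE z in lborel. z \<in> half_space \<and> snd z < 1 \<longrightarrow>
       ennreal ((U z - g (fst z))\<^sup>2) \<le> ennreal (snd z powr (1 - \<alpha>) / (1 - \<alpha>)) * vertical_energy \<alpha> G (fst z)"
proof -
  note G = H1_borel(2)[OF H] and U = H1_borel(1)[OF H]
  have Gsq: "sq_integrable (hs_measure \<alpha>) G" using H by (simp add: H1_def)
  have [measurable]: "vertical_energy \<alpha> G \<in> borel_measurable borel" by (rule vertical_energy_borel[OF G])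
  have "(\<integral>\<^sup>+x. vertical_energy \<alpha> G x \<partial>lborel) < \<infinity>"
    using order_le_less_trans[OF nn_integral_vertical_energy[OF Gsq] ennreal_less_top] by simp
  then have "AE x in lborel. vertical_energy \<alpha> G x \<noteq> \<infinity>"
    by (intro nn_integral_noteq_infinite) auto
  then have fin: "AE x in lborel. vertical_energy \<alpha> G x < \<infinity>" by (simp add: less_top)
  define W where "W z = U z - vertical_primitive G z" for z
  have Wb: "W \<in> borel_measurable borel" unfolding W_def using U vertical_primitive_borel[OF G] by measurable
  have [measurable]: "W \<in> borel_measurable (borel \<Otimes>\<^sub>M borel)" using Wb by (rule borel_pair)
  have [measurable]: "W \<in> borel_measurable borel" by (rule Wb)
  \<comment> \<open>\<open>W\<close> will turn out to be independent of \<open>y\<close>, so its average over \<open>1 < y < 2\<close> is its value for \<open>y < 1\<close>\<close>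
  define g where "g x = (\<integral>\<eta>. indicator {1<..<2} \<eta> * W (x, \<eta>) \<partial>lborel)" for x
  have gb: "g \<in> borel_measurable borel" unfolding g_def by measurable
  have "AE \<tau> in lborel. AE z in lborel. z \<in> half_space \<and> 0 < \<tau> \<longrightarrow> W (z + (0, \<tau>)) = W z"
  proof (rule AE_I2)
    fix \<tau> :: real
    show "AE z in lborel. z \<in> half_space \<and> 0 < \<tau> \<longrightarrow> W (z + (0, \<tau>)) = W z"
    proof (cases "0 < \<tau>")
      case True
      from vertical_shift[OF H \<alpha> True fin] show ?thesis unfolding W_def by eventually_elim auto
    qed simp
  qed
  then have "AE z in lborel. AE \<tau> in lborel. z \<in> half_space \<and> 0 < \<tau> \<longrightarrow> W (z + (0, \<tau>)) = W z"
    by (subst lborel_pair.AE_commute) measurable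
  then have const: "AE z in lborel. z \<in> half_space \<and> snd z < 1 \<longrightarrow> W z = g (fst z)"
  proof eventually_elim
    case (elim z)
    show ?case
    proof
      assume z: "z \<in> half_space \<and> snd z < 1"
      define x y where "x = fst z" and "y = snd z"
      have zxy: "z = (x, y)" and y: "0 < y" "y < 1" using z by (auto simp: x_def y_def in_half_space)
      from AE_affine[OF elim, of 1 "- y"] have "AE \<eta> in lborel. 0 < \<eta> - y \<longrightarrow> W (x, \<eta>) = W (x, y)"
        using z by (simp add: zxy)
      then have "AE \<eta> in lborel. indicator {1<..<2} \<eta> * W (x, \<eta>) = indicator {1<..<2} \<eta> * W (x, y)"
        by eventually_elim (use y in \<open>auto simp: indicator_def\<close>)
      then have "g x = (\<integral>\<eta>. indicator {1<..<2} \<eta> * W (x, y) \<partial>(lborel :: real measure))"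
        unfolding g_def by (intro integral_cong_AE) measurable
      then show "W z = g (fst z)" by (simp add: zxy)
    qed
  qed
  have meas: "Measurable.pred borel (\<lambda>x. vertical_energy \<alpha> G x < \<infinity>)" by measurable
  have "AE z in lborel. z \<in> half_space \<and> snd z < 1 \<longrightarrow>
       ennreal ((U z - g (fst z))\<^sup>2) \<le> ennreal (snd z powr (1 - \<alpha>) / (1 - \<alpha>)) * vertical_energy \<alpha> G (fst z)"
    using const AE_fst_lborel[OF meas fin]
  proof eventually_elim
    case (elim z)
    show ?case
    proof
      assume z: "z \<in> half_space \<and> snd z < 1"
      then have "U z - g (fst z) = vertical_primitive G (fst z, snd z)" using elim(1) by (simp add: W_def)
      then show "ennreal ((U z - g (fst z))\<^sup>2) \<le> ennreal (snd z powr (1 - \<alpha>) / (1 - \<alpha>)) * vertical_energy \<alpha> G (fst z)"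
        using vertical_integrable(2)[OF G \<alpha> elim(2), of "snd z"] z by (simp add: in_half_space)
    qed
  qed
  with gb show ?thesis by (rule that)
qed

lemma ennreal_square_sum_le:
  "ennreal ((a + b)\<^sup>2) \<le> 2 * ennreal (a\<^sup>2) + 2 * ennreal (b\<^sup>2)"
proof -
  have "(a + b)\<^sup>2 \<le> 2 * a\<^sup>2 + 2 * b\<^sup>2" using sum_squares_bound[of a b] by (simp add: power2_sum)
  then have "ennreal ((a + b)\<^sup>2) \<le> ennreal (2 * a\<^sup>2 + 2 * b\<^sup>2)" by (rule ennreal_leI)
  also have "\<dots> = 2 * ennreal (a\<^sup>2) + 2 * ennreal (b\<^sup>2)" by (simp add: ennreal_plus ennreal_mult)
  finally show ?thesis .
qed

text \<open>On the slab \<open>1/2 < y < 1\<close> over the ball, \<open>g\<^sup>2 \<le> 2 U\<^sup>2 + 2 (U - g)\<^sup>2\<close>; the first summand of the constant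
  is the comparison of weights there, combined with Hardy's inequality, the second one stems from the trace representation.\<close>

definition trace_const :: "nat => real => real => real" where
  "trace_const d \<alpha> R = sqrt (8 * (2 + R\<^sup>2) * (hardy_const d \<alpha>)\<^sup>2 + 2 / (1 - \<alpha>))"

lemma is_trace0_of_representation:
  fixes U :: "'a::euclidean_space \<times> real => real"
  assumes H: "H1 \<alpha> U G" and \<alpha>: "-1 < \<alpha>" "\<alpha> < 1" and [measurable]: "g \<in> borel_measurable borel"
    and rep: "AE z in lborel. z \<in> half_space \<and> snd z < 1 \<longrightarrow>
       ennreal ((U z - g (fst z))\<^sup>2) \<le> ennreal (snd z powr (1 - \<alpha>) / (1 - \<alpha>)) * vertical_energy \<alpha> G (fst z)"
  shows "is_trace0 U g"
  unfolding is_trace0_def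
proof (intro conjI allI impI)
  show "g \<in> borel_measurable lborel" by simp
  fix K :: "'a set" assume "compact K"
  note [measurable] = H1_borel[OF H] vertical_energy_borel[OF H1_borel(2)[OF H], of \<alpha>]
  have Gsq: "sq_integrable (hs_measure \<alpha>) G" using H by (simp add: H1_def)
  define E where "E = (l2 (hs_measure \<alpha>) G)\<^sup>2"
  let ?F = "\<lambda>h. (\<integral>\<^sup>+z. indicator (K \<times> {0<..<h}) z * ennreal ((U z - g (fst z))\<^sup>2) \<partial>lborel) / ennreal h"
  have bound: "?F h \<le> ennreal (h powr (1 - \<alpha>) / (1 - \<alpha>) * E)" if h: "0 < h" "h < 1" for h
  proof -
    let ?c = "ennreal (h powr (1 - \<alpha>) / (1 - \<alpha>))"
    have [measurable]: "(\<lambda>z. vertical_energy \<alpha> G (fst z)) \<in> borel_measurable (borel :: ('a \<times> real) measure)"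
      unfolding borel_prod[symmetric] by measurable
    have ind: "(\<lambda>z. indicator {0<..<h} (snd z) :: ennreal) \<in> borel_measurable (borel :: ('a \<times> real) measure)"
      unfolding borel_prod[symmetric] by measurable
    have "(\<integral>\<^sup>+z. indicator (K \<times> {0<..<h}) z * ennreal ((U z - g (fst z))\<^sup>2) \<partial>lborel) \<le>
        (\<integral>\<^sup>+z. indicator {0<..<h} (snd z) * (?c * vertical_energy \<alpha> G (fst z)) \<partial>lborel)"
    proof (rule nn_integral_mono_AE)
      show "AE z in lborel. indicator (K \<times> {0<..<h}) z * ennreal ((U z - g (fst z))\<^sup>2) \<le>
          indicator {0<..<h} (snd z) * (?c * vertical_energy \<alpha> G (fst z))"
        using rep
      proof eventually_elim
        case (elim z)
        show ?case
        proof (cases "z \<in> K \<times> {0<..<h}")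
          case True
          then have y: "0 < snd z" "snd z < h" by auto
          then have "ennreal ((U z - g (fst z))\<^sup>2) \<le> ennreal (snd z powr (1 - \<alpha>) / (1 - \<alpha>)) * vertical_energy \<alpha> G (fst z)"
            using elim h by (auto simp: in_half_space)
          also have "\<dots> \<le> ?c * vertical_energy \<alpha> G (fst z)"
            using y \<alpha> by (intro mult_right_mono ennreal_leI divide_right_mono powr_mono2) auto
          finally show ?thesis using True y by simp
        qed simp
      qed
    qed
    also have "\<dots> = (\<integral>\<^sup>+x. \<integral>\<^sup>+y. indicator {0<..<h} y * (?c * vertical_energy \<alpha> G x) \<partial>lborel \<partial>lborel)"
      by (subst nn_integral_fst_lborel) (use ind in auto)
    also have "\<dots> = ennreal h * (?c * (\<integral>\<^sup>+x. vertical_energy \<alpha> G x \<partial>lborel))"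
      using h by (simp add: nn_integral_multc nn_integral_cmult)
    also have "\<dots> \<le> ennreal h * (?c * ennreal E)"
      unfolding E_def by (intro mult_left_mono nn_integral_vertical_energy[OF Gsq]) auto
    also have "?c * ennreal E = ennreal (h powr (1 - \<alpha>) / (1 - \<alpha>) * E)"
      using \<alpha> by (intro ennreal_mult[symmetric]) (auto simp: E_def)
    finally show ?thesis using h by (intro divide_le_posI_ennreal) (auto simp: mult.commute)
  qed
  have "((\<lambda>h. h powr (1 - \<alpha>)) \<longlongrightarrow> 0) (at_right 0)"
    by (rule tendsto_zero_powrI[OF tendsto_ident_at tendsto_const]) (use \<alpha> in \<open>auto simp: eventually_at_filter\<close>)
  then have "((\<lambda>h. ennreal (h powr (1 - \<alpha>) / (1 - \<alpha>) * E)) \<longlongrightarrow> ennreal (0 / (1 - \<alpha>) * E)) (at_right 0)"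
    by (intro tendsto_ennrealI tendsto_intros) (use \<alpha> in auto)
  then have lim: "((\<lambda>h. ennreal (h powr (1 - \<alpha>) / (1 - \<alpha>) * E)) \<longlongrightarrow> 0) (at_right 0)" by simp
  show "(?F \<longlongrightarrow> 0) (at_right 0)"
  proof (rule tendsto_sandwich[OF _ _ tendsto_const lim])
    have "\<forall>\<^sub>F h in at_right (0::real). h \<in> {0<..<1}" by (rule eventually_at_right_real) simp
    then show "\<forall>\<^sub>F h in at_right 0. ?F h \<le> ennreal (h powr (1 - \<alpha>) / (1 - \<alpha>) * E)"
      by eventually_elim (rule bound, auto)
  qed simp
qed

text \<open>Averaging over the slab \<open>1/2 < y < 1\<close> gives up nothing, since all weights are comparable to constants there.\<close>

lemma trace_bound_of_representation:
  fixes U :: "'a::euclidean_space \<times> real => real"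
  assumes H: "H1 \<alpha> U G" and \<alpha>: "-1 < \<alpha>" "\<alpha> < 1" "1 < real DIM('a) + \<alpha>" and [measurable]: "g \<in> borel_measurable borel"
    and rep: "AE z in lborel. z \<in> half_space \<and> snd z < 1 \<longrightarrow>
       ennreal ((U z - g (fst z))\<^sup>2) \<le> ennreal (snd z powr (1 - \<alpha>) / (1 - \<alpha>)) * vertical_energy \<alpha> G (fst z)"
  shows "(\<integral>\<^sup>+x. indicator (cball 0 R) x * ennreal ((g x)\<^sup>2) \<partial>lborel) \<le> ennreal ((trace_const DIM('a) \<alpha> R * l2 (hs_measure \<alpha>) G)\<^sup>2)"
proof -
  note [measurable] = H1_borel[OF H] vertical_energy_borel[OF H1_borel(2)[OF H], of \<alpha>]
  have Gsq: "sq_integrable (hs_measure \<alpha>) G" and Usq: "sq_integrable (rho_measure \<alpha>) U" using H by (simp_all add: H1_def)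
  have VE [measurable]: "(\<lambda>z. vertical_energy \<alpha> G (fst z)) \<in> borel_measurable (borel :: ('a \<times> real) measure)"
    unfolding borel_prod[symmetric] by measurable
  have gf [measurable]: "(\<lambda>z. g (fst z)) \<in> borel_measurable (borel :: ('a \<times> real) measure)"
    unfolding borel_prod[symmetric] by measurable
  have [measurable]: "(\<lambda>z. indicator {1/2<..<1} (snd z) :: ennreal) \<in> borel_measurable (borel :: ('a \<times> real) measure)"
    unfolding borel_prod[symmetric] by (rule measurable_compose[OF measurable_snd]) simp
  have cb [measurable]: "cball (0::'a) R \<in> sets borel" by (simp add: borel_closed)
  have ball: "(\<lambda>z. indicator (cball 0 R) (fst z) :: ennreal) \<in> borel_measurable (borel :: ('a \<times> real) measure)"
    unfolding borel_prod[symmetric] by (rule measurable_compose[OF measurable_fst]) (intro borel_measurable_indicator, simp add: borel_closed)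
  have [measurable]: "(\<lambda>z. indicator (cball 0 R) (fst z) * indicator {1/2<..<1} (snd z) :: ennreal) \<in> borel_measurable (borel :: ('a \<times> real) measure)"
    using ball by (rule borel_measurable_times_ennreal) measurable
  let ?I = "\<lambda>z::'a \<times> real. indicator (cball 0 R) (fst z) * indicator {1/2<..<1} (snd z) :: ennreal"
  let ?w = "\<lambda>z. ennreal (indicator half_space z * y_weight \<alpha> z) * (ennreal (1 / (rho z)\<^sup>2) * ennreal ((norm (U z))\<^sup>2))"
  let ?c = "4 * (2 + R\<^sup>2)"
  have weight: "2 * ennreal ((U z)\<^sup>2) \<le> ennreal ?c * ?w z"
    if z: "norm (fst z) \<le> R" "1/2 < snd z" "snd z < 1" for z
  proof -
    have "1 / 2 \<le> snd z powr \<alpha>"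
    proof (cases "0 \<le> \<alpha>")
      case True
      have "(1/2) = (1/2 :: real) powr 1" by simp
      also have "\<dots> \<le> (1/2) powr \<alpha>" using \<alpha> by (intro powr_mono') auto
      also have "\<dots> \<le> snd z powr \<alpha>" using z True by (intro powr_mono2) auto
      finally show ?thesis .
    next
      case False
      have "1 = snd z powr 0" using z by simp
      also have "\<dots> \<le> snd z powr \<alpha>" using z False by (intro powr_mono') auto
      finally show ?thesis by simp
    qed
    moreover have "(rho z)\<^sup>2 \<le> 2 + R\<^sup>2"
    proof -
      have "(norm (fst z))\<^sup>2 \<le> R\<^sup>2" using z by (intro power_mono) auto
      moreover have "(snd z)\<^sup>2 \<le> 1" using z by (simp add: power_le_one)
      ultimately show ?thesis by (simp add: rho_power2 norm_prod_def)
    qed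
    then have "1 / (2 + R\<^sup>2) \<le> 1 / (rho z)\<^sup>2" using rho_pos[of z] by (intro divide_left_mono) (auto intro!: mult_pos_pos add_pos_nonneg)
    ultimately have "(1/2) * (1 / (2 + R\<^sup>2)) \<le> snd z powr \<alpha> * (1 / (rho z)\<^sup>2)" by (intro mult_mono) auto
    then have "?c * ((1/2) * (1 / (2 + R\<^sup>2))) \<le> ?c * (snd z powr \<alpha> * (1 / (rho z)\<^sup>2))" by (intro mult_left_mono) auto
    moreover have "?c * ((1/2) * (1 / (2 + R\<^sup>2))) = 2"
    proof -
      have "2 + R\<^sup>2 \<noteq> 0" by (smt (verit) zero_le_power2)
      then show ?thesis by (simp add: field_simps)
    qed
    ultimately have "2 * (U z)\<^sup>2 \<le> ?c * (snd z powr \<alpha> * (1 / (rho z)\<^sup>2)) * (U z)\<^sup>2" by (intro mult_right_mono) auto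
    then have "ennreal (2 * (U z)\<^sup>2) \<le> ennreal (?c * (snd z powr \<alpha> * ((1 / (rho z)\<^sup>2) * (U z)\<^sup>2)))"
      by (intro ennreal_leI) (simp only: mult.assoc)
    also have "\<dots> = ennreal ?c * (ennreal (snd z powr \<alpha>) * (ennreal (1 / (rho z)\<^sup>2) * ennreal ((U z)\<^sup>2)))"
      by (subst ennreal_mult, simp, simp, subst ennreal_mult, simp, simp, subst ennreal_mult, simp, simp, rule refl)
    finally show ?thesis using z by (simp add: ennreal_mult in_half_space y_weight_def)
  qed
  have "(\<integral>\<^sup>+x. indicator (cball 0 R) x * ennreal ((g x)\<^sup>2) \<partial>lborel) * ennreal (1/2) =
      (\<integral>\<^sup>+x. \<integral>\<^sup>+y. indicator (cball 0 R) x * ennreal ((g x)\<^sup>2) * indicator {1/2<..<1::real} y \<partial>lborel \<partial>lborel)"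
    by (simp add: nn_integral_cmult nn_integral_multc)
  also have "\<dots> = (\<integral>\<^sup>+z. ?I z * ennreal ((g (fst z))\<^sup>2) \<partial>lborel)"
  proof -
    have F: "(\<lambda>z. ?I z * ennreal ((g (fst z))\<^sup>2)) \<in> borel_measurable borel" by measurable
    show ?thesis unfolding nn_integral_fst_lborel[OF F] by (intro nn_integral_cong) (simp add: mult_ac)
  qed
  also have "\<dots> \<le> (\<integral>\<^sup>+z. ennreal ?c * ?w z
       + indicator {1/2<..<1} (snd z) * (ennreal (2 / (1 - \<alpha>)) * vertical_energy \<alpha> G (fst z)) \<partial>lborel)"
  proof (rule nn_integral_mono_AE)
    show "AE z in lborel. ?I z * ennreal ((g (fst z))\<^sup>2) \<le> ennreal ?c * ?w z
       + indicator {1/2<..<1} (snd z) * (ennreal (2 / (1 - \<alpha>)) * vertical_energy \<alpha> G (fst z))"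
      using rep
    proof eventually_elim
      case (elim z)
      show ?case
      proof (cases "norm (fst z) \<le> R \<and> snd z \<in> {1/2<..<1}")
        case True
        then have y: "1/2 < snd z" "snd z < 1" by auto
        have "ennreal ((g (fst z))\<^sup>2) = ennreal ((U z + (g (fst z) - U z))\<^sup>2)" by simp
        also have "\<dots> \<le> 2 * ennreal ((U z)\<^sup>2) + 2 * ennreal ((g (fst z) - U z)\<^sup>2)" by (rule ennreal_square_sum_le)
        also have "ennreal ((g (fst z) - U z)\<^sup>2) = ennreal ((U z - g (fst z))\<^sup>2)" by (simp add: power2_commute)
        also have "2 * ennreal ((U z)\<^sup>2) + 2 * ennreal ((U z - g (fst z))\<^sup>2) \<le>
          ennreal ?c * ?w z +
          ennreal (2 / (1 - \<alpha>)) * vertical_energy \<alpha> G (fst z)"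
        proof (rule add_mono)
          show "2 * ennreal ((U z)\<^sup>2) \<le> ennreal ?c * ?w z"
            by (rule weight) (use True y in auto)
          have "ennreal ((U z - g (fst z))\<^sup>2) \<le> ennreal (snd z powr (1 - \<alpha>) / (1 - \<alpha>)) * vertical_energy \<alpha> G (fst z)"
            using elim y by (auto simp: in_half_space)
          also have "\<dots> \<le> ennreal (1 / (1 - \<alpha>)) * vertical_energy \<alpha> G (fst z)"
          proof (intro mult_right_mono ennreal_leI divide_right_mono)
            have "snd z powr (1 - \<alpha>) \<le> 1 powr (1 - \<alpha>)" using y \<alpha> by (intro powr_mono2) auto
            then show "snd z powr (1 - \<alpha>) \<le> 1" by simp
          qed (use \<alpha> in auto)
          finally have "2 * ennreal ((U z - g (fst z))\<^sup>2) \<le> 2 * (ennreal (1 / (1 - \<alpha>)) * vertical_energy \<alpha> G (fst z))"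
            by (rule mult_left_mono) simp
          also have "2 * (ennreal (1 / (1 - \<alpha>)) * vertical_energy \<alpha> G (fst z)) = ennreal (2 * (1 / (1 - \<alpha>))) * vertical_energy \<alpha> G (fst z)"
            using \<alpha> by (subst ennreal_mult) (auto simp: mult.assoc)
          finally show "2 * ennreal ((U z - g (fst z))\<^sup>2) \<le> ennreal (2 / (1 - \<alpha>)) * vertical_energy \<alpha> G (fst z)" by simp
        qed
        finally show ?thesis using True by simp
      qed (auto simp: indicator_def)
    qed
  qed
  also have "\<dots> = ennreal ?c * (\<integral>\<^sup>+z. ?w z \<partial>lborel) +
      (\<integral>\<^sup>+z. indicator {1/2<..<1} (snd z) * (ennreal (2 / (1 - \<alpha>)) * vertical_energy \<alpha> G (fst z)) \<partial>(lborel :: ('a \<times> real) measure))"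
    by (subst nn_integral_add) (auto simp: nn_integral_cmult)
  also have "(\<integral>\<^sup>+z. ?w z \<partial>lborel) = ennreal ((l2 (rho_measure \<alpha>) U)\<^sup>2)"
    using nn_integral_rho[of "\<lambda>z. ennreal ((norm (U z))\<^sup>2)" \<alpha>] nn_integral_hs[of "\<lambda>z. ennreal (1 / (rho z)\<^sup>2) * ennreal ((norm (U z))\<^sup>2)" \<alpha>]
      nn_integral_l2[OF Usq] by simp
  also have "(\<integral>\<^sup>+z. indicator {1/2<..<1} (snd z) * (ennreal (2 / (1 - \<alpha>)) * vertical_energy \<alpha> G (fst z)) \<partial>(lborel :: ('a \<times> real) measure)) =
      (\<integral>\<^sup>+x. \<integral>\<^sup>+y. indicator {1/2<..<1::real} y * (ennreal (2 / (1 - \<alpha>)) * vertical_energy \<alpha> G x) \<partial>lborel \<partial>lborel)"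
    by (subst nn_integral_fst_lborel) auto
  also have "\<dots> = ennreal (1/2) * (ennreal (2 / (1 - \<alpha>)) * (\<integral>\<^sup>+x. vertical_energy \<alpha> G x \<partial>lborel))"
    by (simp add: nn_integral_multc nn_integral_cmult)
  also have "ennreal ?c * ennreal ((l2 (rho_measure \<alpha>) U)\<^sup>2) + \<dots> \<le>
      ennreal ?c * ennreal ((hardy_const DIM('a) \<alpha> * l2 (hs_measure \<alpha>) G)\<^sup>2) + ennreal (1/2) * (ennreal (2 / (1 - \<alpha>)) * ennreal ((l2 (hs_measure \<alpha>) G)\<^sup>2))"
    by (intro add_mono mult_left_mono ennreal_leI power_mono hardy_inequality[OF H \<alpha>(1,3)] nn_integral_vertical_energy[OF Gsq]) auto
  also have "\<dots> = ennreal ((trace_const DIM('a) \<alpha> R * l2 (hs_measure \<alpha>) G)\<^sup>2 * (1/2))"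
  proof -
    have "(trace_const DIM('a) \<alpha> R * l2 (hs_measure \<alpha>) G)\<^sup>2 * (1/2) =
      ?c * (hardy_const DIM('a) \<alpha> * l2 (hs_measure \<alpha>) G)\<^sup>2 + 1/2 * (2 / (1 - \<alpha>) * (l2 (hs_measure \<alpha>) G)\<^sup>2)"
      using \<alpha> by (simp add: trace_const_def power_mult_distrib algebra_simps)
    moreover have "ennreal c * ennreal A + ennreal h * (ennreal k * ennreal B) = ennreal (c * A + h * (k * B))"
      if "0 \<le> c" "0 \<le> A" "0 \<le> h" "0 \<le> k" "0 \<le> B" for c A h k B
      using that by (simp add: ennreal_plus ennreal_mult)
    moreover have "0 \<le> 2 / (1 - \<alpha>)" using \<alpha> by simp
    moreover have "0 \<le> ?c" by simp
    ultimately show ?thesis by (simp only: zero_le_power2 zero_le_divide_1_iff zero_le_numeral)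
  qed
  finally have "(\<integral>\<^sup>+x. indicator (cball 0 R) x * ennreal ((g x)\<^sup>2) \<partial>lborel) * ennreal (1/2) * 2 \<le>
     ennreal ((trace_const DIM('a) \<alpha> R * l2 (hs_measure \<alpha>) G)\<^sup>2 * (1/2)) * 2" by (rule mult_right_mono) simp
  moreover have "ennreal (1/2) * 2 = 1" using ennreal_mult[of "1/2" 2] by simp
  moreover have "ennreal (x * (1/2)) * 2 = ennreal x" if "0 \<le> x" for x using ennreal_mult[of "x * (1/2)" 2] that by simp
  ultimately show ?thesis by (simp add: mult.assoc)
qed

lemma trace_unique:
  fixes U :: "'a::euclidean_space \<times> real => real"
  assumes [measurable]: "U \<in> borel_measurable borel" and g1: "is_trace0 U g1" and g2: "is_trace0 U g2"
  shows "AE x in lborel. g1 x = g2 x"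
proof -
  have [measurable]: "g1 \<in> borel_measurable borel" "g2 \<in> borel_measurable borel" using g1 g2 by (auto simp: is_trace0_def)
  have [measurable]: "(\<lambda>z. g1 (fst z)) \<in> borel_measurable (borel :: ('a \<times> real) measure)" "(\<lambda>z. g2 (fst z)) \<in> borel_measurable (borel :: ('a \<times> real) measure)"
    unfolding borel_prod[symmetric] by measurable
  have "AE x in lborel. x \<in> cball 0 (real n) \<longrightarrow> g1 x = g2 x" for n
  proof -
    define K where "K = cball (0::'a) (real n)"
    have K: "compact K" by (simp add: K_def)
    have [measurable]: "K \<in> sets borel" by (simp add: K_def)
    define I where "I = (\<integral>\<^sup>+x. indicator K x * ennreal ((g1 x - g2 x)\<^sup>2) \<partial>lborel)"
    let ?F = "\<lambda>g h. (\<integral>\<^sup>+z. indicator (K \<times> {0<..<h}) z * ennreal ((U z - g (fst z))\<^sup>2) \<partial>lborel) / ennreal h"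
    have bound: "I \<le> 2 * ?F g1 h + 2 * ?F g2 h" if h: "0 < h" for h
    proof -
      have [measurable]: "K \<times> {0<..<h} \<in> sets (borel :: ('a \<times> real) measure)"
        unfolding borel_prod[symmetric] by measurable
      have "I * ennreal h = (\<integral>\<^sup>+x. \<integral>\<^sup>+y. indicator K x * ennreal ((g1 x - g2 x)\<^sup>2) * indicator {0<..<h} y \<partial>lborel \<partial>lborel)"
        using h by (simp add: I_def nn_integral_cmult nn_integral_multc)
      also have "\<dots> = (\<integral>\<^sup>+z. indicator (K \<times> {0<..<h}) z * ennreal ((g1 (fst z) - g2 (fst z))\<^sup>2) \<partial>lborel)"
        by (subst nn_integral_fst_lborel) (auto intro!: nn_integral_cong simp: indicator_def)
      also have "\<dots> \<le> (\<integral>\<^sup>+z. 2 * (indicator (K \<times> {0<..<h}) z * ennreal ((U z - g1 (fst z))\<^sup>2)) + 2 * (indicator (K \<times> {0<..<h}) z * ennreal ((U z - g2 (fst z))\<^sup>2)) \<partial>lborel)"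
      proof (rule nn_integral_mono)
        fix z :: "'a \<times> real"
        have "ennreal ((g1 (fst z) - g2 (fst z))\<^sup>2) \<le> 2 * ennreal ((U z - g1 (fst z))\<^sup>2) + 2 * ennreal ((U z - g2 (fst z))\<^sup>2)"
          using ennreal_square_sum_le[of "g1 (fst z) - U z" "U z - g2 (fst z)"] by (simp add: power2_commute[of "g1 _"])
        then show "indicator (K \<times> {0<..<h}) z * ennreal ((g1 (fst z) - g2 (fst z))\<^sup>2) \<le> 2 * (indicator (K \<times> {0<..<h}) z * ennreal ((U z - g1 (fst z))\<^sup>2)) + 2 * (indicator (K \<times> {0<..<h}) z * ennreal ((U z - g2 (fst z))\<^sup>2))"
          by (cases "z \<in> K \<times> {0<..<h}") auto
      qed
      also have "\<dots> = 2 * (\<integral>\<^sup>+z. indicator (K \<times> {0<..<h}) z * ennreal ((U z - g1 (fst z))\<^sup>2) \<partial>lborel) + 2 * (\<integral>\<^sup>+z. indicator (K \<times> {0<..<h}) z * ennreal ((U z - g2 (fst z))\<^sup>2) \<partial>lborel)"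
        by (subst nn_integral_add) (auto simp: nn_integral_cmult)
      finally have "I * ennreal h / ennreal h \<le> (2 * (\<integral>\<^sup>+z. indicator (K \<times> {0<..<h}) z * ennreal ((U z - g1 (fst z))\<^sup>2) \<partial>lborel) + 2 * (\<integral>\<^sup>+z. indicator (K \<times> {0<..<h}) z * ennreal ((U z - g2 (fst z))\<^sup>2) \<partial>lborel)) / ennreal h"
        by (rule divide_right_mono_ennreal)
      then show ?thesis using h by (simp add: mult_divide_eq_ennreal add_divide_distrib_ennreal ennreal_times_divide)
    qed
    have "((\<lambda>h. 2 * ?F g1 h + 2 * ?F g2 h) \<longlongrightarrow> 2 * 0 + 2 * 0) (at_right 0)"
      using g1 g2 K unfolding is_trace0_def by (intro tendsto_add ennreal_tendsto_cmult) auto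
    then have lim: "((\<lambda>h. 2 * ?F g1 h + 2 * ?F g2 h) \<longlongrightarrow> 0) (at_right 0)" by simp
    have "I \<le> 0"
    proof (rule tendsto_lowerbound[OF lim])
      show "\<forall>\<^sub>F h in at_right 0. I \<le> 2 * ?F g1 h + 2 * ?F g2 h"
        using bound by (auto simp: eventually_at_filter)
    qed simp
    then have "I = 0" by simp
    then have "AE x in lborel. indicator K x * ennreal ((g1 x - g2 x)\<^sup>2) = 0"
      unfolding I_def by (subst (asm) nn_integral_0_iff_AE) auto
    then show ?thesis by eventually_elim (auto simp: K_def indicator_def split: if_splits)
  qed
  then have "AE x in lborel. \<forall>n. x \<in> cball 0 (real n) \<longrightarrow> g1 x = g2 x" unfolding AE_all_countable by blast
  then show ?thesis
  proof eventually_elim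
    case (elim x)
    obtain n where "norm x \<le> real n" using real_arch_simple by blast
    then show ?case using elim by auto
  qed
qed

theorem trace_bound:
  fixes U :: "'a::euclidean_space \<times> real => real"
  assumes H: "H1 \<alpha> U G" and \<alpha>: "-1 < \<alpha>" "\<alpha> < 1" "1 < real DIM('a) + \<alpha>" and tr: "is_trace0 U g"
  shows "(\<integral>\<^sup>+x. indicator (cball 0 R) x * ennreal ((g x)\<^sup>2) \<partial>lborel) \<le> ennreal ((trace_const DIM('a) \<alpha> R * l2 (hs_measure \<alpha>) G)\<^sup>2)"
proof -
  obtain g' where g': "g' \<in> borel_measurable borel" "AE z in lborel. z \<in> half_space \<and> snd z < 1 \<longrightarrow>
       ennreal ((U z - g' (fst z))\<^sup>2) \<le> ennreal (snd z powr (1 - \<alpha>) / (1 - \<alpha>)) * vertical_energy \<alpha> G (fst z)"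
    using trace_representation[OF H \<alpha>(1,2)] by blast
  have "AE x in lborel. g x = g' x"
    by (rule trace_unique[OF H1_borel(1)[OF H] tr is_trace0_of_representation[OF H \<alpha>(1,2) g']])
  then have "(\<integral>\<^sup>+x. indicator (cball 0 R) x * ennreal ((g x)\<^sup>2) \<partial>lborel) = (\<integral>\<^sup>+x. indicator (cball 0 R) x * ennreal ((g' x)\<^sup>2) \<partial>lborel)"
    by (intro nn_integral_cong_AE) (auto elim: eventually_mono)
  then show ?thesis using trace_bound_of_representation[OF H \<alpha> g'] by simp
qed

theorem trace_exists:
  fixes U :: "'a::euclidean_space \<times> real => real"
  assumes H: "H1 \<alpha> U G" and \<alpha>: "-1 < \<alpha>" "\<alpha> < 1"
  obtains g where "is_trace0 U g"
proof -
  obtain g where g: "g \<in> borel_measurable borel" "AE z in lborel. z \<in> half_space \<and> snd z < 1 \<longrightarrow>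
       ennreal ((U z - g (fst z))\<^sup>2) \<le> ennreal (snd z powr (1 - \<alpha>) / (1 - \<alpha>)) * vertical_energy \<alpha> G (fst z)"
    using trace_representation[OF H \<alpha>] by blast
  show ?thesis by (rule that[OF is_trace0_of_representation[OF H \<alpha> g]])
qed

section \<open>The energy space\<close>

text \<open>Triples of functions should form a real vector space, as the abstract locale requires.\<close>

instantiation "fun" :: (type, scaleR) scaleR
begin
definition scaleR_fun where "scaleR_fun r f = (\<lambda>x. r *\<^sub>R f x)"
instance ..
end

instance "fun" :: (type, real_vector) real_vector
  by standard (auto simp: fun_eq_iff scaleR_fun_def plus_fun_def scaleR_add_right scaleR_add_left)

lemma sq_integrable_inner:
  assumes F: "sq_integrable M (F :: 'a => 'b::euclidean_space)" and b: "norm b \<le> 1"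
  shows "sq_integrable M (\<lambda>x. F x \<bullet> b)" "l2 M (\<lambda>x. F x \<bullet> b) \<le> l2 M F"
proof -
  have [measurable]: "F \<in> borel_measurable M" using F by (simp add: sq_integrable_def)
  have "(\<integral>\<^sup>+x. ennreal ((norm (F x \<bullet> b))\<^sup>2) \<partial>M) \<le> (\<integral>\<^sup>+x. ennreal ((norm (F x))\<^sup>2) \<partial>M)"
  proof (intro nn_integral_mono ennreal_leI power_mono)
    fix x
    have "norm (F x \<bullet> b) \<le> norm (F x) * norm b" by (simp add: Cauchy_Schwarz_ineq2)
    also have "\<dots> \<le> norm (F x) * 1" using b by (intro mult_left_mono) auto
    finally show "norm (F x \<bullet> b) \<le> norm (F x)" by simp
  qed simp
  then have le: "(\<integral>\<^sup>+x. ennreal ((norm (F x \<bullet> b))\<^sup>2) \<partial>M) \<le> ennreal ((l2 M F)\<^sup>2)" by (simp add: nn_integral_l2[OF F])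
  from sq_integrableI_nn[OF _ this]
  show "sq_integrable M (\<lambda>x. F x \<bullet> b)" "l2 M (\<lambda>x. F x \<bullet> b) \<le> l2 M F" by auto
qed

text \<open>On a compact subset of the open half space a positive continuous weight is bounded from
  above and below. Hence testing with a bounded function that lives there is a bounded
  functional on the weighted space.\<close>

definition local_control :: "('a::euclidean_space \<times> real) measure => bool" where
  "local_control M \<longleftrightarrow> (\<forall>K \<psi> C. compact K \<and> K \<subseteq> half_space \<and> \<psi> \<in> borel_measurable borel \<and> (\<forall>z. \<bar>\<psi> z\<bar> \<le> C) \<and> (\<forall>z. z \<notin> K \<longrightarrow> \<psi> z = 0) \<longrightarrow>
     (\<exists>c. \<forall>F. sq_integrable M F \<longrightarrow> integrable lborel (\<lambda>z. F z * \<psi> z) \<and> \<bar>\<integral>z. F z * \<psi> z \<partial>lborel\<bar> \<le> c * l2 M F))"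

lemma local_control_weight:
  fixes W :: "'a::euclidean_space \<times> real => real"
  defines "M \<equiv> density lborel (\<lambda>z. ennreal (indicator half_space z * W z))"
  assumes W [measurable]: "W \<in> borel_measurable borel" and cont: "continuous_on half_space W"
    and pos: "\<And>z. z \<in> half_space ==> 0 < W z"
  shows "local_control M"
  unfolding local_control_def
proof (intro allI impI)
  fix K :: "('a \<times> real) set" and \<psi> :: "'a \<times> real => real" and C
  assume "compact K \<and> K \<subseteq> half_space \<and> \<psi> \<in> borel_measurable borel \<and> (\<forall>z. \<bar>\<psi> z\<bar> \<le> C) \<and> (\<forall>z. z \<notin> K \<longrightarrow> \<psi> z = 0)"
  then have K: "compact K" "K \<subseteq> half_space" and \<psi> [measurable]: "\<psi> \<in> borel_measurable borel"
    and bdd: "\<And>z. \<bar>\<psi> z\<bar> \<le> C" and off: "\<And>z. z \<notin> K ==> \<psi> z = 0" by auto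
  have [measurable]: "K \<in> sets borel" using K by (simp add: compact_imp_closed borel_closed)
  define q where "q z = indicator K z * (\<psi> z / W z)" for z
  have qb [measurable]: "q \<in> borel_measurable borel" unfolding q_def by measurable
  have "\<exists>c0>0. \<forall>z\<in>K. c0 \<le> W z"
  proof (cases "K = {}")
    case False
    obtain z0 where "z0 \<in> K" "\<And>z. z \<in> K ==> W z0 \<le> W z"
      using continuous_attains_inf[OF K(1) False continuous_on_subset[OF cont K(2)]] by blast
    then show ?thesis using pos K(2) by blast
  qed (auto intro: exI[of _ 1])
  then obtain c0 where c0: "0 < c0" "\<And>z. z \<in> K ==> c0 \<le> W z" by blast
  have "(\<integral>\<^sup>+z. ennreal ((norm (q z))\<^sup>2) \<partial>M) = (\<integral>\<^sup>+z. ennreal (indicator half_space z * W z) * ennreal ((norm (q z))\<^sup>2) \<partial>lborel)"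
    unfolding M_def by (rule nn_integral_density) auto
  also have "\<dots> \<le> (\<integral>\<^sup>+z. ennreal (C\<^sup>2 / c0) * indicator K z \<partial>lborel)"
  proof (rule nn_integral_mono)
    fix z :: "'a \<times> real"
    show "ennreal (indicator half_space z * W z) * ennreal ((norm (q z))\<^sup>2) \<le> ennreal (C\<^sup>2 / c0) * indicator K z"
    proof (cases "z \<in> K")
      case True
      have Wz: "0 < W z" "c0 \<le> W z" "z \<in> half_space"
        using c0(2)[OF True] less_le_trans[OF c0(1) c0(2)[OF True]] subsetD[OF K(2) True] by blast+
      have "W z * (norm (q z))\<^sup>2 = (\<psi> z)\<^sup>2 / W z" using Wz True by (simp add: q_def power_divide power2_eq_square)
      also have "\<dots> \<le> C\<^sup>2 / c0"
        using Wz c0 power_mono[OF bdd[of z], of 2] by (intro frac_le) auto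
      finally show ?thesis using True Wz by (simp add: ennreal_leI flip: ennreal_mult)
    qed (simp add: q_def)
  qed
  also have "\<dots> = ennreal (C\<^sup>2 / c0) * emeasure lborel K" by (simp add: nn_integral_cmult)
  also have "\<dots> < \<infinity>" using emeasure_compact_finite[OF K(1)] by (simp add: ennreal_mult_less_top)
  finally have fin: "(\<integral>\<^sup>+z. ennreal ((norm (q z))\<^sup>2) \<partial>M) < \<infinity>" .
  have setsM [measurable_cong]: "sets M = sets borel" by (simp add: M_def)
  have qsq: "sq_integrable M q"
    unfolding sq_integrable_def using fin by (auto intro!: integrableI_bounded)
  show "\<exists>c. \<forall>F. sq_integrable M F \<longrightarrow> integrable lborel (\<lambda>z. F z * \<psi> z) \<and> \<bar>\<integral>z. F z * \<psi> z \<partial>lborel\<bar> \<le> c * l2 M F"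
  proof (intro exI[of _ "l2 M q"] allI impI conjI)
    fix F :: "'a \<times> real => real" assume F: "sq_integrable M F"
    have Fb [measurable]: "F \<in> borel_measurable borel" using F setsM by (simp add: sq_integrable_def cong: measurable_cong_sets)
    have eq: "indicator half_space z * W z * (F z * q z) = F z * \<psi> z" for z
      using pos[of z] K(2) off[of z] by (auto simp: q_def indicator_def)
    have bd: "\<bar>F z * q z\<bar> \<le> 1 * (norm (F z) * norm (q z))" for z by (simp add: abs_mult)
    have meas: "(\<lambda>z. F z * q z) \<in> borel_measurable M" by measurable
    note P = integrable_product_l2[OF F qsq meas bd zero_le_one]
    have nn: "AE z in lborel. 0 \<le> indicator half_space z * W z" 
    proof (rule AE_I2)
      fix z show "0 \<le> indicator half_space z * W z" using pos[of z] by (cases "z \<in> half_space") auto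
    qed
    show "integrable lborel (\<lambda>z. F z * \<psi> z)"
      using P(1) unfolding M_def by (subst (asm) integrable_density) (use nn in \<open>auto simp: eq\<close>)
    have "(\<integral>z. F z * q z \<partial>M) = (\<integral>z. F z * \<psi> z \<partial>lborel)"
      unfolding M_def by (subst integral_density) (use nn in \<open>auto simp: eq\<close>)
    then show "\<bar>\<integral>z. F z * \<psi> z \<partial>lborel\<bar> \<le> l2 M q * l2 M F" using P(2) by (simp add: mult.commute)
  qed
qed

lemma continuous_y_weight: "continuous_on half_space (y_weight \<alpha> :: 'a::euclidean_space \<times> real => real)"
  unfolding y_weight_def by (intro continuous_intros) (auto simp: in_half_space)

lemma continuous_rho_weight:
  "continuous_on half_space (\<lambda>z::'a::euclidean_space \<times> real. y_weight \<alpha> z * (1 / (rho z)\<^sup>2))"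
proof -
  have "rho z \<noteq> 0" for z :: "'a \<times> real" using rho_pos[of z] by simp
  then show ?thesis
    unfolding rho_def by (intro continuous_intros continuous_y_weight) (auto simp: add_nonneg_eq_0_iff)
qed

lemma local_control_hs: "local_control (hs_measure \<alpha> :: ('a::euclidean_space \<times> real) measure)"
  and local_control_rho: "local_control (rho_measure \<alpha> :: ('a \<times> real) measure)"
proof -
  show "local_control (hs_measure \<alpha> :: ('a \<times> real) measure)"
    unfolding hs_measure_def by (rule local_control_weight[OF y_weight_borel continuous_y_weight]) (simp add: in_half_space y_weight_def)
  have m: "(\<lambda>z::'a \<times> real. y_weight \<alpha> z * (1 / (rho z)\<^sup>2)) \<in> borel_measurable borel" by measurable
  have pos: "0 < y_weight \<alpha> z * (1 / (rho z)\<^sup>2)" if "z \<in> half_space" for z :: "'a \<times> real"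
    using that rho_pos[of z] by (simp add: in_half_space y_weight_def)
  show "local_control (rho_measure \<alpha> :: ('a \<times> real) measure)"
    unfolding rho_measure_def by (rule local_control_weight[OF m continuous_rho_weight pos])
qed

lemma local_control_locally_integrable:
  fixes F :: "'a::euclidean_space \<times> real => real"
  assumes M: "local_control M" and F: "sq_integrable M F"
  shows "locally_integrable half_space F"
  unfolding locally_integrable_def
proof (intro allI impI)
  fix K :: "('a \<times> real) set" assume K: "compact K \<and> K \<subseteq> half_space"
  have "(indicator K :: 'a \<times> real => real) \<in> borel_measurable borel" using K by (simp add: compact_imp_closed)
  moreover have "\<bar>indicator K z\<bar> \<le> (1::real)" for z by (simp split: split_indicator)
  ultimately have "\<exists>c. \<forall>F. sq_integrable M F \<longrightarrow> integrable lborel (\<lambda>z. F z * indicator K z) \<and> \<bar>\<integral>z. F z * indicator K z \<partial>lborel\<bar> \<le> c * l2 M F"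
    using M[unfolded local_control_def, rule_format, of K "indicator K" 1] K by simp
  then have "integrable lborel (\<lambda>z. F z * indicator K z)" using F by blast
  then show "set_integrable lborel K F" by (simp add: set_integrable_def mult.commute)
qed

lemmas sq_integrable_locally = local_control_locally_integrable[OF local_control_hs] local_control_locally_integrable[OF local_control_rho]

lemma test_fun_bounded:
  assumes "test_fun D \<phi>"
  obtains K C where "compact K" "K \<subseteq> D" "\<phi> \<in> borel_measurable borel" "\<And>z. \<bar>\<phi> z\<bar> \<le> C" "\<And>z. z \<notin> K ==> \<phi> z = 0"
proof -
  obtain K where K: "compact K" "K \<subseteq> D" "\<And>x. x \<notin> K ==> \<phi> x = 0" "smooth \<phi>" using assms by (rule test_funE) (rule that)
  obtain C where C: "0 \<le> C" "\<And>x. x \<in> K ==> \<bar>\<phi> x\<bar> \<le> C" using smooth_bounded_compact[OF K(4,1)] by blast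
  then have "\<bar>\<phi> z\<bar> \<le> C" for z using K(3)[of z] by (cases "z \<in> K") auto
  then show ?thesis using that K smooth_measurable by blast
qed

lemma local_control_tendsto:
  fixes F :: "nat => 'a::euclidean_space \<times> real => real"
  assumes M: "local_control M" and \<phi>: "test_fun half_space \<phi>" and F: "\<And>n. sq_integrable M (F n)" "sq_integrable M f"
    and lim: "(\<lambda>n. l2 M (\<lambda>z. F n z - f z)) \<longlonglongrightarrow> 0"
  shows "(\<lambda>n. LINT z:half_space|lborel. F n z * \<phi> z) \<longlonglongrightarrow> (LINT z:half_space|lborel. f z * \<phi> z)"
proof -
  obtain K C where K: "compact K" "K \<subseteq> half_space" "\<phi> \<in> borel_measurable borel" "\<And>z. \<bar>\<phi> z\<bar> \<le> C" "\<And>z. z \<notin> K ==> \<phi> z = 0"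
    using test_fun_bounded[OF \<phi>] by blast
  have "\<exists>c. \<forall>F. sq_integrable M F \<longrightarrow> integrable lborel (\<lambda>z. F z * \<phi> z) \<and> \<bar>\<integral>z. F z * \<phi> z \<partial>lborel\<bar> \<le> c * l2 M F"
    by (rule M[unfolded local_control_def, rule_format, of K \<phi> C]) (use K in blast)
  then obtain c where c: "integrable lborel (\<lambda>z. F z * \<phi> z)" "\<bar>\<integral>z. F z * \<phi> z \<partial>lborel\<bar> \<le> c * l2 M F"
    if "sq_integrable M F" for F by blast
  show ?thesis unfolding set_integral_test[OF \<phi>]
  proof (rule Lim_null[THEN iffD2], rule Lim_null_comparison)
    show "\<forall>\<^sub>F n in sequentially. norm ((\<integral>z. F n z * \<phi> z \<partial>lborel) - (\<integral>z. f z * \<phi> z \<partial>lborel)) \<le> c * l2 M (\<lambda>z. F n z - f z)"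
    proof (intro always_eventually allI)
      fix n
      have "(\<integral>z. F n z * \<phi> z \<partial>lborel) - (\<integral>z. f z * \<phi> z \<partial>lborel) = (\<integral>z. (F n z - f z) * \<phi> z \<partial>lborel)"
        using c(1)[OF F(1)] c(1)[OF F(2)] by (simp add: left_diff_distrib)
      then show "norm ((\<integral>z. F n z * \<phi> z \<partial>lborel) - (\<integral>z. f z * \<phi> z \<partial>lborel)) \<le> c * l2 M (\<lambda>z. F n z - f z)"
        using c(2)[OF sq_integrable_diff[OF F(1) F(2)]] by simp
    qed
    show "(\<lambda>n. c * l2 M (\<lambda>z. F n z - f z)) \<longlonglongrightarrow> 0" using tendsto_mult[OF tendsto_const lim, of c] by simp
  qed
qed

lemmas hs_test_tendsto = local_control_tendsto[OF local_control_hs]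
lemmas rho_test_tendsto = local_control_tendsto[OF local_control_rho]

lemma has_weak_derivI1:
  assumes "locally_integrable D u" "locally_integrable D w"
    "\<And>\<phi>. test_fun D \<phi> ==> (LINT x:D|lborel. u x * pd b \<phi> x) = - (LINT x:D|lborel. w x * \<phi> x)"
  shows "has_weak_deriv D [b] u w"
  using assms by (simp add: has_weak_deriv_def)

lemma H1_limit:
  fixes U :: "nat => 'a::euclidean_space \<times> real => real"
  assumes H: "\<And>n. H1 \<alpha> (U n) (G n)" and u: "sq_integrable (rho_measure \<alpha>) u" and g: "sq_integrable (hs_measure \<alpha>) g"
    and limU: "(\<lambda>n. l2 (rho_measure \<alpha>) (\<lambda>z. U n z - u z)) \<longlonglongrightarrow> 0"
    and limG: "(\<lambda>n. l2 (hs_measure \<alpha>) (\<lambda>z. G n z - g z)) \<longlonglongrightarrow> 0"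
  shows "H1 \<alpha> u g"
  unfolding H1_def has_weak_grad_def
proof (intro conjI ballI u g)
  fix b :: "'a \<times> real" assume b: "b \<in> Basis"
  have Un: "sq_integrable (rho_measure \<alpha>) (U n)" and Gn: "sq_integrable (hs_measure \<alpha>) (G n)" for n
    using H by (auto simp: H1_def)
  have nb: "norm b \<le> 1" using b by simp
  have gb: "sq_integrable (hs_measure \<alpha>) (\<lambda>z. g z \<bullet> b)" "sq_integrable (hs_measure \<alpha>) (\<lambda>z. G n z \<bullet> b)" for n
    using sq_integrable_inner(1)[OF _ nb] g Gn by blast+
  have limb: "(\<lambda>n. l2 (hs_measure \<alpha>) (\<lambda>z. G n z \<bullet> b - g z \<bullet> b)) \<longlonglongrightarrow> 0"
  proof (rule tendsto_sandwich[OF _ _ tendsto_const limG])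
    show "\<forall>\<^sub>F n in sequentially. l2 (hs_measure \<alpha>) (\<lambda>z. G n z \<bullet> b - g z \<bullet> b) \<le> l2 (hs_measure \<alpha>) (\<lambda>z. G n z - g z)"
      using sq_integrable_inner(2)[OF sq_integrable_diff[OF Gn g] nb] by (simp add: inner_diff_left)
  qed simp
  show "has_weak_deriv half_space [b] u (\<lambda>z. g z \<bullet> b)"
  proof (rule has_weak_derivI1)
    show "locally_integrable half_space u" by (rule sq_integrable_locally(2)[OF u])
    show "locally_integrable half_space (\<lambda>z. g z \<bullet> b)" by (rule sq_integrable_locally(1)[OF gb(1)])
    fix \<phi> :: "'a \<times> real => real" assume \<phi>: "test_fun half_space \<phi>"
    have 1: "(\<lambda>n. LINT z:half_space|lborel. U n z * pd b \<phi> z) \<longlonglongrightarrow> (LINT z:half_space|lborel. u z * pd b \<phi> z)"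
      by (rule rho_test_tendsto[OF test_fun_pd[OF \<phi> b] Un u limU])
    have 2: "(\<lambda>n. LINT z:half_space|lborel. (G n z \<bullet> b) * \<phi> z) \<longlonglongrightarrow> (LINT z:half_space|lborel. (g z \<bullet> b) * \<phi> z)"
      by (rule hs_test_tendsto[OF \<phi> gb(2) gb(1) limb])
    have 3: "(LINT z:half_space|lborel. U n z * pd b \<phi> z) = - (LINT z:half_space|lborel. (G n z \<bullet> b) * \<phi> z)" for n
      using H b \<phi> by (intro has_weak_gradD) (auto simp: H1_def)
    show "(LINT z:half_space|lborel. u z * pd b \<phi> z) = - (LINT z:half_space|lborel. (g z \<bullet> b) * \<phi> z)"
      using LIMSEQ_unique[OF 1[unfolded 3] tendsto_minus[OF 2]] .
  qed
qed

lemma locally_integrable_lincomb: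
  fixes u v :: "'a::euclidean_space => real"
  shows "locally_integrable D u ==> locally_integrable D v ==> locally_integrable D (\<lambda>z. r * u z + s * v z)"
  unfolding locally_integrable_def
  by (auto intro!: set_integral_add(1) set_integrable_mult_right)

lemma has_weak_grad_lincomb:
  assumes U: "has_weak_grad D U G" and V: "has_weak_grad D V H"
  shows "has_weak_grad D (\<lambda>z. r * U z + s * V z) (\<lambda>z. r *\<^sub>R G z + s *\<^sub>R H z)"
  unfolding has_weak_grad_def
proof
  fix b :: 'a assume b: "b \<in> Basis"
  note lU = has_weak_grad_locally_integrable[OF U] and lV = has_weak_grad_locally_integrable[OF V]
  show "has_weak_deriv D [b] (\<lambda>z. r * U z + s * V z) (\<lambda>z. (r *\<^sub>R G z + s *\<^sub>R H z) \<bullet> b)"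
  proof (rule has_weak_derivI1)
    show "locally_integrable D (\<lambda>z. r * U z + s * V z)" by (intro locally_integrable_lincomb lU lV)
    show "locally_integrable D (\<lambda>z. (r *\<^sub>R G z + s *\<^sub>R H z) \<bullet> b)"
      using locally_integrable_lincomb[OF lU(2)[OF b] lV(2)[OF b]] by (simp add: inner_add_left)
    fix \<phi> :: "'a => real" assume \<phi>: "test_fun D \<phi>"
    have lin: "(LINT x:D|lborel. (r * u x + s * v x) * \<psi> x) = r * (LINT x:D|lborel. u x * \<psi> x) + s * (LINT x:D|lborel. v x * \<psi> x)"
      if u: "locally_integrable D u" and v: "locally_integrable D v" and \<psi>: "test_fun D \<psi>" for u v \<psi>
    proof -
      obtain K where K: "compact K" "K \<subseteq> D" "\<And>x. x \<notin> K ==> \<psi> x = 0" "smooth \<psi>" using \<psi> by (rule test_funE) (rule that)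
      have i: "integrable lborel (\<lambda>x. u x * \<psi> x)" "integrable lborel (\<lambda>x. v x * \<psi> x)"
        using integrable_mult_compact[OF locally_integrable_compact[OF u K(1,2)] K(4,1,3)]
          integrable_mult_compact[OF locally_integrable_compact[OF v K(1,2)] K(4,1,3)] by auto
      have eq: "(LINT z:D|lborel. h z * \<psi> z) = (\<integral>z. h z * \<psi> z \<partial>lborel)" for h
        by (rule set_integral_outside_zero) (use K in auto)
      show ?thesis unfolding eq using i by (simp add: distrib_right mult.assoc)
    qed
    show "(LINT x:D|lborel. (r * U x + s * V x) * pd b \<phi> x) = - (LINT x:D|lborel. ((r *\<^sub>R G x + s *\<^sub>R H x) \<bullet> b) * \<phi> x)"
      using lin[OF lU(1) lV(1) test_fun_pd[OF \<phi> b]] lin[OF lU(2)[OF b] lV(2)[OF b] \<phi>]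
        has_weak_gradD[OF U b \<phi>] has_weak_gradD[OF V b \<phi>] by (simp add: inner_add_left)
  qed
qed

lemma H1_lincomb:
  assumes "H1 \<alpha> U G" "H1 \<alpha> V H"
  shows "H1 \<alpha> (\<lambda>z. r * U z + s * V z) (\<lambda>z. r *\<^sub>R G z + s *\<^sub>R H z)"
  using assms has_weak_grad_lincomb[of half_space U G V H r s]
    sq_integrable_add[OF sq_integrable_scale[of _ U r] sq_integrable_scale[of _ V s]]
    sq_integrable_add[OF sq_integrable_scale[of _ G r] sq_integrable_scale[of _ H s]]
  unfolding H1_def by simp

lemma H1_zero: "H1 \<alpha> (\<lambda>z. 0) (\<lambda>z. 0)"
  by (auto simp: H1_def has_weak_grad_def intro!: has_weak_derivI1)
     (auto simp: locally_integrable_def set_integrable_def set_lebesgue_integral_def)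

lemma is_trace0_zero: "is_trace0 (\<lambda>z. 0) (\<lambda>x. 0)"
  by (simp add: is_trace0_def)

lemma is_trace0_scale:
  assumes "is_trace0 U g" and [measurable]: "U \<in> borel_measurable (borel :: ('a::euclidean_space \<times> real) measure)"
  shows "is_trace0 (\<lambda>z. r * U z) (\<lambda>x. r * g x)"
  unfolding is_trace0_def
proof (intro conjI allI impI)
  have [measurable]: "g \<in> borel_measurable borel" using assms(1) by (simp add: is_trace0_def)
  have [measurable]: "(\<lambda>z. g (fst z)) \<in> borel_measurable (borel :: ('a \<times> real) measure)" unfolding borel_prod[symmetric] by measurable
  show "(\<lambda>x. r * g x) \<in> borel_measurable lborel" by measurable
  fix K :: "'a set" assume K: "compact K"
  have [measurable]: "K \<in> sets borel" using K by (simp add: compact_imp_closed borel_closed)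
  let ?F = "\<lambda>U g h. (\<integral>\<^sup>+z. indicator (K \<times> {0<..<h}) z * ennreal ((U z - g (fst z))\<^sup>2) \<partial>lborel) / ennreal h"
  have "?F (\<lambda>z. r * U z) (\<lambda>x. r * g x) h = ennreal (r\<^sup>2) * ?F U g h" for h
  proof -
    have [measurable]: "K \<times> {0<..<h} \<in> sets (borel :: ('a \<times> real) measure)" unfolding borel_prod[symmetric] by measurable
    have "(\<integral>\<^sup>+z. indicator (K \<times> {0<..<h}) z * ennreal ((r * U z - r * g (fst z))\<^sup>2) \<partial>lborel) =
       (\<integral>\<^sup>+z. ennreal (r\<^sup>2) * (indicator (K \<times> {0<..<h}) z * ennreal ((U z - g (fst z))\<^sup>2)) \<partial>lborel)"
      by (intro nn_integral_cong) (auto simp: right_diff_distrib[symmetric] power_mult_distrib ennreal_mult indicator_def)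
    then show ?thesis by (simp add: nn_integral_cmult ennreal_times_divide)
  qed
  moreover have "((\<lambda>h. ennreal (r\<^sup>2) * ?F U g h) \<longlongrightarrow> ennreal (r\<^sup>2) * 0) (at_right 0)"
    by (intro ennreal_tendsto_cmult) (use assms(1) K in \<open>auto simp: is_trace0_def\<close>)
  ultimately show "(?F (\<lambda>z. r * U z) (\<lambda>x. r * g x) \<longlongrightarrow> 0) (at_right 0)" by simp
qed

lemma is_trace0_add:
  assumes "is_trace0 U g" "is_trace0 V k" and [measurable]: "U \<in> borel_measurable (borel :: ('a::euclidean_space \<times> real) measure)" "V \<in> borel_measurable borel"
  shows "is_trace0 (\<lambda>z. U z + V z) (\<lambda>x. g x + k x)"
  unfolding is_trace0_def
proof (intro conjI allI impI)
  have [measurable]: "g \<in> borel_measurable borel" "k \<in> borel_measurable borel" using assms(1,2) by (simp_all add: is_trace0_def)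
  have [measurable]: "(\<lambda>z. g (fst z)) \<in> borel_measurable (borel :: ('a \<times> real) measure)" "(\<lambda>z. k (fst z)) \<in> borel_measurable (borel :: ('a \<times> real) measure)"
    unfolding borel_prod[symmetric] by measurable
  show "(\<lambda>x. g x + k x) \<in> borel_measurable lborel" by measurable
  fix K :: "'a set" assume K: "compact K"
  have [measurable]: "K \<in> sets borel" using K by (simp add: compact_imp_closed borel_closed)
  let ?F = "\<lambda>U g h. (\<integral>\<^sup>+z. indicator (K \<times> {0<..<h}) z * ennreal ((U z - g (fst z))\<^sup>2) \<partial>lborel) / ennreal h"
  have bound: "?F (\<lambda>z. U z + V z) (\<lambda>x. g x + k x) h \<le> 2 * ?F U g h + 2 * ?F V k h" for h
  proof -
    have [measurable]: "K \<times> {0<..<h} \<in> sets (borel :: ('a \<times> real) measure)" unfolding borel_prod[symmetric] by measurable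
    have "(\<integral>\<^sup>+z. indicator (K \<times> {0<..<h}) z * ennreal ((U z + V z - (g (fst z) + k (fst z)))\<^sup>2) \<partial>lborel) \<le>
       (\<integral>\<^sup>+z. 2 * (indicator (K \<times> {0<..<h}) z * ennreal ((U z - g (fst z))\<^sup>2)) + 2 * (indicator (K \<times> {0<..<h}) z * ennreal ((V z - k (fst z))\<^sup>2)) \<partial>lborel)"
    proof (rule nn_integral_mono)
      fix z :: "'a \<times> real"
      have "ennreal ((U z + V z - (g (fst z) + k (fst z)))\<^sup>2) \<le> 2 * ennreal ((U z - g (fst z))\<^sup>2) + 2 * ennreal ((V z - k (fst z))\<^sup>2)"
        using ennreal_square_sum_le[of "U z - g (fst z)" "V z - k (fst z)"] by (simp add: algebra_simps)
      then show "indicator (K \<times> {0<..<h}) z * ennreal ((U z + V z - (g (fst z) + k (fst z)))\<^sup>2) \<le> 2 * (indicator (K \<times> {0<..<h}) z * ennreal ((U z - g (fst z))\<^sup>2)) + 2 * (indicator (K \<times> {0<..<h}) z * ennreal ((V z - k (fst z))\<^sup>2))"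
        by (cases "z \<in> K \<times> {0<..<h}") auto
    qed
    also have "\<dots> = 2 * (\<integral>\<^sup>+z. indicator (K \<times> {0<..<h}) z * ennreal ((U z - g (fst z))\<^sup>2) \<partial>lborel) + 2 * (\<integral>\<^sup>+z. indicator (K \<times> {0<..<h}) z * ennreal ((V z - k (fst z))\<^sup>2) \<partial>lborel)"
      by (subst nn_integral_add) (auto simp: nn_integral_cmult)
    finally show ?thesis
      using divide_right_mono_ennreal[of _ _ "ennreal h"] by (fastforce simp: add_divide_distrib_ennreal ennreal_times_divide)
  qed
  have "((\<lambda>h. 2 * ?F U g h + 2 * ?F V k h) \<longlongrightarrow> 2 * 0 + 2 * 0) (at_right 0)"
    using assms(1,2) K unfolding is_trace0_def by (intro tendsto_add ennreal_tendsto_cmult) auto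
  then have lim: "((\<lambda>h. 2 * ?F U g h + 2 * ?F V k h) \<longlongrightarrow> 0) (at_right 0)" by simp
  show "(?F (\<lambda>z. U z + V z) (\<lambda>x. g x + k x) \<longlongrightarrow> 0) (at_right 0)"
    by (rule tendsto_sandwich[OF _ _ tendsto_const lim]) (use bound in auto)
qed

lemma nn_integral_hs_translate:
  fixes F :: "'a::euclidean_space \<times> real => ennreal"
  assumes [measurable]: "F \<in> borel_measurable borel"
  shows "(\<integral>\<^sup>+z. F (z + (v, 0)) \<partial>hs_measure \<alpha>) = (\<integral>\<^sup>+z. F z \<partial>hs_measure \<alpha>)"
proof -
  have w: "indicator half_space (z + (v, 0)) * y_weight \<alpha> (z + (v, 0)) = (indicator half_space z * y_weight \<alpha> z :: real)" for z
    by (simp add: indicator_def in_half_space y_weight_def)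
  have "(\<integral>\<^sup>+z. F z \<partial>hs_measure \<alpha>) = (\<integral>\<^sup>+z. ennreal (indicator half_space z * y_weight \<alpha> z) * F z \<partial>lborel)"
    by (rule nn_integral_hs) simp
  also have "\<dots> = (\<integral>\<^sup>+z. ennreal (indicator half_space (z + (v, 0)) * y_weight \<alpha> (z + (v, 0))) * F (z + (v, 0)) \<partial>lborel)"
    using nn_integral_affine[of "\<lambda>z. ennreal (indicator half_space z * y_weight \<alpha> z) * F z" 1 "(v, 0)"]
    by (simp add: add.commute)
  also have "\<dots> = (\<integral>\<^sup>+z. F (z + (v, 0)) \<partial>hs_measure \<alpha>)"
    unfolding w by (rule nn_integral_hs[symmetric]) measurable
  finally show ?thesis by simp
qed

lemma hs_translate:
  fixes G :: "'a::euclidean_space \<times> real => 'b::euclidean_space"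
  assumes G: "sq_integrable (hs_measure \<alpha>) G"
  shows "sq_integrable (hs_measure \<alpha>) (\<lambda>z. G (z + (v, 0)))"
    and "l2 (hs_measure \<alpha>) (\<lambda>z. G (z + (v, 0))) = l2 (hs_measure \<alpha>) G"
proof -
  have [measurable]: "G \<in> borel_measurable borel" using G by (auto simp: sq_integrable_def)
  have eq: "(\<integral>\<^sup>+z. ennreal ((norm (G (z + (v, 0))))\<^sup>2) \<partial>hs_measure \<alpha>) = ennreal ((l2 (hs_measure \<alpha>) G)\<^sup>2)"
    unfolding nn_integral_l2[OF G, symmetric] by (rule nn_integral_hs_translate) measurable
  show sq: "sq_integrable (hs_measure \<alpha>) (\<lambda>z. G (z + (v, 0)))"
    by (rule sq_integrableI_nn(1)[of _ _ "l2 (hs_measure \<alpha>) G"]) (use eq in auto)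
  have "ennreal ((l2 (hs_measure \<alpha>) (\<lambda>z. G (z + (v, 0))))\<^sup>2) = ennreal ((l2 (hs_measure \<alpha>) G)\<^sup>2)"
    using nn_integral_l2[OF sq] eq by simp
  then show "l2 (hs_measure \<alpha>) (\<lambda>z. G (z + (v, 0))) = l2 (hs_measure \<alpha>) G" by simp
qed

text \<open>A translation changes \<open>rho\<^sup>2\<close> at most by the factor \<open>2 + 2 (norm v)\<^sup>2\<close>.\<close>

lemma rho_translate:
  fixes U :: "'a::euclidean_space \<times> real => real"
  assumes U: "sq_integrable (rho_measure \<alpha>) U"
  shows "sq_integrable (rho_measure \<alpha>) (\<lambda>z. U (z + (v, 0)))"
proof -
  have [measurable]: "U \<in> borel_measurable borel" using U by (auto simp: sq_integrable_def)
  define c where "c = 2 + 2 * (norm v)\<^sup>2"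
  have c: "0 < c" by (simp add: c_def add_pos_nonneg)
  have r: "1 / (rho z)\<^sup>2 \<le> c * (1 / (rho (z + (v, 0)))\<^sup>2)" for z
  proof -
    have "(norm (z + (v, 0 :: real)))\<^sup>2 \<le> (norm z + norm v)\<^sup>2"
      using norm_triangle_ineq[of z "(v, 0)"] by (intro power_mono) (auto simp: norm_prod_def)
    also have "\<dots> \<le> 2 * (norm z)\<^sup>2 + 2 * (norm v)\<^sup>2"
      using sum_squares_bound[of "norm z" "norm v"] by (simp add: power2_sum)
    finally have "(rho (z + (v, 0)))\<^sup>2 \<le> 1 + 2 * (norm z)\<^sup>2 + 2 * (norm v)\<^sup>2" by (simp add: rho_power2)
    also have "\<dots> \<le> c * (rho z)\<^sup>2" by (simp add: c_def rho_power2 algebra_simps)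
    finally show ?thesis using rho_pos[of z] rho_pos[of "z + (v, 0)"] by (simp add: field_simps)
  qed
  have "(\<integral>\<^sup>+z. ennreal ((norm (U (z + (v, 0))))\<^sup>2) \<partial>rho_measure \<alpha>) =
     (\<integral>\<^sup>+z. ennreal (1 / (rho z)\<^sup>2) * ennreal ((norm (U (z + (v, 0))))\<^sup>2) \<partial>hs_measure \<alpha>)"
    by (rule nn_integral_rho) measurable
  also have "\<dots> \<le> (\<integral>\<^sup>+z. ennreal c * (ennreal (1 / (rho (z + (v, 0)))\<^sup>2) * ennreal ((norm (U (z + (v, 0))))\<^sup>2)) \<partial>hs_measure \<alpha>)"
  proof (rule nn_integral_mono)
    fix z :: "'a \<times> real"
    have "ennreal (1 / (rho z)\<^sup>2) \<le> ennreal (c * (1 / (rho (z + (v, 0)))\<^sup>2))" using r by (rule ennreal_leI)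
    also have "\<dots> = ennreal c * ennreal (1 / (rho (z + (v, 0)))\<^sup>2)" by (rule ennreal_mult) (use c in auto)
    finally show "ennreal (1 / (rho z)\<^sup>2) * ennreal ((norm (U (z + (v, 0))))\<^sup>2) \<le>
       ennreal c * (ennreal (1 / (rho (z + (v, 0)))\<^sup>2) * ennreal ((norm (U (z + (v, 0))))\<^sup>2))"
      unfolding mult.assoc[symmetric] by (rule mult_right_mono) simp
  qed
  also have "\<dots> = ennreal c * (\<integral>\<^sup>+z. ennreal (1 / (rho (z + (v, 0)))\<^sup>2) * ennreal ((norm (U (z + (v, 0))))\<^sup>2) \<partial>hs_measure \<alpha>)"
    by (rule nn_integral_cmult) measurable
  also have "(\<integral>\<^sup>+z. ennreal (1 / (rho (z + (v, 0)))\<^sup>2) * ennreal ((norm (U (z + (v, 0))))\<^sup>2) \<partial>hs_measure \<alpha>) =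
      (\<integral>\<^sup>+z. ennreal (1 / (rho z)\<^sup>2) * ennreal ((norm (U z))\<^sup>2) \<partial>hs_measure \<alpha>)"
    by (rule nn_integral_hs_translate) measurable
  also have "\<dots> = ennreal ((l2 (rho_measure \<alpha>) U)\<^sup>2)"
    using nn_integral_l2[OF U] nn_integral_rho[of "\<lambda>z. ennreal ((norm (U z))\<^sup>2)" \<alpha>] by simp
  finally have "(\<integral>\<^sup>+z. ennreal ((norm (U (z + (v, 0))))\<^sup>2) \<partial>rho_measure \<alpha>) \<le> ennreal ((sqrt c * l2 (rho_measure \<alpha>) U)\<^sup>2)"
    using c by (simp add: power_mult_distrib ennreal_mult)
  then show ?thesis by (intro sq_integrableI_nn(1)[of _ _ "sqrt c * l2 (rho_measure \<alpha>) U"]) (use c in auto)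
qed

lemma lborel_translate:
  fixes g :: "'a::euclidean_space => real"
  assumes g: "sq_integrable lborel g"
  shows "sq_integrable lborel (\<lambda>x. g (x + v))" "l2 lborel (\<lambda>x. g (x + v)) = l2 lborel g"
proof -
  have [measurable]: "g \<in> borel_measurable borel" using g by (auto simp: sq_integrable_def)
  have i: "integrable lborel (\<lambda>x. (norm (g x))\<^sup>2)" using g by (simp add: sq_integrable_def)
  show "sq_integrable lborel (\<lambda>x. g (x + v))"
    using integrable_translate[OF i, of v] by (simp add: sq_integrable_def)
  show "l2 lborel (\<lambda>x. g (x + v)) = l2 lborel g"
    unfolding l2_def by (subst integral_translate[where f = "\<lambda>x. (norm (g x))\<^sup>2"]) auto
qed

lemma locally_integrable_translate:
  fixes u :: "'a::euclidean_space \<times> real => real"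
  assumes u: "locally_integrable half_space u" and [measurable]: "u \<in> borel_measurable borel"
  shows "locally_integrable half_space (\<lambda>z. u (z + (v, 0)))"
  unfolding locally_integrable_def
proof (intro allI impI)
  fix K :: "('a \<times> real) set" assume K: "compact K \<and> K \<subseteq> half_space"
  define K' where "K' = (\<lambda>z. z + (v, 0)) ` K"
  have K': "compact K'" "K' \<subseteq> half_space"
    unfolding K'_def using K by (auto intro!: compact_continuous_image continuous_intros simp: in_half_space subset_iff)
  have "integrable lborel (\<lambda>z. indicator K' z * u z)"
    using locally_integrable_compact[OF u K'] by (simp add: set_integrable_def)
  from integrable_translate[OF this, of "(v, 0)"]
  have "integrable lborel (\<lambda>z. indicator K' (z + (v, 0)) * u (z + (v, 0)))" .
  moreover have "indicator K' (z + (v, 0)) = (indicator K z :: real)" for z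
  proof -
    have "z + (v, 0) \<in> K' \<longleftrightarrow> z \<in> K" unfolding K'_def image_iff by (metis add_right_cancel)
    then show ?thesis by (simp add: indicator_def)
  qed
  ultimately show "set_integrable lborel K (\<lambda>z. u (z + (v, 0)))" by (simp add: set_integrable_def)
qed

lemma minus_horizontal: "z - (v, 0) = z + (- v, 0)" for z :: "'a::euclidean_space \<times> real"
  by (simp add: prod_eq_iff)

lemma test_fun_translate:
  fixes \<phi> :: "'a::euclidean_space \<times> real => real"
  assumes \<phi>: "test_fun half_space \<phi>"
  shows "test_fun half_space (\<lambda>z. \<phi> (z - (v, 0)))"
proof -
  obtain K where K: "compact K" "K \<subseteq> half_space" "\<And>x. x \<notin> K ==> \<phi> x = 0" "smooth \<phi>" using \<phi> by (rule test_funE) (rule that)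
  show ?thesis
  proof (rule test_funI)
    show "smooth (\<lambda>z. \<phi> (z - (v, 0)))" using C_k_affine[of _ \<phi> 1 "(- v, 0)"] K(4) by (simp add: minus_horizontal)
    show "compact ((\<lambda>z. z + (v, 0)) ` K)" by (intro compact_continuous_image continuous_intros K)
    show "(\<lambda>z. z + (v, 0)) ` K \<subseteq> half_space" using K(2) by (auto simp: in_half_space subset_iff)
    show "\<phi> (x - (v, 0)) = 0" if "x \<notin> (\<lambda>z. z + (v, 0)) ` K" for x
    proof (rule K(3))
      show "x - (v, 0) \<notin> K"
      proof
        assume "x - (v, 0) \<in> K"
        then have "(x - (v, 0)) + (v, 0) \<in> (\<lambda>z. z + (v, 0)) ` K" by (rule imageI)
        then show False using that by simp
      qed
    qed
  qed
qed

lemma set_integral_half_space_translate: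
  fixes f :: "'a::euclidean_space \<times> real => real"
  assumes [measurable]: "f \<in> borel_measurable borel"
  shows "(LINT z:half_space|lborel. f (z + (v, 0))) = (LINT z:half_space|lborel. f z)"
proof -
  have "(\<integral>z. indicator half_space (z + (v, 0)) * f (z + (v, 0)) \<partial>lborel) = (\<integral>z. indicator half_space z * f z \<partial>lborel)"
    by (rule integral_translate[where f = "\<lambda>z. indicator half_space z * f z"]) measurable
  then show ?thesis by (simp add: set_lebesgue_integral_def indicator_def in_half_space)
qed

lemma H1_translate:
  fixes U :: "'a::euclidean_space \<times> real => real"
  assumes H: "H1 \<alpha> U G"
  shows "H1 \<alpha> (\<lambda>z. U (z + (v, 0))) (\<lambda>z. G (z + (v, 0)))"
  unfolding H1_def has_weak_grad_def
proof (intro conjI ballI)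
  note [measurable] = H1_borel[OF H]
  have Usq: "sq_integrable (rho_measure \<alpha>) U" and Gsq: "sq_integrable (hs_measure \<alpha>) G"
    and wg: "has_weak_grad half_space U G" using H by (auto simp: H1_def)
  show "sq_integrable (hs_measure \<alpha>) (\<lambda>z. G (z + (v, 0)))" by (rule hs_translate(1)[OF Gsq])
  show "sq_integrable (rho_measure \<alpha>) (\<lambda>z. U (z + (v, 0)))" by (rule rho_translate[OF Usq])
  fix b :: "'a \<times> real" assume b: "b \<in> Basis"
  note l = has_weak_grad_locally_integrable[OF wg]
  show "has_weak_deriv half_space [b] (\<lambda>z. U (z + (v, 0))) (\<lambda>z. G (z + (v, 0)) \<bullet> b)"
  proof (rule has_weak_derivI1)
    show "locally_integrable half_space (\<lambda>z. U (z + (v, 0)))" by (rule locally_integrable_translate[OF l(1)]) measurable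
    show "locally_integrable half_space (\<lambda>z. G (z + (v, 0)) \<bullet> b)" by (rule locally_integrable_translate[OF l(2)[OF b]]) measurable
    fix \<phi> :: "'a \<times> real => real" assume \<phi>: "test_fun half_space \<phi>"
    then have sm: "smooth \<phi>" by (simp add: test_fun_def)
    have pdb: "pd b (\<lambda>z. \<phi> (z - (v, 0))) z = pd b \<phi> (z - (v, 0))" for z
      using pd_affine[where f = \<phi> and v = b and c = 1 and t = "(- v, 0)" and x = z] sm by (simp add: minus_horizontal)
    have [measurable]: "\<phi> \<in> borel_measurable borel" "pd b \<phi> \<in> borel_measurable borel"
      by (rule smooth_measurable[OF sm], rule smooth_measurable[OF smooth_partial[OF sm b]])
    have "(LINT z:half_space|lborel. U (z + (v, 0)) * pd b \<phi> z) = (LINT z:half_space|lborel. U z * pd b \<phi> (z - (v, 0)))"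
      using set_integral_half_space_translate[of "\<lambda>z. U z * pd b \<phi> (z - (v, 0))" v] by simp
    also have "\<dots> = - (LINT z:half_space|lborel. (G z \<bullet> b) * \<phi> (z - (v, 0)))"
      using has_weak_gradD[OF wg b test_fun_translate[OF \<phi>, of v]] unfolding pdb .
    also have "\<dots> = - (LINT z:half_space|lborel. (G (z + (v, 0)) \<bullet> b) * \<phi> z)"
      using set_integral_half_space_translate[of "\<lambda>z. (G z \<bullet> b) * \<phi> (z - (v, 0))" v] by simp
    finally show "(LINT z:half_space|lborel. U (z + (v, 0)) * pd b \<phi> z) = - (LINT z:half_space|lborel. (G (z + (v, 0)) \<bullet> b) * \<phi> z)" .
  qed
qed

lemma is_trace0_translate:
  fixes U :: "'a::euclidean_space \<times> real => real"
  assumes tr: "is_trace0 U g" and [measurable]: "U \<in> borel_measurable borel"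
  shows "is_trace0 (\<lambda>z. U (z + (v, 0))) (\<lambda>x. g (x + v))"
  unfolding is_trace0_def
proof (intro conjI allI impI)
  have [measurable]: "g \<in> borel_measurable borel" using tr by (simp add: is_trace0_def)
  have [measurable]: "(\<lambda>z. g (fst z)) \<in> borel_measurable (borel :: ('a \<times> real) measure)" unfolding borel_prod[symmetric] by measurable
  show "(\<lambda>x. g (x + v)) \<in> borel_measurable lborel" by measurable
  fix K :: "'a set" assume K: "compact K"
  define K' where "K' = (\<lambda>x. x + v) ` K"
  have K': "compact K'" unfolding K'_def by (intro compact_continuous_image continuous_intros K)
  then have [measurable]: "K' \<in> sets borel" by (simp add: compact_imp_closed borel_closed)
  have "(\<integral>\<^sup>+z. indicator (K \<times> {0<..<h}) z * ennreal ((U (z + (v, 0)) - g (fst z + v))\<^sup>2) \<partial>lborel) =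
     (\<integral>\<^sup>+z. indicator (K' \<times> {0<..<h}) z * ennreal ((U z - g (fst z))\<^sup>2) \<partial>lborel)" for h
  proof -
    have [measurable]: "K' \<times> {0<..<h} \<in> sets (borel :: ('a \<times> real) measure)" unfolding borel_prod[symmetric] by measurable
    have "indicator (K' \<times> {0<..<h}) ((v, 0) + z) = (indicator (K \<times> {0<..<h}) z :: ennreal)" for z
      by (cases z) (auto simp: K'_def indicator_def add.commute)
    then show ?thesis
      using nn_integral_affine[of "\<lambda>z. indicator (K' \<times> {0<..<h}) z * ennreal ((U z - g (fst z))\<^sup>2)" 1 "(v, 0)"]
      by (simp add: add.commute[of _ v] add.commute[of _ "(v, 0)"])
  qed
  then show "((\<lambda>h. (\<integral>\<^sup>+z. indicator (K \<times> {0<..<h}) z * ennreal ((U (z + (v, 0)) - g (fst z + v))\<^sup>2) \<partial>lborel) / ennreal h) \<longlongrightarrow> 0) (at_right 0)"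
    using tr K' by (simp add: is_trace0_def)
qed

text \<open>A function, its gradient and its trace. Storing all three avoids choosing representatives of gradients and
  traces whenever functions are added or translated.\<close>

type_synonym 'a triple = "('a \<times> real => real) \<times> ('a \<times> real => 'a \<times> real) \<times> ('a => real)"

abbreviation val :: "'a triple => 'a \<times> real => real" where "val v \<equiv> fst v"
abbreviation grad :: "'a triple => 'a \<times> real => 'a \<times> real" where "grad v \<equiv> fst (snd v)"
abbreviation trc :: "'a triple => 'a => real" where "trc v \<equiv> snd (snd v)"

definition energy_triples :: "real => real => 'a::euclidean_space triple set" where
  "energy_triples \<alpha> \<kappa> = {v. H1 \<alpha> (val v) (grad v) \<and> is_trace0 (val v) (trc v) \<and> (0 < \<kappa> \<longrightarrow> sq_integrable lborel (trc v))}"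

text \<open>The norm of the pair is the Euclidean one, so that coercivity holds for its square. If \<open>\<kappa> = 0\<close>,
  the junk value of \<open>l2\<close> of a trace that is not square integrable is multiplied by 0.\<close>

definition energy_norm :: "real => real => 'a::euclidean_space triple => real" where
  "energy_norm \<alpha> \<kappa> v = norm (l2 (hs_measure \<alpha>) (grad v), sqrt \<kappa> * l2 lborel (trc v))"

definition shift :: "'a::euclidean_space => 'a triple => 'a triple" where
  "shift e v = (\<lambda>z. val v (z + (e, 0)), \<lambda>z. grad v (z + (e, 0)), \<lambda>x. trc v (x + e))"

lemma energy_triplesD:
  assumes "v \<in> energy_triples \<alpha> \<kappa>"
  shows "H1 \<alpha> (val v) (grad v)" "is_trace0 (val v) (trc v)" "0 < \<kappa> ==> sq_integrable lborel (trc v)"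
    "sq_integrable (hs_measure \<alpha>) (grad v)" "sq_integrable (rho_measure \<alpha>) (val v)" "val v \<in> borel_measurable borel"
    "grad v \<in> borel_measurable borel" "trc v \<in> borel_measurable borel"
  using assms H1_borel[of \<alpha> "val v" "grad v"] by (auto simp: energy_triples_def H1_def is_trace0_def)

lemma triple_add: "u + v = (\<lambda>z. val u z + val v z, \<lambda>z. grad u z + grad v z, \<lambda>x. trc u x + trc v x)"
  and triple_scale: "r *\<^sub>R v = (\<lambda>z. r * val v z, \<lambda>z. r *\<^sub>R grad v z, \<lambda>x. r * trc v x)"
  and triple_diff: "u - v = (\<lambda>z. val u z - val v z, \<lambda>z. grad u z - grad v z, \<lambda>x. trc u x - trc v x)"
  for u v :: "'a::euclidean_space triple"
  by (simp_all add: prod_eq_iff plus_fun_def scaleR_fun_def fun_diff_def)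

lemma energy_triples_add:
  assumes "u \<in> energy_triples \<alpha> \<kappa>" "v \<in> energy_triples \<alpha> \<kappa>"
  shows "u + v \<in> energy_triples \<alpha> \<kappa>"
  using energy_triplesD[OF assms(1)] energy_triplesD[OF assms(2)] H1_lincomb[of \<alpha> "val u" "grad u" "val v" "grad v" 1 1]
    is_trace0_add[of "val u" "trc u" "val v" "trc v"] sq_integrable_add[of lborel "trc u" "trc v"]
  unfolding triple_add energy_triples_def by simp

lemma energy_triples_scale:
  assumes "v \<in> energy_triples \<alpha> \<kappa>"
  shows "r *\<^sub>R v \<in> energy_triples \<alpha> \<kappa>"
  using energy_triplesD[OF assms] H1_lincomb[of \<alpha> "val v" "grad v" "val v" "grad v" r 0]
    is_trace0_scale[of "val v" "trc v" r] sq_integrable_scale[of lborel "trc v" r]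
  unfolding triple_scale energy_triples_def by simp

lemma energy_triples_diff:
  assumes "u \<in> energy_triples \<alpha> \<kappa>" "v \<in> energy_triples \<alpha> \<kappa>"
  shows "u - v \<in> energy_triples \<alpha> \<kappa>"
  using energy_triples_add[OF assms(1) energy_triples_scale[OF assms(2), of "-1"]] by simp

lemma energy_triples_zero: "0 \<in> energy_triples \<alpha> \<kappa>"
  by (simp add: energy_triples_def fst_zero snd_zero zero_fun_def H1_zero is_trace0_zero)

lemma shift_mem:
  assumes v: "v \<in> energy_triples \<alpha> \<kappa>"
  shows "shift e v \<in> energy_triples \<alpha> \<kappa>"
proof -
  note D = energy_triplesD[OF v]
  show ?thesis unfolding energy_triples_def shift_def mem_Collect_eq fst_conv snd_conv
    by (intro conjI impI H1_translate[OF D(1)] is_trace0_translate[OF D(2) D(6)] lborel_translate(1)[OF D(3)])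
qed

lemma norm_Pair_mono: "0 \<le> a ==> a \<le> a' ==> 0 \<le> b ==> b \<le> b' ==> norm (a, b) \<le> norm (a', b')" for a b a' b' :: real
  unfolding norm_prod_def by (intro real_sqrt_le_mono add_mono power_mono) auto

lemma energy_norm_triangle:
  assumes u: "u \<in> energy_triples \<alpha> \<kappa>" and v: "v \<in> energy_triples \<alpha> \<kappa>" and \<kappa>: "0 \<le> \<kappa>"
  shows "energy_norm \<alpha> \<kappa> (u + v) \<le> energy_norm \<alpha> \<kappa> u + energy_norm \<alpha> \<kappa> v"
proof -
  have "sqrt \<kappa> * l2 lborel (trc (u + v)) \<le> sqrt \<kappa> * l2 lborel (trc u) + sqrt \<kappa> * l2 lborel (trc v)"
  proof (cases "0 < \<kappa>")
    case True
    then have "l2 lborel (trc (u + v)) \<le> l2 lborel (trc u) + l2 lborel (trc v)"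
      unfolding triple_add snd_conv by (intro l2_triangle energy_triplesD(3)[OF u] energy_triplesD(3)[OF v])
    then show ?thesis using \<kappa> by (simp flip: distrib_left add: mult_left_mono)
  qed (use \<kappa> in simp)
  moreover have "l2 (hs_measure \<alpha>) (grad (u + v)) \<le> l2 (hs_measure \<alpha>) (grad u) + l2 (hs_measure \<alpha>) (grad v)"
    unfolding triple_add fst_conv snd_conv by (intro l2_triangle energy_triplesD(4)[OF u] energy_triplesD(4)[OF v])
  ultimately have "energy_norm \<alpha> \<kappa> (u + v) \<le> norm (l2 (hs_measure \<alpha>) (grad u) + l2 (hs_measure \<alpha>) (grad v), sqrt \<kappa> * l2 lborel (trc u) + sqrt \<kappa> * l2 lborel (trc v))"
    unfolding energy_norm_def using \<kappa> by (intro norm_Pair_mono) auto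
  also have "\<dots> \<le> energy_norm \<alpha> \<kappa> u + energy_norm \<alpha> \<kappa> v"
    unfolding energy_norm_def
    using norm_triangle_ineq[of "(l2 (hs_measure \<alpha>) (grad u), sqrt \<kappa> * l2 lborel (trc u))" "(l2 (hs_measure \<alpha>) (grad v), sqrt \<kappa> * l2 lborel (trc v))"]
    by simp
  finally show ?thesis .
qed

lemma energy_norm_scale: "energy_norm \<alpha> \<kappa> (r *\<^sub>R v) = \<bar>r\<bar> * energy_norm \<alpha> \<kappa> v"
proof -
  have "energy_norm \<alpha> \<kappa> (r *\<^sub>R v) = norm (\<bar>r\<bar> *\<^sub>R (l2 (hs_measure \<alpha>) (grad v), sqrt \<kappa> * l2 lborel (trc v)))"
  proof -
    have e: "l2 lborel (\<lambda>x. r * trc v x) = \<bar>r\<bar> * l2 lborel (trc v)" using l2_scale[of lborel r "trc v"] by simp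
    show ?thesis unfolding energy_norm_def triple_scale fst_conv snd_conv l2_scale e by (simp add: mult_ac)
  qed
  then show ?thesis unfolding norm_scaleR abs_idempotent energy_norm_def[of _ _ v] .
qed

lemma energy_norm_shift:
  assumes v: "v \<in> energy_triples \<alpha> \<kappa>" and \<kappa>: "0 \<le> \<kappa>"
  shows "energy_norm \<alpha> \<kappa> (shift e v) = energy_norm \<alpha> \<kappa> v"
proof -
  have e: "sqrt \<kappa> * l2 lborel (\<lambda>x. trc v (x + e)) = sqrt \<kappa> * l2 lborel (trc v)"
    using lborel_translate(2)[OF energy_triplesD(3)[OF v]] \<kappa> by (cases "0 < \<kappa>") auto
  show ?thesis unfolding energy_norm_def shift_def fst_conv snd_conv e hs_translate(2)[OF energy_triplesD(4)[OF v]] ..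
qed

lemma energy_norm_ge:
  shows "l2 (hs_measure \<alpha>) (grad v) \<le> energy_norm \<alpha> \<kappa> v"
    and "0 \<le> \<kappa> ==> sqrt \<kappa> * l2 lborel (trc v) \<le> energy_norm \<alpha> \<kappa> v"
  unfolding energy_norm_def norm_prod_def by (simp_all add: real_le_rsqrt)

lemma trace_diff_ball_bound:
  fixes u v :: "'a::euclidean_space triple"
  assumes \<alpha>: "-1 < \<alpha>" "\<alpha> < 1" "1 < real DIM('a) + \<alpha>"
    and H: "H1 \<alpha> (val u) (grad u)" "H1 \<alpha> (val v) (grad v)" and tr: "is_trace0 (val u) (trc u)" "is_trace0 (val v) (trc v)"
  shows "(\<integral>\<^sup>+x. indicator (cball 0 R) x * ennreal ((trc u x - trc v x)\<^sup>2) \<partial>lborel) \<le>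
     ennreal ((trace_const DIM('a) \<alpha> R * l2 (hs_measure \<alpha>) (\<lambda>z. grad u z - grad v z))\<^sup>2)"
proof (rule trace_bound[OF _ \<alpha>])
  show "H1 \<alpha> (\<lambda>z. val u z - val v z) (\<lambda>z. grad u z - grad v z)"
    using H1_lincomb[OF H, of 1 "-1"] by simp
  show "is_trace0 (\<lambda>z. val u z - val v z) (\<lambda>x. trc u x - trc v x)"
    using is_trace0_add[OF tr(1) is_trace0_scale[OF tr(2), of "-1"]] H1_borel[OF H(1)] H1_borel[OF H(2)] by simp
qed

text \<open>Gradients converge in the weighted \<open>L\<^sup>2\<close> space, functions by Hardy's inequality. The limit of the traces in \<open>L\<^sup>2\<close>
  is the trace of the limit, because the trace estimate identifies the two on every ball.\<close>

theorem energy_triples_complete: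
  fixes X :: "nat => 'a::euclidean_space triple"
  assumes \<alpha>: "-1 < \<alpha>" "\<alpha> < 1" "1 < real DIM('a) + \<alpha>" and \<kappa>: "0 \<le> \<kappa>"
    and X: "\<And>n. X n \<in> energy_triples \<alpha> \<kappa>"
    and cauchy: "\<And>e. e > 0 ==> \<exists>M. \<forall>m\<ge>M. \<forall>n\<ge>M. energy_norm \<alpha> \<kappa> (X m - X n) < e"
  shows "\<exists>w\<in>energy_triples \<alpha> \<kappa>. (\<lambda>n. energy_norm \<alpha> \<kappa> (X n - w)) \<longlonglongrightarrow> 0"
proof -
  note XD = energy_triplesD[OF X]
  have diffE: "X m - X n \<in> energy_triples \<alpha> \<kappa>" for m n by (intro energy_triples_diff X)
  have diffG: "grad (X m - X n) = (\<lambda>z. grad (X m) z - grad (X n) z)" "val (X m - X n) = (\<lambda>z. val (X m) z - val (X n) z)"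
    "trc (X m - X n) = (\<lambda>x. trc (X m) x - trc (X n) x)" for m n unfolding triple_diff by simp_all
  obtain g where g: "sq_integrable (hs_measure \<alpha>) g" "(\<lambda>n. l2 (hs_measure \<alpha>) (\<lambda>z. grad (X n) z - g z)) \<longlonglongrightarrow> 0"
  proof (rule l2_complete[of "hs_measure \<alpha>" "\<lambda>n. grad (X n)"])
    show "sq_integrable (hs_measure \<alpha>) (grad (X n))" for n by (rule XD)
    fix e :: real assume "e > 0"
    from cauchy[OF this] show "\<exists>m. \<forall>p\<ge>m. \<forall>q\<ge>m. l2 (hs_measure \<alpha>) (\<lambda>x. grad (X p) x - grad (X q) x) < e"
      using energy_norm_ge(1)[of \<alpha> "X _ - X _" \<kappa>] unfolding diffG by (meson order_le_less_trans)
  qed blast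
  let ?G = "\<lambda>n. l2 (hs_measure \<alpha>) (\<lambda>z. grad (X n) z - g z)"
  have hc: "0 < hardy_const DIM('a) \<alpha>" by (rule hardy_const_pos[OF \<alpha>(3)])
  obtain u where u: "sq_integrable (rho_measure \<alpha>) u" "(\<lambda>n. l2 (rho_measure \<alpha>) (\<lambda>z. val (X n) z - u z)) \<longlonglongrightarrow> 0"
  proof (rule l2_complete[of "rho_measure \<alpha>" "\<lambda>n. val (X n)"])
    show "sq_integrable (rho_measure \<alpha>) (val (X n))" for n by (rule XD)
    fix e :: real assume "e > 0"
    then have "e / hardy_const DIM('a) \<alpha> > 0" using hc by simp
    from cauchy[OF this] obtain M where M: "\<And>m n. m \<ge> M ==> n \<ge> M ==> energy_norm \<alpha> \<kappa> (X m - X n) < e / hardy_const DIM('a) \<alpha>" by blast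
    have "l2 (rho_measure \<alpha>) (\<lambda>x. val (X p) x - val (X q) x) < e" if "p \<ge> M" "q \<ge> M" for p q
    proof -
      have "l2 (rho_measure \<alpha>) (val (X p - X q)) \<le> hardy_const DIM('a) \<alpha> * l2 (hs_measure \<alpha>) (grad (X p - X q))"
        by (rule hardy_inequality[OF energy_triplesD(1)[OF diffE] \<alpha>(1,3)])
      also have "\<dots> \<le> hardy_const DIM('a) \<alpha> * energy_norm \<alpha> \<kappa> (X p - X q)"
        using hc by (intro mult_left_mono energy_norm_ge) auto
      also have "\<dots> < e" using M[OF that] hc by (simp add: field_simps)
      finally show ?thesis unfolding diffG .
    qed
    then show "\<exists>m. \<forall>p\<ge>m. \<forall>q\<ge>m. l2 (rho_measure \<alpha>) (\<lambda>x. val (X p) x - val (X q) x) < e" by blast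
  qed blast
  have H: "H1 \<alpha> u g" by (rule H1_limit[OF XD(1) u(1) g(1) u(2) g(2)])
  obtain k where k: "is_trace0 u k" using trace_exists[OF H \<alpha>(1,2)] by blast
  have [measurable]: "k \<in> borel_measurable borel" using k by (simp add: is_trace0_def)
  have kX [measurable]: "trc (X n) \<in> borel_measurable borel" for n by (rule XD)
  have ball: "(\<integral>\<^sup>+x. indicator (cball 0 R) x * ennreal ((trc (X n) x - k x)\<^sup>2) \<partial>lborel) \<le>
     ennreal ((trace_const DIM('a) \<alpha> R * ?G n)\<^sup>2)" for n R
    using trace_diff_ball_bound[OF \<alpha> XD(1)[of n] _ XD(2)[of n], where v = "(u, g, k)" and R = R] H k by simp
  have tr: "sq_integrable lborel k \<and> (\<lambda>n. l2 lborel (\<lambda>x. trc (X n) x - k x)) \<longlonglongrightarrow> 0" if pos: "0 < \<kappa>"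
  proof -
    have XT: "sq_integrable lborel (trc (X n))" for n by (rule XD(3)[OF pos])
    obtain k' where k': "sq_integrable lborel k'" "(\<lambda>n. l2 lborel (\<lambda>x. trc (X n) x - k' x)) \<longlonglongrightarrow> 0"
    proof (rule l2_complete[of lborel "\<lambda>n. trc (X n)"])
      fix e :: real assume "e > 0"
      then have "sqrt \<kappa> * e > 0" using pos by simp
      from cauchy[OF this] obtain M where M: "\<And>m n. m \<ge> M ==> n \<ge> M ==> energy_norm \<alpha> \<kappa> (X m - X n) < sqrt \<kappa> * e" by blast
      have "l2 lborel (\<lambda>x. trc (X p) x - trc (X q) x) < e" if "p \<ge> M" "q \<ge> M" for p q
      proof -
        have "sqrt \<kappa> * l2 lborel (trc (X p - X q)) < sqrt \<kappa> * e"
          using energy_norm_ge(2)[OF \<kappa>, of "X p - X q" \<alpha>] M[OF that] by simp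
        then show ?thesis using pos unfolding diffG by simp
      qed
      then show "\<exists>m. \<forall>p\<ge>m. \<forall>q\<ge>m. l2 lborel (\<lambda>x. trc (X p) x - trc (X q) x) < e" by blast
    qed (use XT in blast)+
    let ?K = "\<lambda>n. l2 lborel (\<lambda>x. trc (X n) x - k' x)"
    have [measurable]: "k' \<in> borel_measurable borel" using k'(1) by (auto simp: sq_integrable_def)
    have "AE x in lborel. x \<in> cball 0 (real N) \<longrightarrow> k' x = k x" for N
    proof -
      define I where "I = (\<integral>\<^sup>+x. indicator (cball 0 (real N)) x * ennreal ((k' x - k x)\<^sup>2) \<partial>lborel)"
      have cb [measurable]: "cball (0::'a) (real N) \<in> sets borel" by (simp add: borel_closed)
      let ?c = "trace_const DIM('a) \<alpha> (real N)"
      have "I \<le> ennreal (2 * (?K n)\<^sup>2 + 2 * (?c * ?G n)\<^sup>2)" for n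
      proof -
        have "I \<le> (\<integral>\<^sup>+x. 2 * ennreal ((norm (trc (X n) x - k' x))\<^sup>2) + 2 * (indicator (cball 0 (real N)) x * ennreal ((trc (X n) x - k x)\<^sup>2)) \<partial>lborel)"
          unfolding I_def
        proof (rule nn_integral_mono)
          fix x :: 'a
          have "ennreal ((k' x - k x)\<^sup>2) \<le> 2 * ennreal ((trc (X n) x - k' x)\<^sup>2) + 2 * ennreal ((trc (X n) x - k x)\<^sup>2)"
            using ennreal_square_sum_le[of "k' x - trc (X n) x" "trc (X n) x - k x"] by (simp add: power2_commute[of "k' x"])
          then show "indicator (cball 0 (real N)) x * ennreal ((k' x - k x)\<^sup>2) \<le> 2 * ennreal ((norm (trc (X n) x - k' x))\<^sup>2) + 2 * (indicator (cball 0 (real N)) x * ennreal ((trc (X n) x - k x)\<^sup>2))"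
            by (cases "x \<in> cball 0 (real N)") auto
        qed
        also have "\<dots> = 2 * (\<integral>\<^sup>+x. ennreal ((norm (trc (X n) x - k' x))\<^sup>2) \<partial>lborel) + 2 * (\<integral>\<^sup>+x. indicator (cball 0 (real N)) x * ennreal ((trc (X n) x - k x)\<^sup>2) \<partial>lborel)"
          by (subst nn_integral_add) (auto simp: nn_integral_cmult)
        also have "\<dots> \<le> 2 * ennreal ((?K n)\<^sup>2) + 2 * ennreal ((?c * ?G n)\<^sup>2)"
          by (intro add_mono mult_left_mono ball) (simp_all add: nn_integral_l2[OF sq_integrable_diff[OF XT k'(1)], simplified])
        also have "\<dots> = ennreal (2 * (?K n)\<^sup>2 + 2 * (?c * ?G n)\<^sup>2)"
          by (simp add: ennreal_plus ennreal_mult)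
        finally show ?thesis .
      qed
      moreover have "(\<lambda>n. ennreal (2 * (?K n)\<^sup>2 + 2 * (?c * ?G n)\<^sup>2)) \<longlonglongrightarrow> ennreal (2 * 0\<^sup>2 + 2 * (?c * 0)\<^sup>2)"
        by (intro tendsto_ennrealI tendsto_intros k' g)
      ultimately have "I \<le> ennreal (2 * 0\<^sup>2 + 2 * (?c * 0)\<^sup>2)" by (intro LIMSEQ_le_const) auto
      then have "I = 0" by simp
      then have "AE x in lborel. indicator (cball 0 (real N)) x * ennreal ((k' x - k x)\<^sup>2) = 0"
        unfolding I_def by (subst (asm) nn_integral_0_iff_AE) auto
      then show ?thesis by eventually_elim (auto simp: indicator_def split: if_splits)
    qed
    then have "AE x in lborel. \<forall>N. x \<in> cball 0 (real N) \<longrightarrow> k' x = k x" unfolding AE_all_countable by blast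
    then have ae: "AE x in lborel. k' x = k x"
    proof eventually_elim
      case (elim x)
      obtain n where "norm x \<le> real n" using real_arch_simple by blast
      then show ?case using elim by auto
    qed
    have "l2 lborel (\<lambda>x. trc (X n) x - k x) = ?K n" for n
      by (rule sq_integrable_AE(2)[OF sq_integrable_diff[OF XT k'(1)]]) (use ae in auto)
    then show ?thesis using sq_integrable_AE(1)[OF k'(1) _ ae] k'(2) by simp
  qed
  show ?thesis
  proof (intro bexI)
    show "(u, g, k) \<in> energy_triples \<alpha> \<kappa>" using H k tr by (simp add: energy_triples_def)
    have "(\<lambda>n. sqrt \<kappa> * l2 lborel (\<lambda>x. trc (X n) x - k x)) \<longlonglongrightarrow> 0"
    proof (cases "0 < \<kappa>")
      case True
      then show ?thesis using tendsto_mult[OF tendsto_const, of _ 0 sequentially "sqrt \<kappa>"] tr by simp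
    qed (use \<kappa> in simp)
    with g(2) have "(\<lambda>n. norm (?G n, sqrt \<kappa> * l2 lborel (\<lambda>x. trc (X n) x - k x))) \<longlonglongrightarrow> norm (0::real, 0::real)"
      by (intro tendsto_norm tendsto_Pair)
    then show "(\<lambda>n. energy_norm \<alpha> \<kappa> (X n - (u, g, k))) \<longlonglongrightarrow> 0"
      by (simp add: energy_norm_def triple_diff)
  qed
qed

theorem energy_translation:
  fixes dir :: "'i => 'a::euclidean_space"
  assumes \<alpha>: "-1 < \<alpha>" "\<alpha> < 1" "1 < real DIM('a) + \<alpha>" and \<kappa>: "0 \<le> \<kappa>"
  shows "translation_energy (energy_triples \<alpha> \<kappa> :: 'a triple set) (energy_norm \<alpha> \<kappa>) (\<lambda>i h. shift (h *\<^sub>R dir i))"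
proof
  show "subspace (energy_triples \<alpha> \<kappa> :: 'a triple set)"
    by (simp add: subspace_def energy_triples_zero energy_triples_add energy_triples_scale)
  fix u v :: "'a triple" and i h r
  show "shift (h *\<^sub>R dir i) (u + v) = shift (h *\<^sub>R dir i) u + shift (h *\<^sub>R dir i) v"
    by (simp add: shift_def triple_add)
  show "shift (h *\<^sub>R dir i) (r *\<^sub>R v) = r *\<^sub>R shift (h *\<^sub>R dir i) v"
    by (simp add: shift_def triple_scale)
  show "shift (- h *\<^sub>R dir i) (shift (h *\<^sub>R dir i) v) = v"
    by (simp add: shift_def add.assoc zero_prod_def[symmetric])
  assume v: "v \<in> energy_triples \<alpha> \<kappa>"
  show "0 \<le> energy_norm \<alpha> \<kappa> v" by (simp add: energy_norm_def)
  show "energy_norm \<alpha> \<kappa> (r *\<^sub>R v) = \<bar>r\<bar> * energy_norm \<alpha> \<kappa> v" by (rule energy_norm_scale)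
  show "shift (h *\<^sub>R dir i) v \<in> energy_triples \<alpha> \<kappa>" by (rule shift_mem[OF v])
  show "energy_norm \<alpha> \<kappa> (shift (h *\<^sub>R dir i) v) = energy_norm \<alpha> \<kappa> v" by (rule energy_norm_shift[OF v \<kappa>])
  assume u: "u \<in> energy_triples \<alpha> \<kappa>"
  show "energy_norm \<alpha> \<kappa> (u + v) \<le> energy_norm \<alpha> \<kappa> u + energy_norm \<alpha> \<kappa> v" by (rule energy_norm_triangle[OF u v \<kappa>])
qed (rule energy_triples_complete[OF \<alpha> \<kappa>])

section \<open>The coefficient form\<close>

locale energy_setting =
  fixes \<alpha> \<kappa> :: real and ty :: "'d::finite itself"
  assumes \<alpha>: "-1 < \<alpha>" "\<alpha> < 1" "1 < real CARD('d) + \<alpha>" and \<kappa>: "0 \<le> \<kappa>"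

sublocale energy_setting \<subseteq> translation_energy "energy_triples \<alpha> \<kappa> :: (real^'d) triple set" "energy_norm \<alpha> \<kappa>"
    "\<lambda>(i::'d) h. shift (h *\<^sub>R axis i 1)"
  by (rule energy_translation) (use \<alpha> \<kappa> in auto)

text \<open>The scalar \<open>c\<close> is 1 for the bilinear form itself and 0 for its tangential derivatives, in which only
  the derivatives of \<open>\<AA>\<close> survive.\<close>

definition coeff_integrand :: "(real^'d => real^'d^'d) => real => (real^'d) triple => (real^'d) triple => (real^'d) \<times> real => real" where
  "coeff_integrand A c u v z = (A (fst z) *v fst (grad u z)) \<bullet> fst (grad v z) + c * (snd (grad u z) * snd (grad v z))"

definition coeff_form :: "real => real => (real^'d => real^'d^'d) => real => (real^'d) triple => (real^'d) triple => real" where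
  "coeff_form \<alpha> \<kappa> A c u v = (\<integral>z. coeff_integrand A c u v z \<partial>hs_measure \<alpha>) + c * \<kappa> * (\<integral>x. trc u x * trc v x \<partial>lborel)"

lemma norm_matrix_vector_le: "norm (A *v x) \<le> norm A * norm x" for A :: "real^'n^'m"
proof -
  have "norm (A *v x) = L2_set (\<lambda>i. \<bar>A $ i \<bullet> x\<bar>) UNIV"
    by (simp add: norm_vec_def matrix_vector_mul_component)
  also have "\<dots> \<le> L2_set (\<lambda>i. norm (A $ i) * norm x) UNIV"
    by (rule L2_set_mono) (auto simp: Cauchy_Schwarz_ineq2)
  also have "\<dots> = norm A * norm x" by (simp add: norm_vec_def L2_set_left_distrib)
  finally show ?thesis .
qed

lemma continuous_matrix_vector: "continuous_on UNIV (\<lambda>p. fst p *v snd p :: real^'m)" for dummy :: "real^'n^'m"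
  unfolding matrix_vector_mult_def by (intro continuous_intros)

lemma coeff_integrand_borel:
  fixes A :: "real^'d => real^'d^'d"
  assumes A: "continuous_on UNIV A" and u: "grad u \<in> borel_measurable borel" and v: "grad v \<in> borel_measurable borel"
  shows "coeff_integrand A c u v \<in> borel_measurable borel"
proof -
  have f: "(fst :: (real^'d) \<times> real => _) \<in> borel_measurable borel" "(snd :: (real^'d) \<times> real => _) \<in> borel_measurable borel"
    by (intro borel_measurable_continuous_onI continuous_intros)+
  have Az: "(\<lambda>z::(real^'d) \<times> real. A (fst z)) \<in> borel_measurable borel"
    by (rule measurable_compose[OF f(1) borel_measurable_continuous_onI[OF A]])
  have [measurable]: "(\<lambda>z. fst (grad u z)) \<in> borel_measurable borel" "(\<lambda>z. snd (grad u z)) \<in> borel_measurable borel"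
    "(\<lambda>z. fst (grad v z)) \<in> borel_measurable borel" "(\<lambda>z. snd (grad v z)) \<in> borel_measurable borel"
    using measurable_compose[OF u f(1)] measurable_compose[OF u f(2)] measurable_compose[OF v f(1)] measurable_compose[OF v f(2)] by auto
  have [measurable]: "(\<lambda>z. A (fst z) *v fst (grad u z)) \<in> borel_measurable borel"
    by (rule borel_measurable_continuous_Pair[OF Az]) (measurable, rule continuous_matrix_vector)
  show ?thesis unfolding coeff_integrand_def by measurable
qed

lemma coeff_integrand_bound:
  assumes "norm (A (fst z)) \<le> m"
  shows "\<bar>coeff_integrand A c u v z\<bar> \<le> (m + \<bar>c\<bar>) * (norm (grad u z) * norm (grad v z))"
proof -
  have n: "norm (fst p) \<le> norm p" "\<bar>snd p\<bar> \<le> norm p" for p :: "(real^'d) \<times> real"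
    using norm_fst_le[of "fst p" "snd p"] norm_snd_le[of "snd p" "fst p"] by simp_all
  have m: "0 \<le> m" using assms norm_ge_zero order_trans by blast
  have "\<bar>(A (fst z) *v fst (grad u z)) \<bullet> fst (grad v z)\<bar> \<le> norm (A (fst z) *v fst (grad u z)) * norm (fst (grad v z))"
    by (rule Cauchy_Schwarz_ineq2)
  also have "\<dots> \<le> (m * norm (grad u z)) * norm (grad v z)"
    by (intro mult_mono order_trans[OF norm_matrix_vector_le] n assms m mult_nonneg_nonneg) auto
  finally have 1: "\<bar>(A (fst z) *v fst (grad u z)) \<bullet> fst (grad v z)\<bar> \<le> m * (norm (grad u z) * norm (grad v z))" by (simp add: mult.assoc)
  have 2: "\<bar>c * (snd (grad u z) * snd (grad v z))\<bar> \<le> \<bar>c\<bar> * (norm (grad u z) * norm (grad v z))"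
    unfolding abs_mult by (intro mult_left_mono mult_mono n) auto
  show ?thesis unfolding coeff_integrand_def distrib_right using 1 2 by linarith
qed

context energy_setting
begin

lemma coeff_form_estimates:
  fixes A :: "real^'d => real^'d^'d"
  assumes A: "continuous_on UNIV A" and m: "\<And>x. norm (A x) \<le> m"
    and u: "u \<in> energy_triples \<alpha> \<kappa>" and v: "v \<in> energy_triples \<alpha> \<kappa>"
  shows "integrable (hs_measure \<alpha>) (coeff_integrand A c u v)"
    and "0 < \<kappa> ==> integrable lborel (\<lambda>x. trc u x * trc v x)"
    and "\<bar>coeff_form \<alpha> \<kappa> A c u v\<bar> \<le> (m + 2 * \<bar>c\<bar>) * energy_norm \<alpha> \<kappa> u * energy_norm \<alpha> \<kappa> v"
proof -
  have m0: "0 \<le> m" using m[of 0] norm_ge_zero order_trans by blast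
  note U = energy_triplesD[OF u] and V = energy_triplesD[OF v]
  have meas: "coeff_integrand A c u v \<in> borel_measurable (hs_measure \<alpha>)"
    using coeff_integrand_borel[OF A U(7) V(7)] by (simp cong: measurable_cong_sets)
  have bd: "\<bar>coeff_integrand A c u v z\<bar> \<le> (m + \<bar>c\<bar>) * (norm (grad u z) * norm (grad v z))" for z
    by (rule coeff_integrand_bound[OF m])
  have nn: "0 \<le> m + \<bar>c\<bar>" using m0 by simp
  note P = integrable_product_l2[OF U(4) V(4) meas bd nn]
  show "integrable (hs_measure \<alpha>) (coeff_integrand A c u v)" by (rule P(1))
  have Nn: "0 \<le> energy_norm \<alpha> \<kappa> u" "0 \<le> energy_norm \<alpha> \<kappa> v" by (simp_all add: energy_norm_def)
  have 1: "\<bar>\<integral>z. coeff_integrand A c u v z \<partial>hs_measure \<alpha>\<bar> \<le> (m + \<bar>c\<bar>) * (energy_norm \<alpha> \<kappa> u * energy_norm \<alpha> \<kappa> v)"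
    using P(2) mult_left_mono[OF mult_mono[OF energy_norm_ge(1)[of \<alpha> u \<kappa>] energy_norm_ge(1)[of \<alpha> v \<kappa>] Nn(1) l2_nonneg] nn]
    by (simp add: mult.assoc)
  show T: "integrable lborel (\<lambda>x. trc u x * trc v x)" if "0 < \<kappa>"
    by (rule integrable_product_l2(1)[OF U(3)[OF that] V(3)[OF that] _ _ zero_le_one]) (use U(8) V(8) in \<open>auto simp: abs_mult\<close>)
  have 2: "\<bar>c * \<kappa> * (\<integral>x. trc u x * trc v x \<partial>lborel)\<bar> \<le> \<bar>c\<bar> * (energy_norm \<alpha> \<kappa> u * energy_norm \<alpha> \<kappa> v)"
  proof (cases "0 < \<kappa>")
    case True
    have "\<bar>\<integral>x. trc u x * trc v x \<partial>lborel\<bar> \<le> 1 * l2 lborel (trc u) * l2 lborel (trc v)"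
      by (rule integrable_product_l2(2)[OF U(3)[OF True] V(3)[OF True] _ _ zero_le_one]) (use U(8) V(8) in \<open>auto simp: abs_mult\<close>)
    then have "\<kappa> * \<bar>\<integral>x. trc u x * trc v x \<partial>lborel\<bar> \<le> \<kappa> * (l2 lborel (trc u) * l2 lborel (trc v))"
      using \<kappa> by (intro mult_left_mono) auto
    also have "\<dots> = (sqrt \<kappa> * l2 lborel (trc u)) * (sqrt \<kappa> * l2 lborel (trc v))"
    proof -
      have "(sqrt \<kappa> * l2 lborel (trc u)) * (sqrt \<kappa> * l2 lborel (trc v)) = (sqrt \<kappa> * sqrt \<kappa>) * (l2 lborel (trc u) * l2 lborel (trc v))"
        by (simp only: mult_ac)
      then show ?thesis using \<kappa> by simp
    qed
    also have "\<dots> \<le> energy_norm \<alpha> \<kappa> u * energy_norm \<alpha> \<kappa> v"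
      by (intro mult_mono energy_norm_ge(2)[OF \<kappa>] Nn mult_nonneg_nonneg) (use \<kappa> in auto)
    finally have "\<bar>c\<bar> * (\<kappa> * \<bar>\<integral>x. trc u x * trc v x \<partial>lborel\<bar>) \<le> \<bar>c\<bar> * (energy_norm \<alpha> \<kappa> u * energy_norm \<alpha> \<kappa> v)"
      by (intro mult_left_mono) auto
    then show ?thesis using \<kappa> by (simp add: abs_mult mult.assoc)
  qed (use \<kappa> Nn in simp)
  have "\<bar>coeff_form \<alpha> \<kappa> A c u v\<bar> \<le> (m + \<bar>c\<bar>) * (energy_norm \<alpha> \<kappa> u * energy_norm \<alpha> \<kappa> v) + \<bar>c\<bar> * (energy_norm \<alpha> \<kappa> u * energy_norm \<alpha> \<kappa> v)"
    unfolding coeff_form_def using 1 2 by linarith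
  also have "\<dots> = (m + 2 * \<bar>c\<bar>) * energy_norm \<alpha> \<kappa> u * energy_norm \<alpha> \<kappa> v" by (simp add: algebra_simps)
  finally show "\<bar>coeff_form \<alpha> \<kappa> A c u v\<bar> \<le> (m + 2 * \<bar>c\<bar>) * energy_norm \<alpha> \<kappa> u * energy_norm \<alpha> \<kappa> v" .
qed

lemma coeff_form_linear:
  fixes A :: "real^'d => real^'d^'d"
  assumes A: "continuous_on UNIV A" and m: "\<And>x. norm (A x) \<le> m"
    and u: "u \<in> energy_triples \<alpha> \<kappa>" and u': "u' \<in> energy_triples \<alpha> \<kappa>" and v: "v \<in> energy_triples \<alpha> \<kappa>"
  shows "coeff_form \<alpha> \<kappa> A c (u + u') v = coeff_form \<alpha> \<kappa> A c u v + coeff_form \<alpha> \<kappa> A c u' v"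
    and "coeff_form \<alpha> \<kappa> A c v (u + u') = coeff_form \<alpha> \<kappa> A c v u + coeff_form \<alpha> \<kappa> A c v u'"
    and "coeff_form \<alpha> \<kappa> A c (r *\<^sub>R u) v = r * coeff_form \<alpha> \<kappa> A c u v"
    and "coeff_form \<alpha> \<kappa> A c v (r *\<^sub>R u) = r * coeff_form \<alpha> \<kappa> A c v u"
proof -
  note E = coeff_form_estimates(1,2)[OF A m]
  have l: "coeff_integrand A c (u + u') v = (\<lambda>z. coeff_integrand A c u v z + coeff_integrand A c u' v z)"
    "coeff_integrand A c v (u + u') = (\<lambda>z. coeff_integrand A c v u z + coeff_integrand A c v u' z)"
    "coeff_integrand A c (r *\<^sub>R u) v = (\<lambda>z. r * coeff_integrand A c u v z)"
    "coeff_integrand A c v (r *\<^sub>R u) = (\<lambda>z. r * coeff_integrand A c v u z)"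
    unfolding triple_add triple_scale coeff_integrand_def
    by (auto simp: fun_eq_iff matrix_vector_right_distrib inner_add_left inner_add_right algebra_simps matrix_vector_mult_scaleR)
  have tu: "(\<integral>x. trc (u + u') x * trc v x \<partial>lborel) = (\<integral>x. trc u x * trc v x \<partial>lborel) + (\<integral>x. trc u' x * trc v x \<partial>lborel)"
    "(\<integral>x. trc v x * trc (u + u') x \<partial>lborel) = (\<integral>x. trc v x * trc u x \<partial>lborel) + (\<integral>x. trc v x * trc u' x \<partial>lborel)" if "0 < \<kappa>"
    using E(2)[OF u v that] E(2)[OF u' v that] E(2)[OF v u that] E(2)[OF v u' that] unfolding triple_add
    by (simp_all add: distrib_right distrib_left)
  have ts: "(\<integral>x. trc (r *\<^sub>R u) x * trc v x \<partial>lborel) = r * (\<integral>x. trc u x * trc v x \<partial>lborel)"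
    "(\<integral>x. trc v x * trc (r *\<^sub>R u) x \<partial>lborel) = r * (\<integral>x. trc v x * trc u x \<partial>lborel)"
    unfolding triple_scale by (simp_all add: mult.assoc mult.left_commute)
  show "coeff_form \<alpha> \<kappa> A c (u + u') v = coeff_form \<alpha> \<kappa> A c u v + coeff_form \<alpha> \<kappa> A c u' v"
    "coeff_form \<alpha> \<kappa> A c v (u + u') = coeff_form \<alpha> \<kappa> A c v u + coeff_form \<alpha> \<kappa> A c v u'"
    using E(1)[OF u v, of c] E(1)[OF u' v, of c] E(1)[OF v u, of c] E(1)[OF v u', of c] tu \<kappa>
    unfolding coeff_form_def l by (cases "0 < \<kappa>"; simp add: algebra_simps)+
  show "coeff_form \<alpha> \<kappa> A c (r *\<^sub>R u) v = r * coeff_form \<alpha> \<kappa> A c u v"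
    "coeff_form \<alpha> \<kappa> A c v (r *\<^sub>R u) = r * coeff_form \<alpha> \<kappa> A c v u"
    unfolding coeff_form_def l ts by (simp_all add: algebra_simps)
qed

lemma form_coeff:
  fixes A :: "real^'d => real^'d^'d"
  assumes A: "continuous_on UNIV A" and m: "\<And>x. norm (A x) \<le> m"
  shows "form (m + 2 * \<bar>c\<bar>) (coeff_form \<alpha> \<kappa> A c)"
proof -
  have m0: "0 \<le> m" using m[of 0] norm_ge_zero order_trans by blast
  have nn: "0 \<le> (m + 2 * \<bar>c\<bar>) * energy_norm \<alpha> \<kappa> w" if "w \<in> energy_triples \<alpha> \<kappa>" for w :: "(real^'d) triple"
    using m0 N_nonneg[OF that] by simp
  note lin = coeff_form_linear[OF A m, where c = c] and est = coeff_form_estimates(3)[OF A m, where c = c]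
  show ?thesis unfolding form_def
  proof (intro conjI ballI)
    fix u :: "(real^'d) triple" assume u: "u \<in> energy_triples \<alpha> \<kappa>"
    show "functional ((m + 2 * \<bar>c\<bar>) * energy_norm \<alpha> \<kappa> u) (coeff_form \<alpha> \<kappa> A c u)"
      unfolding functional_def
    proof (intro conjI ballI allI nn[OF u])
      fix w w' :: "(real^'d) triple" and r assume w: "w \<in> energy_triples \<alpha> \<kappa>"
      show "coeff_form \<alpha> \<kappa> A c u (r *\<^sub>R w) = r * coeff_form \<alpha> \<kappa> A c u w" by (rule lin(4)[OF w w u])
      show "\<bar>coeff_form \<alpha> \<kappa> A c u w\<bar> \<le> (m + 2 * \<bar>c\<bar>) * energy_norm \<alpha> \<kappa> u * energy_norm \<alpha> \<kappa> w" by (rule est[OF u w])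
      assume w': "w' \<in> energy_triples \<alpha> \<kappa>"
      show "coeff_form \<alpha> \<kappa> A c u (w + w') = coeff_form \<alpha> \<kappa> A c u w + coeff_form \<alpha> \<kappa> A c u w'" by (rule lin(2)[OF w w' u])
    qed
    show "functional ((m + 2 * \<bar>c\<bar>) * energy_norm \<alpha> \<kappa> u) (\<lambda>w. coeff_form \<alpha> \<kappa> A c w u)"
      unfolding functional_def
    proof (intro conjI ballI allI nn[OF u])
      fix w w' :: "(real^'d) triple" and r assume w: "w \<in> energy_triples \<alpha> \<kappa>"
      show "coeff_form \<alpha> \<kappa> A c (r *\<^sub>R w) u = r * coeff_form \<alpha> \<kappa> A c w u" by (rule lin(3)[OF w w u])
      show "\<bar>coeff_form \<alpha> \<kappa> A c w u\<bar> \<le> (m + 2 * \<bar>c\<bar>) * energy_norm \<alpha> \<kappa> u * energy_norm \<alpha> \<kappa> w"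
        using est[OF w u] by (simp add: mult.commute mult.left_commute)
      assume w': "w' \<in> energy_triples \<alpha> \<kappa>"
      show "coeff_form \<alpha> \<kappa> A c (w + w') u = coeff_form \<alpha> \<kappa> A c w u + coeff_form \<alpha> \<kappa> A c w' u" by (rule lin(1)[OF w w' u])
    qed
  qed
qed

lemma integral_hs_translate:
  fixes F :: "(real^'d) \<times> real => real"
  assumes [measurable]: "F \<in> borel_measurable borel"
  shows "(\<integral>z. F (z + (v, 0)) \<partial>hs_measure \<alpha>) = (\<integral>z. F z \<partial>hs_measure \<alpha>)"
proof -
  have eq: "(\<integral>z. F z \<partial>hs_measure \<alpha>) = (LINT z:half_space|lborel. y_weight \<alpha> z * F z)"
    if [measurable]: "F \<in> borel_measurable borel" for F :: "(real^'d) \<times> real => real"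
    unfolding hs_measure_def set_lebesgue_integral_def by (subst integral_density) (auto simp: mult.assoc)
  have "(\<integral>z. F (z + (v, 0)) \<partial>hs_measure \<alpha>) = (LINT z:half_space|lborel. y_weight \<alpha> (z + (v, 0)) * F (z + (v, 0)))"
    by (subst eq) (auto simp: y_weight_def)
  also have "\<dots> = (\<integral>z. F z \<partial>hs_measure \<alpha>)"
    unfolding eq[OF assms] by (rule set_integral_half_space_translate[where f = "\<lambda>z. y_weight \<alpha> z * F z"]) measurable
  finally show ?thesis .
qed

text \<open>Translating both arguments amounts to translating the coefficient.\<close>

lemma coeff_form_shift:
  fixes A :: "real^'d => real^'d^'d"
  assumes A: "continuous_on UNIV A" and u: "u \<in> energy_triples \<alpha> \<kappa>" and v: "v \<in> energy_triples \<alpha> \<kappa>"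
  shows "coeff_form \<alpha> \<kappa> A c (shift (- e) u) (shift (- e) v) = coeff_form \<alpha> \<kappa> (\<lambda>x. A (x + e)) c u v"
proof -
  have A': "continuous_on UNIV (\<lambda>x. A (x + e))"
    by (intro continuous_on_compose2[OF A] continuous_intros) auto
  note U = energy_triplesD[OF u] and V = energy_triplesD[OF v]
  have [measurable]: "trc u \<in> borel_measurable borel" "trc v \<in> borel_measurable borel" by (rule U V)+
  have "coeff_integrand A c (shift (- e) u) (shift (- e) v) z = coeff_integrand (\<lambda>x. A (x + e)) c u v (z + (- e, 0))" for z
    by (simp add: coeff_integrand_def shift_def)
  then have "(\<integral>z. coeff_integrand A c (shift (- e) u) (shift (- e) v) z \<partial>hs_measure \<alpha>) = (\<integral>z. coeff_integrand (\<lambda>x. A (x + e)) c u v z \<partial>hs_measure \<alpha>)"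
    using integral_hs_translate[OF coeff_integrand_borel[OF A' U(7) V(7), of c], of "- e"] by simp
  moreover have "(\<integral>x. trc (shift (- e) u) x * trc (shift (- e) v) x \<partial>lborel) = (\<integral>x. trc u x * trc v x \<partial>lborel)"
    using integral_translate[of "\<lambda>x. trc u x * trc v x" "- e"] by (simp add: shift_def)
  ultimately show ?thesis by (simp add: coeff_form_def)
qed

end

text \<open>The derivative is uniformly continuous, having compact support.\<close>

lemma uniform_difference_quotient:
  fixes A :: "'a::euclidean_space => 'b::euclidean_space"
  assumes C1: "C_k (Suc 0) A" and b: "b \<in> Basis" and K: "compact K" "\<And>x. x \<notin> K ==> A x = L" and e: "0 < e"
  shows "\<exists>d>0. \<forall>h x. h \<noteq> 0 \<longrightarrow> \<bar>h\<bar> < d \<longrightarrow> norm ((1 / h) *\<^sub>R (A (x + h *\<^sub>R b) - A x) - frechet_derivative A (at x) b) \<le> e"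
proof -
  define A' where "A' x = frechet_derivative A (at x) b" for x
  have der: "(A has_derivative frechet_derivative A (at x)) (at x)" for x by (rule C_k_SucD[OF C1])
  have cont: "continuous_on UNIV A'" using C_k_SucD_partial[OF C1 b] by (simp add: A'_def[abs_def])
  have A'0: "A' x = 0" if "x \<notin> K" for x
  proof -
    have "(A has_derivative (\<lambda>h. 0)) (at x)"
      by (rule has_derivative_transform_within_open[of "\<lambda>x. L" _ _ _ "- K"])
         (use K that compact_imp_closed in auto)
    from fun_cong[OF frechet_derivative_at[OF this], of b] show ?thesis by (simp add: A'_def)
  qed
  obtain R where R: "0 < R" "K \<subseteq> cball 0 R" using compact_imp_bounded[OF K(1)] bounded_subset_cball by (metis bounded_pos subsetI mem_cball_0)
  have "uniformly_continuous_on (cball 0 (R + 1)) A'"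
    by (intro compact_uniformly_continuous continuous_on_subset[OF cont]) auto
  then obtain d where d: "0 < d" "\<And>x y. x \<in> cball 0 (R + 1) ==> y \<in> cball 0 (R + 1) ==> dist y x < d ==> dist (A' y) (A' x) < e"
    unfolding uniformly_continuous_on_def using e by metis
  define d' where "d' = min d 1"
  have unif: "norm (A' y - A' x) \<le> e" if xy: "dist y x < d'" for x y
  proof (cases "x \<in> cball 0 (R + 1) \<and> y \<in> cball 0 (R + 1)")
    case True
    then show ?thesis using d(2)[of x y] xy by (auto simp: d'_def dist_norm)
  next
    case False
    have "norm x \<le> norm y + dist y x" "norm y \<le> norm x + dist y x"
      using norm_triangle_sub[of x y] norm_triangle_sub[of y x] by (simp_all add: dist_norm norm_minus_commute)
    then have "x \<notin> K" "y \<notin> K" using False R(2) xy by (auto simp: d'_def subset_iff)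
    then show ?thesis using A'0 e by simp
  qed
  have lin: "linear (frechet_derivative A (at x))" for x using der has_derivative_linear by blast
  have "norm ((1 / h) *\<^sub>R (A (x + h *\<^sub>R b) - A x) - A' x) \<le> e" if h: "h \<noteq> 0" "\<bar>h\<bar> < d'" for h x
  proof -
    define f where "f t = A (x + t *\<^sub>R b) - t *\<^sub>R A' x" for t
    have fder: "(f has_derivative (\<lambda>s. s *\<^sub>R (A' (x + t *\<^sub>R b) - A' x))) (at t within S)" for t S
    proof -
      have "((\<lambda>t. x + t *\<^sub>R b) has_derivative (\<lambda>s. s *\<^sub>R b)) (at t within S)" by (auto intro!: derivative_eq_intros)
      from has_derivative_compose[OF this der]
      have "((\<lambda>t. A (x + t *\<^sub>R b)) has_derivative (\<lambda>s. s *\<^sub>R A' (x + t *\<^sub>R b))) (at t within S)"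
        by (simp add: linear_cmul[OF lin] A'_def)
      then show ?thesis unfolding f_def by (auto intro!: derivative_eq_intros simp: algebra_simps)
    qed
    have "norm (f h - f 0) \<le> e * norm (h - 0)"
    proof (rule differentiable_bound[of "closed_segment 0 h"])
      fix t assume t: "t \<in> closed_segment 0 h"
      have "\<bar>t\<bar> \<le> \<bar>h\<bar>" using t by (auto simp: closed_segment_eq_real_ivl split: if_splits)
      then have le: "norm (A' (x + t *\<^sub>R b) - A' x) \<le> e"
        using h b by (intro unif) (simp add: dist_norm)
      show "onorm (\<lambda>s. s *\<^sub>R (A' (x + t *\<^sub>R b) - A' x)) \<le> e"
      proof (rule onorm_bound)
        show "norm (s *\<^sub>R (A' (x + t *\<^sub>R b) - A' x)) \<le> e * norm s" for s
          using mult_left_mono[OF le, of "\<bar>s\<bar>"] by (simp add: mult.commute)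
      qed (use e in simp)
    qed (auto intro: fder)
    then have le: "norm (A (x + h *\<^sub>R b) - A x - h *\<^sub>R A' x) \<le> e * \<bar>h\<bar>" by (simp add: f_def algebra_simps)
    have eq: "(1 / h) *\<^sub>R (A (x + h *\<^sub>R b) - A x) - A' x = (1 / h) *\<^sub>R (A (x + h *\<^sub>R b) - A x - h *\<^sub>R A' x)"
      using h by (simp add: scaleR_diff_right)
    show ?thesis unfolding eq norm_scaleR
      using mult_left_mono[OF le, of "\<bar>1 / h\<bar>"] h by simp
  qed
  then show ?thesis using d(1) by (intro exI[of _ d']) (auto simp: d'_def A'_def)
qed

primrec coeff_bound :: "nat => real => (real^'d => real^'d^'d) => bool" where
  "coeff_bound 0 m A \<longleftrightarrow> (\<forall>x. norm (A x) \<le> m)"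
| "coeff_bound (Suc k) m A \<longleftrightarrow> (\<forall>x. norm (A x) \<le> m) \<and> (\<forall>i. coeff_bound k m (\<lambda>x. frechet_derivative A (at x) (axis i 1)))"

lemma coeff_bound_mono: "coeff_bound k m A ==> m \<le> m' ==> coeff_bound k m' A"
  by (induction k arbitrary: A) (auto intro: order_trans)

lemma partial_constant_outside:
  fixes A :: "'a::euclidean_space => 'b::real_normed_vector"
  assumes K: "compact K" "\<And>x. x \<notin> K ==> A x = L" and x: "x \<notin> K"
  shows "frechet_derivative A (at x) b = 0"
proof -
  have "(A has_derivative (\<lambda>h. 0)) (at x)"
    by (rule has_derivative_transform_within_open[of "\<lambda>x. L" _ _ _ "- K"])
       (use K x compact_imp_closed in auto)
  from fun_cong[OF frechet_derivative_at[OF this], of b] show ?thesis by simp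
qed

lemma coeff_bound_exists:
  fixes A :: "real^'d => real^'d^'d"
  assumes "C_k k A" "compact K" "\<And>x. x \<notin> K ==> A x = L"
  shows "\<exists>m. coeff_bound k m A"
  using assms(1,3)
proof (induction k arbitrary: A L)
  case 0
  have "bounded (A ` K)"
    by (intro compact_imp_bounded compact_continuous_image assms(2)) (use 0 in \<open>auto intro: continuous_on_subset\<close>)
  then obtain c where c: "\<And>x. x \<in> K ==> norm (A x) \<le> c" by (auto simp: bounded_iff)
  have "norm (A x) \<le> max c (norm L)" for x using c[of x] 0(2)[of x] by (cases "x \<in> K") auto
  then show ?case by auto
next
  case (Suc k)
  have b: "axis i 1 \<in> (Basis :: (real^'d) set)" for i by (auto simp: Basis_vec_def)
  have "\<exists>m. coeff_bound k m (\<lambda>x. frechet_derivative A (at x) (axis i 1))" for i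
    by (rule Suc.IH[OF C_k_SucD_partial[OF Suc.prems(1) b], where L = 0]) (rule partial_constant_outside[OF assms(2) Suc.prems(2)])
  then obtain m where m: "\<And>i. coeff_bound k (m i) (\<lambda>x. frechet_derivative A (at x) (axis i 1))" by metis
  have "bounded (A ` K)"
    by (intro compact_imp_bounded compact_continuous_image assms(2)) (use C_k_continuous[OF Suc.prems(1)] in \<open>auto intro: continuous_on_subset\<close>)
  then obtain c where c: "\<And>x. x \<in> K ==> norm (A x) \<le> c" by (auto simp: bounded_iff)
  have A: "norm (A x) \<le> max c (norm L)" for x using c[of x] Suc.prems(2)[of x] by (cases "x \<in> K") auto
  define M where "M = Max (insert (max c (norm L)) (range m))"
  have "m i \<le> M" for i unfolding M_def by (rule Max_ge) auto
  moreover have "max c (norm L) \<le> M" unfolding M_def by (rule Max_ge) auto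
  ultimately have "\<forall>x. norm (A x) \<le> M" "\<forall>i. coeff_bound k M (\<lambda>x. frechet_derivative A (at x) (axis i 1))"
    using order_trans[OF A] coeff_bound_mono[OF m] by blast+
  then show ?case by auto
qed

context energy_setting
begin

lemma form_mono: "form B b ==> B \<le> B' ==> form B' b"
  unfolding form_def by (meson functional_mono mult_right_mono N_nonneg)

lemma smooth_form_mono: "smooth_form k B b ==> B \<le> B' ==> smooth_form k B' b"
proof (induction k arbitrary: b)
  case (Suc k)
  show ?case unfolding smooth_form.simps
  proof (intro conjI allI)
    show "form B' b" by (rule form_mono[OF smooth_form_form[OF Suc.prems(1)] Suc.prems(2)])
    fix i
    obtain b' where b': "\<And>e. e > 0 ==> \<forall>\<^sub>F h in at 0. \<forall>u\<in>energy_triples \<alpha> \<kappa>. \<forall>v\<in>energy_triples \<alpha> \<kappa>.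
                  \<bar>(b (shift (- h *\<^sub>R axis i 1) u) (shift (- h *\<^sub>R axis i 1) v) - b u v) / h - b' u v\<bar> \<le> e * energy_norm \<alpha> \<kappa> u * energy_norm \<alpha> \<kappa> v"
      "smooth_form k B b'" using Suc.prems(1) by (rule smooth_form_SucE[where i=i]) (rule that)
    show "\<exists>b'. (\<forall>e>0. \<forall>\<^sub>F h in at 0. \<forall>u\<in>energy_triples \<alpha> \<kappa>. \<forall>v\<in>energy_triples \<alpha> \<kappa>.
                  \<bar>(b (shift (- h *\<^sub>R axis i 1) u) (shift (- h *\<^sub>R axis i 1) v) - b u v) / h - b' u v\<bar> \<le> e * energy_norm \<alpha> \<kappa> u * energy_norm \<alpha> \<kappa> v) \<and>
       smooth_form k B' b'"
      by (intro exI[of _ b'] conjI allI impI b'(1) Suc.IH[OF b'(2) Suc.prems(2)])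
  qed
qed (simp add: form_mono)

text \<open>By translation invariance of the integrals, the derivative of the form is the form of the derivative of \<open>\<AA>\<close>, and
  uniform convergence of the difference quotients of \<open>\<AA>\<close> is convergence in the operator norm.\<close>

theorem smooth_form_coeff:
  fixes A :: "real^'d => real^'d^'d"
  assumes "C_k k A" "coeff_bound k m A" "compact K" "\<And>x. x \<notin> K ==> A x = L"
  shows "smooth_form k (m + 2 * \<bar>c\<bar>) (coeff_form \<alpha> \<kappa> A c)"
  using assms(1,2,4)
proof (induction k arbitrary: A L c)
  case 0
  then show ?case using form_coeff[of A m c] by simp
next
  case (Suc k)
  note cont = C_k_continuous[OF Suc.prems(1)]
  have m: "norm (A x) \<le> m" for x using Suc.prems(2) by simp
  show ?case unfolding smooth_form.simps
  proof (intro conjI allI)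
    show "form (m + 2 * \<bar>c\<bar>) (coeff_form \<alpha> \<kappa> A c)" by (rule form_coeff[OF cont m])
    fix i :: 'd
    define A' where "A' x = frechet_derivative A (at x) (axis i 1)" for x
    have b: "axis i 1 \<in> (Basis :: (real^'d) set)" by (auto simp: Basis_vec_def)
    have A'C: "C_k k A'" unfolding A'_def using C_k_SucD_partial[OF Suc.prems(1) b] .
    have A'b: "coeff_bound k m A'" using Suc.prems(2) by (simp add: A'_def[abs_def])
    have A'm: "norm (A' x) \<le> m" for x using A'b by (cases k) auto
    have "smooth_form k (m + 2 * \<bar>0\<bar>) (coeff_form \<alpha> \<kappa> A' 0)"
    proof (rule Suc.IH[OF A'C A'b])
      show "A' x = 0" if "x \<notin> K" for x unfolding A'_def by (rule partial_constant_outside[OF assms(3) Suc.prems(3) that])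
    qed
    then have s: "smooth_form k (m + 2 * \<bar>c\<bar>) (coeff_form \<alpha> \<kappa> A' 0)" by (rule smooth_form_mono) simp
    have "\<forall>\<^sub>F h in at 0. \<forall>u\<in>energy_triples \<alpha> \<kappa>. \<forall>v\<in>energy_triples \<alpha> \<kappa>.
        \<bar>(coeff_form \<alpha> \<kappa> A c (shift (- h *\<^sub>R axis i 1) u) (shift (- h *\<^sub>R axis i 1) v) - coeff_form \<alpha> \<kappa> A c u v) / h - coeff_form \<alpha> \<kappa> A' 0 u v\<bar>
          \<le> e * energy_norm \<alpha> \<kappa> u * energy_norm \<alpha> \<kappa> v" if e: "0 < e" for e
    proof -
      have C1: "C_k (Suc 0) A" by (rule C_k_le[OF Suc.prems(1)]) simp
      obtain d where d: "0 < d" "\<And>h x. h \<noteq> 0 ==> \<bar>h\<bar> < d ==> norm ((1 / h) *\<^sub>R (A (x + h *\<^sub>R axis i 1) - A x) - A' x) \<le> e"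
        using uniform_difference_quotient[OF C1 b assms(3) Suc.prems(3) e] unfolding A'_def by blast
      have "\<bar>(coeff_form \<alpha> \<kappa> A c (shift (- h *\<^sub>R axis i 1) u) (shift (- h *\<^sub>R axis i 1) v) - coeff_form \<alpha> \<kappa> A c u v) / h - coeff_form \<alpha> \<kappa> A' 0 u v\<bar>
          \<le> e * energy_norm \<alpha> \<kappa> u * energy_norm \<alpha> \<kappa> v"
        if h: "h \<noteq> 0" "\<bar>h\<bar> < d" and u: "u \<in> energy_triples \<alpha> \<kappa>" and v: "v \<in> energy_triples \<alpha> \<kappa>" for h u v
      proof -
        define Ah where "Ah x = A (x + h *\<^sub>R axis i 1)" for x
        define Q where "Q x = (1 / h) *\<^sub>R (Ah x - A x) - A' x" for x
        have Ahc: "continuous_on UNIV Ah" unfolding Ah_def by (intro continuous_on_compose2[OF cont] continuous_intros) auto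
        have A'c: "continuous_on UNIV A'" by (rule C_k_continuous[OF A'C])
        have Qc: "continuous_on UNIV Q" unfolding Q_def by (intro continuous_intros Ahc cont A'c)
        have Qe: "norm (Q x) \<le> e" for x unfolding Q_def Ah_def by (rule d(2)[OF h])
        have Ahm: "norm (Ah x) \<le> m" for x unfolding Ah_def by (rule m)
        have sh: "coeff_form \<alpha> \<kappa> A c (shift (- h *\<^sub>R axis i 1) u) (shift (- h *\<^sub>R axis i 1) v) = coeff_form \<alpha> \<kappa> Ah c u v"
          using coeff_form_shift[OF cont u v, of c "h *\<^sub>R axis i 1"] by (simp add: Ah_def[abs_def])
        note I = coeff_form_estimates(1)[OF Ahc Ahm u v, of c] coeff_form_estimates(1)[OF cont m u v, of c] coeff_form_estimates(1)[OF A'c A'm u v, of 0]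
        have "coeff_integrand Q 0 u v z = (1 / h) * (coeff_integrand Ah c u v z - coeff_integrand A c u v z) - coeff_integrand A' 0 u v z" for z
          by (simp add: coeff_integrand_def Q_def matrix_vector_mult_diff_rdistrib scaleR_matrix_vector_assoc[symmetric] inner_diff_left algebra_simps)
        then have "coeff_form \<alpha> \<kappa> Q 0 u v = (coeff_form \<alpha> \<kappa> Ah c u v - coeff_form \<alpha> \<kappa> A c u v) / h - coeff_form \<alpha> \<kappa> A' 0 u v"
          using I by (simp add: coeff_form_def)
        then show ?thesis using coeff_form_estimates(3)[OF Qc Qe u v, of 0] unfolding sh by simp
      qed
      then show ?thesis using d(1) unfolding eventually_at by (auto intro!: exI[of _ d])
    qed
    then show "\<exists>b'. (\<forall>e>0. \<forall>\<^sub>F h in at 0. \<forall>u\<in>energy_triples \<alpha> \<kappa>. \<forall>v\<in>energy_triples \<alpha> \<kappa>.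
        \<bar>(coeff_form \<alpha> \<kappa> A c (shift (- h *\<^sub>R axis i 1) u) (shift (- h *\<^sub>R axis i 1) v) - coeff_form \<alpha> \<kappa> A c u v) / h - b' u v\<bar>
          \<le> e * energy_norm \<alpha> \<kappa> u * energy_norm \<alpha> \<kappa> v) \<and> smooth_form k (m + 2 * \<bar>c\<bar>) b'"
      by (intro exI[of _ "coeff_form \<alpha> \<kappa> A' 0"] conjI allI impI s)
  qed
qed

lemma coeff_form_coercive:
  fixes A :: "real^'d => real^'d^'d"
  assumes A: "continuous_on UNIV A" and m: "\<And>x. norm (A x) \<le> m"
    and a0: "0 < a0" "\<And>x \<eta>. a0 * (norm \<eta>)\<^sup>2 \<le> (A x *v \<eta>) \<bullet> \<eta>" and v: "v \<in> energy_triples \<alpha> \<kappa>"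
  shows "min a0 1 * (energy_norm \<alpha> \<kappa> v)\<^sup>2 \<le> coeff_form \<alpha> \<kappa> A 1 v v"
proof -
  note V = energy_triplesD[OF v]
  have i: "integrable (hs_measure \<alpha>) (\<lambda>z. (norm (grad v z))\<^sup>2)" using V(4) by (simp add: sq_integrable_def)
  have "min a0 1 * (l2 (hs_measure \<alpha>) (grad v))\<^sup>2 = (\<integral>z. min a0 1 * (norm (grad v z))\<^sup>2 \<partial>hs_measure \<alpha>)"
    by (simp add: l2_power2)
  also have "\<dots> \<le> (\<integral>z. coeff_integrand A 1 v v z \<partial>hs_measure \<alpha>)"
  proof (rule integral_mono)
    fix z
    have "min a0 1 * (norm (fst (grad v z)))\<^sup>2 \<le> a0 * (norm (fst (grad v z)))\<^sup>2" by (intro mult_right_mono) auto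
    also have "\<dots> \<le> (A (fst z) *v fst (grad v z)) \<bullet> fst (grad v z)" by (rule a0)
    finally have 1: "min a0 1 * (norm (fst (grad v z)))\<^sup>2 \<le> (A (fst z) *v fst (grad v z)) \<bullet> fst (grad v z)" .
    have 2: "min a0 1 * (snd (grad v z))\<^sup>2 \<le> 1 * (snd (grad v z))\<^sup>2" by (intro mult_right_mono) auto
    have "(norm (grad v z))\<^sup>2 = (norm (fst (grad v z)))\<^sup>2 + (snd (grad v z))\<^sup>2"
      by (cases "grad v z") (simp add: norm_prod_def)
    then show "min a0 1 * (norm (grad v z))\<^sup>2 \<le> coeff_integrand A 1 v v z"
      using 1 2 by (simp add: coeff_integrand_def distrib_left power2_eq_square)
  qed (use i coeff_form_estimates(1)[OF A m v v, of 1] in auto)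
  finally have 1: "min a0 1 * (l2 (hs_measure \<alpha>) (grad v))\<^sup>2 \<le> (\<integral>z. coeff_integrand A 1 v v z \<partial>hs_measure \<alpha>)" .
  have "(\<integral>x. trc v x * trc v x \<partial>lborel) = (l2 lborel (trc v))\<^sup>2" unfolding l2_power2 by (simp add: power2_eq_square)
  moreover have "min a0 1 * (\<kappa> * (l2 lborel (trc v))\<^sup>2) \<le> 1 * (\<kappa> * (l2 lborel (trc v))\<^sup>2)"
    using \<kappa> by (intro mult_right_mono) auto
  moreover have "(energy_norm \<alpha> \<kappa> v)\<^sup>2 = (l2 (hs_measure \<alpha>) (grad v))\<^sup>2 + \<kappa> * (l2 lborel (trc v))\<^sup>2"
    using \<kappa> by (simp add: energy_norm_def norm_prod_def power_mult_distrib)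
  ultimately show ?thesis using 1 by (simp add: coeff_form_def distrib_left)
qed

end

section \<open>The right-hand side\<close>

text \<open>The difference quotient is the average of the derivative over the segment, so its error is controlled by the continuity of
  translations in \<open>L\<^sup>2\<close>.\<close>

lemma L2_difference_quotient:
  fixes F :: "'a::euclidean_space => real"
  assumes wg: "has_weak_grad UNIV F G" and F [measurable]: "F \<in> borel_measurable borel" and G [measurable]: "G \<in> borel_measurable borel"
    and Gb: "sq_integrable lborel (\<lambda>x. G x \<bullet> b)" and e: "0 < e"
  shows "\<exists>d>0. \<forall>h. h \<noteq> 0 \<longrightarrow> \<bar>h\<bar> < d \<longrightarrow> sq_integrable lborel (\<lambda>x. (1 / h) * (F (x + h *\<^sub>R b) - F x) - G x \<bullet> b) \<and>
      l2 lborel (\<lambda>x. (1 / h) * (F (x + h *\<^sub>R b) - F x) - G x \<bullet> b) \<le> e"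
proof -
  obtain d where d: "0 < d" "\<And>v. norm v < d ==> l2 lborel (\<lambda>x. G (x + v) \<bullet> b - G x \<bullet> b) < e"
    using L2_translation_continuous[OF Gb e] by blast
  have d': "0 < d / (norm b + 1)" using d(1) by (simp add: add_nonneg_pos)
  have "sq_integrable lborel (\<lambda>x. (1 / h) * (F (x + h *\<^sub>R b) - F x) - G x \<bullet> b) \<and>
      l2 lborel (\<lambda>x. (1 / h) * (F (x + h *\<^sub>R b) - F x) - G x \<bullet> b) \<le> e" if h: "h \<noteq> 0" "\<bar>h\<bar> < d / (norm b + 1)" for h
  proof -
    interpret A: affine_flow UNIV F G 0 "h *\<^sub>R b" by standard (use wg in auto)
    define q where "q x = (1 / h) * (F (x + h *\<^sub>R b) - F x) - G x \<bullet> b" for x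
    have [measurable]: "q \<in> borel_measurable borel" unfolding q_def by measurable
    have small: "norm (t *\<^sub>R (h *\<^sub>R b)) < d" if t: "t \<in> {0..1}" for t
    proof -
      have "norm (t *\<^sub>R (h *\<^sub>R b)) \<le> 1 * (\<bar>h\<bar> * norm b)" using t by (simp add: abs_mult mult_left_le_one_le mult_right_mono)
      also have "\<dots> \<le> \<bar>h\<bar> * (norm b + 1)" by (simp add: mult_left_mono)
      also have "\<dots> < d" using h(2) pos_less_divide_eq[of "norm b + 1" "\<bar>h\<bar>" d] by (simp add: add_nonneg_pos)
      finally show ?thesis .
    qed
    have "(\<integral>\<^sup>+x. ennreal ((norm (q x))\<^sup>2) \<partial>lborel) \<le>
       (\<integral>\<^sup>+x. \<integral>\<^sup>+t. indicator {0..1} t * ennreal ((G (x + t *\<^sub>R (h *\<^sub>R b)) \<bullet> b - G x \<bullet> b)\<^sup>2) \<partial>lborel \<partial>lborel)"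
    proof (rule nn_integral_mono_AE)
      show "AE x in lborel. ennreal ((norm (q x))\<^sup>2) \<le> (\<integral>\<^sup>+t. indicator {0..1} t * ennreal ((G (x + t *\<^sub>R (h *\<^sub>R b)) \<bullet> b - G x \<bullet> b)\<^sup>2) \<partial>lborel)"
        using A.flow_increment
      proof eventually_elim
        case (elim x)
        then have i: "integrable lborel (A.rate x)" "F (x + h *\<^sub>R b) - F x = (\<integral>t. A.rate x t \<partial>lborel)"
          by (auto simp: A.flow_def)
        define r where "r t = (1 / h) * A.rate x t - indicator {0..1} t * (G x \<bullet> b)" for t
        have c: "integrable lborel (\<lambda>t. indicator {0..1::real} t * (G x \<bullet> b))" by simp
        have ri: "integrable lborel r" unfolding r_def using i(1) c by simp
        have rq: "(\<integral>t. r t \<partial>lborel) = q x" unfolding r_def q_def i(2) using i(1) c by simp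
        have req: "r t = indicator {0..1} t * (G (x + t *\<^sub>R (h *\<^sub>R b)) \<bullet> b - G x \<bullet> b)" for t
          using h(1) by (simp add: r_def A.rate_def A.flow_def A.speed_def right_diff_distrib)
        have r0: "t \<notin> {0..1} ==> r t = 0" for t by (simp add: req)
        have "ennreal ((norm (q x))\<^sup>2) \<le> (\<integral>\<^sup>+t. ennreal ((r t)\<^sup>2) \<partial>lborel)"
          using Jensen_unit_interval[OF ri r0] by (simp add: rq)
        also have "\<dots> = (\<integral>\<^sup>+t. indicator {0..1} t * ennreal ((G (x + t *\<^sub>R (h *\<^sub>R b)) \<bullet> b - G x \<bullet> b)\<^sup>2) \<partial>lborel)"
          by (intro nn_integral_cong) (auto simp: req indicator_def)
        finally show ?case .
      qed
    qed
    also have "\<dots> = (\<integral>\<^sup>+t. \<integral>\<^sup>+x. indicator {0..1} t * ennreal ((G (x + t *\<^sub>R (h *\<^sub>R b)) \<bullet> b - G x \<bullet> b)\<^sup>2) \<partial>lborel \<partial>lborel)"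
      by (rule lborel_pair.Fubini'[symmetric]) (simp add: case_prod_beta')
    also have "\<dots> \<le> (\<integral>\<^sup>+t. indicator {0..1} t * ennreal (e\<^sup>2) \<partial>(lborel :: real measure))"
    proof (rule nn_integral_mono)
      fix t :: real
      show "(\<integral>\<^sup>+x. indicator {0..1} t * ennreal ((G (x + t *\<^sub>R (h *\<^sub>R b)) \<bullet> b - G x \<bullet> b)\<^sup>2) \<partial>lborel) \<le> indicator {0..1} t * ennreal (e\<^sup>2)"
      proof (cases "t \<in> {0..1}")
        case True
        define v where "v = t *\<^sub>R (h *\<^sub>R b)"
        have sq: "sq_integrable lborel (\<lambda>x. G (x + v) \<bullet> b - G x \<bullet> b)"
          by (intro sq_integrable_diff Gb lborel_translate(1)[OF Gb])
        have "(\<integral>\<^sup>+x. ennreal ((G (x + v) \<bullet> b - G x \<bullet> b)\<^sup>2) \<partial>lborel) = ennreal ((l2 lborel (\<lambda>x. G (x + v) \<bullet> b - G x \<bullet> b))\<^sup>2)"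
          using nn_integral_l2[OF sq] by simp
        also have "\<dots> \<le> ennreal (e\<^sup>2)"
          using d(2)[of v] small[OF True] by (intro ennreal_leI power_mono) (auto simp: v_def)
        finally show ?thesis using True by (simp add: v_def)
      qed simp
    qed
    also have "\<dots> = ennreal (e\<^sup>2)" by (simp add: nn_integral_multc)
    finally have le: "(\<integral>\<^sup>+x. ennreal ((norm (q x))\<^sup>2) \<partial>lborel) \<le> ennreal (e\<^sup>2)" .
    have "sq_integrable lborel q" "l2 lborel q \<le> e"
      using sq_integrableI_nn[OF _ le] e by auto
    then show ?thesis unfolding q_def by blast
  qed
  then show ?thesis using d' by blast
qed

lemma mi_order_Suc: "mi_order (\<zeta>(i := Suc (\<zeta> i))) = Suc (mi_order \<zeta>)"
proof -
  have "(\<Sum>j\<in>UNIV. (\<zeta>(i := Suc (\<zeta> i))) j) = Suc (\<zeta> i) + (\<Sum>j\<in>UNIV - {i}. (\<zeta>(i := Suc (\<zeta> i))) j)"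
    by (subst sum.remove[of _ i]) auto
  moreover have "(\<Sum>j\<in>UNIV. \<zeta> j) = \<zeta> i + (\<Sum>j\<in>UNIV - {i}. \<zeta> j)" by (rule sum.remove) auto
  ultimately show ?thesis by (simp add: mi_order_def)
qed

abbreviation pairing :: "('a::euclidean_space => real) => 'a triple => real" where
  "pairing q v \<equiv> \<integral>x. q x * trc v x \<partial>lborel"

context energy_setting
begin

lemma trace_const_nonneg: "0 \<le> trace_const CARD('d) \<alpha> R"
  using \<alpha> by (simp add: trace_const_def)

text \<open>Only the trace on the ball matters, and there it is controlled by the gradient alone. The bound is therefore the same for
  all \<open>\<kappa>\<close>.\<close>

lemma trace_pairing:
  fixes q :: "real^'d => real"
  assumes q: "sq_integrable lborel q" and off: "\<forall>x. x \<notin> cball 0 R \<longrightarrow> q x = 0" and v: "v \<in> energy_triples \<alpha> \<kappa>"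
  shows "integrable lborel (\<lambda>x. q x * trc v x)"
    and "\<bar>pairing q v\<bar> \<le> l2 lborel q * trace_const CARD('d) \<alpha> R * energy_norm \<alpha> \<kappa> v"
proof -
  note V = energy_triplesD[OF v]
  have [measurable]: "trc v \<in> borel_measurable borel" by (rule V)
  have [measurable]: "cball (0::real^'d) R \<in> sets borel" by (simp add: borel_closed)
  have [measurable]: "q \<in> borel_measurable borel" using q by (auto simp: sq_integrable_def)
  define g where "g x = indicator (cball 0 R) x * trc v x" for x
  have "(\<integral>\<^sup>+x. ennreal ((norm (g x))\<^sup>2) \<partial>lborel) = (\<integral>\<^sup>+x. indicator (cball 0 R) x * ennreal ((trc v x)\<^sup>2) \<partial>lborel)"
    by (intro nn_integral_cong) (auto simp: g_def indicator_def)
  also have "\<dots> \<le> ennreal ((trace_const DIM(real^'d) \<alpha> R * l2 (hs_measure \<alpha>) (grad v))\<^sup>2)"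
    by (rule trace_bound[OF V(1) \<alpha>(1,2) _ V(2)]) (use \<alpha>(3) in simp)
  finally have le: "(\<integral>\<^sup>+x. ennreal ((norm (g x))\<^sup>2) \<partial>lborel) \<le> ennreal ((trace_const CARD('d) \<alpha> R * l2 (hs_measure \<alpha>) (grad v))\<^sup>2)" by simp
  have gm: "g \<in> borel_measurable lborel" unfolding g_def by measurable
  note g = sq_integrableI_nn[OF gm le mult_nonneg_nonneg[OF trace_const_nonneg l2_nonneg]]
  have bd: "\<bar>q x * trc v x\<bar> \<le> 1 * (norm (q x) * norm (g x))" for x
    using off by (cases "x \<in> cball 0 R") (auto simp: g_def abs_mult)
  have m: "(\<lambda>x. q x * trc v x) \<in> borel_measurable lborel" by measurable
  note P = integrable_product_l2[OF q g(1) m bd zero_le_one]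
  show "integrable lborel (\<lambda>x. q x * trc v x)" by (rule P(1))
  have "l2 lborel q * l2 lborel g \<le> l2 lborel q * (trace_const CARD('d) \<alpha> R * energy_norm \<alpha> \<kappa> v)"
    using g(2) energy_norm_ge(1)[of \<alpha> v \<kappa>] trace_const_nonneg[of R]
    by (intro mult_left_mono) (auto intro: order_trans mult_left_mono)
  then show "\<bar>pairing q v\<bar> \<le> l2 lborel q * trace_const CARD('d) \<alpha> R * energy_norm \<alpha> \<kappa> v" using P(2) by (simp add: mult.assoc)
qed

text \<open>The family \<open>F\<close> plays the role of the derivatives of the data. Shifting \<open>v\<close> by \<open>-h\<close> is shifting
  \<open>F \<zeta>\<close> by \<open>h\<close>. The radius is enlarged by 1 to contain the shifted supports.\<close>

theorem smooth_fun_trace_functional: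
  fixes F :: "('d => nat) => real^'d => real"
  assumes F: "\<And>\<zeta>. mi_order \<zeta> \<le> m ==> sq_integrable lborel (F \<zeta>)" "\<And>\<zeta>. mi_order \<zeta> \<le> m ==> l2 lborel (F \<zeta>) \<le> M"
    and off: "\<And>\<zeta>. \<forall>x. x \<notin> cball 0 R \<longrightarrow> F \<zeta> x = 0"
    and wg: "\<And>\<zeta>. mi_order \<zeta> < m ==> has_weak_grad UNIV (F \<zeta>) (\<lambda>x. \<chi> i. F (\<zeta>(i := Suc (\<zeta> i))) x)"
  shows "mi_order \<zeta> + k \<le> m ==> smooth_fun k (\<bar>D\<bar> * M * trace_const CARD('d) \<alpha> R) (\<lambda>v. D * pairing (F \<zeta>) v)"
proof -
  have M0: "0 \<le> M" if "mi_order \<zeta> \<le> m" for \<zeta> :: "'d => nat" using F(2)[OF that] l2_nonneg order_trans by blast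
  have fn: "functional (\<bar>D\<bar> * M * trace_const CARD('d) \<alpha> R) (\<lambda>v. D * pairing (F \<zeta>) v)" if z: "mi_order \<zeta> \<le> m" for \<zeta>
    unfolding functional_def
  proof (intro conjI ballI allI)
    note P = trace_pairing[OF F(1)[OF z] off]
    show "0 \<le> \<bar>D\<bar> * M * trace_const CARD('d) \<alpha> R" using M0[OF z] trace_const_nonneg[of R] by simp
    fix u v :: "(real^'d) triple" and r assume u: "u \<in> energy_triples \<alpha> \<kappa>"
    show "D * pairing (F \<zeta>) (r *\<^sub>R u) = r * (D * pairing (F \<zeta>) u)"
      unfolding triple_scale by (simp add: mult.left_commute)
    have "\<bar>D * pairing (F \<zeta>) u\<bar> \<le> \<bar>D\<bar> * (l2 lborel (F \<zeta>) * trace_const CARD('d) \<alpha> R * energy_norm \<alpha> \<kappa> u)"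
      unfolding abs_mult by (intro mult_left_mono P(2) u) auto
    also have "\<dots> \<le> \<bar>D\<bar> * (M * trace_const CARD('d) \<alpha> R * energy_norm \<alpha> \<kappa> u)"
      by (intro mult_left_mono mult_right_mono F(2) z trace_const_nonneg N_nonneg u) auto
    finally show "\<bar>D * pairing (F \<zeta>) u\<bar> \<le> \<bar>D\<bar> * M * trace_const CARD('d) \<alpha> R * energy_norm \<alpha> \<kappa> u" by (simp add: mult.assoc)
    assume v: "v \<in> energy_triples \<alpha> \<kappa>"
    show "D * pairing (F \<zeta>) (u + v) = D * pairing (F \<zeta>) u + D * pairing (F \<zeta>) v"
      unfolding triple_add using P(1)[OF u] P(1)[OF v] by (simp add: distrib_left)
  qed
  show "mi_order \<zeta> + k \<le> m ==> smooth_fun k (\<bar>D\<bar> * M * trace_const CARD('d) \<alpha> R) (\<lambda>v. D * pairing (F \<zeta>) v)"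
  proof (induction k arbitrary: \<zeta>)
    case 0
    then show ?case using fn by simp
  next
    case (Suc k)
    then have z: "mi_order \<zeta> \<le> m" "mi_order \<zeta> < m" by auto
    show ?case unfolding smooth_fun.simps
    proof (intro conjI allI fn[OF z(1)])
      fix i :: 'd
      define b :: "real^'d" where "b = axis i 1"
      define \<zeta>' where "\<zeta>' = \<zeta>(i := Suc (\<zeta> i))"
      have ord: "mi_order \<zeta>' = Suc (mi_order \<zeta>)" by (simp add: \<zeta>'_def mi_order_Suc)
      have z': "mi_order \<zeta>' \<le> m" using ord z by simp
      have s: "smooth_fun k (\<bar>D\<bar> * M * trace_const CARD('d) \<alpha> R) (\<lambda>v. D * pairing (F \<zeta>') v)"
        by (rule Suc.IH) (use ord Suc.prems in simp)
      define G where "G x = (\<chi> i. F (\<zeta>(i := Suc (\<zeta> i))) x)" for x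
      have Fb [measurable]: "F \<zeta> \<in> borel_measurable borel" "F \<zeta>' \<in> borel_measurable borel"
        using F(1)[OF z(1)] F(1)[OF z'] by (auto simp: sq_integrable_def)
      have Gb: "G \<in> borel_measurable borel"
      proof (rule borel_measurable_euclidean_space[THEN iffD2], rule ballI)
        fix c :: "real^'d" assume "c \<in> Basis"
        then obtain j where c: "c = axis j 1" by (auto simp: Basis_vec_def)
        have "mi_order (\<zeta>(j := Suc (\<zeta> j))) \<le> m" using z(2) by (simp add: mi_order_Suc)
        from F(1)[OF this] show "(\<lambda>x. G x \<bullet> c) \<in> borel_measurable borel"
          by (simp add: G_def c inner_axis sq_integrable_def)
      qed
      have Gi: "(\<lambda>x. G x \<bullet> b) = F \<zeta>'" by (simp add: G_def b_def inner_axis \<zeta>'_def fun_eq_iff)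
      have Gisq: "sq_integrable lborel (\<lambda>x. G x \<bullet> b)" unfolding Gi by (rule F(1)[OF z'])
      have "\<forall>\<^sub>F h in at 0. \<forall>v\<in>energy_triples \<alpha> \<kappa>. \<bar>(D * pairing (F \<zeta>) (shift (- h *\<^sub>R axis i 1) v) - D * pairing (F \<zeta>) v) / h
          - D * pairing (F \<zeta>') v\<bar> \<le> e * energy_norm \<alpha> \<kappa> v" if e: "0 < e" for e
      proof -
        define e' where "e' = e / (\<bar>D\<bar> * trace_const CARD('d) \<alpha> (R + 1) + 1)"
        have pos: "0 < \<bar>D\<bar> * trace_const CARD('d) \<alpha> (R + 1) + 1" using trace_const_nonneg[of "R + 1"] by (simp add: add_nonneg_pos)
        have e': "0 < e'" using e pos by (simp add: e'_def)
        have e'2: "\<bar>D\<bar> * e' * trace_const CARD('d) \<alpha> (R + 1) \<le> e"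
        proof -
          have "\<bar>D\<bar> * e' * trace_const CARD('d) \<alpha> (R + 1) = e' * (\<bar>D\<bar> * trace_const CARD('d) \<alpha> (R + 1))" by simp
          also have "\<dots> \<le> e' * (\<bar>D\<bar> * trace_const CARD('d) \<alpha> (R + 1) + 1)" using e' by (intro mult_left_mono) auto
          also have "\<dots> = e" using pos by (simp add: e'_def)
          finally show ?thesis .
        qed
        obtain d where d: "0 < d" "\<And>h. h \<noteq> 0 ==> \<bar>h\<bar> < d ==> sq_integrable lborel (\<lambda>x. (1 / h) * (F \<zeta> (x + h *\<^sub>R b) - F \<zeta> x) - F \<zeta>' x) \<and>
            l2 lborel (\<lambda>x. (1 / h) * (F \<zeta> (x + h *\<^sub>R b) - F \<zeta> x) - F \<zeta>' x) \<le> e'"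
          using L2_difference_quotient[OF wg[OF z(2), folded G_def] Fb(1) Gb Gisq e'] fun_cong[OF Gi] by auto
        have "\<bar>(D * pairing (F \<zeta>) (shift (- h *\<^sub>R axis i 1) v) - D * pairing (F \<zeta>) v) / h
          - D * pairing (F \<zeta>') v\<bar> \<le> e * energy_norm \<alpha> \<kappa> v"
          if h: "h \<noteq> 0" "\<bar>h\<bar> < min d 1" and v: "v \<in> energy_triples \<alpha> \<kappa>" for h v
        proof -
          have [measurable]: "trc v \<in> borel_measurable borel" by (rule energy_triplesD(8)[OF v])
          define q where "q x = (1 / h) * (F \<zeta> (x + h *\<^sub>R b) - F \<zeta> x) - F \<zeta>' x" for x
          have q: "sq_integrable lborel q" "l2 lborel q \<le> e'" using d(2)[of h] h unfolding q_def by auto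
          have nb: "norm b = 1" by (simp add: b_def)
          have shifted: "F \<zeta> (x + h *\<^sub>R b) = 0" "F \<zeta>'' x = 0" if "x \<notin> cball 0 (R + 1)" for x \<zeta>''
          proof -
            have x: "R + 1 < norm x" using that by simp
            then show "F \<zeta>'' x = 0" by (intro off[rule_format]) simp
            have "norm x \<le> norm (x + h *\<^sub>R b) + norm (h *\<^sub>R b)" using norm_triangle_ineq4[of "x + h *\<^sub>R b" "h *\<^sub>R b"] by simp
            then have "R < norm (x + h *\<^sub>R b)" using x h nb by simp
            then show "F \<zeta> (x + h *\<^sub>R b) = 0" by (intro off[rule_format]) simp
          qed
          have offh: "\<forall>x. x \<notin> cball 0 (R + 1) \<longrightarrow> F \<zeta> (x + h *\<^sub>R b) = 0"
            and offx: "\<forall>x. x \<notin> cball 0 (R + 1) \<longrightarrow> F \<zeta>'' x = 0"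
            and qoff: "\<forall>x. x \<notin> cball 0 (R + 1) \<longrightarrow> q x = 0" for \<zeta>''
            using shifted unfolding q_def by auto
          note P1 = trace_pairing(1)[OF lborel_translate(1)[OF F(1)[OF z(1)], of "h *\<^sub>R b"] offh v]
          note P2 = trace_pairing(1)[OF F(1)[OF z(1)] offx v] and P3 = trace_pairing(1)[OF F(1)[OF z'] offx v]
          have "pairing (F \<zeta>) (shift (- h *\<^sub>R axis i 1) v) = (\<integral>x. F \<zeta> (x + h *\<^sub>R b) * trc v x \<partial>lborel)"
            using integral_translate[of "\<lambda>x. F \<zeta> (x + h *\<^sub>R b) * trc v x" "- h *\<^sub>R b"] by (simp add: shift_def b_def)
          then have "(D * pairing (F \<zeta>) (shift (- h *\<^sub>R axis i 1) v) - D * pairing (F \<zeta>) v) / h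
             - D * pairing (F \<zeta>') v = D * ((1 / h) * ((\<integral>x. F \<zeta> (x + h *\<^sub>R b) * trc v x \<partial>lborel) - pairing (F \<zeta>) v) - pairing (F \<zeta>') v)"
            by (simp add: right_diff_distrib diff_divide_distrib)
          also have "(1 / h) * ((\<integral>x. F \<zeta> (x + h *\<^sub>R b) * trc v x \<partial>lborel) - pairing (F \<zeta>) v) - pairing (F \<zeta>') v =
              (\<integral>x. (1 / h) * (F \<zeta> (x + h *\<^sub>R b) * trc v x - F \<zeta> x * trc v x) - F \<zeta>' x * trc v x \<partial>lborel)"
            using P1 P2 P3 by simp
          also have "\<dots> = pairing q v"
            by (rule Bochner_Integration.integral_cong) (simp_all add: q_def left_diff_distrib mult.assoc)
          finally have eq: "(D * pairing (F \<zeta>) (shift (- h *\<^sub>R axis i 1) v) - D * pairing (F \<zeta>) v) / h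
             - D * pairing (F \<zeta>') v = D * pairing q v" .
          have "\<bar>D * pairing q v\<bar> \<le> \<bar>D\<bar> * (l2 lborel q * trace_const CARD('d) \<alpha> (R + 1) * energy_norm \<alpha> \<kappa> v)"
            unfolding abs_mult by (intro mult_left_mono trace_pairing(2)[OF q(1) qoff v]) auto
          also have "\<dots> \<le> \<bar>D\<bar> * (e' * trace_const CARD('d) \<alpha> (R + 1) * energy_norm \<alpha> \<kappa> v)"
            by (intro mult_left_mono mult_right_mono q trace_const_nonneg N_nonneg v) auto
          also have "\<dots> = (\<bar>D\<bar> * e' * trace_const CARD('d) \<alpha> (R + 1)) * energy_norm \<alpha> \<kappa> v" by simp
          also have "\<dots> \<le> e * energy_norm \<alpha> \<kappa> v" by (intro mult_right_mono e'2 N_nonneg v)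
          finally show ?thesis unfolding eq .
        qed
        then show ?thesis using d(1) unfolding eventually_at by (intro exI[of _ "min d 1"]) auto
      qed
      then show "\<exists>l'. (\<forall>e>0. \<forall>\<^sub>F h in at 0. \<forall>v\<in>energy_triples \<alpha> \<kappa>. \<bar>(D * pairing (F \<zeta>) (shift (- h *\<^sub>R axis i 1) v) - D * pairing (F \<zeta>) v) / h
          - l' v\<bar> \<le> e * energy_norm \<alpha> \<kappa> v) \<and> smooth_fun k (\<bar>D\<bar> * M * trace_const CARD('d) \<alpha> R) l'"
        by (intro exI[of _ "\<lambda>v. D * pairing (F \<zeta>') v"] conjI allI impI s)
    qed
  qed
qed

end

section \<open>Zero extension of the data\<close>

lemma line_derivative:
  fixes \<phi> :: "'a::euclidean_space => real"
  assumes "smooth \<phi>"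
  shows "((\<lambda>s. \<phi> (y + s *\<^sub>R a)) has_real_derivative pd a \<phi> (y + s *\<^sub>R a)) (at s)"
proof -
  have lin: "linear (frechet_derivative \<phi> (at x))" for x using smooth_has_derivative[OF assms] has_derivative_linear by blast
  have "((\<lambda>s. y + s *\<^sub>R a) has_derivative (\<lambda>h. h *\<^sub>R a)) (at s)" by (auto intro!: derivative_eq_intros)
  from has_derivative_compose[OF this smooth_has_derivative[OF assms]]
  show ?thesis unfolding has_field_derivative_def
    by (rule has_derivative_eq_rhs) (simp add: fun_eq_iff linear_cmul[OF lin] mult.commute)
qed

text \<open>The second-order difference equals \<open>h\<^sup>2\<close> times a mixed derivative at a nearby point, by the mean
  value theorem in each variable. Exchanging the roles of \<open>a\<close> and \<open>b\<close> gives Schwarz's theorem.\<close>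

lemma mixed_difference:
  fixes \<phi> :: "'a::euclidean_space => real"
  assumes \<phi>: "smooth \<phi>" and a: "a \<in> Basis" and b: "b \<in> Basis" and h: "0 < h"
  shows "\<exists>s t. 0 < s \<and> s < h \<and> 0 < t \<and> t < h \<and>
    \<phi> (x + h *\<^sub>R a + h *\<^sub>R b) - \<phi> (x + h *\<^sub>R a) - \<phi> (x + h *\<^sub>R b) + \<phi> x = h\<^sup>2 * pd b (pd a \<phi>) (x + s *\<^sub>R a + t *\<^sub>R b)"
proof -
  define f where "f s = \<phi> (x + h *\<^sub>R b + s *\<^sub>R a) - \<phi> (x + s *\<^sub>R a)" for s
  have "(f has_real_derivative pd a \<phi> (x + h *\<^sub>R b + s *\<^sub>R a) - pd a \<phi> (x + s *\<^sub>R a)) (at s)" for s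
    unfolding f_def by (intro DERIV_diff line_derivative[OF \<phi>])
  then obtain s where s: "0 < s" "s < h" "f h - f 0 = (h - 0) * (pd a \<phi> (x + h *\<^sub>R b + s *\<^sub>R a) - pd a \<phi> (x + s *\<^sub>R a))"
    using MVT2[OF h, of f "\<lambda>s. pd a \<phi> (x + h *\<^sub>R b + s *\<^sub>R a) - pd a \<phi> (x + s *\<^sub>R a)"] by blast
  have "((\<lambda>t. pd a \<phi> (x + s *\<^sub>R a + t *\<^sub>R b)) has_real_derivative pd b (pd a \<phi>) (x + s *\<^sub>R a + t *\<^sub>R b)) (at t)" for t
    by (rule line_derivative[OF smooth_partial[OF \<phi> a]])
  then obtain t where t: "0 < t" "t < h" "pd a \<phi> (x + s *\<^sub>R a + h *\<^sub>R b) - pd a \<phi> (x + s *\<^sub>R a + 0 *\<^sub>R b) = (h - 0) * pd b (pd a \<phi>) (x + s *\<^sub>R a + t *\<^sub>R b)"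
    using MVT2[OF h, of "\<lambda>t. pd a \<phi> (x + s *\<^sub>R a + t *\<^sub>R b)" "\<lambda>t. pd b (pd a \<phi>) (x + s *\<^sub>R a + t *\<^sub>R b)"] by blast
  have "f h - f 0 = \<phi> (x + h *\<^sub>R a + h *\<^sub>R b) - \<phi> (x + h *\<^sub>R a) - \<phi> (x + h *\<^sub>R b) + \<phi> x"
    by (simp add: f_def add.commute add.left_commute)
  moreover have "f h - f 0 = h * (h * pd b (pd a \<phi>) (x + s *\<^sub>R a + t *\<^sub>R b))"
    using s(3) t(3) by (simp add: add.commute add.left_commute)
  ultimately show ?thesis using s t by (intro exI[of _ s] exI[of _ t]) (simp add: power2_eq_square)
qed

lemma pd_commute:
  fixes \<phi> :: "'a::euclidean_space => real"
  assumes \<phi>: "smooth \<phi>" and a: "a \<in> Basis" and b: "b \<in> Basis"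
  shows "pd a (pd b \<phi>) = pd b (pd a \<phi>)"
proof
  fix x
  define P where "P = pd b (pd a \<phi>)"
  define Q where "Q = pd a (pd b \<phi>)"
  have cont: "continuous_on UNIV P" "continuous_on UNIV Q"
    unfolding P_def Q_def by (intro smooth_continuous smooth_partial \<phi> a b)+
  have "\<exists>p q. P p = Q q \<and> norm (p - x) \<le> 2 / real (Suc n) \<and> norm (q - x) \<le> 2 / real (Suc n)" for n
  proof -
    define h where "h = 1 / real (Suc n)"
    have h: "0 < h" by (simp add: h_def)
    obtain s t where st: "0 < s" "s < h" "0 < t" "t < h"
      "\<phi> (x + h *\<^sub>R a + h *\<^sub>R b) - \<phi> (x + h *\<^sub>R a) - \<phi> (x + h *\<^sub>R b) + \<phi> x = h\<^sup>2 * P (x + s *\<^sub>R a + t *\<^sub>R b)"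
      using mixed_difference[OF \<phi> a b h, of x] unfolding P_def by blast
    obtain s' t' where st': "0 < s'" "s' < h" "0 < t'" "t' < h"
      "\<phi> (x + h *\<^sub>R b + h *\<^sub>R a) - \<phi> (x + h *\<^sub>R b) - \<phi> (x + h *\<^sub>R a) + \<phi> x = h\<^sup>2 * Q (x + s' *\<^sub>R b + t' *\<^sub>R a)"
      using mixed_difference[OF \<phi> b a h, of x] unfolding Q_def by blast
    have "h\<^sup>2 * P (x + s *\<^sub>R a + t *\<^sub>R b) = h\<^sup>2 * Q (x + s' *\<^sub>R b + t' *\<^sub>R a)"
      unfolding st(5)[symmetric] st'(5)[symmetric] by (simp add: add.commute add.left_commute)
    then have "P (x + s *\<^sub>R a + t *\<^sub>R b) = Q (x + s' *\<^sub>R b + t' *\<^sub>R a)" using h by simp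
    moreover have "norm (x + s *\<^sub>R a + t *\<^sub>R b - x) \<le> 2 / real (Suc n)"
    proof -
      have "norm (x + s *\<^sub>R a + t *\<^sub>R b - x) \<le> norm (s *\<^sub>R a) + norm (t *\<^sub>R b)" using norm_triangle_ineq[of "s *\<^sub>R a" "t *\<^sub>R b"] by simp
      also have "\<dots> \<le> h + h" using st a b by simp
      finally show ?thesis by (simp add: h_def)
    qed
    moreover have "norm (x + s' *\<^sub>R b + t' *\<^sub>R a - x) \<le> 2 / real (Suc n)"
    proof -
      have "norm (x + s' *\<^sub>R b + t' *\<^sub>R a - x) \<le> norm (s' *\<^sub>R b) + norm (t' *\<^sub>R a)" using norm_triangle_ineq[of "s' *\<^sub>R b" "t' *\<^sub>R a"] by simp
      also have "\<dots> \<le> h + h" using st' a b by simp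
      finally show ?thesis by (simp add: h_def)
    qed
    ultimately show ?thesis by blast
  qed
  then obtain p q where pq: "\<And>n. P (p n) = Q (q n)" "\<And>n. norm (p n - x) \<le> 2 / real (Suc n)" "\<And>n. norm (q n - x) \<le> 2 / real (Suc n)" by metis
  have lim0: "(\<lambda>n. 2 / real (Suc n)) \<longlonglongrightarrow> 0"
    using tendsto_mult[OF tendsto_const LIMSEQ_Suc[OF lim_inverse_n'], of 2] by simp
  have "p \<longlonglongrightarrow> x" by (rule Lim_null[THEN iffD2], rule Lim_null_comparison[OF _ lim0]) (use pq in auto)
  then have "(\<lambda>n. P (p n)) \<longlonglongrightarrow> P x" using cont(1) by (auto simp: continuous_on_eq_continuous_at intro: isCont_tendsto_compose)
  moreover have "q \<longlonglongrightarrow> x" by (rule Lim_null[THEN iffD2], rule Lim_null_comparison[OF _ lim0]) (use pq in auto)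
  then have "(\<lambda>n. Q (q n)) \<longlonglongrightarrow> Q x" using cont(2) by (auto simp: continuous_on_eq_continuous_at intro: isCont_tendsto_compose)
  ultimately have "P x = Q x" using pq(1) LIMSEQ_unique by simp
  then show "pd a (pd b \<phi>) x = pd b (pd a \<phi>) x" by (simp add: P_def Q_def)
qed

lemma smooth_partials: "smooth \<phi> ==> set vs \<subseteq> Basis ==> smooth (partials vs \<phi>)"
proof (induction vs)
  case (Cons v vs)
  then have "smooth (partials vs \<phi>)" "v \<in> Basis" by auto
  from smooth_partial[OF this] show ?case by simp
qed simp

lemma partials_append: "partials (vs @ ws) \<phi> = partials vs (partials ws \<phi>)"
  by (induction vs) auto

lemma partials_rotate: "smooth \<phi> ==> v \<in> Basis ==> set vs \<subseteq> Basis ==> partials (v # vs) \<phi> = partials (vs @ [v]) \<phi>"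
proof (induction vs)
  case (Cons w vs)
  have "partials (v # w # vs) \<phi> = pd v (pd w (partials vs \<phi>))" by simp
  also have "\<dots> = pd w (pd v (partials vs \<phi>))"
    by (rule pd_commute[OF smooth_partials]) (use Cons.prems in auto)
  also have "\<dots> = pd w (partials (vs @ [v]) \<phi>)" using Cons by simp
  finally show ?case by simp
qed simp

text \<open>Makes the choice of the list in \<open>mi_list\<close> immaterial.\<close>

lemma partials_permute:
  fixes \<phi> :: "real^'d => real" and xs ys :: "'d list"
  assumes "smooth \<phi>" "\<And>i. count_list xs i = count_list ys i"
  shows "partials (map (\<lambda>i. axis i 1) xs) \<phi> = partials (map (\<lambda>i. axis i 1) ys) \<phi>"
  using assms
proof (induction xs arbitrary: ys \<phi>)
  case Nil
  then have "ys = []" by (metis count_list.simps(1) count_list_0_iff list.set_intros(1) neq_Nil_conv)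
  then show ?case by simp
next
  case (Cons x xs)
  have B: "axis i 1 \<in> (Basis :: (real^'d) set)" for i by (auto simp: Basis_vec_def)
  then have Bs: "set (map (\<lambda>i. axis i 1) zs) \<subseteq> (Basis :: (real^'d) set)" for zs by auto
  let ?m = "map (\<lambda>i::'d. axis i 1 :: real^'d)"
  have "count_list ys x \<noteq> 0" using Cons.prems(2)[of x] by simp
  then have "x \<in> set ys" by (simp add: count_list_0_iff)
  then obtain y1 y2 where ys: "ys = y1 @ x # y2" by (meson split_list)
  have cnt: "count_list xs i = count_list (y1 @ y2) i" for i using Cons.prems(2)[of i] unfolding ys by (auto split: if_splits)
  have "partials (?m (x # xs)) \<phi> = partials (?m xs @ [axis x 1]) \<phi>"
    using partials_rotate[OF Cons.prems(1) B Bs, of x xs] by simp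
  also have "\<dots> = partials (?m xs) (pd (axis x 1) \<phi>)" by (simp add: partials_append)
  also have "\<dots> = partials (?m (y1 @ y2)) (pd (axis x 1) \<phi>)"
    by (rule Cons.IH[OF smooth_partial[OF Cons.prems(1) B] cnt])
  also have "\<dots> = partials (?m y1) (partials (?m y2 @ [axis x 1]) \<phi>)" by (simp add: partials_append)
  also have "\<dots> = partials (?m y1) (partials (axis x 1 # ?m y2) \<phi>)"
    using partials_rotate[OF Cons.prems(1) B Bs, of x y2] by simp
  also have "\<dots> = partials (?m ys) \<phi>" by (simp add: ys partials_append)
  finally show ?case .
qed

lemma count_mi_list: "count_list (mi_list \<zeta>) i = \<zeta> i"
proof -
  have rep: "count_list (replicate n x) y = (if x = y then n else 0)" for n and x y :: 'a by (induction n) auto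
  have "\<exists>is. \<forall>i. count_list is i = (if i \<in> S then \<zeta> i else 0)" if "finite S" for S
    using that
  proof (induction S)
    case empty
    show ?case by (intro exI[of _ "[]"]) simp
  next
    case (insert j S)
    then obtain "is" where "is": "\<And>i. count_list is i = (if i \<in> S then \<zeta> i else 0)" by blast
    show ?case by (intro exI[of _ "replicate (\<zeta> j) j @ is"]) (use insert.hyps "is" rep in auto)
  qed
  from this[of UNIV] have "\<exists>is. \<forall>i. count_list is i = \<zeta> i" by simp
  from someI_ex[OF this] show ?thesis by (simp add: mi_list_def)
qed

lemma length_mi_list: "length (mi_list \<zeta>) = mi_order \<zeta>"
  using sum_count_set[of "mi_list \<zeta>" UNIV] by (simp add: count_mi_list mi_order_def)

lemma smooth_bump:
  fixes p :: "'a::euclidean_space"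
  assumes "open D" "p \<in> D"
  obtains \<eta> K V where "smooth \<eta>" "compact K" "K \<subseteq> D" "\<And>x. x \<notin> K ==> \<eta> x = 0" "open V" "p \<in> V" "\<And>x. x \<in> V ==> \<eta> x = 1"
proof -
  obtain h :: "real => real" where h: "smooth h" "\<And>t. t \<le> 0 ==> h t = 0" "\<And>t. 1 \<le> t ==> h t = 1"
    by (rule smooth_step_exists) (rule that)
  obtain l u where lu: "p \<in> box l u" "cbox l u \<subseteq> D" using open_contains_cbox[OF assms] by metis
  have lp: "l \<bullet> b < p \<bullet> b" "p \<bullet> b < u \<bullet> b" if "b \<in> Basis" for b using lu(1) that by (auto simp: mem_box)
  define m where "m = (1/2) *\<^sub>R (p + l)"
  define n where "n = (1/2) *\<^sub>R (p + u)"
  have mn: "l \<bullet> b < m \<bullet> b" "m \<bullet> b < p \<bullet> b" "p \<bullet> b < n \<bullet> b" "n \<bullet> b < u \<bullet> b" if "b \<in> Basis" for b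
    using lp[OF that] by (auto simp: m_def n_def inner_add_left)
  define \<eta> where "\<eta> x = (\<Prod>b\<in>Basis. h (1 / (m \<bullet> b - l \<bullet> b) * (x \<bullet> b) + - (l \<bullet> b) / (m \<bullet> b - l \<bullet> b)) *
     h (- 1 / (u \<bullet> b - n \<bullet> b) * (x \<bullet> b) + (u \<bullet> b) / (u \<bullet> b - n \<bullet> b)))" for x
  show ?thesis
  proof (rule that)
    show "smooth \<eta>"
    proof
      fix k
      have "C_k k (\<lambda>x::'a. h (c * (x \<bullet> b) + d))" for c d and b :: 'a
        using C_k_inner_right smooth_affine_real[OF h(1)] by blast
      then show "C_k k \<eta>" unfolding \<eta>_def by (intro C_k_prod C_k_mult)
    qed
    show "compact (cbox l u)" by (rule compact_cbox)
    show "cbox l u \<subseteq> D" by (rule lu)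
    show "\<eta> x = 0" if x: "x \<notin> cbox l u" for x
    proof -
      obtain b where b: "b \<in> Basis" "x \<bullet> b < l \<bullet> b \<or> u \<bullet> b < x \<bullet> b" using x by (auto simp: mem_box not_le)
      note m = mn[OF b(1)]
      have "1 / (m \<bullet> b - l \<bullet> b) * (x \<bullet> b) + - (l \<bullet> b) / (m \<bullet> b - l \<bullet> b) = (x \<bullet> b - l \<bullet> b) / (m \<bullet> b - l \<bullet> b)"
        "- 1 / (u \<bullet> b - n \<bullet> b) * (x \<bullet> b) + (u \<bullet> b) / (u \<bullet> b - n \<bullet> b) = (u \<bullet> b - x \<bullet> b) / (u \<bullet> b - n \<bullet> b)"
        by (simp_all add: diff_divide_distrib)
      then show ?thesis unfolding \<eta>_def using b m
        by (intro prod_zero bexI[of _ b]) (auto intro!: h(2) divide_nonpos_pos)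
    qed
    show "open (box m n)" by (rule open_box)
    show "p \<in> box m n" using mn by (auto simp: mem_box)
    show "\<eta> x = 1" if x: "x \<in> box m n" for x
      unfolding \<eta>_def
    proof (rule prod.neutral, rule ballI)
      fix b :: 'a assume b: "b \<in> Basis"
      note m = mn[OF b]
      have xb: "m \<bullet> b < x \<bullet> b" "x \<bullet> b < n \<bullet> b" using x b by (auto simp: mem_box)
      have "1 / (m \<bullet> b - l \<bullet> b) * (x \<bullet> b) + - (l \<bullet> b) / (m \<bullet> b - l \<bullet> b) = (x \<bullet> b - l \<bullet> b) / (m \<bullet> b - l \<bullet> b)"
        "- 1 / (u \<bullet> b - n \<bullet> b) * (x \<bullet> b) + (u \<bullet> b) / (u \<bullet> b - n \<bullet> b) = (u \<bullet> b - x \<bullet> b) / (u \<bullet> b - n \<bullet> b)"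
        by (simp_all add: diff_divide_distrib)
      then show "h (1 / (m \<bullet> b - l \<bullet> b) * (x \<bullet> b) + - (l \<bullet> b) / (m \<bullet> b - l \<bullet> b)) *
          h (- 1 / (u \<bullet> b - n \<bullet> b) * (x \<bullet> b) + (u \<bullet> b) / (u \<bullet> b - n \<bullet> b)) = 1"
        using m xb by (simp add: h(3) le_divide_eq_1_pos)
    qed
  qed
qed

text \<open>Admissible neighbourhoods are closed under finite unions via \<open>1 - (1 - \<eta>) (1 - \<xi>)\<close>, so compactness reduces
  the claim to points.\<close>

lemma smooth_cutoff:
  fixes K :: "'a::euclidean_space set"
  assumes K: "compact K" and D: "open D" "K \<subseteq> D"
  obtains \<eta> K' V where "smooth \<eta>" "compact K'" "K' \<subseteq> D" "\<And>x. x \<notin> K' ==> \<eta> x = 0" "open V" "K \<subseteq> V" "\<And>x. x \<in> V ==> \<eta> x = 1"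
proof -
  define good where "good V \<longleftrightarrow> open V \<and> (\<exists>\<eta> K'. smooth \<eta> \<and> compact K' \<and> K' \<subseteq> D \<and> (\<forall>x. x \<notin> K' \<longrightarrow> \<eta> x = 0) \<and> (\<forall>x\<in>V. \<eta> x = 1))" for V
  have single: "\<exists>V. good V \<and> p \<in> V" if p: "p \<in> K" for p
  proof -
    obtain \<eta> K' V where "smooth \<eta>" "compact K'" "K' \<subseteq> D" "\<And>x. x \<notin> K' ==> \<eta> x = 0" "open V" "p \<in> V" "\<And>x. x \<in> V ==> \<eta> x = 1"
      using D(1) subsetD[OF D(2) p] by (rule smooth_bump) (rule that)
    then show ?thesis unfolding good_def by (intro exI[of _ V] conjI exI[of _ \<eta>] exI[of _ K']) auto
  qed
  have un: "good (V \<union> W)" if VW: "good V" "good W" for V W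
  proof -
    obtain \<eta> K1 where c: "smooth \<eta>" "compact K1" "K1 \<subseteq> D" "\<forall>x. x \<notin> K1 \<longrightarrow> \<eta> x = 0" "\<forall>x\<in>V. \<eta> x = 1" using VW(1) unfolding good_def by blast
    obtain \<xi> K2 where d: "smooth \<xi>" "compact K2" "K2 \<subseteq> D" "\<forall>x. x \<notin> K2 \<longrightarrow> \<xi> x = 0" "\<forall>x\<in>W. \<xi> x = 1" using VW(2) unfolding good_def by blast
    have "smooth (\<lambda>x. \<eta> x + \<xi> x + (- 1) * (\<eta> x * \<xi> x))"
      using c(1) d(1) by (intro allI C_k_add C_k_mult C_k_const) auto
    then show ?thesis unfolding good_def
      using VW c d by (intro conjI exI[of _ "\<lambda>x. \<eta> x + \<xi> x + (- 1) * (\<eta> x * \<xi> x)"] exI[of _ "K1 \<union> K2"]) (auto simp: good_def)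
  qed
  have empty: "good {}" unfolding good_def by (intro conjI exI[of _ "\<lambda>x. 0"] exI[of _ "{}"]) (auto simp: C_k_const)
  have fin: "good (\<Union>F)" if "finite F" "\<forall>V\<in>F. good V" for F
    using that by (induction F rule: finite_induct) (auto intro: un empty)
  have cover: "K \<subseteq> \<Union>{V. good V}" using single by blast
  have "\<exists>F\<subseteq>{V. good V}. finite F \<and> K \<subseteq> \<Union>F"
    by (rule compactE[OF K cover]) (auto simp: good_def)
  then obtain F where F: "F \<subseteq> {V. good V}" "finite F" "K \<subseteq> \<Union>F" by blast
  have "good (\<Union>F)" by (rule fin[OF F(2)]) (use F in auto)
  then obtain \<eta> K1 where "open (\<Union>F)" "smooth \<eta>" "compact K1" "K1 \<subseteq> D" "\<forall>x. x \<notin> K1 \<longrightarrow> \<eta> x = 0" "\<forall>x\<in>\<Union>F. \<eta> x = 1" unfolding good_def by blast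
  then show ?thesis using F(3) by (intro that[of \<eta> K1 "\<Union>F"]) auto
qed

lemma partials_zero_outside:
  fixes \<phi> :: "'a::euclidean_space => real"
  assumes K: "closed K" "\<And>x. x \<notin> K ==> \<phi> x = 0"
  shows "x \<notin> K ==> partials vs \<phi> x = 0"
proof (induction vs arbitrary: x)
  case (Cons v vs)
  show ?case unfolding partials.simps by (rule pd_zero_outside[OF K(1) Cons.IH Cons.prems])
qed (simp add: K)

lemma partials_local:
  fixes \<phi> \<psi> :: "'a::euclidean_space => real"
  assumes s: "smooth \<phi>" "smooth \<psi>" and V: "open V" "\<And>x. x \<in> V ==> \<phi> x = \<psi> x" and vs: "set vs \<subseteq> Basis"
  shows "x \<in> V ==> partials vs \<phi> x = partials vs \<psi> x"
  using vs
proof (induction vs arbitrary: x)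
  case (Cons v vs)
  have d: "(partials vs \<phi> has_derivative frechet_derivative (partials vs \<phi>) (at x)) (at x)"
    by (rule smooth_has_derivative[OF smooth_partials]) (use s Cons.prems in auto)
  have "(partials vs \<psi> has_derivative frechet_derivative (partials vs \<phi>) (at x)) (at x)"
    by (rule has_derivative_transform_within_open[OF d V(1) Cons.prems(1)]) (use Cons in auto)
  from frechet_derivative_at[OF this] show ?case by simp
qed (simp add: V)

lemma test_fun_partials:
  assumes "test_fun D \<phi>" "set vs \<subseteq> Basis"
  shows "test_fun D (partials vs \<phi>)"
  using assms(2)
proof (induction vs)
  case (Cons v vs)
  then show ?case using test_fun_pd[of D "partials vs \<phi>" v] by simp
qed (simp add: assms)

lemma test_fun_mono: "test_fun D \<phi> ==> D \<subseteq> D' ==> test_fun D' \<phi>"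
  unfolding test_fun_def by blast

lemma locally_integrable_mono: "locally_integrable D u ==> D' \<subseteq> D ==> locally_integrable D' u"
  unfolding locally_integrable_def by blast

lemma set_integral_test_subset:
  fixes w :: "'a::euclidean_space => real"
  assumes "test_fun D' \<phi>" "D' \<subseteq> D"
  shows "(LINT x:D|lborel. w x * \<phi> x) = (LINT x:D'|lborel. w x * \<phi> x)"
  using set_integral_test[OF test_fun_mono[OF assms]] set_integral_test[OF assms(1)] by simp

lemma has_weak_deriv_unique:
  fixes u :: "'a::euclidean_space => real"
  assumes D: "open D" and w: "has_weak_deriv D vs u w" "has_weak_deriv D vs u w'"
  shows "AE x in lborel. x \<in> D \<longrightarrow> w x = w' x"
proof -
  have li: "locally_integrable D w" "locally_integrable D w'" using w by (auto simp: has_weak_deriv_def)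
  have "AE x in lborel. x \<in> D \<longrightarrow> 1 * w x + (- 1) * w' x = 0"
  proof (rule fundamental_lemma[OF D locally_integrable_lincomb[OF li]])
    fix \<phi> :: "'a => real" assume \<phi>: "test_fun D \<phi>"
    note i = integrable_test[OF li(1) \<phi>] integrable_test[OF li(2) \<phi>] and z = set_integral_test[OF \<phi>]
    have "(- 1) ^ length vs * (LINT x:D|lborel. w x * \<phi> x) = (- 1) ^ length vs * (LINT x:D|lborel. w' x * \<phi> x)"
      using w \<phi> unfolding has_weak_deriv_def by metis
    then have "(\<integral>x. w x * \<phi> x \<partial>lborel) = (\<integral>x. w' x * \<phi> x \<partial>lborel)" unfolding z by simp
    then show "(LINT x:D|lborel. (1 * w x + (- 1) * w' x) * \<phi> x) = 0" unfolding z using i by (simp add: left_diff_distrib)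
  qed
  then show ?thesis by eventually_elim auto
qed

text \<open>Weak derivatives are local.\<close>

lemma weak_deriv_zero_outside:
  fixes f :: "'a::euclidean_space => real"
  assumes D: "open D" and K: "closed K" and f: "\<And>x. x \<notin> K ==> f x = 0" and w: "has_weak_deriv D vs f w"
  shows "AE x in lborel. x \<in> D - K \<longrightarrow> w x = 0"
proof (rule fundamental_lemma)
  show "open (D - K)" using D K by (rule open_Diff)
  show "locally_integrable (D - K) w" using w by (auto simp: has_weak_deriv_def intro: locally_integrable_mono)
  fix \<phi> :: "'a => real" assume \<phi>: "test_fun (D - K) \<phi>"
  then obtain K1 where K1: "compact K1" "K1 \<subseteq> D - K" "\<And>x. x \<notin> K1 ==> \<phi> x = 0" "smooth \<phi>" by (rule test_funE) (rule that)
  have "partials vs \<phi> x = 0" if "x \<notin> K1" for x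
    by (rule partials_zero_outside[OF compact_imp_closed[OF K1(1)] K1(3) that])
  then have z: "f x * partials vs \<phi> x = 0" for x using f K1(2) by (cases "x \<in> K") auto
  have "(LINT x:D|lborel. f x * partials vs \<phi> x) = 0" unfolding z by (simp add: set_lebesgue_integral_def)
  then have "(LINT x:D|lborel. w x * \<phi> x) = 0"
    using w test_fun_mono[OF \<phi>, of D] by (simp add: has_weak_deriv_def)
  then show "(LINT x:D - K|lborel. w x * \<phi> x) = 0" using set_integral_test_subset[OF \<phi>, of D w] by simp
qed

text \<open>A test function on the whole space is replaced by its product with a cutoff function, which is a test function on \<open>D\<close>. Both
  integrals only see it near \<open>K\<close>, where the cutoff is 1.\<close>

theorem has_weak_deriv_zero_extension:
  fixes f :: "'a::euclidean_space => real"
  assumes D: "open D" and K: "compact K" "K \<subseteq> D" and f: "\<And>x. x \<notin> K ==> f x = 0"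
    and w: "has_weak_deriv D vs f w" and vs: "set vs \<subseteq> Basis"
  shows "has_weak_deriv UNIV vs f (\<lambda>x. indicator K x * w x)"
proof -
  have Kb [measurable]: "K \<in> sets borel" using K(1) by (simp add: compact_imp_closed)
  have li: "locally_integrable D f" "locally_integrable D w" using w by (auto simp: has_weak_deriv_def)
  have ext: "locally_integrable UNIV (\<lambda>x. indicator K x * g x)" if "locally_integrable D g" for g :: "'a => real"
    unfolding locally_integrable_def
  proof (intro allI impI)
    fix L :: "'a set" assume L: "compact L \<and> L \<subseteq> UNIV"
    have "set_integrable lborel K g" using that K by (rule locally_integrable_compact)
    then have "integrable lborel (\<lambda>x. (indicator K x * g x) * indicator L x)"
      using L by (intro integrable_real_mult_indicator) (simp_all add: set_integrable_def compact_imp_closed)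
    then show "set_integrable lborel L (\<lambda>x. indicator K x * g x)" by (simp add: set_integrable_def mult.commute)
  qed
  have fK: "f = (\<lambda>x. indicator K x * f x)" using f by (auto simp: indicator_def fun_eq_iff)
  obtain \<eta> K' V where c: "smooth \<eta>" "compact K'" "K' \<subseteq> D" "\<And>x. x \<notin> K' ==> \<eta> x = 0" "open V" "K \<subseteq> V" "\<And>x. x \<in> V ==> \<eta> x = 1"
    using K(1) D K(2) by (rule smooth_cutoff) (rule that)
  have wm: "(\<lambda>x. indicator D x * w x) \<in> borel_measurable borel" by (rule locally_integrable_measurable[OF D li(2)])
  have off: "AE x in lborel. x \<in> D - K \<longrightarrow> w x = 0" by (rule weak_deriv_zero_outside[OF D compact_imp_closed[OF K(1)] f w])
  have main: "(LINT x:UNIV|lborel. f x * partials vs \<phi> x) = (- 1) ^ length vs * (LINT x:UNIV|lborel. (indicator K x * w x) * \<phi> x)"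
    if \<phi>: "test_fun UNIV \<phi>" for \<phi>
  proof -
    have sm: "smooth \<phi>" using \<phi> by (auto simp: test_fun_def)
    have [measurable]: "\<phi> \<in> borel_measurable borel" "\<eta> \<in> borel_measurable borel" using smooth_measurable sm c(1) by blast+
    define \<psi> where "\<psi> x = \<eta> x * \<phi> x" for x
    have ps: "smooth \<psi>" unfolding \<psi>_def using c(1) sm by (auto intro: C_k_mult)
    have t: "test_fun D \<psi>" by (rule test_funI[OF ps c(2,3)]) (simp add: \<psi>_def c)
    have e: "f x * partials vs \<phi> x = f x * partials vs \<psi> x" for x
    proof (cases "x \<in> K")
      case True
      have "partials vs \<psi> x = partials vs \<phi> x"
        by (rule partials_local[OF ps sm c(5) _ vs]) (use True c in \<open>auto simp: \<psi>_def\<close>)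
      then show ?thesis by simp
    qed (simp add: f)
    have "(LINT x:UNIV|lborel. f x * partials vs \<phi> x) = (LINT x:UNIV|lborel. f x * partials vs \<psi> x)" by (simp only: e)
    also have "\<dots> = (LINT x:D|lborel. f x * partials vs \<psi> x)"
      by (rule set_integral_test_subset[OF test_fun_partials[OF t vs] subset_UNIV])
    also have "\<dots> = (- 1) ^ length vs * (LINT x:D|lborel. w x * \<psi> x)" using w t by (simp add: has_weak_deriv_def)
    also have "(LINT x:D|lborel. w x * \<psi> x) = (\<integral>x. (indicator D x * w x) * \<psi> x \<partial>lborel)"
      by (simp add: set_lebesgue_integral_def mult.assoc)
    also have "\<dots> = (\<integral>x. indicator K x * (indicator D x * w x) * \<phi> x \<partial>lborel)"
    proof (rule integral_cong_AE)
      show "(\<lambda>x. (indicator D x * w x) * \<psi> x) \<in> borel_measurable lborel"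
        using wm smooth_measurable[OF ps] by simp
      show "(\<lambda>x. indicator K x * (indicator D x * w x) * \<phi> x) \<in> borel_measurable lborel" using wm by simp
      show "AE x in lborel. (indicator D x * w x) * \<psi> x = indicator K x * (indicator D x * w x) * \<phi> x"
        using off by eventually_elim (use c(6,7) in \<open>auto simp: indicator_def \<psi>_def\<close>)
    qed
    also have "\<dots> = (LINT x:UNIV|lborel. (indicator K x * w x) * \<phi> x)"
      unfolding set_lebesgue_integral_def
      by (rule Bochner_Integration.integral_cong) (use K(2) in \<open>auto simp: indicator_def\<close>)
    finally show ?thesis .
  qed
  show ?thesis unfolding has_weak_deriv_def
    using ext[OF li(1)] ext[OF li(2)] main fK by auto
qed

lemma in_L2_iff: "in_L2 w D u \<longleftrightarrow> (\<lambda>x. indicator D x *\<^sub>R u x) \<in> borel_measurable borel \<and>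
   integrable lborel (\<lambda>x. indicator D x * (w x * (norm (u x))\<^sup>2))"
  by (simp add: in_L2_def set_borel_measurable_def set_integrable_def)

lemma set_mi_dirs: "set (mi_dirs \<zeta>) \<subseteq> Basis"
  by (auto simp: mi_dirs_def Basis_vec_def)

lemma length_mi_dirs: "length (mi_dirs \<zeta>) = mi_order \<zeta>"
  by (simp add: mi_dirs_def length_mi_list)

lemma partials_mi_dirs_Suc:
  fixes \<phi> :: "real^'d => real"
  assumes "smooth \<phi>"
  shows "partials (mi_dirs \<zeta>) (pd (axis i 1) \<phi>) = partials (mi_dirs (\<zeta>(i := Suc (\<zeta> i)))) \<phi>"
proof -
  have "partials (mi_dirs \<zeta>) (pd (axis i 1) \<phi>) = partials (map (\<lambda>i. axis i 1) (mi_list \<zeta> @ [i])) \<phi>"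
    by (simp add: mi_dirs_def partials_append)
  also have "\<dots> = partials (mi_dirs (\<zeta>(i := Suc (\<zeta> i)))) \<phi>" unfolding mi_dirs_def
    by (rule partials_permute[OF assms]) (auto simp: count_mi_list)
  finally show ?thesis .
qed

lemma L2_norm_le_Hm_norm:
  fixes f :: "real^'d => real"
  assumes "mi_order \<zeta> \<le> m"
  shows "L2_norm (\<lambda>_. 1) \<Omega> (weak_deriv \<Omega> (mi_dirs \<zeta>) f) \<le> Hm_norm m \<Omega> f"
proof -
  have "finite {\<zeta>::'d => nat. mi_order \<zeta> \<le> m}"
  proof (rule finite_subset)
    show "{\<zeta>::'d => nat. mi_order \<zeta> \<le> m} \<subseteq> PiE UNIV (\<lambda>_. {..m})"
    proof
      fix \<zeta> :: "'d => nat" assume "\<zeta> \<in> {\<zeta>. mi_order \<zeta> \<le> m}"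
      then have "\<zeta> i \<le> m" for i using member_le_sum[of i UNIV \<zeta>] by (simp add: mi_order_def)
      then show "\<zeta> \<in> PiE UNIV (\<lambda>_. {..m})" by (auto simp: PiE_iff)
    qed
  qed (rule finite_PiE, auto)
  then have "(L2_norm (\<lambda>_. 1) \<Omega> (weak_deriv \<Omega> (mi_dirs \<zeta>) f))\<^sup>2 \<le> (\<Sum>\<zeta> | mi_order \<zeta> \<le> m. (L2_norm (\<lambda>_. 1) \<Omega> (weak_deriv \<Omega> (mi_dirs \<zeta>) f))\<^sup>2)"
    using assms by (intro member_le_sum) auto
  then show ?thesis unfolding Hm_norm_def by (rule real_le_rsqrt)
qed

text \<open>Multiplying the chosen weak derivatives by the indicator of \<open>K\<close> gives derivatives on the whole space that
  vanish everywhere, not just almost everywhere, outside \<open>K\<close>.\<close>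

theorem Sobolev_zero_extension:
  fixes f :: "real^'d => real"
  assumes \<Omega>: "open \<Omega>" and supp: "compact K" "K \<subseteq> \<Omega>" "\<And>x. x \<notin> K ==> f x = 0" and f: "in_Hm m \<Omega> f"
  obtains F where "\<And>\<zeta>. mi_order \<zeta> \<le> m ==> sq_integrable lborel (F \<zeta>)" "\<And>\<zeta>. mi_order \<zeta> \<le> m ==> l2 lborel (F \<zeta>) \<le> Hm_norm m \<Omega> f"
    "\<And>\<zeta> x. x \<notin> K ==> F \<zeta> x = 0" "\<And>\<zeta>. mi_order \<zeta> < m ==> has_weak_grad UNIV (F \<zeta>) (\<lambda>x. \<chi> i. F (\<zeta>(i := Suc (\<zeta> i))) x)"
    "AE x in lborel. F (\<lambda>_. 0) x = f x" "f \<in> borel_measurable borel"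
proof -
  define w where "w \<zeta> = weak_deriv \<Omega> (mi_dirs \<zeta>) f" for \<zeta>
  define F where "F \<zeta> x = indicator K x * w \<zeta> x" for \<zeta> x
  have Kb [measurable]: "K \<in> sets borel" using supp(1) by (simp add: compact_imp_closed)
  have \<Omega>b [measurable]: "\<Omega> \<in> sets borel" using \<Omega> by simp
  have w: "has_weak_deriv \<Omega> (mi_dirs \<zeta>) f (w \<zeta>)" if "mi_order \<zeta> \<le> m" for \<zeta>
    unfolding w_def weak_deriv_def using f that by (intro someI_ex[of "has_weak_deriv \<Omega> (mi_dirs \<zeta>) f"]) (auto simp: in_Hm_def)
  have ext: "has_weak_deriv UNIV (mi_dirs \<zeta>) f (F \<zeta>)" if "mi_order \<zeta> \<le> m" for \<zeta>
    unfolding F_def[abs_def] by (rule has_weak_deriv_zero_extension[OF \<Omega> supp w[OF that] set_mi_dirs])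
  have off: "AE x in lborel. x \<in> \<Omega> - K \<longrightarrow> w \<zeta> x = 0" if "mi_order \<zeta> \<le> m" for \<zeta>
    by (rule weak_deriv_zero_outside[OF \<Omega> compact_imp_closed[OF supp(1)] supp(3) w[OF that]])
  have L2: "sq_integrable lborel (F \<zeta>) \<and> l2 lborel (F \<zeta>) \<le> Hm_norm m \<Omega> f" if z: "mi_order \<zeta> \<le> m" for \<zeta>
  proof -
    obtain w' where w': "has_weak_deriv \<Omega> (mi_dirs \<zeta>) f w'" "in_L2 (\<lambda>_. 1) \<Omega> w'" using f z by (auto simp: in_Hm_def)
    define g where "g x = indicator \<Omega> x * w' x" for x
    have "(norm (g x))\<^sup>2 = indicator \<Omega> x * (1 * (norm (w' x))\<^sup>2)" for x by (simp add: g_def indicator_def)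
    then have gsq: "sq_integrable lborel g"
      using w'(2) by (simp add: sq_integrable_def in_L2_iff g_def[abs_def])
    have wm: "(\<lambda>x. indicator \<Omega> x * w \<zeta> x) \<in> borel_measurable borel"
      by (rule locally_integrable_measurable[OF \<Omega>]) (use w[OF z] in \<open>simp add: has_weak_deriv_def\<close>)
    have "F \<zeta> = (\<lambda>x. indicator K x * (indicator \<Omega> x * w \<zeta> x))" using supp(2) by (auto simp: F_def fun_eq_iff indicator_def)
    then have Fm: "F \<zeta> \<in> borel_measurable lborel" using wm by simp
    have eq: "AE x in lborel. g x = F \<zeta> x"
      using has_weak_deriv_unique[OF \<Omega> w'(1) w[OF z]] off[OF z]
      by eventually_elim (use supp(2) in \<open>auto simp: g_def F_def indicator_def\<close>)
    note sq = sq_integrable_AE[OF gsq Fm eq]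
    have "L2_norm (\<lambda>_. 1) \<Omega> (w \<zeta>) = l2 lborel (\<lambda>x. indicator \<Omega> x * w \<zeta> x)"
      unfolding L2_norm_def l2_def set_lebesgue_integral_def
      by (intro arg_cong[where f = sqrt] Bochner_Integration.integral_cong) (auto simp: indicator_def)
    also have "\<dots> = l2 lborel g"
    proof (rule sq_integrable_AE(2)[OF gsq])
      show "(\<lambda>x. indicator \<Omega> x * w \<zeta> x) \<in> borel_measurable lborel" using wm by simp
      show "AE x in lborel. g x = indicator \<Omega> x * w \<zeta> x"
        using has_weak_deriv_unique[OF \<Omega> w'(1) w[OF z]] by eventually_elim (auto simp: g_def indicator_def)
    qed
    finally show ?thesis using sq L2_norm_le_Hm_norm[OF z, of \<Omega> f] by (simp add: w_def)
  qed
  show ?thesis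
  proof (rule that)
    show "sq_integrable lborel (F \<zeta>)" "l2 lborel (F \<zeta>) \<le> Hm_norm m \<Omega> f" if "mi_order \<zeta> \<le> m" for \<zeta> using L2[OF that] by auto
    show "F \<zeta> x = 0" if "x \<notin> K" for \<zeta> x using that by (simp add: F_def)
    show "has_weak_grad UNIV (F \<zeta>) (\<lambda>x. \<chi> i. F (\<zeta>(i := Suc (\<zeta> i))) x)" if z: "mi_order \<zeta> < m" for \<zeta>
      unfolding has_weak_grad_def
    proof
      fix b :: "real^'d" assume "b \<in> Basis"
      then obtain i where b: "b = axis i 1" and bB: "axis i 1 \<in> (Basis :: (real^'d) set)" by (auto simp: Basis_vec_def)
      define \<zeta>' where "\<zeta>' = \<zeta>(i := Suc (\<zeta> i))"
      have z': "mi_order \<zeta>' \<le> m" using z by (simp add: \<zeta>'_def mi_order_Suc)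
      note E = ext[OF less_imp_le[OF z]] and E' = ext[OF z']
      have "has_weak_deriv UNIV [b] (F \<zeta>) (F \<zeta>')"
      proof (rule has_weak_derivI1)
        show "locally_integrable UNIV (F \<zeta>)" "locally_integrable UNIV (F \<zeta>')" using E E' by (auto simp: has_weak_deriv_def)
        fix \<phi> :: "real^'d => real" assume \<phi>: "test_fun UNIV \<phi>"
        then have sm: "smooth \<phi>" by (simp add: test_fun_def)
        have 1: "(LINT x:UNIV|lborel. f x * partials (mi_dirs \<zeta>) (pd b \<phi>) x) = (- 1) ^ mi_order \<zeta> * (LINT x:UNIV|lborel. F \<zeta> x * pd b \<phi> x)"
          using E test_fun_pd[OF \<phi> bB] by (simp add: has_weak_deriv_def length_mi_dirs b)
        have 2: "(LINT x:UNIV|lborel. f x * partials (mi_dirs \<zeta>') \<phi> x) = (- 1) ^ Suc (mi_order \<zeta>) * (LINT x:UNIV|lborel. F \<zeta>' x * \<phi> x)"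
          using E' \<phi> by (simp add: has_weak_deriv_def length_mi_dirs \<zeta>'_def mi_order_Suc)
        have 3: "partials (mi_dirs \<zeta>) (pd b \<phi>) = partials (mi_dirs \<zeta>') \<phi>"
          unfolding b \<zeta>'_def by (rule partials_mi_dirs_Suc[OF sm])
        have 4: "(- 1) ^ mi_order \<zeta> * (LINT x:UNIV|lborel. F \<zeta> x * pd b \<phi> x) = (- 1) ^ mi_order \<zeta> * (- (LINT x:UNIV|lborel. F \<zeta>' x * \<phi> x))"
          using 1 2 unfolding 3 by simp
        show "(LINT x:UNIV|lborel. F \<zeta> x * pd b \<phi> x) = - (LINT x:UNIV|lborel. F \<zeta>' x * \<phi> x)"
          using 4 by (subst (asm) mult_cancel_left) simp
      qed
      then show "has_weak_deriv UNIV [b] (F \<zeta>) (\<lambda>x. (\<chi> i. F (\<zeta>(i := Suc (\<zeta> i))) x) \<bullet> b)"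
        by (simp add: b inner_axis \<zeta>'_def)
    qed
    have z0: "mi_order (\<lambda>_::'d. 0) \<le> m" by (simp add: mi_order_def)
    have "mi_dirs (\<lambda>_::'d. 0) = []" using length_mi_dirs[of "\<lambda>_::'d. 0"] by (simp add: mi_order_def)
    then have "has_weak_deriv UNIV [] f (F (\<lambda>_. 0))" using ext[OF z0] by simp
    moreover from this have "has_weak_deriv UNIV [] f f" by (simp add: has_weak_deriv_def)
    ultimately show "AE x in lborel. F (\<lambda>_. 0) x = f x" using has_weak_deriv_unique[OF open_UNIV] by fastforce
    have "locally_integrable UNIV f" using ext[OF z0] by (simp add: has_weak_deriv_def)
    from locally_integrable_measurable[OF open_UNIV this] show "f \<in> borel_measurable borel" by simp
  qed
qed

section \<open>From limits of difference quotients to weak derivatives\<close>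

lemma has_weak_deriv_Cons:
  assumes "has_weak_deriv D [v] u w'" "has_weak_deriv D vs w' w" "set vs \<subseteq> Basis"
  shows "has_weak_deriv D (v # vs) u w"
  using assms test_fun_partials[OF _ assms(3)] by (simp add: has_weak_deriv_def)

lemma difference_quotient_tendsto:
  fixes \<phi> :: "'a::euclidean_space => real"
  assumes \<phi>: "smooth \<phi>" and h: "filterlim h (at 0) sequentially"
  shows "(\<lambda>n. (\<phi> (z - h n *\<^sub>R e) - \<phi> z) / h n) \<longlonglongrightarrow> - pd e \<phi> z"
proof -
  have "((\<lambda>s. (\<phi> (z + s *\<^sub>R e) - \<phi> z) / s) \<longlongrightarrow> pd e \<phi> z) (at 0)"
    using line_derivative[OF \<phi>, of z e 0] by (simp add: DERIV_def)
  moreover have "filterlim (\<lambda>n. - h n) (at 0) sequentially"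
    using h tendsto_minus[of h 0 sequentially] by (simp add: filterlim_at)
  ultimately have "(\<lambda>n. (\<phi> (z + (- h n) *\<^sub>R e) - \<phi> z) / (- h n)) \<longlonglongrightarrow> pd e \<phi> z" by (rule filterlim_compose)
  from tendsto_minus[OF this] show ?thesis by simp
qed

text \<open>After a discrete integration by parts the difference quotients fall on the test function. There they converge pointwise,
  dominated by the maximum of the derivative on a compact set that contains all shifted supports.\<close>

lemma difference_quotient_test_tendsto:
  fixes u :: "'a::euclidean_space \<times> real => real" and a :: 'a
  assumes u: "locally_integrable half_space u" and [measurable]: "u \<in> borel_measurable borel"
    and \<phi>: "test_fun half_space \<phi>" and a: "a \<in> Basis" and h: "h \<longlonglongrightarrow> 0" "\<And>n. 0 < h n" "\<And>n. h n \<le> 1"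
  shows "(\<lambda>n. \<integral>z. u z * ((\<phi> (z - h n *\<^sub>R (a, 0)) - \<phi> z) / h n) \<partial>lborel) \<longlonglongrightarrow> - (\<integral>z. u z * pd (a, 0) \<phi> z \<partial>lborel)"
proof -
  define e where "e = (a, 0::real)"
  have e: "e \<in> Basis" using a by (simp add: e_def Basis_prod_def)
  obtain K where K: "compact K" "K \<subseteq> half_space" "\<And>x. x \<notin> K ==> \<phi> x = 0" "smooth \<phi>" using \<phi> by (rule test_funE) (rule that)
  obtain L C where C: "\<And>z. \<bar>pd e \<phi> z\<bar> \<le> C" using test_fun_bounded[OF test_fun_pd[OF \<phi> e]] by metis
  obtain K' where K': "compact K'" "K' \<subseteq> half_space" "\<And>t z. 0 \<le> t ==> t \<le> 1 ==> z \<in> K ==> (1 + t * 0) *\<^sub>R z + t *\<^sub>R e \<in> K'"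
    by (rule affine_compact_subset[OF K(1) _ K(2), of 0 e]) (auto simp: in_half_space e_def intro: that)
  have [measurable]: "\<phi> \<in> borel_measurable borel" "pd e \<phi> \<in> borel_measurable borel"
    using smooth_measurable K(4) smooth_partial[OF K(4) e] by blast+
  have [measurable]: "K' \<in> sets borel" using K'(1) by (simp add: compact_imp_closed)
  have bound: "\<bar>(\<phi> (z - h n *\<^sub>R e) - \<phi> z) / h n\<bar> \<le> indicator K' z * C" for z n
  proof (cases "z \<in> K'")
    case True
    obtain s where s: "\<phi> (z - h n *\<^sub>R e + h n *\<^sub>R e) - \<phi> (z - h n *\<^sub>R e + 0 *\<^sub>R e) = (h n - 0) * pd e \<phi> (z - h n *\<^sub>R e + s *\<^sub>R e)"
      using MVT2[OF h(2)[of n], of "\<lambda>s. \<phi> (z - h n *\<^sub>R e + s *\<^sub>R e)" "\<lambda>s. pd e \<phi> (z - h n *\<^sub>R e + s *\<^sub>R e)"] line_derivative[OF K(4)] by blast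
    have "\<bar>\<phi> (z - h n *\<^sub>R e) - \<phi> z\<bar> = h n * \<bar>pd e \<phi> (z - h n *\<^sub>R e + s *\<^sub>R e)\<bar>"
      using s h(2)[of n] by (simp add: abs_mult abs_minus_commute)
    also have "\<dots> \<le> h n * C" using h(2)[of n] C by (intro mult_left_mono) auto
    finally show ?thesis using True h(2)[of n] by (simp add: divide_le_eq mult.commute)
  next
    case False
    have "z \<notin> K" using K'(3)[of 0 z] False by auto
    moreover have "z - h n *\<^sub>R e \<notin> K" using K'(3)[of "h n" "z - h n *\<^sub>R e"] False h(2,3)[of n] by auto
    ultimately show ?thesis using K(3) False by simp
  qed
  have "(\<lambda>n. \<integral>z. u z * ((\<phi> (z - h n *\<^sub>R e) - \<phi> z) / h n) \<partial>lborel) \<longlonglongrightarrow> (\<integral>z. u z * - pd e \<phi> z \<partial>lborel)"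
  proof (rule integral_dominated_convergence)
    show "(\<lambda>z. u z * - pd e \<phi> z) \<in> borel_measurable lborel" by measurable
    show "(\<lambda>z. u z * ((\<phi> (z - h n *\<^sub>R e) - \<phi> z) / h n)) \<in> borel_measurable lborel" for n by measurable
    have "integrable lborel (\<lambda>z. indicator K' z * u z)"
      using locally_integrable_compact[OF u K'(1,2)] by (simp add: set_integrable_def)
    from integrable_mult_right[OF integrable_abs[OF this], of C]
    show "integrable lborel (\<lambda>z. C * \<bar>indicator K' z * u z\<bar>)" .
    show "AE z in lborel. (\<lambda>n. u z * ((\<phi> (z - h n *\<^sub>R e) - \<phi> z) / h n)) \<longlonglongrightarrow> u z * - pd e \<phi> z"
      by (intro AE_I2 tendsto_mult tendsto_const difference_quotient_tendsto[OF K(4)]) (simp add: filterlim_at h(1) less_imp_neq[OF h(2), symmetric])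
    show "AE z in lborel. norm (u z * ((\<phi> (z - h n *\<^sub>R e) - \<phi> z) / h n)) \<le> C * \<bar>indicator K' z * u z\<bar>" for n
    proof (rule AE_I2)
      fix z
      have "norm (u z * ((\<phi> (z - h n *\<^sub>R e) - \<phi> z) / h n)) \<le> \<bar>u z\<bar> * (indicator K' z * C)"
        unfolding real_norm_def abs_mult[of "u z"] by (intro mult_left_mono bound) auto
      then show "norm (u z * ((\<phi> (z - h n *\<^sub>R e) - \<phi> z) / h n)) \<le> C * \<bar>indicator K' z * u z\<bar>"
        by (simp add: abs_mult mult_ac)
    qed
  qed
  then show ?thesis by (simp add: e_def)
qed

context energy_setting
begin

lemma axis_pair_Basis: "(axis i 1, 0) \<in> (Basis :: ((real^'d) \<times> real) set)"
  by (auto simp: Basis_prod_def Basis_vec_def)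

text \<open>Convergence in the energy norm controls only gradients; Hardy's inequality turns it into convergence of the functions,
  which can be tested.\<close>

lemma diff_quot_limit_weak_deriv:
  fixes u w :: "(real^'d) triple"
  assumes u: "u \<in> energy_triples \<alpha> \<kappa>" and w: "w \<in> energy_triples \<alpha> \<kappa>"
    and lim: "((\<lambda>h. energy_norm \<alpha> \<kappa> (diff_quot i h u - w)) \<longlongrightarrow> 0) (at 0)"
  shows "has_weak_deriv half_space [(axis i 1, 0)] (val u) (val w)"
proof (rule has_weak_derivI1)
  note U = energy_triplesD[OF u] and W = energy_triplesD[OF w]
  note [measurable] = U(6) W(6)
  define a :: "real^'d" where "a = axis i 1"
  have a: "a \<in> Basis" by (auto simp: a_def Basis_vec_def)
  show lu: "locally_integrable half_space (val u)" and lw: "locally_integrable half_space (val w)"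
    using sq_integrable_locally(2) U(5) W(5) by blast+
  fix \<phi> :: "(real^'d) \<times> real => real" assume \<phi>: "test_fun half_space \<phi>"
  have [measurable]: "\<phi> \<in> borel_measurable borel" using \<phi> by (auto simp: test_fun_def intro: smooth_measurable)
  define h where "h n = 1 / real (Suc n)" for n
  have h: "h \<longlonglongrightarrow> 0" "0 < h n" "h n \<le> 1" for n
    unfolding h_def using LIMSEQ_Suc[OF lim_1_over_n] by auto
  define d where "d n = diff_quot i (h n) u" for n
  have dE: "d n \<in> energy_triples \<alpha> \<kappa>" for n unfolding d_def by (rule diff_quot_mem[OF u])
  have d: "val (d n) z = (1 / h n) * (val u (z + (h n *\<^sub>R a, 0)) - val u z)" for n z
    by (simp add: d_def diff_quot_def triple_scale triple_diff shift_def a_def)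
  have "filterlim h (at 0) sequentially" by (simp add: filterlim_at h(1) less_imp_neq[OF h(2), symmetric])
  from filterlim_compose[OF lim this] have lim1: "(\<lambda>n. energy_norm \<alpha> \<kappa> (d n - w)) \<longlonglongrightarrow> 0" by (simp add: d_def)
  have le: "l2 (rho_measure \<alpha>) (\<lambda>z. val (d n) z - val w z) \<le> hardy_const CARD('d) \<alpha> * energy_norm \<alpha> \<kappa> (d n - w)" for n
  proof -
    have "l2 (rho_measure \<alpha>) (val (d n - w)) \<le> hardy_const DIM(real^'d) \<alpha> * l2 (hs_measure \<alpha>) (grad (d n - w))"
      by (rule hardy_inequality[OF energy_triplesD(1)[OF E_diff[OF dE w]]]) (use \<alpha> in auto)
    also have "\<dots> \<le> hardy_const DIM(real^'d) \<alpha> * energy_norm \<alpha> \<kappa> (d n - w)"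
      using hardy_const_pos[of "CARD('d)" \<alpha>] \<alpha> by (intro mult_left_mono energy_norm_ge) auto
    finally show ?thesis by (simp add: triple_diff)
  qed
  have "(\<lambda>n. l2 (rho_measure \<alpha>) (\<lambda>z. val (d n) z - val w z)) \<longlonglongrightarrow> 0"
  proof (rule tendsto_sandwich[OF _ _ tendsto_const])
    show "(\<lambda>n. hardy_const CARD('d) \<alpha> * energy_norm \<alpha> \<kappa> (d n - w)) \<longlonglongrightarrow> 0"
      using tendsto_mult[OF tendsto_const lim1, of "hardy_const CARD('d) \<alpha>"] by simp
  qed (use le in auto)
  from rho_test_tendsto[OF \<phi> energy_triplesD(5)[OF dE] W(5) this]
  have L1: "(\<lambda>n. LINT z:half_space|lborel. val (d n) z * \<phi> z) \<longlonglongrightarrow> (LINT z:half_space|lborel. val w z * \<phi> z)" .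
  have eq: "(LINT z:half_space|lborel. val (d n) z * \<phi> z) = (\<integral>z. val u z * ((\<phi> (z - h n *\<^sub>R (a, 0)) - \<phi> z) / h n) \<partial>lborel)" for n
  proof -
    define v where "v = h n *\<^sub>R a"
    have tv: "test_fun half_space (\<lambda>z. \<phi> (z - (v, 0)))" by (rule test_fun_translate[OF \<phi>])
    have lt: "locally_integrable half_space (\<lambda>z. val u (z + (v, 0)))" by (rule locally_integrable_translate[OF lu U(6)])
    note i = integrable_test[OF lt \<phi>] integrable_test[OF lu \<phi>] integrable_test[OF lu tv] set_integral_test[OF \<phi>] set_integral_test[OF tv]
    have t: "(LINT z:half_space|lborel. val u (z + (v, 0)) * \<phi> z) = (LINT z:half_space|lborel. val u z * \<phi> (z - (v, 0)))"
      using set_integral_half_space_translate[of "\<lambda>z. val u z * \<phi> (z - (v, 0))" v] by simp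
    have "(LINT z:half_space|lborel. val (d n) z * \<phi> z) = (\<integral>z. (1 / h n) * (val u (z + (v, 0)) * \<phi> z - val u z * \<phi> z) \<partial>lborel)"
      by (subst set_integral_test[OF \<phi>]) (simp add: d v_def left_diff_distrib mult.assoc)
    also have "\<dots> = (1 / h n) * ((\<integral>z. val u z * \<phi> (z - (v, 0)) \<partial>lborel) - (\<integral>z. val u z * \<phi> z \<partial>lborel))"
      using i t by simp
    also have "\<dots> = (\<integral>z. (1 / h n) * (val u z * \<phi> (z - (v, 0)) - val u z * \<phi> z) \<partial>lborel)" using i by simp
    also have "\<dots> = (\<integral>z. val u z * ((\<phi> (z - h n *\<^sub>R (a, 0)) - \<phi> z) / h n) \<partial>lborel)"
      by (simp add: v_def right_diff_distrib diff_divide_distrib)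
    finally show ?thesis .
  qed
  have "(\<lambda>n. LINT z:half_space|lborel. val (d n) z * \<phi> z) \<longlonglongrightarrow> - (\<integral>z. val u z * pd (a, 0) \<phi> z \<partial>lborel)"
    unfolding eq by (rule difference_quotient_test_tendsto[OF lu U(6) \<phi> a h])
  then have "(LINT z:half_space|lborel. val w z * \<phi> z) = - (\<integral>z. val u z * pd (a, 0) \<phi> z \<partial>lborel)"
    using L1 LIMSEQ_unique by blast
  also have "(\<integral>z. val u z * pd (a, 0) \<phi> z \<partial>lborel) = (LINT z:half_space|lborel. val u z * pd (a, 0) \<phi> z)"
    by (rule set_integral_test[OF test_fun_pd[OF \<phi>], symmetric]) (use axis_pair_Basis in \<open>simp add: a_def\<close>)
  finally show "(LINT z:half_space|lborel. val u z * pd (axis i 1, 0) \<phi> z) = - (LINT z:half_space|lborel. val w z * \<phi> z)"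
    by (simp add: a_def)
qed

theorem smooth_vec_weak_deriv:
  "smooth_vec k M u ==> length js = k ==>
    \<exists>w\<in>energy_triples \<alpha> \<kappa>. energy_norm \<alpha> \<kappa> w \<le> M \<and> has_weak_deriv half_space (map (\<lambda>i. (axis i 1, 0)) js) (val u) (val w)"
proof (induction k arbitrary: u js)
  case 0
  then have u: "u \<in> energy_triples \<alpha> \<kappa>" by simp
  show ?case using 0 sq_integrable_locally(2)[OF energy_triplesD(5)[OF u]]
    by (intro bexI[of _ u]) (auto simp: has_weak_deriv_def)
next
  case (Suc k)
  then obtain i is' where js: "js = i # is'" "length is' = k" by (auto simp: length_Suc_conv)
  obtain w where w: "((\<lambda>h. energy_norm \<alpha> \<kappa> (diff_quot i h u - w)) \<longlongrightarrow> 0) (at 0)" "smooth_vec k M w"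
    using Suc.prems(1) by (rule smooth_vec_SucE[where i=i]) (rule that)
  obtain w' where w': "w' \<in> energy_triples \<alpha> \<kappa>" "energy_norm \<alpha> \<kappa> w' \<le> M" "has_weak_deriv half_space (map (\<lambda>i. (axis i 1, 0)) is') (val w) (val w')"
    using Suc.IH[OF w(2) js(2)] by blast
  have "has_weak_deriv half_space ((axis i 1, 0) # map (\<lambda>i. (axis i 1, 0)) is') (val u) (val w')"
    by (rule has_weak_deriv_Cons[OF diff_quot_limit_weak_deriv[OF smooth_vec_mem[OF Suc.prems(1)] smooth_vec_mem[OF w(2)] w(1)] w'(3)])
       (use axis_pair_Basis in auto)
  then show ?case using w' js by auto
qed

end

section \<open>The variational problem in terms of triples\<close>

lemma integral_hs:
  assumes "F \<in> borel_measurable borel"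
  shows "(\<integral>z. F z \<partial>hs_measure \<alpha>) = (\<integral>z. (indicator half_space z * y_weight \<alpha> z) * F z \<partial>(lborel :: ('a::euclidean_space \<times> real) measure))"
  unfolding hs_measure_def using assms by (subst integral_density) auto

lemma L2_norm_hs:
  fixes G :: "'a::euclidean_space \<times> real => 'b::euclidean_space"
  assumes [measurable]: "G \<in> borel_measurable borel"
  shows "L2_norm (y_weight \<alpha>) half_space G = l2 (hs_measure \<alpha>) G"
  unfolding L2_norm_def l2_def set_lebesgue_integral_def by (subst integral_hs) (auto simp: mult.assoc)

lemma in_L2_hs:
  fixes G :: "'a::euclidean_space \<times> real => 'b::euclidean_space"
  shows "in_L2 (y_weight \<alpha>) half_space G \<longleftrightarrow> sq_integrable (hs_measure \<alpha>) (\<lambda>z. indicator half_space z *\<^sub>R G z)"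
    and "in_L2 (\<lambda>z. y_weight \<alpha> z * (1 / (rho z)\<^sup>2)) half_space G \<longleftrightarrow> sq_integrable (rho_measure \<alpha>) (\<lambda>z. indicator half_space z *\<^sub>R G z)"
proof -
  have *: "in_L2 w half_space G \<longleftrightarrow> sq_integrable (density lborel (\<lambda>z. ennreal (indicator half_space z * w z))) (\<lambda>z. indicator half_space z *\<^sub>R G z)"
    if [measurable]: "w \<in> borel_measurable borel" and nn: "\<And>z. 0 \<le> w z" for w :: "'a \<times> real => real"
  proof (cases "(\<lambda>z. indicator half_space z *\<^sub>R G z) \<in> borel_measurable borel")
    case True
    then have m: "(\<lambda>z. (norm (indicator half_space z *\<^sub>R G z))\<^sup>2) \<in> borel_measurable borel" by measurable
    have "integrable (density lborel (\<lambda>z. ennreal (indicator half_space z * w z))) (\<lambda>z. (norm (indicator half_space z *\<^sub>R G z))\<^sup>2) \<longleftrightarrow>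
        integrable lborel (\<lambda>z. (indicator half_space z * w z) *\<^sub>R (norm (indicator half_space z *\<^sub>R G z))\<^sup>2)"
      by (rule integrable_density) (use m nn in auto)
    also have "(\<lambda>z. (indicator half_space z * w z) *\<^sub>R (norm (indicator half_space z *\<^sub>R G z))\<^sup>2) = (\<lambda>z. indicator half_space z * (w z * (norm (G z))\<^sup>2))"
      by (auto simp: indicator_def fun_eq_iff)
    finally show ?thesis using True by (simp add: in_L2_iff sq_integrable_def)
  qed (simp add: in_L2_iff sq_integrable_def)
  show "in_L2 (y_weight \<alpha>) half_space G \<longleftrightarrow> sq_integrable (hs_measure \<alpha>) (\<lambda>z. indicator half_space z *\<^sub>R G z)"
    unfolding hs_measure_def by (rule *) auto
  show "in_L2 (\<lambda>z. y_weight \<alpha> z * (1 / (rho z)\<^sup>2)) half_space G \<longleftrightarrow> sq_integrable (rho_measure \<alpha>) (\<lambda>z. indicator half_space z *\<^sub>R G z)"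
    unfolding rho_measure_def by (rule *) auto
qed

lemma in_L2_hs_of_sq_integrable:
  fixes G :: "'a::euclidean_space \<times> real => 'b::euclidean_space"
  shows "sq_integrable (hs_measure \<alpha>) G ==> in_L2 (y_weight \<alpha>) half_space G"
    and "sq_integrable (rho_measure \<alpha>) G ==> in_L2 (\<lambda>z. y_weight \<alpha> z * (1 / (rho z)\<^sup>2)) half_space G"
  unfolding in_L2_hs
proof -
  assume G: "sq_integrable (hs_measure \<alpha>) G"
  then have [measurable]: "G \<in> borel_measurable borel" by (simp add: sq_integrable_def measurable_cong_sets[OF sets_hs_measure refl])
  show "sq_integrable (hs_measure \<alpha>) (\<lambda>z. indicator half_space z *\<^sub>R G z)"
    by (rule sq_integrable_AE(1)[OF G]) (auto simp: AE_hs)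
next
  assume G: "sq_integrable (rho_measure \<alpha>) G"
  then have [measurable]: "G \<in> borel_measurable borel" by (simp add: sq_integrable_def measurable_cong_sets[OF sets_rho_measure refl])
  show "sq_integrable (rho_measure \<alpha>) (\<lambda>z. indicator half_space z *\<^sub>R G z)"
    by (rule sq_integrable_AE(1)[OF G]) (auto simp: AE_rho)
qed

lemma in_L2_lborel: "in_L2 (\<lambda>_. 1) UNIV g \<longleftrightarrow> sq_integrable lborel g"
  by (simp add: in_L2_iff sq_integrable_def)

lemma has_weak_deriv_cong:
  assumes "\<And>x. x \<in> D ==> u x = u' x" "\<And>x. x \<in> D ==> w x = w' x"
  shows "has_weak_deriv D vs u w \<longleftrightarrow> has_weak_deriv D vs u' w'"
proof -
  have li: "locally_integrable D f \<longleftrightarrow> locally_integrable D g" if "\<forall>x\<in>D. f x = g x" for f g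
  proof -
    have "set_integrable lborel K f \<longleftrightarrow> set_integrable lborel K g" if "compact K \<and> K \<subseteq> D" for K
      by (rule set_integrable_cong) (use that \<open>\<forall>x\<in>D. f x = g x\<close> in auto)
    then show ?thesis unfolding locally_integrable_def by blast
  qed
  have e: "(LINT x:D|lborel. f x * \<phi> x) = (LINT x:D|lborel. g x * \<phi> x)" if "\<forall>x\<in>D. f x = g x" for f g \<phi>
    unfolding set_lebesgue_integral_def by (rule Bochner_Integration.integral_cong) (use that in \<open>auto simp: indicator_def\<close>)
  have "\<forall>x\<in>D. u x = u' x" "\<forall>x\<in>D. w x = w' x" using assms by auto
  then show ?thesis unfolding has_weak_deriv_def using li[of u u'] li[of w w'] e[of u u'] e[of w w'] by simp
qed

lemma is_trace0_cong:
  fixes U V :: "'a::euclidean_space \<times> real => real"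
  assumes "\<And>z. z \<in> half_space ==> U z = V z"
  shows "is_trace0 U g \<longleftrightarrow> is_trace0 V g"
proof -
  have "(\<integral>\<^sup>+z. indicator (K \<times> {0<..<h}) z * ennreal ((U z - g (fst z))\<^sup>2) \<partial>lborel) =
      (\<integral>\<^sup>+z. indicator (K \<times> {0<..<h}) z * ennreal ((V z - g (fst z))\<^sup>2) \<partial>lborel)" for K and h :: real
    by (rule nn_integral_cong) (use assms in \<open>auto simp: indicator_def in_half_space\<close>)
  then show ?thesis unfolding is_trace0_def by simp
qed

lemma has_weak_grad_unique:
  fixes G H :: "'a::euclidean_space => 'a"
  assumes D: "open D" and G: "has_weak_grad D u G" and H: "has_weak_grad D u H"
  shows "AE x in lborel. x \<in> D \<longrightarrow> G x = H x"
proof -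
  have "AE x in lborel. \<forall>b\<in>Basis. x \<in> D \<longrightarrow> G x \<bullet> b = H x \<bullet> b"
    using has_weak_deriv_unique[OF D] G H unfolding has_weak_grad_def by (intro AE_finite_allI) auto
  then show ?thesis by eventually_elim (auto intro: euclidean_eqI)
qed

text \<open>The values outside the half space are set to 0 to obtain Borel functions.\<close>

definition triple_of :: "('a::euclidean_space \<times> real => real) => 'a triple" where
  "triple_of U = (\<lambda>z. indicator half_space z * U z, \<lambda>z. indicator half_space z *\<^sub>R weak_grad half_space U z, tr0 U)"

lemma trc_triple_of: "trc (triple_of U) = tr0 U"
  by (simp add: triple_of_def)

lemma triple_of_mem:
  fixes U :: "(real^'d) \<times> real => real"
  assumes U: "U \<in> energy_space \<beta> s" and \<beta>: "0 < \<beta>" "\<beta> < 1" and \<kappa>: "0 < \<kappa> ==> 0 < s"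
  shows "triple_of U \<in> energy_triples (1 - 2 * \<beta>) \<kappa>"
proof -
  let ?\<alpha> = "1 - 2 * \<beta>"
  define u where "u z = indicator half_space z * U z" for z
  define W where "W z = indicator half_space z *\<^sub>R weak_grad half_space U z" for z
  have "in_H1rho ?\<alpha> half_space U" using U by (simp add: energy_space_def)
  then obtain G where G: "has_weak_grad half_space U G" "in_L2 (y_weight ?\<alpha>) half_space G"
    and rU: "in_L2 (\<lambda>z. y_weight ?\<alpha> z * (1 / (rho z)\<^sup>2)) half_space U" by (auto simp: in_H1rho_def)
  have wg: "has_weak_grad half_space U (weak_grad half_space U)" unfolding weak_grad_def by (rule someI[of "has_weak_grad half_space U", OF G(1)])
  have usq: "sq_integrable (rho_measure ?\<alpha>) u" using rU unfolding in_L2_hs by (simp add: u_def[abs_def])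
  have Wm: "W \<in> borel_measurable borel"
  proof (rule borel_measurable_euclidean_space[THEN iffD2], rule ballI)
    fix b :: "(real^'d) \<times> real" assume "b \<in> Basis"
    from locally_integrable_measurable[OF open_half_space has_weak_grad_locally_integrable(2)[OF wg this]]
    show "(\<lambda>z. W z \<bullet> b) \<in> borel_measurable borel" by (simp add: W_def)
  qed
  have Wsq: "sq_integrable (hs_measure ?\<alpha>) W"
  proof (rule sq_integrable_AE(1)[OF G(2)[unfolded in_L2_hs]])
    show "W \<in> borel_measurable (hs_measure ?\<alpha>)" using Wm by simp
    show "AE z in hs_measure ?\<alpha>. indicator half_space z *\<^sub>R G z = W z"
      unfolding AE_hs using has_weak_grad_unique[OF open_half_space G(1) wg] by eventually_elim (auto simp: W_def)
  qed
  have "has_weak_grad half_space u W"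
    unfolding has_weak_grad_def
  proof
    fix b :: "(real^'d) \<times> real" assume "b \<in> Basis"
    then have "has_weak_deriv half_space [b] U (\<lambda>z. weak_grad half_space U z \<bullet> b)" using wg by (simp add: has_weak_grad_def)
    then show "has_weak_deriv half_space [b] u (\<lambda>z. W z \<bullet> b)"
      by (rule has_weak_deriv_cong[THEN iffD1, rotated 2]) (auto simp: u_def W_def)
  qed
  then have H: "H1 ?\<alpha> u W" using usq Wsq by (simp add: H1_def)
  have cong: "is_trace0 u g \<longleftrightarrow> is_trace0 U g" for g by (rule is_trace0_cong) (simp add: u_def)
  obtain g where "is_trace0 u g" by (rule trace_exists[OF H]) (use \<beta> in \<open>auto intro: that\<close>)
  then have "is_trace0 U g" using cong by simp
  then have "is_trace0 U (tr0 U)" unfolding tr0_def by (rule someI[of "is_trace0 U"])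
  then have "is_trace0 u (tr0 U)" using cong by simp
  moreover have "sq_integrable lborel (tr0 U)" if "0 < \<kappa>" using U \<kappa>[OF that] by (simp add: energy_space_def in_L2_lborel)
  ultimately show ?thesis using H by (simp add: energy_triples_def triple_of_def u_def[abs_def] W_def[abs_def])
qed

text \<open>Conversely, the chosen trace and gradient of the first component of a triple agree with the stored ones up to
  null sets, so testing with triples is the same as testing with functions.\<close>

lemma val_energy_space:
  fixes v :: "(real^'d) triple"
  assumes v: "v \<in> energy_triples (1 - 2 * \<beta>) \<kappa>" and \<kappa>: "0 < s \<longrightarrow> 0 < \<kappa>"
  shows "val v \<in> energy_space \<beta> s" and "AE x in lborel. tr0 (val v) x = trc v x" and "tr0 (val v) \<in> borel_measurable borel"
    and "AE z in hs_measure (1 - 2 * \<beta>). grad (triple_of (val v)) z = grad v z"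
proof -
  let ?\<alpha> = "1 - 2 * \<beta>"
  note V = energy_triplesD[OF v]
  have wg: "has_weak_grad half_space (val v) (grad v)" using V(1) by (simp add: H1_def)
  have tr: "is_trace0 (val v) (tr0 (val v))" unfolding tr0_def by (rule someI[of "is_trace0 (val v)", OF V(2)])
  show eq: "AE x in lborel. tr0 (val v) x = trc v x" by (rule trace_unique[OF V(6) tr V(2)])
  show m: "tr0 (val v) \<in> borel_measurable borel" using tr by (simp add: is_trace0_def)
  have "sq_integrable lborel (tr0 (val v))" if "0 < s"
    by (rule sq_integrable_AE(1)[OF V(3)[OF \<kappa>[rule_format, OF that]]]) (use m eq in auto)
  then show "val v \<in> energy_space \<beta> s"
    using wg in_L2_hs_of_sq_integrable(1)[OF V(4)] in_L2_hs_of_sq_integrable(2)[OF V(5)]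
    unfolding energy_space_def in_H1rho_def in_L2_lborel by blast
  have "has_weak_grad half_space (val v) (weak_grad half_space (val v))" unfolding weak_grad_def by (rule someI[of "has_weak_grad half_space (val v)", OF wg])
  from has_weak_grad_unique[OF open_half_space this wg]
  show "AE z in hs_measure ?\<alpha>. grad (triple_of (val v)) z = grad v z"
    unfolding AE_hs by eventually_elim (auto simp: triple_of_def)
qed

context energy_setting
begin

lemma bilinear_A_eq_coeff_form:
  fixes A :: "real^'d => real^'d^'d"
  assumes A: "continuous_on UNIV A" and m: "\<And>x. norm (A x) \<le> m"
    and eq: "\<alpha> = 1 - 2 * \<beta>" "\<kappa> = s * d_beta \<beta>"
    and U: "triple_of U \<in> energy_triples \<alpha> \<kappa>" and V: "triple_of V \<in> energy_triples \<alpha> \<kappa>"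
  shows "bilinear_A \<beta> s A U V = coeff_form \<alpha> \<kappa> A 1 (triple_of U) (triple_of V)"
proof -
  have "integrable (hs_measure \<alpha>) (coeff_integrand A 1 (triple_of U) (triple_of V))"
    by (rule coeff_form_estimates(1)[OF A m U V])
  then have meas: "coeff_integrand A 1 (triple_of U) (triple_of V) \<in> borel_measurable borel" using borel_measurable_integrable by fastforce
  have "(LINT z:half_space|lborel. y_weight \<alpha> z * (ext_coeff A (fst z) (weak_grad half_space U z) \<bullet> weak_grad half_space V z)) =
      (\<integral>z. coeff_integrand A 1 (triple_of U) (triple_of V) z \<partial>hs_measure \<alpha>)"
    unfolding integral_hs[OF meas] set_lebesgue_integral_def
    by (rule Bochner_Integration.integral_cong)
       (auto simp: indicator_def coeff_integrand_def triple_of_def ext_coeff_def inner_prod_def)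
  then show ?thesis by (simp add: bilinear_A_def coeff_form_def triple_of_def eq)
qed

lemma coeff_form_AE_eq:
  fixes A :: "real^'d => real^'d^'d"
  assumes A: "continuous_on UNIV A" and m: "\<And>x. norm (A x) \<le> m"
    and u: "u \<in> energy_triples \<alpha> \<kappa>" and v: "v \<in> energy_triples \<alpha> \<kappa>" and w: "w \<in> energy_triples \<alpha> \<kappa>"
    and eq: "AE z in hs_measure \<alpha>. grad v z = grad w z" "AE x in lborel. trc v x = trc w x"
  shows "coeff_form \<alpha> \<kappa> A c u v = coeff_form \<alpha> \<kappa> A c u w"
proof -
  have d: "v - w \<in> energy_triples \<alpha> \<kappa>" by (rule energy_triples_diff[OF v w])
  have "l2 (hs_measure \<alpha>) (grad (v - w)) = 0" "l2 lborel (trc (v - w)) = 0"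
    using eq unfolding l2_def triple_diff fst_conv snd_conv real_sqrt_eq_0_iff by (auto intro!: integral_eq_zero_AE)
  then have "energy_norm \<alpha> \<kappa> (v - w) = 0" by (simp add: energy_norm_def)
  then have "coeff_form \<alpha> \<kappa> A c u (v - w) = 0" using coeff_form_estimates(3)[OF A m u d, of c] by simp
  moreover have "coeff_form \<alpha> \<kappa> A c u ((v - w) + w) = coeff_form \<alpha> \<kappa> A c u (v - w) + coeff_form \<alpha> \<kappa> A c u w"
    by (rule coeff_form_linear(2)[OF A m d w u])
  ultimately show ?thesis by simp
qed

end

lemma d_beta_pos: "0 < \<beta> ==> \<beta> < 1 ==> 0 < d_beta \<beta>"
  by (simp add: d_beta_def Gamma_real_pos)

section \<open>Regularity in the tangential directions\<close>

theorem proposition2p8: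
  fixes \<beta> \<sigma>\<^sub>0 :: real
    and \<Omega> :: "(real^'d) set"
    and A :: "real^'d \<Rightarrow> real^'d^'d"
    and m :: nat
  assumes "CARD('d) = 2 \<or> CARD('d) = 3"
    and "0 < \<beta>" "\<beta> < 1"
    and "0 < \<sigma>\<^sub>0"
    and "bounded_Lipschitz_domain \<Omega>"
    and "admissible_coeff \<Omega> A"
    and "C_k m A"
  shows "\<exists>C. \<forall>(s::real) (f :: real^'d \<Rightarrow> real) (U :: (real^'d) \<times> real \<Rightarrow> real).
           0 \<le> s \<longrightarrow> (CARD('d) = 2 \<longrightarrow> \<sigma>\<^sub>0 \<le> s) \<longrightarrow>
           closure {x. f x \<noteq> 0} \<subseteq> \<Omega> \<longrightarrow> in_Hm m \<Omega> f \<longrightarrow>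
           variational_solution \<beta> s A f U \<longrightarrow>
           (\<forall>\<zeta>. mi_order \<zeta> = m \<longrightarrow>
              (\<exists>W G. has_weak_deriv half_space (mi_xdirs \<zeta>) U W \<and>
                     has_weak_grad half_space W G \<and>
                     in_L2 (y_weight (1 - 2 * \<beta>)) half_space G \<and>
                     L2_norm (y_weight (1 - 2 * \<beta>)) half_space G \<le> C * Hm_norm m \<Omega> f))"
proof -
  define \<alpha> where "\<alpha> = 1 - 2 * \<beta>"
  have \<alpha>: "-1 < \<alpha>" "\<alpha> < 1" "1 < real CARD('d) + \<alpha>" using assms(1-3) by (auto simp: \<alpha>_def)
  have \<Omega>: "open \<Omega>" "bounded \<Omega>" using assms(5) by (auto simp: bounded_Lipschitz_domain_def)
  obtain a0 where a0: "0 < a0" "\<And>x \<eta>. a0 * (norm \<eta>)\<^sup>2 \<le> (A x *v \<eta>) \<bullet> \<eta>" using assms(6) by (auto simp: admissible_coeff_def)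
  have Kc: "compact (closure \<Omega>)" using \<Omega>(2) by (simp add: compact_closure)
  have off: "\<And>x. x \<notin> closure \<Omega> ==> A x = mat 1" using assms(6) by (auto simp: admissible_coeff_def)
  obtain mA where mA: "coeff_bound m mA A" using coeff_bound_exists[OF assms(7) Kc off] by blast
  have nA: "norm (A x) \<le> mA" for x using mA by (cases m) auto
  have cA: "continuous_on UNIV A" by (rule C_k_continuous[OF assms(7)])
  obtain R where R: "\<Omega> \<subseteq> cball 0 R" using \<Omega>(2) by (auto simp: bounded_iff subset_iff)
  \<comment> \<open>the bound and the coercivity constant of the form; neither involves \<open>s\<close>\<close>
  define B where "B = mA + 2"
  define c where "c = min a0 1"
  define C where "C = regularity_const B c m * (\<bar>d_beta \<beta>\<bar> * trace_const CARD('d) \<alpha> R)"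
  have B: "0 \<le> B" using nA[of 0] norm_ge_zero[of "A 0"] unfolding B_def by linarith
  have c: "0 < c" using a0 by (simp add: c_def)
  show ?thesis
  proof (intro exI[of _ C] allI impI)
    fix s :: real and f :: "real^'d => real" and U :: "(real^'d) \<times> real => real" and \<zeta> :: "'d => nat"
    assume s: "0 \<le> s" and supp: "closure {x. f x \<noteq> 0} \<subseteq> \<Omega>" and f: "in_Hm m \<Omega> f"
      and sol: "variational_solution \<beta> s A f U" and \<zeta>: "mi_order \<zeta> = m"
    define \<kappa> where "\<kappa> = s * d_beta \<beta>"
    have db: "0 < d_beta \<beta>" by (rule d_beta_pos) fact+
    have pos: "0 \<le> \<kappa>" "0 < \<kappa> ==> 0 < s" "0 < s \<longrightarrow> 0 < \<kappa>" using s db by (auto simp: \<kappa>_def zero_less_mult_iff)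
    interpret energy_setting \<alpha> \<kappa> "TYPE('d)" by standard (use \<alpha> pos in auto)
    define Kf where "Kf = closure {x. f x \<noteq> 0}"
    have Kf: "compact Kf" "Kf \<subseteq> \<Omega>" unfolding Kf_def using supp bounded_subset[OF \<Omega>(2)] closure_subset[of "{x. f x \<noteq> 0}"] by (auto simp: compact_closure)
    have f0: "\<And>x. x \<notin> Kf ==> f x = 0" unfolding Kf_def using closure_subset[of "{x. f x \<noteq> 0}"] by blast
    obtain F where F: "\<And>\<zeta>. mi_order \<zeta> \<le> m ==> sq_integrable lborel (F \<zeta>)" "\<And>\<zeta>. mi_order \<zeta> \<le> m ==> l2 lborel (F \<zeta>) \<le> Hm_norm m \<Omega> f"
      "\<And>\<zeta> x. x \<notin> Kf ==> F \<zeta> x = 0" "\<And>\<zeta>. mi_order \<zeta> < m ==> has_weak_grad UNIV (F \<zeta>) (\<lambda>x. \<chi> i. F (\<zeta>(i := Suc (\<zeta> i))) x)"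
      "AE x in lborel. F (\<lambda>_. 0) x = f x" "f \<in> borel_measurable borel"
      using \<Omega>(1) Kf f0 f by (rule Sobolev_zero_extension) (assumption, rule that)
    have Foff: "\<And>\<zeta>. \<forall>x. x \<notin> cball 0 R \<longrightarrow> F \<zeta> x = 0" using F(3) Kf(2) R by blast
    have z0: "mi_order (\<lambda>_::'d. 0) + m \<le> m" by (simp add: mi_order_def)
    define l where "l v = d_beta \<beta> * (\<integral>x. F (\<lambda>_. 0) x * trc v x \<partial>lborel)" for v :: "(real^'d) triple"
    have l: "smooth_fun m (\<bar>d_beta \<beta>\<bar> * Hm_norm m \<Omega> f * trace_const CARD('d) \<alpha> R) l"
      unfolding l_def[abs_def] by (rule smooth_fun_trace_functional[OF F(1,2) Foff F(4) z0])
    have form: "smooth_form m B (coeff_form \<alpha> \<kappa> A 1)"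
      using smooth_form_coeff[OF assms(7) mA Kc off, of 1] by (simp add: B_def)
    have coer: "c * (energy_norm \<alpha> \<kappa> v)\<^sup>2 \<le> coeff_form \<alpha> \<kappa> A 1 v v" if "v \<in> energy_triples \<alpha> \<kappa>" for v
      unfolding c_def by (rule coeff_form_coercive[OF cA nA a0 that])
    have UE: "U \<in> energy_space \<beta> s" using sol by (simp add: variational_solution_def)
    have u: "triple_of U \<in> energy_triples \<alpha> \<kappa>"
      unfolding \<alpha>_def by (rule triple_of_mem[OF UE assms(2,3) pos(2)])
    have eq: "coeff_form \<alpha> \<kappa> A 1 (triple_of U) v = l v" if v: "v \<in> energy_triples \<alpha> \<kappa>" for v
    proof -
      note V = val_energy_space[where s = s, OF v[unfolded \<alpha>_def] pos(3), folded \<alpha>_def]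
      \<comment> \<open>the variational equation refers to the chosen gradient and trace of \<open>val v\<close>, not to those stored in \<open>v\<close>\<close>
      have V': "triple_of (val v) \<in> energy_triples \<alpha> \<kappa>" unfolding \<alpha>_def by (rule triple_of_mem[OF V(1) assms(2,3) pos(2)])
      have "coeff_form \<alpha> \<kappa> A 1 (triple_of U) v = coeff_form \<alpha> \<kappa> A 1 (triple_of U) (triple_of (val v))"
        by (rule coeff_form_AE_eq[OF cA nA u V' v V(4), symmetric]) (rule V(2)[folded trc_triple_of])
      also have "\<dots> = bilinear_A \<beta> s A U (val v)"
        by (rule bilinear_A_eq_coeff_form[OF cA nA \<alpha>_def \<kappa>_def u V', symmetric])
      also have "\<dots> = d_beta \<beta> * (\<integral>x. f x * tr0 (val v) x \<partial>lborel)" using sol V(1) by (simp add: variational_solution_def)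
      also have "(\<integral>x. f x * tr0 (val v) x \<partial>lborel) = (\<integral>x. F (\<lambda>_. 0) x * trc v x \<partial>lborel)"
      proof (rule integral_cong_AE)
        show "(\<lambda>x. f x * tr0 (val v) x) \<in> borel_measurable lborel" using F(6) V(3) by simp
        show "(\<lambda>x. F (\<lambda>_. 0) x * trc v x) \<in> borel_measurable lborel"
          using F(1)[of "\<lambda>_. 0"] z0 energy_triplesD(8)[OF v] by (intro borel_measurable_times) (simp_all add: sq_integrable_def)
        show "AE x in lborel. f x * tr0 (val v) x = F (\<lambda>_. 0) x * trc v x" using F(5) V(2) by eventually_elim simp
      qed
      finally show ?thesis by (simp add: l_def)
    qed
    have "smooth_vec m (regularity_const B c m * (\<bar>d_beta \<beta>\<bar> * Hm_norm m \<Omega> f * trace_const CARD('d) \<alpha> R)) (triple_of U)"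
      by (rule regularity[OF c coer B form l u eq])
    then have sv: "smooth_vec m (C * Hm_norm m \<Omega> f) (triple_of U)" by (simp add: C_def mult_ac)
    have "length (mi_list \<zeta>) = m" using \<zeta> by (simp add: length_mi_list)
    from smooth_vec_weak_deriv[OF sv this] obtain w where w: "w \<in> energy_triples \<alpha> \<kappa>" "energy_norm \<alpha> \<kappa> w \<le> C * Hm_norm m \<Omega> f"
      "has_weak_deriv half_space (map (\<lambda>i. (axis i 1, 0)) (mi_list \<zeta>)) (val (triple_of U)) (val w)" by blast
    note W = energy_triplesD[OF w(1)]
    have "mi_xdirs \<zeta> = map (\<lambda>i. (axis i 1, 0)) (mi_list \<zeta>)" by (simp add: mi_xdirs_def mi_dirs_def)
    then have "has_weak_deriv half_space (mi_xdirs \<zeta>) U (val w)"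
      using w(3) has_weak_deriv_cong[of half_space "val (triple_of U)" U "val w" "val w"] by (simp add: triple_of_def)
    moreover have "has_weak_grad half_space (val w) (grad w)" using W(1) by (simp add: H1_def)
    moreover have "in_L2 (y_weight (1 - 2 * \<beta>)) half_space (grad w)"
      using in_L2_hs_of_sq_integrable(1)[OF W(4)] by (simp add: \<alpha>_def)
    moreover have "L2_norm (y_weight (1 - 2 * \<beta>)) half_space (grad w) \<le> C * Hm_norm m \<Omega> f"
      using L2_norm_hs[OF W(7), of \<alpha>] energy_norm_ge(1)[of \<alpha> w \<kappa>] w(2) by (simp add: \<alpha>_def)
    ultimately show "\<exists>W G. has_weak_deriv half_space (mi_xdirs \<zeta>) U W \<and> has_weak_grad half_space W G \<and>
        in_L2 (y_weight (1 - 2 * \<beta>)) half_space G \<and> L2_norm (y_weight (1 - 2 * \<beta>)) half_space G \<le> C * Hm_norm m \<Omega> f"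
      by blast
  qed
qed

end
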